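(* Let $d\ge1$ and let $l\in E_8(-1)$ with $l^2=-2d$. Embed $L_{2d}:=2U\oplus2E_8(-1)\oplus\mathbb Zl\cong 2U\oplus 2E_8(-1)\oplus\langle-2d\rangle$ into $L_{2,26}=2U\oplus2E_8(-1)\oplus E_8(-1)$ (with $l$ in the last summand), so that $\mathcal D_{L_{2d}}\subset\mathcal D_{L_{2,26}}$. Let $R_l=\{r\in E_8(-1)\mid r^2=-2,\ (r,l)=0\}$, $N_l=\#R_l$, and $$F_l=\left.\frac{\Phi_{12}(Z)}{\prod_{\{\pm r\}\subset R_l}(Z,r)}\right|_{\mathcal D_{L_{2d}}},$$ the product taken over one representative of each pair $\{\pm r\}$. Then: (i) $F_l\in M_{12+N_l/2}(\widetilde{\mathrm O}^+(L_{2d}),\det)$ and $F_l$ vanishes on all divisors $\{(Z,r)=0\}$ with $r\in L_{2d}$, $r^2=-2$; (ii) if $N_l>0$ then $F_l$ is a cusp form, for any $d$; (iii) if the weight of $F_l$ is smaller than $68$ (i.e. $N_l<112$), then $F_l$ vanishes along the branch divisor of the projection $\pi\colon\mathcal D_{L_{2d}}\to\widetilde{\mathrm O}^+(L_{2d})\backslash\mathcal D_{L_{2d}}=\mathcal F_{2d}$.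
   Context: $U$ is the hyperbolic plane, $E_8(-1)$ the negative definite $E_8$ lattice. For a lattice $L$ of signature $(2,n)$, $\mathcal D_L$ is one of the two components of $\{[w]\in\mathbb P(L\otimes\mathbb C)\mid (w,w)=0,(w,\bar w)>0\}$; $\mathrm O^+(L)$ preserves it; $\widetilde{\mathrm O}^+(L)$ is the subgroup of $\mathrm O^+(L)$ acting trivially on $L^\vee/L$. $M_k(\Gamma,\chi)$ denotes modular forms of weight $k$ and character $\chi$ (holomorphic functions $F$ on the affine cone over $\mathcal D_L$ with $F(tZ)=t^{-k}F(Z)$ and $F(gZ)=\chi(g)F(Z)$); cusp forms vanish at all cusps. $\Phi_{12}$ is the Borcherds form: the unique modular form of weight $12$ and character $\det$ for $\mathrm O^+(L_{2,26})$; it vanishes exactly on the divisors $\{(Z,r)=0\}$ with $r\in L_{2,26}$, $r^2=-2$, each with multiplicity $1$. The branch divisor of $\pi$ consists of the divisors fixed pointwise by non-trivial elements of $\widetilde{\mathrm O}^+(L_{2d})$. *)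

theory Defs
  imports "HOL-Analysis.Analysis" "HOL-Library.Numeral_Type"
begin

text \<open>A lattice of rank CARD('n) is Z^n with an integral Gram matrix gr.
  Vectors of L tensor C are complex^'n; the C-bilinear extension of the form is bil.\<close>

definition bil :: "('n::finite \<Rightarrow> 'n \<Rightarrow> int) \<Rightarrow> complex^'n \<Rightarrow> complex^'n \<Rightarrow> complex" where
  "bil gr x y = (\<Sum>i\<in>UNIV. \<Sum>j\<in>UNIV. x$i * of_int (gr i j) * y$j)"

definition cvec :: "int^'n \<Rightarrow> complex^'n" where
  "cvec v = (\<chi> i. of_int (v$i))"

definition rvec :: "real^'n \<Rightarrow> complex^'n" where
  "rvec v = (\<chi> i. complex_of_real (v$i))"

definition conjv :: "complex^'n \<Rightarrow> complex^'n" where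
  "conjv w = (\<chi> i. cnj (w$i))"

definition cone :: "('n::finite \<Rightarrow> 'n \<Rightarrow> int) \<Rightarrow> (complex^'n) set" where
  "cone gr = {w. bil gr w w = 0 \<and> 0 < Re (bil gr w (conjv w))}"

text \<open>The affine cone over the chosen component D_L: the connected component of the
  cone containing a fixed base point w0.\<close>
definition Dom :: "('n::finite \<Rightarrow> 'n \<Rightarrow> int) \<Rightarrow> complex^'n \<Rightarrow> (complex^'n) set" where
  "Dom gr w0 = connected_component_set (cone gr) w0"

definition cmat :: "int^'n^'n \<Rightarrow> complex^'n^'n" where
  "cmat g = (\<chi> i j. of_int (g$i$j))"

definition rmat :: "int^'n^'n \<Rightarrow> real^'n^'n" where
  "rmat g = (\<chi> i j. of_int (g$i$j))"

definition act :: "int^'n^'n \<Rightarrow> complex^'n \<Rightarrow> complex^'n" where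
  "act g w = cmat g *v w"

definition Oplus :: "('n::finite \<Rightarrow> 'n \<Rightarrow> int) \<Rightarrow> complex^'n \<Rightarrow> (int^'n^'n) set" where
  "Oplus gr w0 = {g. (\<exists>h::int^'n^'n. g ** h = mat 1 \<and> h ** g = mat 1)
      \<and> (\<forall>x y. bil gr (act g x) (act g y) = bil gr x y)
      \<and> act g ` Dom gr w0 = Dom gr w0}"

text \<open>Stable subgroup: g acts trivially on L^dual/L, where
  L^dual = {v in L tensor Q | (v,L) in Z} = {v | gr v integral}.\<close>
definition Otilde :: "('n::finite \<Rightarrow> 'n \<Rightarrow> int) \<Rightarrow> complex^'n \<Rightarrow> (int^'n^'n) set" where
  "Otilde gr w0 = {g \<in> Oplus gr w0. \<forall>v::real^'n.
      (\<forall>i. (\<Sum>j\<in>UNIV. of_int (gr i j) * v$j) \<in> \<int>) \<longrightarrow> (\<forall>i. (rmat g *v v - v)$i \<in> \<int>)}"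

definition detchar :: "int^'n^'n \<Rightarrow> complex" where
  "detchar g = of_int (det g)"

definition cholo_on :: "(complex^'n::finite \<Rightarrow> complex) \<Rightarrow> (complex^'n) set \<Rightarrow> bool" where
  "cholo_on G U \<longleftrightarrow> (\<forall>z\<in>U. \<exists>G'. (G has_derivative G') (at z) \<and> (\<forall>c v. G' (c *s v) = c * G' v))"

text \<open>Holomorphic on a (locally closed) complex submanifold A: locally the restriction
  of an ambient holomorphic function.\<close>
definition holo_on :: "(complex^'n::finite \<Rightarrow> complex) \<Rightarrow> (complex^'n) set \<Rightarrow> bool" where
  "holo_on F A \<longleftrightarrow> (\<forall>w\<in>A. \<exists>U G. open U \<and> w \<in> U \<and> cholo_on G U \<and> (\<forall>z\<in>U \<inter> A. G z = F z))"

definition ModForm :: "('n::finite \<Rightarrow> 'n \<Rightarrow> int) \<Rightarrow> complex^'n \<Rightarrow> (int^'n^'n) set \<Rightarrow> nat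
    \<Rightarrow> (int^'n^'n \<Rightarrow> complex) \<Rightarrow> (complex^'n \<Rightarrow> complex) \<Rightarrow> bool" where
  "ModForm gr w0 \<Gamma> k \<chi>' F \<longleftrightarrow> holo_on F (Dom gr w0)
     \<and> (\<forall>t w. t \<noteq> 0 \<longrightarrow> w \<in> Dom gr w0 \<longrightarrow> F (t *s w) = inverse t ^ k * F w)
     \<and> (\<forall>g\<in>\<Gamma>. \<forall>w\<in>Dom gr w0. F (act g w) = \<chi>' g * F w)"

text \<open>Vanishing at all cusps: at every (0-dimensional) cusp, i.e. every nonzero isotropic
  c in L, the Fourier expansion in the coordinates normalised by (w,c)=1 only involves
  characters lambda (lambda orthogonal to c) of strictly positive norm.  (Vanishing of the
  coefficients with lambda^2=0 at all 0-dimensional cusps is vanishing at all cusps,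
  including the 1-dimensional ones.)\<close>
definition Cusp :: "('n::finite \<Rightarrow> 'n \<Rightarrow> int) \<Rightarrow> complex^'n \<Rightarrow> (complex^'n \<Rightarrow> complex) \<Rightarrow> bool" where
  "Cusp gr w0 F \<longleftrightarrow> (\<forall>c::int^'n. c \<noteq> 0 \<longrightarrow> bil gr (cvec c) (cvec c) = 0 \<longrightarrow>
     (\<exists>a::real^'n \<Rightarrow> complex.
        (\<forall>m. a m \<noteq> 0 \<longrightarrow> bil gr (rvec m) (cvec c) = 0 \<and> 0 < Re (bil gr (rvec m) (rvec m)))
      \<and> (\<forall>w\<in>Dom gr w0. bil gr w (cvec c) = 1 \<longrightarrow>
           ((\<lambda>\<mu>. a \<mu> * exp (2 * of_real pi * \<i> * bil gr (rvec \<mu>) w)) has_sum F w) UNIV)))"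

definition parallel :: "complex^'n \<Rightarrow> complex^'n \<Rightarrow> bool" where
  "parallel a b \<longleftrightarrow> (\<exists>t::complex. a = t *s b)"

text \<open>F vanishes along every divisor fixed pointwise (in D_L) by an element of Gamma
  acting non-trivially on D_L. Such divisors are (unions of components of) hyperplane
  sections D_L cap v^perp.\<close>
definition VanishBranch :: "('n::finite \<Rightarrow> 'n \<Rightarrow> int) \<Rightarrow> complex^'n \<Rightarrow> (int^'n^'n) set
    \<Rightarrow> (complex^'n \<Rightarrow> complex) \<Rightarrow> bool" where
  "VanishBranch gr w0 \<Gamma> F \<longleftrightarrow> (\<forall>g\<in>\<Gamma>. (\<exists>w\<in>Dom gr w0. \<not> parallel (act g w) w) \<longrightarrow>
     (\<forall>v::complex^'n. v \<noteq> 0 \<longrightarrow>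
        (\<forall>z\<in>Dom gr w0. bil gr z v = 0 \<longrightarrow> parallel (act g z) z) \<longrightarrow>
        (\<forall>z\<in>Dom gr w0. bil gr z v = 0 \<longrightarrow> F z = 0)))"

text \<open>E_8(-1): negative of the E8 Cartan matrix (Bourbaki numbering, 0-based:
  chain 0-2-3-4-5-6-7, node 1 attached to node 3).\<close>
definition e8edge :: "nat \<Rightarrow> nat \<Rightarrow> bool" where
  "e8edge a b \<longleftrightarrow> {a,b} \<in> {{0,2},{2,3},{3,4},{4,5},{5,6},{6,7},{1,3}}"

definition e8m :: "nat \<Rightarrow> nat \<Rightarrow> int" where
  "e8m a b = (if a = b then -2 else if e8edge a b then 1 else 0)"

text \<open>Gram matrix of 2U + m E_8(-1) on indices 0..4+8m-1 (U on 0,1 and on 2,3).\<close>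
definition blockgram :: "nat \<Rightarrow> nat \<Rightarrow> int" where
  "blockgram a b = (if a < 4 \<or> b < 4 then (if {a,b} = {0,1} \<or> {a,b} = {2,3} then 1 else 0)
     else if (a - 4) div 8 = (b - 4) div 8 then e8m ((a - 4) mod 8) ((b - 4) mod 8) else 0)"

definition ix28 :: "28 \<Rightarrow> nat" where "ix28 i = nat (Rep_bit0 i)"
definition ix21 :: "21 \<Rightarrow> nat" where "ix21 i = nat (Rep_bit1 i)"
definition ix8 :: "8 \<Rightarrow> nat" where "ix8 i = nat (Rep_bit0 i)"

text \<open>L_{2,26} = 2U + 3E_8(-1) (indices 20..27 form the last E_8(-1)).\<close>
definition g28 :: "28 \<Rightarrow> 28 \<Rightarrow> int" where
  "g28 i j = blockgram (ix28 i) (ix28 j)"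

text \<open>L_{2d} = 2U + 2E_8(-1) + <-2d> (index 20 is the generator l).\<close>
definition g21 :: "nat \<Rightarrow> 21 \<Rightarrow> 21 \<Rightarrow> int" where
  "g21 d i j = (if ix21 i < 20 \<and> ix21 j < 20 then blockgram (ix21 i) (ix21 j)
     else if ix21 i = 20 \<and> ix21 j = 20 then - 2 * int d else 0)"

definition e8 :: "int^8 \<Rightarrow> int^8 \<Rightarrow> int" where
  "e8 x y = (\<Sum>i\<in>UNIV. \<Sum>j\<in>UNIV. x$i * e8m (ix8 i) (ix8 j) * y$j)"

text \<open>Base points fixing the components: w0 = (e1+f1) + i (e2+f2).\<close>
definition w28 :: "complex^28" where
  "w28 = (\<chi> i. if ix28 i < 2 then 1 else if ix28 i < 4 then \<i> else 0)"
definition w21 :: "complex^21" where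
  "w21 = (\<chi> i. if ix21 i < 2 then 1 else if ix21 i < 4 then \<i> else 0)"

definition iota :: "int^8 \<Rightarrow> complex^21 \<Rightarrow> complex^28" where
  "iota l w = (\<chi> i. if ix28 i < 20 then w $ (of_nat (ix28 i))
      else w $ (of_nat 20) * of_int (l $ (of_nat (ix28 i - 20))))"

definition emb8 :: "int^8 \<Rightarrow> complex^28" where
  "emb8 r = (\<chi> i. if ix28 i < 20 then 0 else of_int (r $ (of_nat (ix28 i - 20))))"

definition Rl :: "int^8 \<Rightarrow> (int^8) set" where
  "Rl l = {r. e8 r r = -2 \<and> e8 r l = 0}"

end

theory Submission
  imports Defs "HOL-Complex_Analysis.Cauchy_Integral_Formula"
begin

text \<open>Near \<open>z\<close>, \<open>\<Phi>\<close> vanishes on the hyperplanes \<open>r\<^sup>\<bottom>\<close>, \<open>r \<in> P\<close>, so the quotient \<open>G\<close> exists, and it inherits the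
  transformation law because a stable isometry of \<open>L\<^sub>2\<^sub>d\<close> extends to \<open>L\<^sub>2\<^sub>,\<^sub>2\<^sub>6\<close> by the identity on \<open>l\<^sup>\<bottom> \<subset> E\<^sub>8\<close>. By continuity
  \<open>G\<close> vanishes on \<open>x\<^sup>\<bottom>\<close> for every root \<open>x\<close> of \<open>L\<^sub>2\<^sub>,\<^sub>2\<^sub>6\<close> not proportional to an element of \<open>P\<close>.

  An isometry fixing a divisor is \<open>\<plusminus>\<close> a reflection \<open>\<sigma>\<^sub>y\<close>. The sign \<open>+\<close> has determinant \<open>-1\<close>, which forces \<open>F = 0\<close> on the
  divisor. For \<open>-\<sigma>\<^sub>y\<close> stability makes the orthogonal complement of \<open>y\<^sup>\<bottom>\<close> in \<open>L\<^sub>2\<^sub>,\<^sub>2\<^sub>6\<close> a lattice of rank 8 and determinant at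
  most 4 containing \<open>l\<^sup>\<bottom>\<close>; it is close enough to \<open>E\<^sub>8\<close> to contain a root \<open>x\<close> with \<open>(x,l) \<noteq> 0\<close>, and \<open>G\<close> vanishes on \<open>x\<^sup>\<bottom>\<close>.

  At a cusp, \<open>\<Phi>\<close> has a Fourier expansion whose exponents have norm \<open>\<ge> 0\<close> by the Koecher principle. In a direction \<open>\<xi>\<close> normal
  to \<open>L\<^sub>2\<^sub>d\<close> the leading Taylor coefficient of \<open>\<Phi>\<close> is a multiple of \<open>F\<close>, and it has order \<open>N\<^sub>l/2 > 0\<close>: only exponents \<open>\<mu>\<close> with
  \<open>(\<mu>,\<xi>) \<noteq> 0\<close> contribute, and the projection of such a \<open>\<mu>\<close> to \<open>L\<^sub>2\<^sub>d\<close> has positive norm.\<close>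

section \<open>Holomorphic functions of several variables\<close>

text \<open>No classification of definite lattices of rank 8 enters. A solution of
  \<open>t^2 = 1 + d N^2 e\<close> yields an explicit isotropic vector f of U + E8; every isotropic
  vector there is equivalent to a multiple of a standard one, so f^perp/f is E8. The glued lattice
  sits in it as the kernel of a parity, and the claim becomes: some root of E8 is even for one
  functional and nonzero for another. The Koecher principle comes from Eichler transvections. They
  preserve \<open>\<Phi>\<close>, so a bound over one imaginary part y holds over all its images,
  which grow quadratically. A coefficient can obey all these bounds only if its exponent pairs with
  every integral isotropic vector orthogonal to the cusp with the same sign as y does; by density of
  such vectors the exponent has norm \<ge> 0. Fourier coefficients are extracted one coordinate at a
  time on a tube in all 28 coordinates, which avoids choosing a basis of the translation lattice of
  the cusp.\<close>

lemma norm_vmult: "norm (c *s v) = norm c * norm (v :: complex^'n::finite)"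
  by (simp add: norm_vec_def norm_mult L2_set_right_distrib)

lemma linear_vmult_left: "linear (\<lambda>s::complex. s *s (v::complex^'n::finite))"
  proof (rule linearI)
  fix r :: real and b :: complex
  have "((r *\<^sub>R b) *s v) $ i = (r *\<^sub>R (b *s v)) $ i" for i by (simp only: vector_smult_component vector_scaleR_component) simp
  then show "(r *\<^sub>R b) *s v = r *\<^sub>R (b *s v)" unfolding vec_eq_iff by blast
qed (auto simp: vec_eq_iff algebra_simps)

lemma scaleR_eq_vmult: "r *\<^sub>R (v::complex^'n) = of_real r *s v"
proof -
  have "(r *\<^sub>R v) $ i = (of_real r *s v) $ i" for i
  proof -
    have "(r *\<^sub>R v) $ i = r *\<^sub>R (v $ i)" by simp
    then show ?thesis by (simp only: vector_smult_component scaleR_conv_of_real)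
  qed
  then show ?thesis unfolding vec_eq_iff by blast
qed

lemma has_derivative_line: "((\<lambda>s. z + s *s (v::complex^'n::finite)) has_derivative (\<lambda>s. s *s v)) F"
  using linear_vmult_left[of v] by (auto intro!: derivative_eq_intros simp: linear_linear bounded_linear_imp_has_derivative)

lemma continuous_on_vmult [continuous_intros]:
  "continuous_on S f \<Longrightarrow> continuous_on S g \<Longrightarrow> continuous_on S (\<lambda>x. (f x::complex) *s (g x :: complex^'n::finite))"
  unfolding vector_scalar_mult_def by (intro continuous_intros continuous_on_mult continuous_on_component) auto

lemma cholo_onI:
  assumes "\<And>z. z \<in> U \<Longrightarrow> (G has_derivative G' z) (at z)" "\<And>z c v. z \<in> U \<Longrightarrow> G' z (c *s v) = c * G' z v"
  shows "cholo_on G U"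
  using assms unfolding cholo_on_def by blast

lemma cholo_on_subset: "cholo_on f U \<Longrightarrow> V \<subseteq> U \<Longrightarrow> cholo_on f V"
  unfolding cholo_on_def by blast

lemma cholo_on_ball_cover:
  assumes "\<And>z. z \<in> U \<Longrightarrow> \<exists>V. z \<in> V \<and> cholo_on f V" shows "cholo_on f U"
  using assms unfolding cholo_on_def by blast

lemma cholo_on_transform:
  assumes "cholo_on f U" "open U" "\<And>z. z \<in> U \<Longrightarrow> g z = f z" shows "cholo_on g U"
  using assms has_derivative_transform_within_open[OF _ \<open>open U\<close>] unfolding cholo_on_def by metis

lemma cholo_on_continuous: assumes "cholo_on f U" shows "continuous_on U f"
proof (rule differentiable_imp_continuous_on, unfold differentiable_on_def, rule ballI)
  fix z assume "z \<in> U"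
  then obtain f' where "(f has_derivative f') (at z)" using assms unfolding cholo_on_def by blast
  then show "f differentiable (at z within U)" using differentiable_at_withinI differentiableI by blast
qed

lemma cholo_on_const: "cholo_on (\<lambda>z. c) U"
  by (rule cholo_onI[where G'="\<lambda>z v. 0"]) auto

lemma cholo_on_clinear:
  assumes "\<And>x y. f (x + y) = f x + f y" "\<And>c x. f (c *s x) = c * f (x::complex^'n::finite)" shows "cholo_on f U"
proof (rule cholo_onI[where G'="\<lambda>z. f"])
  have "linear f" by (rule linearI) (auto simp: assms scaleR_eq_vmult scaleR_conv_of_real)
  then show "(f has_derivative f) (at z)" for z
    by (simp add: linear_linear bounded_linear_imp_has_derivative)
qed (use assms in auto)

lemma cholo_on_nth: "cholo_on (\<lambda>z. z $ i) U"
  by (rule cholo_on_clinear) auto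

lemma cholo_on_add: assumes "cholo_on f U" "cholo_on g U" shows "cholo_on (\<lambda>z. f z + g z) U"
  unfolding cholo_on_def
proof
  fix z assume "z \<in> U"
  then obtain f' g' where "(f has_derivative f') (at z)" "\<And>c v. f' (c *s v) = c * f' v"
     "(g has_derivative g') (at z)" "\<And>c v. g' (c *s v) = c * g' v" using assms unfolding cholo_on_def by blast
  then show "\<exists>G'. ((\<lambda>z. f z + g z) has_derivative G') (at z) \<and> (\<forall>c v. G' (c *s v) = c * G' v)"
    by (intro exI[where x="\<lambda>v. f' v + g' v"]) (auto intro: has_derivative_add simp: algebra_simps)
qed

lemma cholo_on_mult: assumes "cholo_on f U" "cholo_on g U" shows "cholo_on (\<lambda>z. f z * g z) U"
  unfolding cholo_on_def
proof
  fix z assume "z \<in> U"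
  then obtain f' g' where "(f has_derivative f') (at z)" "\<And>c v. f' (c *s v) = c * f' v"
     "(g has_derivative g') (at z)" "\<And>c v. g' (c *s v) = c * g' v" using assms unfolding cholo_on_def by blast
  then show "\<exists>G'. ((\<lambda>z. f z * g z) has_derivative G') (at z) \<and> (\<forall>c v. G' (c *s v) = c * G' v)"
    by (intro exI[where x="\<lambda>v. f z * g' v + f' v * g z"]) (auto intro: has_derivative_mult simp: algebra_simps)
qed

lemma cholo_on_sum: "(\<And>i. i \<in> I \<Longrightarrow> cholo_on (f i) U) \<Longrightarrow> cholo_on (\<lambda>z. \<Sum>i\<in>I. f i z) U"
  by (induction I rule: infinite_finite_induct) (auto intro: cholo_on_const cholo_on_add)

lemma cholo_on_prod: "(\<And>i. i \<in> I \<Longrightarrow> cholo_on (f i) U) \<Longrightarrow> cholo_on (\<lambda>z. \<Prod>i\<in>I. f i z) U"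
  by (induction I rule: infinite_finite_induct) (auto intro: cholo_on_const cholo_on_mult)

lemma cholo_on_compose_holo:
  assumes "cholo_on f U" "g holomorphic_on V" "open V" "f ` U \<subseteq> V" shows "cholo_on (\<lambda>z. g (f z)) U"
  unfolding cholo_on_def
proof
  fix z assume z: "z \<in> U"
  then obtain f' where f: "(f has_derivative f') (at z)" "\<And>c v. f' (c *s v) = c * f' v"
    using assms unfolding cholo_on_def by blast
  have "(g has_field_derivative deriv g (f z)) (at (f z))"
    using assms z holomorphic_derivI by blast
  then have "(g has_derivative (\<lambda>v. deriv g (f z) * v)) (at (f z))" by (simp add: has_field_derivative_def)
  from has_derivative_compose[OF f(1) this]
  show "\<exists>G'. ((\<lambda>z. g (f z)) has_derivative G') (at z) \<and> (\<forall>c v. G' (c *s v) = c * G' v)"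
    using f(2) by (intro exI[where x="\<lambda>v. deriv g (f z) * f' v"]) auto
qed

lemma cholo_on_inverse: "cholo_on f U \<Longrightarrow> (\<And>z. z \<in> U \<Longrightarrow> f z \<noteq> 0) \<Longrightarrow> cholo_on (\<lambda>z. inverse (f z)) U"
  by (rule cholo_on_compose_holo[where V="-{0}"]) (auto intro!: holomorphic_intros)

lemma cholo_on_divide: "cholo_on f U \<Longrightarrow> cholo_on g U \<Longrightarrow> (\<And>z. z \<in> U \<Longrightarrow> g z \<noteq> 0) \<Longrightarrow> cholo_on (\<lambda>z. f z / g z) U"
  unfolding divide_inverse by (intro cholo_on_mult cholo_on_inverse) auto

lemma cholo_on_compose:
  fixes H :: "complex^'m::finite \<Rightarrow> complex^'n::finite"
  assumes f: "cholo_on f V" and H: "\<And>i. cholo_on (\<lambda>x. H x $ i) U" and "H ` U \<subseteq> V"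
  shows "cholo_on (\<lambda>x. f (H x)) U"
  unfolding cholo_on_def
proof
  fix z assume z: "z \<in> U"
  have "\<forall>i. \<exists>H'. ((\<lambda>x. H x $ i) has_derivative H') (at z) \<and> (\<forall>c v. H' (c *s v) = c * H' v)"
    using H z unfolding cholo_on_def by blast
  then obtain H' where H': "\<And>i. ((\<lambda>x. H x $ i) has_derivative H' i) (at z)" "\<And>i c v. H' i (c *s v) = c * H' i v" by metis
  have Hd: "(H has_derivative (\<lambda>v. \<chi> i. H' i v)) (at z)"
  proof (subst has_derivative_componentwise_within, intro ballI)
    fix b :: "complex^'n" assume "b \<in> Basis"
    then obtain i c where b: "b = axis i c" by (auto simp: Basis_vec_def)
    have "((\<lambda>x. H x $ i \<bullet> c) has_derivative (\<lambda>v. H' i v \<bullet> c)) (at z)"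
      by (rule has_derivative_inner_left[OF H'(1)])
    then show "((\<lambda>x. H x \<bullet> b) has_derivative (\<lambda>x. (\<chi> i. H' i x) \<bullet> b)) (at z)"
      by (simp add: b inner_axis)
  qed
  obtain f' where f': "(f has_derivative f') (at (H z))" "\<And>c v. f' (c *s v) = c * f' v"
    using f z assms(3) unfolding cholo_on_def by blast
  have "(\<chi> i. H' i (c *s v)) = c *s (\<chi> i. H' i v)" for c v using H'(2) by (auto simp: vec_eq_iff)
  with has_derivative_compose[OF Hd f'(1)]
  show "\<exists>G'. ((\<lambda>x. f (H x)) has_derivative G') (at z) \<and> (\<forall>c v. G' (c *s v) = c * G' v)"
    using f'(2) by (intro exI[where x="\<lambda>v. f' (\<chi> i. H' i v)"]) auto
qed

lemma has_field_derivative_line: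
  fixes f :: "complex^'n::finite \<Rightarrow> complex"
  assumes "(f has_derivative f') (at (z + s *s v))" "\<And>c v. f' (c *s v) = c * f' v"
  shows "((\<lambda>s. f (z + s *s v)) has_field_derivative f' v) (at s)"
  using has_derivative_compose[OF has_derivative_line[of z v "at s"] assms(1)] assms(2)
    ext[of "\<lambda>x. x * f' v" "(*) (f' v)", OF mult.commute]
  by (simp add: has_field_derivative_def)

lemma open_line: "open U \<Longrightarrow> open {s. z + s *s (v::complex^'n::finite) \<in> U}"
proof -
  assume "open U"
  have "continuous_on UNIV (\<lambda>s. z + s *s v)" by (intro continuous_intros)
  from open_vimage[OF \<open>open U\<close> this] show ?thesis by (simp add: vimage_def)
qed

lemma cholo_on_line:
  assumes "cholo_on f U" shows "(\<lambda>s. f (z + s *s v)) holomorphic_on {s. z + s *s v \<in> U}"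
  unfolding holomorphic_on_def field_differentiable_def
proof
  fix s assume "s \<in> {s. z + s *s v \<in> U}"
  then obtain f' where "(f has_derivative f') (at (z + s *s v))" "\<And>c v. f' (c *s v) = c * f' v"
    using assms unfolding cholo_on_def by blast
  from has_field_derivative_line[OF this]
  show "\<exists>f'. ((\<lambda>s. f (z + s *s v)) has_field_derivative f') (at s within {s. z + s *s v \<in> U})"
    using has_field_derivative_at_within by blast
qed

text \<open>Restrict \<open>f\<close> to the complex line through \<open>z\<close> in direction
  \<open>h\<close> and apply Cauchy's estimate to the second derivative there. The constant depends
  only on \<open>M\<close> and the radius, which makes the estimate uniform in a parameter.\<close>

lemma cholo_remainder:
  assumes f: "cholo_on f U" "open U" and R: "cball z (2*R) \<subseteq> U" and M: "\<And>w. w \<in> cball z (2*R) \<Longrightarrow> norm (f w) \<le> M"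
    and f': "(f has_derivative f') (at z)" "\<And>c v. f' (c *s v) = c * f' v" and h: "norm h \<le> R" "R > 0"
  shows "norm (f (z + h) - f z - f' h) \<le> 2 * M / R\<^sup>2 * (norm h)\<^sup>2"
proof (cases "h = 0")
  case True
  have "f' 0 = 0" using f'(2)[of 0 0] by simp
  then show ?thesis by (simp add: True)
next
  case False
  \<comment> \<open>For \<open>norm s \<le> r\<close> the line stays in the ball of radius
    \<open>2*R\<close>. As \<open>norm h \<le> R\<close>, \<open>r\<close> is at least 2, so discs
    of radius \<open>r/2\<close> about points of the unit disc stay inside as well.\<close>
  define r where "r = 2*R / norm h"
  have r: "r \<ge> 2" "r > 0" using False h by (auto simp: r_def field_simps)
  define g where "g = (\<lambda>s. f (z + s *s h))"
  define D where "D = {s. z + s *s h \<in> U}"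
  have oD: "open D" unfolding D_def by (rule open_line[OF f(2)])
  have gh: "g holomorphic_on D" unfolding g_def D_def by (rule cholo_on_line[OF f(1)])
  have in_ball: "z + s *s h \<in> cball z (2*R)" if "norm s \<le> r" for s
    using that False by (simp add: dist_norm norm_vmult r_def field_simps)
  have sub: "cball 0 r \<subseteq> D" using in_ball R by (auto simp: D_def)
  have sub2: "cball x (r/2) \<subseteq> cball 0 r" if "x \<in> cball 0 1" for x::complex
  proof
    fix y assume "y \<in> cball x (r/2)"
    then have "norm y \<le> norm x + r/2" by (metis dist_norm mem_cball norm_triangle_sub add_left_mono order_trans norm_minus_commute)
    also have "\<dots> \<le> r" using that r by auto
    finally show "y \<in> cball 0 r" by simp
  qed
  have der: "((deriv ^^ i) g has_field_derivative (deriv ^^ Suc i) g x) (at x within cball 0 1)"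
    if "x \<in> cball 0 1" for i x
  proof -
    have "x \<in> D" using that sub r by auto
    moreover have "(deriv ^^ i) g holomorphic_on D" by (rule holomorphic_higher_deriv[OF gh oD])
    ultimately show ?thesis using holomorphic_derivI[OF _ oD] has_field_derivative_at_within by auto
  qed
  have B: "norm ((deriv ^^ 2) g x) \<le> fact 2 * M / (r/2)^2" if x: "x \<in> cball 0 1" for x
  proof (rule Cauchy_inequality)
    show "g holomorphic_on ball x (r/2)" using gh sub sub2[OF x] holomorphic_on_subset[OF gh, of "ball x (r/2)"] ball_subset_cball by blast
    show "continuous_on (cball x (r/2)) g" using holomorphic_on_imp_continuous_on[OF gh] sub sub2[OF x] continuous_on_subset by blast
    show "norm (g y) \<le> M" if "norm (x - y) = r/2" for y
    proof -
      have "y \<in> cball x (r/2)" using that by (simp add: dist_norm)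
      then have "norm y \<le> r" using sub2[OF x] by auto
      then show ?thesis unfolding g_def using in_ball M by blast
    qed
  qed (use r in auto)
  have "norm ((deriv ^^ 0) g 1 - (\<Sum>i\<le>1. (deriv ^^ i) g 0 * (1-0) ^ i / fact i)) \<le> (fact 2 * M / (r/2)^2) * norm (1-0::complex)^(Suc 1) / fact 1"
    by (rule field_Taylor[where S="cball 0 1"]) (use der B in \<open>auto simp: numeral_2_eq_2\<close>)
  moreover have "deriv g 0 = f' h"
    unfolding g_def by (rule DERIV_imp_deriv, rule has_field_derivative_line) (use f' in auto)
  ultimately have "norm (f (z + h) - f z - f' h) \<le> 8 * M / r^2"
    by (simp add: g_def power_divide vector_smult_lid vector_smult_lzero diff_diff_eq)
  also have "\<dots> = 2 * M / R\<^sup>2 * (norm h)\<^sup>2" using h False by (simp add: r_def field_simps power2_eq_square)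
  finally show ?thesis .
qed

text \<open>The quadratic remainder bound is uniform in \<open>t\<close>. It yields the derivative
  of the integral, and also continuity of \<open>f' t h\<close> in \<open>t\<close>, as a uniform
  limit of difference quotients, although nothing is assumed about how \<open>f'\<close> depends on
  \<open>t\<close>.\<close>

lemma integral_has_derivative_cholo:
  fixes f :: "complex^'n::finite \<Rightarrow> real \<Rightarrow> complex"
  assumes ab: "a \<le> b" and U: "open U" and cont: "continuous_on (U \<times> {a..b}) (\<lambda>(z,t). f z t)"
    and ch: "\<And>t. t \<in> {a..b} \<Longrightarrow> cholo_on (\<lambda>z. f z t) U" and z: "z \<in> U"
    and f': "\<And>t. t \<in> {a..b} \<Longrightarrow> ((\<lambda>z. f z t) has_derivative f' t) (at z)"
            "\<And>t c v. t \<in> {a..b} \<Longrightarrow> f' t (c *s v) = c * f' t v"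
  shows "((\<lambda>z. integral {a..b} (f z)) has_derivative (\<lambda>h. integral {a..b} (\<lambda>t. f' t h))) (at z)"
    and "(\<lambda>t. f' t h) integrable_on {a..b}"
proof -
  obtain e where e: "e > 0" "cball z e \<subseteq> U" using U z open_contains_cball by blast
  define R where "R = e/2"
  have R: "R > 0" "cball z (2*R) \<subseteq> U" using e by (auto simp: R_def)
  have "compact (cball z (2*R) \<times> {a..b})" by (intro compact_Times) auto
  moreover have "continuous_on (cball z (2*R) \<times> {a..b}) (\<lambda>(z,t). f z t)" using cont R by (elim continuous_on_subset) auto
  ultimately have "bounded ((\<lambda>(z,t). f z t) ` (cball z (2*R) \<times> {a..b}))" using compact_continuous_image compact_imp_bounded by blast
  then obtain M where "\<forall>y \<in> (\<lambda>(z,t). f z t) ` (cball z (2*R) \<times> {a..b}). norm y \<le> M" using bounded_iff by blast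
  then have M: "norm (f w t) \<le> M" if "w \<in> cball z (2*R)" "t \<in> {a..b}" for w t using that by force
  define C where "C = 2 * M / R\<^sup>2"
  have "M \<ge> 0" using M[of z a] R ab norm_ge_zero order_trans by (metis atLeastAtMost_iff centre_in_cball le_less mult_2 add_nonneg_nonneg order_refl)
  then have C0: "C \<ge> 0" by (simp add: C_def)
  have rem: "norm (f (z + h) t - f z t - f' t h) \<le> C * (norm h)\<^sup>2" if "norm h \<le> R" "t \<in> {a..b}" for h t
    unfolding C_def by (rule cholo_remainder[OF ch[OF that(2)] U R(2) M f'(1)[OF that(2)] f'(2)[OF that(2)] that(1) R(1)]) (use that in auto)
  have ct: "continuous_on {a..b} (f w)" if "w \<in> U" for w
  proof -
    have "continuous_on {a..b} ((\<lambda>(z,t). f z t) \<circ> (\<lambda>t. (w,t)))"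
      by (rule continuous_on_compose) (use that in \<open>auto intro!: continuous_intros continuous_on_subset[OF cont]\<close>)
    then show ?thesis by (simp add: o_def)
  qed
  have cf': "continuous_on {a..b} (\<lambda>t. f' t h)" for h
  proof (rule uniform_limit_theorem[where F=sequentially and f="\<lambda>n t. of_nat (Suc n) * (f (z + of_real (inverse (Suc n)) *s h) t - f z t)"])
    have small: "\<forall>\<^sub>F n in sequentially. norm (of_real (inverse (real (Suc n))) *s h) \<le> R"
    proof -
      have "(\<lambda>n. inverse (real (Suc n)) * norm h) \<longlonglongrightarrow> 0 * norm h" by (intro tendsto_intros LIMSEQ_inverse_real_of_nat)
      then have "\<forall>\<^sub>F n in sequentially. inverse (real (Suc n)) * norm h < R" using R(1) order_tendstoD(2) by fastforce
      then show ?thesis by (rule eventually_mono) (simp add: norm_vmult norm_inverse del: of_real_inverse of_nat_Suc)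
    qed
    have inU: "z + k \<in> U" if "norm k \<le> R" for k using R that by (auto simp: subset_iff dist_norm)
    show "\<forall>\<^sub>F n in sequentially. continuous_on {a..b} (\<lambda>t. of_nat (Suc n) * (f (z + of_real (inverse (Suc n)) *s h) t - f z t))"
      using small by (rule eventually_mono) (intro continuous_intros ct inU z)
    show "uniform_limit {a..b} (\<lambda>n t. of_nat (Suc n) * (f (z + of_real (inverse (Suc n)) *s h) t - f z t)) (\<lambda>t. f' t h) sequentially"
    proof (rule uniform_limitI)
      fix \<epsilon>::real assume "\<epsilon> > 0"
      have "(\<lambda>n. inverse (real (Suc n)) * (C * (norm h)\<^sup>2)) \<longlonglongrightarrow> 0 * (C * (norm h)\<^sup>2)" by (intro tendsto_intros LIMSEQ_inverse_real_of_nat)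
      then have "\<forall>\<^sub>F n in sequentially. inverse (real (Suc n)) * (C * (norm h)\<^sup>2) < \<epsilon>" using \<open>\<epsilon>>0\<close> order_tendstoD(2) by fastforce
      with small show "\<forall>\<^sub>F n in sequentially. \<forall>t\<in>{a..b}. dist (of_nat (Suc n) * (f (z + of_real (inverse (Suc n)) *s h) t - f z t)) (f' t h) < \<epsilon>"
      proof eventually_elim
        case (elim n)
        define m :: real where "m = real (Suc n)"
        have m: "m > 0" by (simp add: m_def)
        show ?case
        proof
          fix t assume t: "t \<in> {a..b}"
          define k where "k = complex_of_real (inverse m) *s h"
          have nk: "norm k = norm h / m" using m by (simp add: k_def norm_vmult norm_inverse divide_inverse)
          have fk: "f' t k = f' t h / of_real m" using f'(2)[OF t] by (simp add: k_def divide_inverse)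
          have e1: "norm k \<le> R" using elim(1) unfolding k_def m_def .
          from rem[OF e1 t] have "norm (f (z + k) t - f z t - f' t h / of_real m) \<le> C * (norm h / m)\<^sup>2" by (simp add: nk fk)
          then have "m * norm (f (z + k) t - f z t - f' t h / of_real m) \<le> m * (C * (norm h / m)\<^sup>2)" using m by (simp add: mult_left_mono)
          moreover have "m * norm (f (z + k) t - f z t - f' t h / of_real m) = norm (of_real m * (f (z + k) t - f z t - f' t h / of_real m))"
            using m by (simp add: norm_mult)
          moreover have "of_real m * (f (z + k) t - f z t - f' t h / of_real m) = of_real m * (f (z + k) t - f z t) - f' t h"
            using m by (simp add: algebra_simps)
          moreover have "m * (C * (norm h / m)\<^sup>2) = inverse m * (C * (norm h)\<^sup>2)" using m by (simp add: field_simps power2_eq_square)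
          ultimately have "norm (of_real m * (f (z + k) t - f z t) - f' t h) \<le> inverse m * (C * (norm h)\<^sup>2)" by metis
          also have "\<dots> < \<epsilon>" using elim(2) unfolding m_def .
          finally show "dist (of_nat (Suc n) * (f (z + of_real (inverse (real (Suc n))) *s h) t - f z t)) (f' t h) < \<epsilon>"
            by (simp only: dist_norm k_def m_def of_real_of_nat_eq)
        qed
      qed
    qed
  qed auto
  show int': "(\<lambda>t. f' t h) integrable_on {a..b}" for h using cf' integrable_continuous_interval by blast
  define F' where "F' = (\<lambda>h. integral {a..b} (\<lambda>t. f' t h))"
  have lin': "linear (f' t)" if "t \<in> {a..b}" for t using f'(1)[OF that] has_derivative_linear by blast
  have "linear F'"
  proof (rule linearI)
    fix h k :: "complex^'n" and r :: real
    have "F' (h + k) = integral {a..b} (\<lambda>t. f' t h + f' t k)" unfolding F'_def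
      by (rule integral_cong) (use lin' linear_add in blast)
    then show "F' (h + k) = F' h + F' k" by (simp add: F'_def integral_add int')
    have "F' (r *\<^sub>R h) = integral {a..b} (\<lambda>t. r *\<^sub>R f' t h)" unfolding F'_def
      by (rule integral_cong) (use lin' linear_scale in blast)
    then show "F' (r *\<^sub>R h) = r *\<^sub>R F' h" by (simp add: F'_def)
  qed
  then have bl: "bounded_linear F'" by (simp add: linear_linear)
  have intf: "f w integrable_on {a..b}" if "w \<in> U" for w using ct[OF that] integrable_continuous_interval by blast
  have rem2: "norm (integral {a..b} (f (z+h)) - integral {a..b} (f z) - F' h) \<le> (b - a) * (C * (norm h)\<^sup>2)" if "norm h \<le> R" for h
  proof -
    have zh: "z + h \<in> U" using R that by (auto simp: subset_iff dist_norm)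
    have "integral {a..b} (f (z+h)) - integral {a..b} (f z) - F' h = integral {a..b} (\<lambda>t. f (z+h) t - f z t - f' t h)"
      by (simp add: F'_def integral_diff intf zh z int' integrable_diff)
    also have "norm \<dots> \<le> integral {a..b} (\<lambda>t. C * (norm h)\<^sup>2)"
      by (rule integral_norm_bound_integral) (use rem[OF that] in \<open>auto intro!: integrable_diff intf zh z int'\<close>)
    also have "\<dots> = (b - a) * (C * (norm h)\<^sup>2)" using ab by simp
    finally show ?thesis .
  qed
  have "((\<lambda>z. integral {a..b} (f z)) has_derivative F') (at z)"
    unfolding has_derivative_at_alt
  proof (intro conjI allI impI bl)
    fix \<epsilon>::real assume "\<epsilon> > 0"
    define K where "K = (b - a) * C + 1"
    have K: "K > 0" using C0 ab by (simp add: K_def add_nonneg_pos)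
    show "\<exists>d>0. \<forall>y. norm (y - z) < d \<longrightarrow> norm (integral {a..b} (f y) - integral {a..b} (f z) - F' (y - z)) \<le> \<epsilon> * norm (y - z)"
    proof (intro exI[where x="min R (\<epsilon>/K)"] conjI allI impI)
      show "min R (\<epsilon>/K) > 0" using R K \<open>\<epsilon>>0\<close> by auto
      fix y assume y: "norm (y - z) < min R (\<epsilon>/K)"
      have "norm (integral {a..b} (f y) - integral {a..b} (f z) - F' (y - z)) \<le> (b - a) * (C * (norm (y-z))\<^sup>2)"
        using rem2[of "y - z"] y by simp
      also have "\<dots> \<le> K * (norm (y-z))\<^sup>2" by (simp add: K_def algebra_simps)
      also have "\<dots> = (K * norm (y-z)) * norm (y-z)" by (simp add: power2_eq_square)
      also have "\<dots> \<le> \<epsilon> * norm (y-z)" using y K by (intro mult_right_mono) (auto simp: field_simps)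
      finally show "norm (integral {a..b} (f y) - integral {a..b} (f z) - F' (y - z)) \<le> \<epsilon> * norm (y - z)" .
    qed
  qed
  then show "((\<lambda>z. integral {a..b} (f z)) has_derivative (\<lambda>h. integral {a..b} (\<lambda>t. f' t h))) (at z)" unfolding F'_def .
qed

lemma cholo_on_integral:
  fixes f :: "complex^'n::finite \<Rightarrow> real \<Rightarrow> complex"
  assumes "a \<le> b" "open U" "continuous_on (U \<times> {a..b}) (\<lambda>(z,t). f z t)" "\<And>t. t \<in> {a..b} \<Longrightarrow> cholo_on (\<lambda>z. f z t) U"
  shows "cholo_on (\<lambda>z. integral {a..b} (f z)) U"
  unfolding cholo_on_def
proof
  fix z assume z: "z \<in> U"
  then have "\<forall>t\<in>{a..b}. \<exists>f'. ((\<lambda>z. f z t) has_derivative f') (at z) \<and> (\<forall>c v. f' (c *s v) = c * f' v)"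
    using assms(4) unfolding cholo_on_def by blast
  then obtain f' where f': "\<And>t. t \<in> {a..b} \<Longrightarrow> ((\<lambda>z. f z t) has_derivative f' t) (at z)"
      "\<And>t c v. t \<in> {a..b} \<Longrightarrow> f' t (c *s v) = c * f' t v" by metis
  from integral_has_derivative_cholo[OF assms(1-4) z f']
  have "((\<lambda>z. integral {a..b} (f z)) has_derivative (\<lambda>h. integral {a..b} (\<lambda>t. f' t h))) (at z)" by blast
  moreover have "integral {a..b} (\<lambda>t. f' t (c *s v)) = c * integral {a..b} (\<lambda>t. f' t v)" for c v
  proof -
    have "integral {a..b} (\<lambda>t. f' t (c *s v)) = integral {a..b} (\<lambda>t. c * f' t v)"
      by (rule integral_cong) (use f'(2) in auto)
    then show ?thesis by simp
  qed
  ultimately show "\<exists>G'. ((\<lambda>z. integral {a..b} (f z)) has_derivative G') (at z) \<and> (\<forall>c v. G' (c *s v) = c * G' v)" by blast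
qed

text \<open>Cauchy's formula with the factor 2 pi i cancelled by the parametrisation of the circle.
  It becomes an integral over \<open>{0..1}\<close>, the kind handled by
  \<open>cholo_on_integral\<close>.\<close>

lemma circle_mean:
  assumes "continuous_on (cball z r) f" "f holomorphic_on ball z r" "norm (w - z) < r"
  shows "((\<lambda>x. f (z + r * exp (2 * of_real pi * \<i> * of_real x)) * (r * exp (2 * of_real pi * \<i> * of_real x)) /
     (z + r * exp (2 * of_real pi * \<i> * of_real x) - w)) has_integral f w) {0..1}"
proof -
  have "((\<lambda>u. f u/(u-w)) has_contour_integral (2 * of_real pi * \<i> * f w)) (circlepath z r)"
    by (rule Cauchy_integral_circlepath[OF assms])
  then have "((\<lambda>x. f (circlepath z r x) / (circlepath z r x - w) * vector_derivative (circlepath z r) (at x within {0..1}))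
      has_integral (2 * of_real pi * \<i> * f w)) {0..1}" by (simp only: has_contour_integral_def)
  moreover have eq: "inverse (2 * of_real pi * \<i>) * (2 * of_real pi * \<i> * f w) = f w" by (simp add: field_simps)
  ultimately
  have "((\<lambda>x. inverse (2 * of_real pi * \<i>) * (f (circlepath z r x) / (circlepath z r x - w) * vector_derivative (circlepath z r) (at x within {0..1})))
      has_integral f w) {0..1}" using has_integral_mult_right[of _ "2 * of_real pi * \<i> * f w" "{0..1}" "inverse (2 * of_real pi * \<i>)"] by (simp only: eq)
  then show ?thesis
  proof (rule has_integral_eq[rotated])
    fix x :: real assume x: "x \<in> {0..1}"
    have c: "circlepath z r x = z + r * exp (2 * of_real pi * \<i> * of_real x)" by (simp add: circlepath)
    have v: "vector_derivative (circlepath z r) (at x within {0..1}) = 2 * of_real pi * \<i> * r * exp (2 * of_real pi * \<i> * of_real x)"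
      using vector_derivative_circlepath01[of x z r] x by simp
    have alg: "k \<noteq> 0 \<Longrightarrow> inverse k * (A / B * (k * (C * D))) = A * (C * D) / B" for k A B C D :: complex
      by (simp add: field_simps)
    show "inverse (2 * of_real pi * \<i>) * (f (circlepath z r x) / (circlepath z r x - w) * vector_derivative (circlepath z r) (at x within {0..1})) =
       f (z + r * exp (2 * of_real pi * \<i> * of_real x)) * (r * exp (2 * of_real pi * \<i> * of_real x)) / (z + r * exp (2 * of_real pi * \<i> * of_real x) - w)"
      unfolding c v using pi_neq_zero alg[of "2 * of_real pi * \<i>"] by (simp only: mult.assoc) simp
  qed
qed

text \<open>The quotient is the circular mean of \<open>f (z + s v) / (s + \<phi> z)\<close> over \<open>\<bar>s\<bar> = R\<close>.\<close>
lemma cholo_divide_linear: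
  fixes f \<phi> :: "complex^'n::finite \<Rightarrow> complex"
  assumes f: "cholo_on f U" and U: "open U" and w0: "w0 \<in> U" "\<phi> w0 = 0"
    and \<phi>: "\<And>x y. \<phi> (x + y) = \<phi> x + \<phi> y" "\<And>c x. \<phi> (c *s x) = c * \<phi> x" "\<phi> v = 1"
    and zero: "\<And>z. z \<in> U \<Longrightarrow> \<phi> z = 0 \<Longrightarrow> f z = 0"
  shows "\<exists>V g. open V \<and> w0 \<in> V \<and> V \<subseteq> U \<and> cholo_on g V \<and> (\<forall>z\<in>V. f z = g z * \<phi> z)"
proof -
  have vz: "v \<noteq> 0" using \<phi>(2)[of 0 0] \<phi>(3) by auto
  obtain e where e: "e > 0" "ball w0 e \<subseteq> U" using U w0 open_contains_ball by blast
  define R where "R = e / (4 * norm v)"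
  have R: "R > 0" "2 * R * norm v = e/2" using e vz by (auto simp: R_def field_simps)
  have c\<phi>: "continuous_on UNIV \<phi>" by (rule cholo_on_continuous, rule cholo_on_clinear) (use \<phi> in auto)
  define V where "V = ball w0 (e/2) \<inter> {z. norm (\<phi> z) < R}"
  have oV: "open V" unfolding V_def by (intro open_Int open_ball open_Collect_less continuous_intros c\<phi>)
  have w0V: "w0 \<in> V" using e R w0 by (simp add: V_def)
  have inU: "z + s *s v \<in> U" if "z \<in> V" "norm s < 2*R" for z s
  proof -
    have "norm s * norm v < 2 * R * norm v" using that vz by simp
    then have "norm (s *s v) < e/2" by (simp only: norm_vmult R(2))
    moreover have "dist w0 z < e/2" using that by (simp add: V_def)
    moreover have "dist w0 (z + s *s v) \<le> dist w0 z + dist z (z + s *s v)" by (rule dist_triangle)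
    moreover have "dist z (z + s *s v) = norm (s *s v)" by (simp add: dist_norm)
    ultimately have "dist w0 (z + s *s v) < e" by linarith
    then show ?thesis using e(2) by auto
  qed
  define E where "E = (\<lambda>t::real. exp (2 * of_real pi * \<i> * of_real t))"
  have nE: "norm (E t) = 1" for t by (simp add: E_def)
  have cE: "continuous_on S E" for S unfolding E_def by (intro continuous_intros)
  have den: "of_real R * E t + \<phi> z \<noteq> 0" if "z \<in> V" for t z
  proof
    assume "of_real R * E t + \<phi> z = 0"
    then have "norm (of_real R * E t) = norm (\<phi> z)" by (metis add_eq_0_iff norm_minus_cancel)
    then show False using that R by (simp add: norm_mult nE V_def)
  qed
  have REU: "z + (of_real R * E t) *s v \<in> U" if "z \<in> V" for z t by (rule inU[OF that]) (use R in \<open>simp add: norm_mult nE\<close>)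
  define h where "h = (\<lambda>z t. f (z + (of_real R * E t) *s v) / (of_real R * E t + \<phi> z))"
  define g where "g = (\<lambda>z. integral {0..1} (h z))"
  have fU: "continuous_on U f" by (rule cholo_on_continuous[OF f])
  have gV: "cholo_on g V" unfolding g_def
  proof (rule cholo_on_integral)
    show "continuous_on (V \<times> {0..1}) (\<lambda>(z, t). h z t)" unfolding h_def case_prod_beta
      by (intro continuous_intros continuous_on_compose2[OF fU] continuous_on_compose2[OF cE] continuous_on_compose2[OF c\<phi>])
         (use REU den in auto)
    show "cholo_on (\<lambda>z. h z t) V" for t unfolding h_def
    proof (rule cholo_on_divide)
      show "cholo_on (\<lambda>z. f (z + (of_real R * E t) *s v)) V"
        by (rule cholo_on_compose[OF f]) (use REU in \<open>auto intro: cholo_on_add cholo_on_const cholo_on_nth\<close>)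
      show "cholo_on (\<lambda>z. of_real R * E t + \<phi> z) V"
        by (intro cholo_on_add cholo_on_const cholo_on_clinear) (use \<phi> in auto)
    qed (use den in auto)
  qed (use oV in auto)
  have "f z = g z * \<phi> z" if z: "z \<in> V" for z
  proof -
    define k where "k = (\<lambda>s. f (z + s *s v))"
    have kh: "k holomorphic_on {s. z + s *s v \<in> U}" unfolding k_def by (rule cholo_on_line[OF f])
    have sub: "cball 0 R \<subseteq> {s. z + s *s v \<in> U}" using inU[OF z] R by auto
    have k1: "continuous_on (cball 0 R) k" using holomorphic_on_imp_continuous_on[OF kh] sub continuous_on_subset by blast
    have k2: "k holomorphic_on ball 0 R" using kh sub by (meson ball_subset_cball holomorphic_on_subset order_trans)
    have \<phi>z: "norm (- \<phi> z - 0) < R" using z by (simp add: V_def)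
    have i1: "((\<lambda>x. k (of_real R * E x)) has_integral k 0) {0..1}"
      proof -
      have "0 + complex_of_real R * E x \<noteq> 0" for x using R by (simp add: E_def)
      then show ?thesis using circle_mean[OF k1 k2, of 0] R by (simp add: E_def)
    qed
    have i2: "((\<lambda>x. k (of_real R * E x) * (of_real R * E x) / (of_real R * E x + \<phi> z)) has_integral k (- \<phi> z)) {0..1}"
      using circle_mean[OF k1 k2 \<phi>z] by (simp add: E_def)
    \<comment> \<open>\<open>z + (- \<phi> z) *s v\<close> is the projection of \<open>z\<close>
      along \<open>v\<close> to the hyperplane, where \<open>f\<close> vanishes. Hence the Cauchy
      integral of \<open>k\<close> at \<open>- \<phi> z\<close> is 0 and may be subtracted from the
      mean value of \<open>k\<close>, which is \<open>f z\<close>.\<close>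
    have ss: "z + (-\<phi> z) *s v \<in> U" by (rule inU[OF z]) (use \<phi>z R in auto)
    have "\<phi> (z + (-\<phi> z) *s v) = \<phi> z + (-\<phi> z) * \<phi> v" by (simp only: \<phi>)
    then have "\<phi> (z + (-\<phi> z) *s v) = 0" by (simp add: \<phi>(3))
    from zero[OF ss this] have "k (- \<phi> z) = 0" by (simp add: k_def)
    with has_integral_diff[OF i1 i2]
    have "((\<lambda>x. k (of_real R * E x) - k (of_real R * E x) * (of_real R * E x) / (of_real R * E x + \<phi> z)) has_integral f z) {0..1}"
      by (simp add: k_def)
    moreover have "k (of_real R * E x) - k (of_real R * E x) * (of_real R * E x) / (of_real R * E x + \<phi> z) = h z x * \<phi> z" for x
      using den[OF z, of x] by (simp add: h_def k_def field_simps)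
    ultimately have "((\<lambda>x. h z x * \<phi> z) has_integral f z) {0..1}" by simp
    then have "f z = integral {0..1} (\<lambda>x. h z x * \<phi> z)" by (rule integral_unique[symmetric])
    then show ?thesis by (simp add: g_def)
  qed
  moreover have "V \<subseteq> U" using inU[of _ 0] R by auto
  ultimately show ?thesis using oV w0V gV by blast
qed

section \<open>Fourier expansion on tube domains\<close>

definition ee :: "complex \<Rightarrow> complex" where "ee t = exp (2 * of_real pi * \<i> * t)"

lemma ee_add: "ee (s + t) = ee s * ee t"
  by (simp add: ee_def exp_add algebra_simps)

lemma ee_0 [simp]: "ee 0 = 1"
  by (simp add: ee_def)

lemma ee_neq_0 [simp]: "ee t \<noteq> 0"
  by (simp add: ee_def)

lemma ee_minus: "ee (- t) = inverse (ee t)"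
  by (simp add: ee_def exp_minus)

lemma norm_ee: "norm (ee t) = exp (- 2 * pi * Im t)"
  by (simp add: ee_def)

lemma ee_of_int: "ee (of_int k) = 1"
proof -
  have "ee (of_int k) = cis (2 * pi * of_int k)" unfolding ee_def cis_conv_exp by (rule arg_cong[where f=exp]) simp
  then show ?thesis by (simp add: cis_multiple_2pi)
qed

lemma ee_has_field_derivative: "(ee has_field_derivative 2 * of_real pi * \<i> * ee t) (at t within S)"
  unfolding ee_def by (auto intro!: derivative_eq_intros)

lemma holomorphic_on_ee: "ee holomorphic_on S"
  using ee_has_field_derivative holomorphic_on_def field_differentiable_def by blast

lemma continuous_on_ee: "continuous_on S f \<Longrightarrow> continuous_on S (\<lambda>x. ee (f x))"
  unfolding ee_def by (intro continuous_intros)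

lemma ee_eq_1: "ee s = 1 \<Longrightarrow> \<bar>Re s\<bar> < 1 \<Longrightarrow> s = 0"
proof -
  assume "ee s = 1" and s: "\<bar>Re s\<bar> < 1"
  then obtain n :: int where n: "Re (2 * of_real pi * \<i> * s) = 0" "Im (2 * of_real pi * \<i> * s) = of_int (2 * n) * pi"
    unfolding ee_def exp_eq_1 by blast
  then have "Im s = 0" "Re s = of_int n" by auto
  moreover from this s have "n = 0" by linarith
  ultimately show "s = 0" by (simp add: complex_eq_iff)
qed

section \<open>Fourier series in one variable\<close>

abbreviation "per \<equiv> {-(1/2)..1/2::real}"

text \<open>Integration by parts; the boundary terms cancel because the character takes equal values
  at \<open>1/2\<close> and \<open>-1/2\<close>. With \<open>f\<close> constant this is
  orthogonality of characters, with \<open>f\<close> the quotient \<open>h\<close> of the next lemma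
  it is the decay of its coefficients, and on a tube it is the eigenvalue equation for
  \<open>Fop\<close>.\<close>

lemma fourier_parts:
  assumes "\<And>x. x \<in> per \<Longrightarrow> (f has_vector_derivative f' x) (at x within per)" "f (1/2) = f (-1/2)"
  shows "((\<lambda>x. f' x * ee (- of_int k * of_real x) - 2 * of_real pi * \<i> * of_int k * (f x * ee (- of_int k * of_real x))) has_integral 0) per"
proof -
  have ex: "((\<lambda>x. ee (- of_int k * of_real x)) has_vector_derivative
      - (2 * of_real pi * \<i> * of_int k) * ee (- of_int k * of_real x)) (at x within per)" for x
    unfolding ee_def by (rule has_vector_derivative_eq_rhs, rule has_vector_derivative_real_field, (rule derivative_eq_intros refl)+) simp
  have "((\<lambda>x. f x * ee (- of_int k * of_real x)) has_vector_derivative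
     (f x * (- (2 * of_real pi * \<i> * of_int k) * ee (- of_int k * of_real x)) + f' x * ee (- of_int k * of_real x))) (at x within per)"
    if "x \<in> per" for x by (rule has_vector_derivative_mult[OF assms(1)[OF that] ex])
  then have "((\<lambda>x. f x * (- (2 * of_real pi * \<i> * of_int k) * ee (- of_int k * of_real x)) + f' x * ee (- of_int k * of_real x)) has_integral
     (f (1/2) * ee (- of_int k * of_real (1/2)) - f (-(1/2)) * ee (- of_int k * of_real (-(1/2))))) per"
    by (intro fundamental_theorem_of_calculus) auto
  moreover have "ee (- of_int k * of_real (1/2)) = ee (- of_int k * of_real (-1/2))"
  proof -
    have "ee (- of_int k * of_real (-1/2)) = ee (- of_int k * of_real (1/2) + of_int k)" by (simp add: field_simps)
    then show ?thesis by (simp only: ee_add ee_of_int mult_1_right)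
  qed
  ultimately show ?thesis using assms(2) by (simp add: algebra_simps)
qed

text \<open>Writing \<open>g - g 0\<close> as \<open>h * (ee - 1)\<close> makes the k-th coefficient
  of \<open>g\<close> a difference of neighbouring coefficients of \<open>h\<close>, up to
  \<open>g 0\<close> at \<open>k = 0\<close>. The symmetric partial sum telescopes to
  \<open>g 0\<close> plus two coefficients of \<open>h\<close>, which tend to 0.\<close>

lemma fourier_series_at_0:
  assumes g: "g holomorphic_on D" "open D" and real: "\<And>x. complex_of_real x \<in> D" and per: "g (1/2) = g (-1/2)"
  shows "(\<lambda>K. \<Sum>k=-int K..int K. integral per (\<lambda>x. g (of_real x) * ee (- of_int k * of_real x))) \<longlonglongrightarrow> g 0"
proof -
  \<comment> \<open>The strip contains the period interval, and 0 is the only zero of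
    \<open>ee - 1\<close> in it, so \<open>h\<close> below is holomorphic there.\<close>
  define D' where "D' = D \<inter> {s. \<bar>Re s\<bar> < 1}"
  have oD: "open D'" unfolding D'_def using g(2) by (intro open_Int open_Collect_less continuous_intros)
  have zD: "0 \<in> D'" using real[of 0] by (simp add: D'_def)
  define q where "q = (\<lambda>s. if s = 0 then deriv g 0 else (g s - g 0) / (s - 0))"
  define p where "p = (\<lambda>s. if s = 0 then deriv ee 0 else (ee s - ee 0) / (s - 0))"
  have qh: "q holomorphic_on D'" unfolding q_def
    by (rule pole_lemma_open) (use oD g in \<open>auto simp: D'_def intro: holomorphic_on_subset\<close>)
  have ph: "p holomorphic_on D'" unfolding p_def by (rule pole_lemma_open[OF holomorphic_on_ee oD])
  have "deriv ee 0 = 2 * of_real pi * \<i>" using DERIV_imp_deriv[OF ee_has_field_derivative[of 0]] by simp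
  then have pz: "p s \<noteq> 0" if "s \<in> D'" for s using that ee_eq_1 by (auto simp: p_def D'_def)
  define h where "h = (\<lambda>s. q s / p s)"
  have hh: "h holomorphic_on D'" unfolding h_def using pz by (intro holomorphic_intros qh ph) auto
  have gh: "g s = g 0 + h s * (ee s - 1)" if "s \<in> D'" for s
    using pz[OF that] by (auto simp: h_def q_def p_def)
  have inD: "complex_of_real x \<in> D'" if "x \<in> per" for x using that real by (auto simp: D'_def)
  have hc: "continuous_on per (\<lambda>x. h (of_real x))"
    by (rule continuous_on_compose2[OF holomorphic_on_imp_continuous_on[OF hh]]) (use inD in \<open>auto intro!: continuous_intros\<close>)
  have dhc: "continuous_on per (\<lambda>x. deriv h (of_real x))"
    by (rule continuous_on_compose2[OF holomorphic_on_imp_continuous_on[OF holomorphic_deriv[OF hh oD]]]) (use inD in \<open>auto intro!: continuous_intros\<close>)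
  define H where "H = (\<lambda>k::int. integral per (\<lambda>x. h (of_real x) * ee (- of_int k * of_real x)))"
  have hint: "(\<lambda>x. h (of_real x) * ee (- of_int k * of_real x)) integrable_on per" for k::int
    by (intro integrable_continuous_interval continuous_intros hc continuous_on_ee)
  have gk: "integral per (\<lambda>x. g (of_real x) * ee (- of_int k * of_real x)) = (if k = 0 then g 0 else 0) + (H (k - 1) - H k)" for k :: int
  proof -
    have i0: "integral per (\<lambda>x. ee (- of_int k * of_real x)) = (if k = 0 then 1 else 0)"
    proof (cases "k = 0")
      case False
      have "((\<lambda>x. (0::complex) * ee (- of_int k * of_real x) - 2 * of_real pi * \<i> * of_int k * (1 * ee (- of_int k * of_real x))) has_integral 0) per"
        by (rule fourier_parts[of "\<lambda>x. 1"]) auto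
      then have "((\<lambda>x. - (2 * of_real pi * \<i> * of_int k) * ee (- of_int k * of_real x)) has_integral 0) per" by (simp add: algebra_simps)
      from has_integral_mult_right[OF this, of "inverse (- (2 * of_real pi * \<i> * of_int k))"]
      moreover have "inverse (- (2 * of_real pi * \<i> * of_int k)) * (- (2 * of_real pi * \<i> * of_int k) * w) = w" for w
        using False by (simp only: mult.assoc[symmetric]) (simp add: field_simps)
      ultimately have "((\<lambda>x. ee (- of_int k * of_real x)) has_integral 0) per" by (simp only: mult_zero_right)
      then show ?thesis using False by (simp add: integral_unique)
    qed simp
    have "integral per (\<lambda>x. g (of_real x) * ee (- of_int k * of_real x)) =
       integral per (\<lambda>x. g 0 * ee (- of_int k * of_real x) + (h (of_real x) * ee (- of_int (k - 1) * of_real x) - h (of_real x) * ee (- of_int k * of_real x)))"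
    proof (rule integral_cong)
      fix x assume x: "x \<in> per"
      have "ee (- of_int (k - 1) * of_real x) = ee (- of_int k * of_real x) * ee (of_real x)"
        by (simp add: ee_add[symmetric] algebra_simps)
      then show "g (of_real x) * ee (- of_int k * of_real x) =
        g 0 * ee (- of_int k * of_real x) + (h (of_real x) * ee (- of_int (k - 1) * of_real x) - h (of_real x) * ee (- of_int k * of_real x))"
        by (subst gh[OF inD[OF x]]) (simp add: algebra_simps)
    qed
    also have "\<dots> = integral per (\<lambda>x. g 0 * ee (- of_int k * of_real x)) + (H (k-1) - H k)"
      unfolding H_def
      by (subst integral_add) (auto intro!: integrable_diff hint integral_diff integrable_continuous_interval continuous_intros continuous_on_ee simp del: of_int_diff simp: hc)
    finally show ?thesis using i0 by simp
  qed
  have tel: "(\<Sum>k=-int K..int K. H (k - 1) - H k) = H (- int K - 1) - H (int K)" for K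
  proof (induction K)
    case (Suc K)
    have "{-int (Suc K)..int (Suc K)} = insert (-int (Suc K)) (insert (int (Suc K)) {-int K..int K})" by auto
    then show ?case using Suc by (simp add: algebra_simps) (rule arg_cong[where f=H], simp)
  qed simp
  have sumg: "(\<Sum>k=-int K..int K. integral per (\<lambda>x. g (of_real x) * ee (- of_int k * of_real x))) = g 0 + (H (- int K - 1) - H (int K))" for K
    unfolding gk sum.distrib tel by simp
  have "bounded ((\<lambda>x. deriv h (of_real x)) ` per)" using dhc compact_continuous_image compact_imp_bounded by blast
  then obtain B where B: "\<And>x. x \<in> per \<Longrightarrow> norm (deriv h (of_real x)) \<le> B" unfolding bounded_iff ball_simps by blast
  \<comment> \<open>\<open>ee\<close> equals -1 at both ends of the period, so \<open>h\<close>
    inherits equal end values from \<open>g\<close>, and integration by parts bounds its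
    coefficients by a multiple of \<open>1/k\<close>.\<close>
  have Hb: "norm (H k) \<le> B / (2 * pi * \<bar>of_int k\<bar>)" if "k \<noteq> 0" for k :: int
  proof -
    have "h (of_real (1/2)) = h (of_real (-1/2))"
    proof -
      have "ee (1/2) = -1" "ee (-1/2) = -1" unfolding ee_def by (auto simp: exp_eq_polar cis.ctr complex_eq_iff)
      moreover have "g 0 + h (1/2) * (ee (1/2) - 1) = g 0 + h (-1/2) * (ee (-1/2) - 1)"
        using gh[of "1/2"] gh[of "-1/2"] inD[of "1/2"] inD[of "-1/2"] per by simp
      ultimately show ?thesis by simp
    qed
    then have i: "((\<lambda>x. deriv h (of_real x) * ee (- of_int k * of_real x) - 2 * of_real pi * \<i> * of_int k * (h (of_real x) * ee (- of_int k * of_real x))) has_integral 0) per"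
    proof (intro fourier_parts)
      fix x assume "x \<in> per"
      then show "((\<lambda>x. h (of_real x)) has_vector_derivative deriv h (of_real x)) (at x within per)"
        by (intro has_vector_derivative_real_field holomorphic_derivI[OF hh oD] inD)
    qed
    have i2: "(\<lambda>x. deriv h (of_real x) * ee (- of_int k * of_real x)) integrable_on per"
      by (intro integrable_continuous_interval continuous_intros dhc continuous_on_ee)
    have "integral per (\<lambda>x. deriv h (of_real x) * ee (- of_int k * of_real x)) - 2 * of_real pi * \<i> * of_int k * H k = 0"
      using has_integral_unique[OF has_integral_diff[OF integrable_integral[OF i2] has_integral_mult_right[OF integrable_integral[OF hint]]] i]
      unfolding H_def .
    then have "2 * of_real pi * \<i> * of_int k * H k = integral per (\<lambda>x. deriv h (of_real x) * ee (- of_int k * of_real x))" by simp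
    then have "norm (2 * of_real pi * \<i> * of_int k * H k) = norm (integral per (\<lambda>x. deriv h (of_real x) * ee (- of_int k * of_real x)))" by simp
    also have "\<dots> \<le> integral per (\<lambda>x. B)"
      by (rule integral_norm_bound_integral) (use i2 B in \<open>auto simp: norm_mult norm_ee\<close>)
    finally have "2 * pi * \<bar>of_int k\<bar> * norm (H k) \<le> B" by (simp add: norm_mult)
    then show ?thesis using that by (simp add: field_simps)
  qed
  have l1: "(\<lambda>K. H (int K)) \<longlonglongrightarrow> 0"
  proof (rule Lim_null_comparison)
    show "\<forall>\<^sub>F K in sequentially. norm (H (int K)) \<le> (B / (2*pi)) * inverse (real K)"
      using eventually_gt_at_top[of 0] by eventually_elim (use Hb[of "int _"] in \<open>auto simp: divide_simps\<close>)
    show "(\<lambda>K. (B / (2*pi)) * inverse (real K)) \<longlonglongrightarrow> 0" using tendsto_mult_right_zero[OF lim_inverse_n] by blast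
  qed
  have l2: "(\<lambda>K. H (- int K - 1)) \<longlonglongrightarrow> 0"
  proof (rule Lim_null_comparison)
    have "norm (H (- int K - 1)) \<le> (B / (2*pi)) * inverse (real (Suc K))" for K
      using Hb[of "- int K - 1"] by (simp add: divide_simps algebra_simps)
    then show "\<forall>\<^sub>F K in sequentially. norm (H (- int K - 1)) \<le> (B / (2*pi)) * inverse (real (Suc K))" by simp
    show "(\<lambda>K. (B / (2*pi)) * inverse (real (Suc K))) \<longlonglongrightarrow> 0" using tendsto_mult_right_zero[OF LIMSEQ_inverse_real_of_nat] by blast
  qed
  have "(\<lambda>K. g 0 + (H (- int K - 1) - H (int K))) \<longlonglongrightarrow> g 0 + (0 - 0)" by (intro tendsto_intros l1 l2)
  then show ?thesis unfolding sumg by simp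
qed

locale tube =
  fixes T :: "(complex^'n::finite) set"
  assumes openT: "open T" and convT: "convex T" and transT: "\<And>z t. z \<in> T \<Longrightarrow> z + rvec t \<in> T"
begin

definition nice :: "(complex^'n \<Rightarrow> complex) \<Rightarrow> bool" where
  "nice f \<longleftrightarrow> cholo_on f T \<and> (\<forall>z\<in>T. \<forall>b. f (z + axis b 1) = f z)"

text \<open>Fourier coefficient in the coordinate \<open>b\<close> alone, kept as a function on the
  tube including its dependence on \<open>z $ b\<close>. Iteration over the coordinates then
  produces the terms of the multiple series.\<close>

definition Fop :: "'n \<Rightarrow> int \<Rightarrow> (complex^'n \<Rightarrow> complex) \<Rightarrow> complex^'n \<Rightarrow> complex" where
  "Fop b k f z = integral per (\<lambda>x. f (z + of_real x *s axis b 1) * ee (- of_int k * of_real x))"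

text \<open>Infinitesimal form of multiplication by \<open>ee (k * s)\<close> under translation by
  \<open>s\<close> in the coordinate \<open>b\<close>. As a differential equation it survives later
  averaging, see \<open>eigen_Fop_preserved\<close>; it is integrated only in
  \<open>eigen_shift\<close>.\<close>

definition eigen :: "'n \<Rightarrow> int \<Rightarrow> (complex^'n \<Rightarrow> complex) \<Rightarrow> bool" where
  "eigen b k f \<longleftrightarrow> (\<forall>z\<in>T. \<forall>f'. (f has_derivative f') (at z) \<longrightarrow> f' (axis b 1) = 2 * of_real pi * \<i> * of_int k * f z)"

lemma rvec_axis: "of_real x *s axis b (1::complex) = rvec (x *\<^sub>R axis b 1)"
  by (auto simp: vec_eq_iff rvec_def axis_def)

lemma T_line: "z \<in> T \<Longrightarrow> z + of_real x *s axis b 1 \<in> T"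
  unfolding rvec_axis by (rule transT)

lemma continuous_Fop:
  assumes "cholo_on f T"
  shows "continuous_on (T \<times> per) (\<lambda>(z,x). f (z + of_real x *s axis b 1) * ee (- of_int k * of_real x))"
  unfolding case_prod_beta
  by (intro continuous_intros continuous_on_compose2[OF cholo_on_continuous[OF assms]] continuous_on_ee) (auto intro: T_line)

lemma cholo_Fop_integrand:
  assumes "cholo_on f T" shows "cholo_on (\<lambda>z. f (z + of_real x *s axis b 1) * ee (- of_int k * of_real x)) T"
  by (intro cholo_on_mult cholo_on_const cholo_on_compose[OF assms]) (auto intro!: cholo_on_add cholo_on_nth cholo_on_const T_line)

lemma Fop_derivative:
  assumes f: "cholo_on f T" and z: "z \<in> T"
  shows "\<exists>f'. (\<forall>x. (f has_derivative f' x) (at (z + of_real x *s axis b 1))) \<and> (\<forall>x c v. f' x (c *s v) = c * f' x v) \<and>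
    (Fop b k f has_derivative (\<lambda>h. integral per (\<lambda>x. f' x h * ee (- of_int k * of_real x)))) (at z) \<and>
    (\<forall>h. (\<lambda>x. f' x h * ee (- of_int k * of_real x)) integrable_on per)"
proof -
  have "\<forall>x. \<exists>f'. (f has_derivative f') (at (z + of_real x *s axis b 1)) \<and> (\<forall>c v. f' (c *s v) = c * f' v)"
    using f T_line[OF z] unfolding cholo_on_def by blast
  then obtain f' where f': "\<And>x. (f has_derivative f' x) (at (z + of_real x *s axis b 1))" "\<And>x c v. f' x (c *s v) = c * f' x v"
    by metis
  have d: "((\<lambda>z. f (z + of_real x *s axis b 1) * ee (- of_int k * of_real x)) has_derivative (\<lambda>h. f' x h * ee (- of_int k * of_real x))) (at z)" for x
  proof -
    have "((\<lambda>z. z + of_real x *s axis b 1) has_derivative (\<lambda>h. h)) (at z)" by (auto intro!: derivative_eq_intros)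
    from has_derivative_mult_left[OF has_derivative_compose[OF this f'(1)]] show ?thesis .
  qed
  have l: "f' x (c *s v) * ee (- of_int k * of_real x) = c * (f' x v * ee (- of_int k * of_real x))" for x c v by (simp add: f'(2))
  note D = integral_has_derivative_cholo[OF _ openT continuous_Fop[OF f] cholo_Fop_integrand[OF f] z d l]
  have "(Fop b k f has_derivative (\<lambda>h. integral per (\<lambda>x. f' x h * ee (- of_int k * of_real x)))) (at z)"
    unfolding Fop_def[abs_def] by (rule D(1)) auto
  moreover have "(\<lambda>x. f' x h * ee (- of_int k * of_real x)) integrable_on per" for h by (rule D(2)) auto
  ultimately show ?thesis using f' by blast
qed

lemma cholo_Fop: assumes "cholo_on f T" shows "cholo_on (Fop b k f) T"
  unfolding Fop_def[abs_def]
  by (rule cholo_on_integral[OF _ openT continuous_Fop[OF assms] cholo_Fop_integrand[OF assms]]) auto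

lemma nice_Fop: assumes "nice f" shows "nice (Fop b k f)"
proof -
  have "Fop b k f (z + axis c 1) = Fop b k f z" if "z \<in> T" for z c
  proof -
    have "f (z + axis c 1 + of_real x *s axis b 1) = f (z + of_real x *s axis b 1)" for x
      using assms T_line[OF that] unfolding nice_def by (metis add.assoc add.commute)
    then show ?thesis by (simp add: Fop_def)
  qed
  then show ?thesis using assms cholo_Fop by (auto simp: nice_def)
qed

lemma eigen_Fop: assumes f: "nice f" shows "eigen b k (Fop b k f)"
  unfolding eigen_def
proof (intro ballI allI impI)
  fix z F' assume z: "z \<in> T" and F': "(Fop b k f has_derivative F') (at z)"
  have ch: "cholo_on f T" using f by (simp add: nice_def)
  obtain f' where f'a: "(\<forall>x. (f has_derivative f' x) (at (z + of_real x *s axis b 1))) \<and> (\<forall>x c v. f' x (c *s v) = c * f' x v) \<and>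
    (Fop b k f has_derivative (\<lambda>h. integral per (\<lambda>x. f' x h * ee (- of_int k * of_real x)))) (at z) \<and>
    (\<forall>h. (\<lambda>x. f' x h * ee (- of_int k * of_real x)) integrable_on per)" using Fop_derivative[OF ch z, of b k] ..
  note f' = f'a[THEN conjunct1, rule_format] f'a[THEN conjunct2, THEN conjunct1, rule_format]
    f'a[THEN conjunct2, THEN conjunct2, THEN conjunct1] f'a[THEN conjunct2, THEN conjunct2, THEN conjunct2, rule_format]
  have "F' = (\<lambda>h. integral per (\<lambda>x. f' x h * ee (- of_int k * of_real x)))"
    using has_derivative_unique[OF F' f'(3)] .
  then have F'a: "F' (axis b 1) = integral per (\<lambda>x. f' x (axis b 1) * ee (- of_int k * of_real x))" by simp
  have vd: "((\<lambda>x. f (z + of_real x *s axis b 1)) has_vector_derivative f' x (axis b 1)) (at x within per)" if "x \<in> per" for x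
    by (intro has_vector_derivative_real_field has_field_derivative_line f' that)
  have eq: "f (z + of_real (1/2) *s axis b 1) = f (z + of_real (-1/2) *s axis b 1)"
  proof -
    have "z + of_real (1/2) *s axis b 1 = (z + of_real (-1/2) *s axis b 1) + axis b 1"
      by (auto simp: vec_eq_iff axis_def)
    then show ?thesis using f T_line[OF z] unfolding nice_def by metis
  qed
  have ig: "(\<lambda>x. f (z + of_real x *s axis b 1) * ee (- of_int k * of_real x)) integrable_on per"
    by (intro integrable_continuous_interval continuous_intros continuous_on_ee continuous_on_compose2[OF cholo_on_continuous[OF ch]])
       (auto intro: T_line[OF z])
  have "integral per (\<lambda>x. f' x (axis b 1) * ee (- of_int k * of_real x)) - 2 * of_real pi * \<i> * of_int k * Fop b k f z = 0"
    using has_integral_unique[OF has_integral_diff[OF integrable_integral[OF f'(4)] has_integral_mult_right[OF integrable_integral[OF ig]]] fourier_parts[OF vd eq, of k]]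
    unfolding Fop_def .
  then show "F' (axis b 1) = 2 * of_real pi * \<i> * of_int k * Fop b k f z" by (simp add: F'a)
qed

lemma eigen_Fop_preserved: assumes f: "nice f" and e: "eigen c m f" shows "eigen c m (Fop b k f)"
  unfolding eigen_def
proof (intro ballI allI impI)
  fix z F' assume z: "z \<in> T" and F': "(Fop b k f has_derivative F') (at z)"
  have ch: "cholo_on f T" using f by (simp add: nice_def)
  obtain f' where f'a: "(\<forall>x. (f has_derivative f' x) (at (z + of_real x *s axis b 1))) \<and> (\<forall>x c v. f' x (c *s v) = c * f' x v) \<and>
    (Fop b k f has_derivative (\<lambda>h. integral per (\<lambda>x. f' x h * ee (- of_int k * of_real x)))) (at z) \<and>
    (\<forall>h. (\<lambda>x. f' x h * ee (- of_int k * of_real x)) integrable_on per)" using Fop_derivative[OF ch z, of b k] ..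
  note f' = f'a[THEN conjunct1, rule_format] f'a[THEN conjunct2, THEN conjunct1, rule_format]
    f'a[THEN conjunct2, THEN conjunct2, THEN conjunct1] f'a[THEN conjunct2, THEN conjunct2, THEN conjunct2, rule_format]
  have "F' = (\<lambda>h. integral per (\<lambda>x. f' x h * ee (- of_int k * of_real x)))"
    using has_derivative_unique[OF F' f'(3)] .
  then have "F' (axis c 1) = integral per (\<lambda>x. f' x (axis c 1) * ee (- of_int k * of_real x))" by simp
  also have "\<dots> = integral per (\<lambda>x. 2 * of_real pi * \<i> * of_int m * (f (z + of_real x *s axis b 1) * ee (- of_int k * of_real x)))"
  proof (rule integral_cong)
    fix x
    have "f' x (axis c 1) = 2 * of_real pi * \<i> * of_int m * f (z + of_real x *s axis b 1)"
      using e f'(1)[of x] T_line[OF z, of x b] unfolding eigen_def by blast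
    then show "f' x (axis c 1) * ee (- of_int k * of_real x) =
      2 * of_real pi * \<i> * of_int m * (f (z + of_real x *s axis b 1) * ee (- of_int k * of_real x))" by (simp only: mult.assoc)
  qed
  also have "\<dots> = 2 * of_real pi * \<i> * of_int m * Fop b k f z" by (simp add: Fop_def)
  finally show "F' (axis c 1) = 2 * of_real pi * \<i> * of_int m * Fop b k f z" .
qed

lemma Fop_bound:
  assumes f: "cholo_on f T" and z: "z \<in> T" and M: "\<And>t. norm (f (z + rvec t)) \<le> M"
  shows "norm (Fop b k f (z + rvec t)) \<le> M"
proof -
  have zt: "z + rvec t \<in> T" by (rule transT[OF z])
  have "norm (f (z + rvec t + of_real x *s axis b 1)) \<le> M" for x
  proof -
    have "z + rvec t + of_real x *s axis b 1 = z + rvec (t + x *\<^sub>R axis b 1)" by (auto simp: vec_eq_iff rvec_def axis_def)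
    then show ?thesis using M by (simp only:)
  qed
  then have "norm (Fop b k f (z + rvec t)) \<le> integral per (\<lambda>x. M)" unfolding Fop_def
    by (intro integral_norm_bound_integral integrable_continuous_interval continuous_intros continuous_on_ee continuous_on_compose2[OF cholo_on_continuous[OF f]])
       (auto intro: T_line[OF zt] simp: norm_mult norm_ee)
  then show ?thesis by simp
qed

lemma Fop_partial_sums:
  assumes f: "nice f" and z: "z \<in> T"
  shows "(\<lambda>K. \<Sum>k=-int K..int K. Fop b k f z) \<longlonglongrightarrow> f z"
proof -
  define g where "g = (\<lambda>s. f (z + s *s axis b 1))"
  have gh: "g holomorphic_on {s. z + s *s axis b 1 \<in> T}" unfolding g_def using f by (intro cholo_on_line) (simp add: nice_def)
  have g2: "g (1/2) = g (-1/2)"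
  proof -
    have eq: "z + (1/2) *s axis b 1 = (z + (-1/2) *s axis b 1) + axis b 1"
      by (auto simp: vec_eq_iff axis_def)
    have "z + (-1/2) *s axis b 1 \<in> T" using T_line[OF z, of "-1/2" b] by simp
    then show ?thesis unfolding g_def eq using f unfolding nice_def by blast
  qed
  have "(\<lambda>K. \<Sum>k=-int K..int K. integral per (\<lambda>x. g (of_real x) * ee (- of_int k * of_real x))) \<longlonglongrightarrow> g 0"
    by (rule fourier_series_at_0[OF gh open_line[OF openT] _ g2]) (auto intro: T_line[OF z])
  then show ?thesis by (simp add: g_def Fop_def)
qed

text \<open>\<open>F (z + \<tau> *s v) * ee (- \<tau> * S)\<close> has derivative 0 along the
  segment, which stays in the tube by convexity. Only coordinates in which \<open>v\<close> is
  nonzero must be eigendirections, so the lemma also serves operators over part of the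
  coordinates.\<close>

lemma eigen_shift:
  assumes F: "cholo_on F T" and e: "\<And>b. v $ b \<noteq> 0 \<Longrightarrow> eigen b (k b) F" and z: "z \<in> T" "z + v \<in> T"
  shows "F (z + v) = ee (\<Sum>b\<in>UNIV. of_int (k b) * v $ b) * F z"
proof -
  define S where "S = (\<Sum>b\<in>UNIV. of_int (k b) * v $ b)"
  define \<phi> where "\<phi> = (\<lambda>\<tau>. F (z + \<tau> *s v) * ee (- \<tau> * S))"
  define D where "D = closed_segment 0 (1::complex)"
  have inT: "z + \<tau> *s v \<in> T" if \<tau>: "\<tau> \<in> D" for \<tau>
  proof -
    obtain u where u: "0 \<le> u" "u \<le> 1" "\<tau> = of_real u" using \<tau> by (auto simp: D_def closed_segment_def scaleR_conv_of_real)
    have "(1 - u) *\<^sub>R z + u *\<^sub>R (z + v) \<in> T" using convT z u by (simp add: convexD)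
    also have "(1 - u) *\<^sub>R z + u *\<^sub>R (z + v) = z + u *\<^sub>R v" by (simp add: algebra_simps)
    finally show ?thesis by (simp add: u(3) scaleR_eq_vmult)
  qed
  have "\<exists>c. \<forall>x\<in>D. \<phi> x = c"
  proof (rule has_field_derivative_zero_constant)
    show "convex D" unfolding D_def by simp
    fix \<tau> assume t: "\<tau> \<in> D"
    obtain F' where F': "(F has_derivative F') (at (z + \<tau> *s v))" "\<And>c v. F' (c *s v) = c * F' v"
      using F inT[OF t] unfolding cholo_on_def by blast
    have lin: "linear F'" using F'(1) has_derivative_linear by blast
    have v: "v = (\<Sum>b\<in>UNIV. v $ b *s axis b 1)"
      by (simp add: vec_eq_iff axis_def if_distrib cong: if_cong)
    have "F' v = (\<Sum>b\<in>UNIV. F' (v $ b *s axis b 1))" by (subst v) (rule linear_sum[OF lin])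
    also have "\<dots> = (\<Sum>b\<in>UNIV. 2 * of_real pi * \<i> * F (z + \<tau> *s v) * (of_int (k b) * v $ b))"
    proof (rule sum.cong)
      fix b
      have "F' (axis b 1) = 2 * of_real pi * \<i> * of_int (k b) * F (z + \<tau> *s v)" if "v $ b \<noteq> 0"
        using e[OF that] F'(1) inT[OF t] unfolding eigen_def by blast
      then show "F' (v $ b *s axis b 1) = 2 * of_real pi * \<i> * F (z + \<tau> *s v) * (of_int (k b) * v $ b)"
        by (cases "v $ b = 0") (simp_all add: F'(2) linear_0[OF lin])
    qed simp
    also have "\<dots> = 2 * of_real pi * \<i> * F (z + \<tau> *s v) * S" by (simp add: S_def sum_distrib_left)
    finally have F'v: "F' v = 2 * of_real pi * \<i> * F (z + \<tau> *s v) * S" .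
    have d1: "((\<lambda>s. F (z + s *s v)) has_field_derivative F' v) (at \<tau> within D)"
      by (rule has_field_derivative_at_within, rule has_field_derivative_line[OF F'])
    have d2: "((\<lambda>s. ee (- s * S)) has_field_derivative (2 * of_real pi * \<i> * ee (- \<tau> * S)) * (- S)) (at \<tau> within D)"
      by (rule DERIV_chain2[OF ee_has_field_derivative]) (auto intro!: derivative_eq_intros)
    show "(\<phi> has_field_derivative 0) (at \<tau> within D)" unfolding \<phi>_def
      by (rule DERIV_cong[OF DERIV_mult[OF d1 d2]]) (simp add: F'v)
  qed
  then have "\<phi> 1 = \<phi> 0" unfolding D_def by (metis ends_in_segment)
  then have "F (z + v) * ee (- S) = F z" by (simp add: \<phi>_def)
  then show ?thesis unfolding S_def[symmetric] by (simp add: ee_minus field_simps)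
qed

primrec Fops :: "'n list \<Rightarrow> int list \<Rightarrow> (complex^'n \<Rightarrow> complex) \<Rightarrow> complex^'n \<Rightarrow> complex" where
  "Fops [] ks f = f"
| "Fops (b # bs) ks f = Fops bs (tl ks) (Fop b (hd ks) f)"

lemma nice_Fops: "nice f \<Longrightarrow> nice (Fops bs ks f)"
  by (induction bs arbitrary: ks f) (simp_all add: nice_Fop)

lemma eigen_Fops_preserved: "nice f \<Longrightarrow> eigen c m f \<Longrightarrow> eigen c m (Fops bs ks f)"
  by (induction bs arbitrary: ks f) (simp_all add: nice_Fop eigen_Fop_preserved)

lemma eigen_Fops: "nice f \<Longrightarrow> b \<in> set bs \<Longrightarrow> eigen b (k b) (Fops bs (map k bs) f)"
proof (induction bs arbitrary: f)
  case (Cons c bs)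
  show ?case
  proof (cases "b \<in> set bs")
    case True
    then show ?thesis using Cons.IH[OF nice_Fop[OF Cons.prems(1)]] by simp
  next
    case False
    then have "b = c" using Cons.prems by simp
    then show ?thesis using eigen_Fops_preserved[OF nice_Fop[OF Cons.prems(1)] eigen_Fop[OF Cons.prems(1)]] by simp
  qed
qed simp

lemma Fops_bound:
  "nice f \<Longrightarrow> z \<in> T \<Longrightarrow> (\<And>t. norm (f (z + rvec t)) \<le> M) \<Longrightarrow> norm (Fops bs ks f (z + rvec t)) \<le> M"
proof (induction bs arbitrary: ks f t)
  case (Cons b bs)
  have "cholo_on f T" using Cons.prems(1) by (simp add: nice_def)
  then have "norm (Fop b (hd ks) f (z + rvec t)) \<le> M" for t using Fop_bound Cons.prems by blast
  then show ?case using Cons.IH[OF nice_Fop[OF Cons.prems(1)] Cons.prems(2)] by simp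
qed simp

lemma nice_int_periodic:
  assumes f: "nice f" and z: "z \<in> T" shows "f (z + rvec (\<chi> b. of_int (m b))) = f z"
proof -
  have nat: "f (w + of_real (real n) *s axis b 1) = f w" if "w \<in> T" for w n b
  proof (induction n)
    case (Suc n)
    have "w + of_real (real (Suc n)) *s axis b 1 = (w + of_real (real n) *s axis b 1) + axis b 1"
      by (auto simp: vec_eq_iff algebra_simps)
    then show ?case using Suc f T_line[OF that] unfolding nice_def by metis
  qed simp
  have int: "f (w + of_real (of_int k) *s axis b 1) = f w" if w: "w \<in> T" for w k b
  proof (cases "k \<ge> 0")
    case True then show ?thesis using nat[OF w, of "nat k" b] by simp
  next
    case False
    then have r: "real (nat (- k)) = - of_int k" by simp
    have "(w + of_real (of_int k) *s axis b 1) + of_real (real (nat (- k))) *s axis b 1 = w"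
      unfolding r by (simp add: vec_eq_iff)
    then show ?thesis using nat[OF T_line[OF w, of "of_int k" b], of "nat (-k)" b] by metis
  qed
  have "w \<in> T \<Longrightarrow> f (w + (\<Sum>b\<in>B. of_real (of_int (m b)) *s axis b 1)) = f w" for B w
  proof (induction B arbitrary: w rule: infinite_finite_induct)
    case (insert b B)
    have "f (w + (\<Sum>b\<in>insert b B. of_real (of_int (m b)) *s axis b 1)) = f ((w + of_real (of_int (m b)) *s axis b 1) + (\<Sum>b\<in>B. of_real (of_int (m b)) *s axis b 1))"
      using insert by (simp add: add.assoc)
    also have "\<dots> = f (w + of_real (of_int (m b)) *s axis b 1)" by (rule insert.IH[OF T_line[OF insert.prems]])
    also have "\<dots> = f w" by (rule int[OF insert.prems])
    finally show ?case .
  qed auto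
  moreover have "rvec (\<chi> b. of_int (m b)) = (\<Sum>b\<in>UNIV. of_real (of_int (m b)) *s axis b (1::complex))"
    by (simp add: vec_eq_iff rvec_def axis_def if_distrib cong: if_cong)
  ultimately show ?thesis using z by metis
qed

text \<open>Integral periodicity moves the real part into the unit cube, so a bound on a compact set
  of real and imaginary parts suffices.\<close>

lemma nice_bounded:
  assumes f: "nice f" and z: "z \<in> T"
  obtains \<delta> M where "\<delta> > 0"
    "\<And>y t. (\<And>b. \<bar>y $ b\<bar> \<le> \<delta>) \<Longrightarrow> z + \<i> *s rvec y \<in> T \<and> norm (f (z + \<i> *s rvec y + rvec t)) \<le> M"
proof -
  obtain e where e: "e > 0" "ball z e \<subseteq> T" using openT z open_contains_ball by blast
  \<comment> \<open>The norm is at most the sum of the moduli of the coordinates, hence at most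
    \<open>CARD('n) * \<delta>\<close>, which is half of \<open>e\<close>.\<close>
  define \<delta> where "\<delta> = e / (2 * of_nat CARD('n))"
  have d: "\<delta> > 0" using e by (simp add: \<delta>_def)
  have yT: "z + \<i> *s rvec y \<in> T" if y: "\<And>b. \<bar>y $ b\<bar> \<le> \<delta>" for y
  proof -
    have "norm (rvec y) = norm y" unfolding norm_vec_def rvec_def by simp
    then have "norm (\<i> *s rvec y) = norm y" by (simp only: norm_vmult norm_ii mult_1)
    also have "\<dots> \<le> (\<Sum>b\<in>UNIV. \<bar>y $ b\<bar>)" by (rule norm_le_l1_cart)
    also have "\<dots> \<le> (\<Sum>b\<in>(UNIV::'n set). \<delta>)" by (rule sum_mono) (rule y)
    also have "\<dots> = e / 2" by (simp add: \<delta>_def)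
    also have "\<dots> < e" using e(1) by simp
    finally have "norm (\<i> *s rvec y) < e" .
    then have "z + \<i> *s rvec y \<in> ball z e" by (simp only: mem_ball dist_norm) simp
    then show ?thesis using e(2) by blast
  qed
  define h where "h = (\<lambda>(y,t). z + \<i> *s rvec y + rvec t)"
  define K :: "((real^'n) \<times> (real^'n)) set" where "K = cbox (\<chi> b. -\<delta>) (\<chi> b. \<delta>) \<times> cbox (\<chi> b. 0) (\<chi> b. (1::real))"
  have rc: "continuous_on S (\<lambda>x. rvec (g x))" if "continuous_on S g" for S and g :: "'q::topological_space \<Rightarrow> real^'n"
    unfolding rvec_def by (rule continuous_on_vec_lambda, rule continuous_on_of_real, rule continuous_on_component, rule that)
  have ch: "continuous_on K h" unfolding h_def case_prod_beta by (intro continuous_intros rc)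
  have cK: "compact K" unfolding K_def by (intro compact_Times compact_cbox)
  have hT: "h ` K \<subseteq> T"
  proof
    fix w assume "w \<in> h ` K"
    then obtain y t where w: "w = z + \<i> *s rvec y + rvec t" and y: "\<And>b. - \<delta> \<le> y $ b \<and> y $ b \<le> \<delta>"
      unfolding h_def K_def by (auto simp: mem_box_cart)
    have "\<bar>y $ b\<bar> \<le> \<delta>" for b using y[of b] by linarith
    then show "w \<in> T" unfolding w by (intro transT yT)
  qed
  have "compact (f ` h ` K)"
    by (intro compact_continuous_image continuous_on_subset[OF cholo_on_continuous hT] ch cK) (use f in \<open>simp add: nice_def\<close>)
  then obtain M where M: "\<And>p. p \<in> K \<Longrightarrow> norm (f (h p)) \<le> M" using compact_imp_bounded bounded_iff by (metis image_eqI)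
  have "z + \<i> *s rvec y \<in> T \<and> norm (f (z + \<i> *s rvec y + rvec t)) \<le> M" if y: "\<And>b. \<bar>y $ b\<bar> \<le> \<delta>" for y t
  proof -
    define r where "r = (\<chi> b. frac (t $ b))"
    have "z + \<i> *s rvec y + rvec t = (z + \<i> *s rvec y + rvec r) + rvec (\<chi> b. of_int \<lfloor>t $ b\<rfloor>)"
      by (auto simp: vec_eq_iff rvec_def r_def frac_def)
    then have "f (z + \<i> *s rvec y + rvec t) = f (z + \<i> *s rvec y + rvec r)"
      using nice_int_periodic[OF f transT[OF yT[OF y]], of r "\<lambda>b. \<lfloor>t $ b\<rfloor>"] by (simp add: add.assoc)
    moreover have "(y, r) \<in> K"
    proof -
      have "- \<delta> \<le> y $ b \<and> y $ b \<le> \<delta>" for b using y[of b] by linarith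
      then show ?thesis by (simp add: K_def r_def mem_box_cart less_imp_le[OF frac_lt_1])
    qed
    ultimately show ?thesis using M[of "(y, r)"] yT[OF y] by (simp add: h_def)
  qed
  then show ?thesis using d that by blast
qed

text \<open>Moving each imaginary coordinate by \<open>\<delta>\<close> against the sign of its
  index multiplies the coefficient function by the exponential of \<open>2 * pi * \<delta>\<close>
  times the sum of the absolute indices, while it stays bounded by \<open>M\<close>.\<close>

lemma Fops_decay:
  assumes f: "nice f" and z: "z \<in> T" and dist: "distinct bs"
    and \<delta>: "\<delta> > 0" "\<And>y t. (\<And>b. \<bar>y $ b\<bar> \<le> \<delta>) \<Longrightarrow> z + \<i> *s rvec y \<in> T \<and> norm (f (z + \<i> *s rvec y + rvec t)) \<le> M"
    and len: "length ks = length bs"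
  shows "norm (Fops bs ks f z) \<le> M * prod_list (map (\<lambda>k. exp (- 2 * pi * \<delta>) ^ nat \<bar>k\<bar>) ks)"
proof -
  \<comment> \<open>The list of indices becomes a function of the coordinate, with default 0 off
    \<open>bs\<close>. There the shift \<open>v\<close> vanishes, so \<open>eigen_shift\<close> asks
    nothing of these coordinates.\<close>
  define k where "k = (\<lambda>b. if b \<in> set bs then ks ! (SOME i. i < length bs \<and> bs ! i = b) else 0)"
  have kn: "k (bs ! i) = ks ! i" if "i < length bs" for i
  proof -
    have "(SOME j. j < length bs \<and> bs ! j = bs ! i) = i"
      using that dist by (intro some_equality) (auto simp: nth_eq_iff_index_eq)
    then show ?thesis using that by (simp add: k_def)
  qed
  have ks: "ks = map k bs" using kn len by (auto intro: nth_equalityI)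
  define F where "F = Fops bs ks f"
  define y where "y = (\<chi> b. - \<delta> * of_int (sgn (k b)))"
  define v where "v = \<i> *s rvec y"
  have yb: "\<bar>y $ b\<bar> \<le> \<delta>" for b using \<delta>(1) by (simp add: y_def abs_mult sgn_if)
  have vT: "z + v \<in> T" and fM: "norm (f (z + v + rvec t)) \<le> M" for t using \<delta>(2)[of y t] yb by (auto simp: v_def)
  have "norm (F (z + v + rvec 0)) \<le> M" unfolding F_def by (rule Fops_bound[OF f vT fM])
  then have FM: "norm (F (z + v)) \<le> M" by (simp add: rvec_def zero_vec_def[symmetric])
  have "F (z + v) = ee (\<Sum>b\<in>UNIV. of_int (k b) * v $ b) * F z"
  proof (rule eigen_shift)
    show "cholo_on F T" using nice_Fops[OF f] unfolding F_def nice_def by blast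
    fix b assume "v $ b \<noteq> 0"
    then have "b \<in> set bs" by (auto simp: v_def y_def rvec_def k_def split: if_splits)
    then show "eigen b (k b) F" unfolding F_def ks by (rule eigen_Fops[OF f])
  qed (use z vT in auto)
  then have "norm (F (z + v)) = exp (2 * pi * \<delta> * (\<Sum>b\<in>UNIV. of_int \<bar>k b\<bar>)) * norm (F z)"
  proof -
    have "Im (\<Sum>b\<in>UNIV. of_int (k b) * v $ b) = - \<delta> * (\<Sum>b\<in>UNIV. of_int \<bar>k b\<bar>)"
      unfolding sum_distrib_left Im_sum by (rule sum.cong) (auto simp: v_def rvec_def y_def sgn_if abs_if)
    then show ?thesis using \<open>F (z + v) = _\<close> by (simp add: norm_mult norm_ee algebra_simps)
  qed
  moreover have "(\<Sum>b\<in>UNIV. real_of_int \<bar>k b\<bar>) = sum_list (map (\<lambda>k. of_int \<bar>k\<bar>) ks)"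
  proof -
    have "(\<Sum>b\<in>UNIV. real_of_int \<bar>k b\<bar>) = (\<Sum>b\<in>set bs. of_int \<bar>k b\<bar>)"
      by (rule sum.mono_neutral_right) (auto simp: k_def)
    also have "\<dots> = sum_list (map (\<lambda>b. of_int \<bar>k b\<bar>) bs)" using dist by (simp add: sum_list_distinct_conv_sum_set)
    finally show ?thesis unfolding ks by (simp add: o_def)
  qed
  moreover have ex: "exp (- 2 * pi * \<delta> * sum_list (map (\<lambda>k. real_of_int \<bar>k\<bar>) ks)) = prod_list (map (\<lambda>k. exp (- 2 * pi * \<delta>) ^ nat \<bar>k\<bar>) ks)" for ks
  proof (induction ks)
    case (Cons a ks)
    have "exp (- 2 * pi * \<delta>) ^ nat \<bar>a\<bar> = exp (- 2 * pi * \<delta> * of_int \<bar>a\<bar>)"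
      by (simp add: exp_of_nat_mult[symmetric] mult.commute)
    moreover have "exp (- 2 * pi * \<delta> * sum_list (map (\<lambda>k. real_of_int \<bar>k\<bar>) (a # ks))) =
      exp (- 2 * pi * \<delta> * of_int \<bar>a\<bar>) * exp (- 2 * pi * \<delta> * sum_list (map (\<lambda>k. real_of_int \<bar>k\<bar>) ks))"
      unfolding exp_add[symmetric] by (simp only: list.map sum_list.Cons distrib_left)
    ultimately show ?case using Cons by simp
  qed simp
  ultimately have le: "exp (2 * pi * \<delta> * sum_list (map (\<lambda>k. of_int \<bar>k\<bar>) ks)) * norm (F z) \<le> M" using FM by simp
  define s where "s = 2 * pi * \<delta> * sum_list (map (\<lambda>k. real_of_int \<bar>k\<bar>) ks)"
  have "norm (F z) \<le> M * exp (- s)" using le unfolding s_def[symmetric] by (simp add: exp_minus field_simps)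
  also have "exp (- s) = prod_list (map (\<lambda>k. exp (- 2 * pi * \<delta>) ^ nat \<bar>k\<bar>) ks)" using ex[of ks] by (simp add: s_def)
  finally show ?thesis unfolding F_def .
qed

lemma geometric_summable_int:
  fixes q :: real assumes "0 < q" "q < 1" shows "(\<lambda>k::int. q ^ nat \<bar>k\<bar>) summable_on UNIV"
proof -
  have g: "(\<lambda>n::nat. q ^ n) summable_on UNIV"
    using assms summable_geometric[of q] by (intro norm_summable_imp_summable_on) auto
  have "(\<lambda>k::int. q ^ nat \<bar>k\<bar>) summable_on range int"
    using g by (subst summable_on_reindex) (auto simp: o_def)
  moreover have "(\<lambda>k::int. q ^ nat \<bar>k\<bar>) summable_on range (\<lambda>n. - int n)"
    using g by (subst summable_on_reindex) (auto simp: o_def inj_on_def)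
  moreover have "(UNIV::int set) = range int \<union> range (\<lambda>n. - int n)"
  proof -
    have "k = int (nat k) \<or> k = - int (nat (- k))" for k :: int by auto
    then show ?thesis by blast
  qed
  ultimately show ?thesis by (metis summable_on_union)
qed

lemma lists_Suc: "{ks::int list. length ks = Suc m} = (\<lambda>(k,ks). k # ks) ` (UNIV \<times> {ks. length ks = m})"
  by (auto simp: length_Suc_conv image_iff)

lemma inj_Cons: "inj_on (\<lambda>(k,ks). k # ks) A"
  by (auto simp: inj_on_def)

lemma prod_list_summable:
  fixes q :: real assumes "0 < q" "q < 1"
  shows "(\<lambda>ks::int list. prod_list (map (\<lambda>k. q ^ nat \<bar>k\<bar>) ks)) summable_on {ks. length ks = m}"
proof (induction m)
  case (Suc m)
  have "(\<lambda>p::int \<times> int list. q ^ nat \<bar>fst p\<bar> * prod_list (map (\<lambda>k. q ^ nat \<bar>k\<bar>) (snd p))) summable_on (SIGMA k:UNIV. {ks. length ks = m})"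
  proof (rule summable_on_SigmaI)
    show "((\<lambda>ks. q ^ nat \<bar>fst (k, ks)\<bar> * prod_list (map (\<lambda>k. q ^ nat \<bar>k\<bar>) (snd (k, ks)))) has_sum
       q ^ nat \<bar>k\<bar> * infsum (\<lambda>ks. prod_list (map (\<lambda>k. q ^ nat \<bar>k\<bar>) ks)) {ks::int list. length ks = m}) {ks. length ks = m}" for k
      using has_sum_cmult_right[OF has_sum_infsum[OF Suc]] by simp
    show "(\<lambda>k::int. q ^ nat \<bar>k\<bar> * infsum (\<lambda>ks. prod_list (map (\<lambda>k. q ^ nat \<bar>k\<bar>) ks)) {ks::int list. length ks = m}) summable_on UNIV"
      using summable_on_cmult_left[OF geometric_summable_int[OF assms]] .
    show "0 \<le> q ^ nat \<bar>fst (k, ks)\<bar> * prod_list (map (\<lambda>k. q ^ nat \<bar>k\<bar>) (snd (k, ks)))" for k and ks :: "int list"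
      using assms by (auto intro!: mult_nonneg_nonneg prod_list_nonneg)
  qed
  then show ?case unfolding lists_Suc
    by (subst summable_on_reindex[OF inj_Cons]) (simp add: o_def case_prod_unfold)
qed simp

lemma has_sum_int_partial_sums:
  fixes g :: "int \<Rightarrow> complex"
  assumes "(g has_sum S) UNIV" shows "(\<lambda>K. \<Sum>k=-int K..int K. g k) \<longlonglongrightarrow> S"
proof -
  have "filterlim (\<lambda>K. {-int K..int K}) (finite_subsets_at_top UNIV) sequentially"
    unfolding filterlim_finite_subsets_at_top
  proof (intro allI impI)
    fix X :: "int set" assume X: "finite X \<and> X \<subseteq> UNIV"
    define N where "N = nat (Max (insert 0 (abs ` X)))"
    have "X \<subseteq> {-int K..int K}" if "K \<ge> N" for K
    proof
      fix x assume "x \<in> X"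
      then have "\<bar>x\<bar> \<le> Max (insert 0 (abs ` X))" using X by (intro Max_ge) auto
      then show "x \<in> {-int K..int K}" using that by (auto simp: N_def)
    qed
    then show "\<forall>\<^sub>F K in sequentially. finite {-int K..int K} \<and> X \<subseteq> {-int K..int K} \<and> {-int K..int K} \<subseteq> UNIV"
      unfolding eventually_sequentially by auto
  qed
  then show ?thesis using assms unfolding has_sum_def by (rule filterlim_compose[rotated])
qed

lemma Fops_summable:
  assumes f: "nice f" and z: "z \<in> T" and dist: "distinct bs"
  shows "(\<lambda>ks. norm (Fops bs ks f z)) summable_on {ks. length ks = length bs}"
proof -
  obtain \<delta> M where \<delta>: "\<delta> > 0" "\<And>y t. (\<And>b. \<bar>y $ b\<bar> \<le> \<delta>) \<Longrightarrow> z + \<i> *s rvec y \<in> T \<and> norm (f (z + \<i> *s rvec y + rvec t)) \<le> M"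
    using nice_bounded[OF f z] by metis
  show ?thesis
  proof (rule Infinite_Sum.abs_summable_on_comparison_test')
    show "(\<lambda>ks. M * prod_list (map (\<lambda>k. exp (- 2 * pi * \<delta>) ^ nat \<bar>k\<bar>) ks)) summable_on {ks. length ks = length bs}"
      by (rule summable_on_cmult_right, rule prod_list_summable) (use \<delta>(1) in auto)
    show "norm (Fops bs ks f z) \<le> M * prod_list (map (\<lambda>k. exp (- 2 * pi * \<delta>) ^ nat \<bar>k\<bar>) ks)"
      if "ks \<in> {ks. length ks = length bs}" for ks
      by (rule Fops_decay[OF f z dist \<delta>]) (use that in auto)
  qed
qed

text \<open>Induction over the coordinates. Absolute convergence gives some sum \<open>S\<close> and
  allows summing the inner indices by the induction hypothesis; \<open>S\<close> is then identified
  with \<open>f z\<close> through the symmetric partial sums in the outer index.\<close>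

lemma Fops_has_sum:
  assumes "nice f" "z \<in> T" "distinct bs"
  shows "((\<lambda>ks. Fops bs ks f z) has_sum f z) {ks. length ks = length bs}"
  using assms
proof (induction bs arbitrary: f)
  case Nil
  have "{ks::int list. length ks = length ([]::'n list)} = {[]}" by auto
  then show ?case by (auto intro: has_sum_finiteI)
next
  case (Cons b bs)
  let ?L = "{ks::int list. length ks = length bs}"
  have "(\<lambda>ks. Fops (b # bs) ks f z) summable_on {ks. length ks = length (b # bs)}"
    using Fops_summable[OF Cons.prems] by (rule abs_summable_summable)
  then have "(\<lambda>p. Fops bs (snd p) (Fop b (fst p) f) z) summable_on (UNIV \<times> ?L)"
    unfolding length_Cons lists_Suc by (subst (asm) summable_on_reindex[OF inj_Cons]) (simp add: o_def case_prod_unfold)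
  then obtain S where S: "((\<lambda>p. Fops bs (snd p) (Fop b (fst p) f) z) has_sum S) (UNIV \<times> ?L)"
    using has_sum_infsum by blast
  have in1: "((\<lambda>ks. Fops bs ks (Fop b k f) z) has_sum Fop b k f z) ?L" for k
    by (rule Cons.IH) (use Cons.prems nice_Fop in auto)
  have "((\<lambda>k. Fop b k f z) has_sum S) UNIV"
    by (rule has_sum_Sigma'[OF S]) (use in1 in simp)
  from has_sum_int_partial_sums[OF this] Fop_partial_sums[OF Cons.prems(1,2)] have "S = f z"
    by (rule LIMSEQ_unique)
  with S show ?case
    unfolding length_Cons lists_Suc by (subst has_sum_reindex[OF inj_Cons]) (simp add: o_def case_prod_unfold)
qed

text \<open>The functions \<open>Fops\<close> over all coordinates are multiples of characters by
  \<open>eigen_shift\<close>, and \<open>A\<close> is read off at a base point. The second property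
  holds because each term is an iterated average of \<open>f\<close> over real translates; later it
  turns bounds for \<open>f\<close> into restrictions on the exponents.\<close>

theorem fourier_expansion:
  assumes "nice f"
  obtains A :: "int^'n \<Rightarrow> complex" where
    "\<And>z. z \<in> T \<Longrightarrow> ((\<lambda>m. A m * ee (\<Sum>b\<in>UNIV. of_int (m $ b) * z $ b)) has_sum f z) UNIV"
    "\<And>m z M. z \<in> T \<Longrightarrow> (\<And>t. norm (f (z + rvec t)) \<le> M) \<Longrightarrow> norm (A m * ee (\<Sum>b\<in>UNIV. of_int (m $ b) * z $ b)) \<le> M"
proof (cases "T = {}")
  case False
  then obtain z0 where z0: "z0 \<in> T" by blast
  obtain bs :: "'n list" where bs: "set bs = UNIV" "distinct bs" using finite_distinct_list[OF finite] by blast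
  define F where "F = (\<lambda>m::int^'n. Fops bs (map (($) m) bs) f)"
  define A where "A = (\<lambda>m. F m z0 * ee (- (\<Sum>b\<in>UNIV. of_int (m $ b) * z0 $ b)))"
  have AF: "A m * ee (\<Sum>b\<in>UNIV. of_int (m $ b) * z $ b) = F m z" if z: "z \<in> T" for m z
  proof -
    have "F m (z0 + (z - z0)) = ee (\<Sum>b\<in>UNIV. of_int (m $ b) * (z - z0) $ b) * F m z0"
    proof (rule eigen_shift)
      show "cholo_on (F m) T" using nice_Fops[OF assms] unfolding F_def nice_def by blast
      show "eigen b (m $ b) (F m)" for b unfolding F_def by (rule eigen_Fops[OF assms]) (simp add: bs)
    qed (use z z0 in auto)
    moreover have "(\<Sum>b\<in>UNIV. of_int (m $ b) * (z - z0) $ b) = (\<Sum>b\<in>UNIV. of_int (m $ b) * z $ b) + - (\<Sum>b\<in>UNIV. complex_of_int (m $ b) * z0 $ b)"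
      by (simp add: algebra_simps sum_subtractf)
    ultimately show ?thesis by (simp add: A_def ee_add del: add_uminus_conv_diff)
  qed
  have bij: "bij_betw (\<lambda>m::int^'n. map (($) m) bs) UNIV {ks. length ks = length bs}"
  proof (rule bij_betwI')
    show "(map (($) m) bs = map (($) m') bs) = (m = m')" for m m' :: "int^'n" using bs by (auto simp: vec_eq_iff)
    fix ks :: "int list" assume ks: "ks \<in> {ks. length ks = length bs}"
    define m :: "int^'n" where "m = (\<chi> b. the (map_of (zip bs ks) b))"
    have "map (($) m) bs = ks"
      using ks bs by (intro nth_equalityI) (auto simp: m_def map_of_zip_nth)
    then show "\<exists>m\<in>UNIV. ks = map (($) m) bs" by blast
  qed auto
  have "((\<lambda>m. A m * ee (\<Sum>b\<in>UNIV. of_int (m $ b) * z $ b)) has_sum f z) UNIV" if z: "z \<in> T" for z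
    using Fops_has_sum[OF assms z bs(2)] unfolding AF[OF z] F_def
    by (subst has_sum_reindex_bij_betw[OF bij, of "\<lambda>ks. Fops bs ks f z"])
  moreover have "norm (A m * ee (\<Sum>b\<in>UNIV. of_int (m $ b) * z $ b)) \<le> M"
    if z: "z \<in> T" and M: "\<And>t. norm (f (z + rvec t)) \<le> M" for m z M
  proof -
    have "norm (F m (z + rvec 0)) \<le> M" unfolding F_def by (rule Fops_bound[OF assms z M])
    then show ?thesis unfolding AF[OF z] by (simp add: rvec_def zero_vec_def[symmetric])
  qed
  ultimately show ?thesis using that by blast
qed (use that in auto)

end

section \<open>Roots of E8 and of glued lattices\<close>

lemma ix8_of_nat: "k < 8 \<Longrightarrow> ix8 (of_nat k) = k"
  unfolding ix8_def bit0.of_nat_eq by (subst bit0.Rep_Abs_mod) simp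

lemma ix8_less: "ix8 i < 8"
proof -
  have "0 \<le> Rep_bit0 i \<and> Rep_bit0 i < 8" using Rep_bit0[of i] by simp
  then show ?thesis unfolding ix8_def by linarith
qed

lemma of_nat_ix8: "of_nat (ix8 i) = i"
proof -
  have "int (ix8 i) = Rep_bit0 i" using Rep_bit0[of i] by (simp add: ix8_def)
  then show ?thesis unfolding bit0.of_nat_eq using bit0.Rep_mod[of i] by (simp add: Rep_bit0_inverse)
qed

lemma sum8: "(\<Sum>i\<in>(UNIV::8 set). f i) = (\<Sum>k<8. f (of_nat k))"
  by (rule sum.reindex_bij_witness[of _ of_nat ix8]) (auto simp: ix8_of_nat of_nat_ix8 ix8_less)

text \<open>The form of E8(-1) as a polynomial over any commutative ring, so that integral, real and
  complex computations share one formula.\<close>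

definition e8form :: "(nat \<Rightarrow> 'a::comm_ring_1) \<Rightarrow> (nat \<Rightarrow> 'a) \<Rightarrow> 'a" where
  "e8form X Y = X 0 * Y 2 + X 2 * Y 0 + X 2 * Y 3 + X 3 * Y 2 + X 3 * Y 4 + X 4 * Y 3 + X 4 * Y 5 + X 5 * Y 4
    + X 5 * Y 6 + X 6 * Y 5 + X 6 * Y 7 + X 7 * Y 6 + X 1 * Y 3 + X 3 * Y 1
    - 2 * (X 0 * Y 0 + X 1 * Y 1 + X 2 * Y 2 + X 3 * Y 3 + X 4 * Y 4 + X 5 * Y 5 + X 6 * Y 6 + X 7 * Y 7)"

lemma lt8: "{..<8::nat} = {0,1,2,3,4,5,6,7}"
  by auto

lemma e8m_sum: "(\<Sum>b<8. of_int (e8m a b) * Y b) =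
   (if a = 0 then Y 2 - 2 * Y 0 else if a = 1 then Y 3 - 2 * Y 1 else if a = 2 then Y 0 + Y 3 - 2 * Y 2
    else if a = 3 then Y 1 + Y 2 + Y 4 - 2 * Y 3 else if a = 4 then Y 3 + Y 5 - 2 * Y 4 else if a = 5 then Y 4 + Y 6 - 2 * Y 5
    else if a = 6 then Y 5 + Y 7 - 2 * Y 6 else Y 6 - (2::'a::comm_ring_1) * Y 7)" if "a < 8" for Y :: "nat \<Rightarrow> 'a::comm_ring_1"
proof -
  have "a \<in> {0,1,2,3,4,5,6,7}" using that lt8 by blast
  then show ?thesis unfolding lt8
    by (elim insertE emptyE) (simp_all add: e8m_def e8edge_def doubleton_eq_iff algebra_simps)
qed

lemma e8form_sum: "(\<Sum>a<8. \<Sum>b<8. X a * of_int (e8m a b) * Y b) = e8form X Y"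
proof -
  have "(\<Sum>a<8. \<Sum>b<8. X a * of_int (e8m a b) * Y b) = (\<Sum>a<8. X a * (\<Sum>b<8. of_int (e8m a b) * Y b))"
    by (simp add: sum_distrib_left mult.assoc)
  also have "\<dots> = (\<Sum>a<8. X a * (if a = 0 then Y 2 - 2 * Y 0 else if a = 1 then Y 3 - 2 * Y 1 else if a = 2 then Y 0 + Y 3 - 2 * Y 2
    else if a = 3 then Y 1 + Y 2 + Y 4 - 2 * Y 3 else if a = 4 then Y 3 + Y 5 - 2 * Y 4 else if a = 5 then Y 4 + Y 6 - 2 * Y 5
    else if a = 6 then Y 5 + Y 7 - 2 * Y 6 else Y 6 - 2 * Y 7))"
    by (rule sum.cong) (simp_all only: e8m_sum lessThan_iff)
  also have "\<dots> = e8form X Y" unfolding lt8 by (simp add: e8form_def algebra_simps)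
  finally show ?thesis .
qed

lemma e8_form: "e8 x y = e8form (\<lambda>k. x $ of_nat k) (\<lambda>k. y $ of_nat k)"
proof -
  have "e8 x y = (\<Sum>a<8. \<Sum>b<8. x $ of_nat a * e8m a b * y $ of_nat b)"
    unfolding e8_def sum8 by (intro sum.cong refl) (simp add: ix8_of_nat)
  then show ?thesis using e8form_sum[of "\<lambda>k. x $ of_nat k" "\<lambda>k. y $ of_nat k"] by simp
qed

text \<open>Gaussian elimination from the ends 0 and 1 of the diagram towards node 3, then along the
  chain to 7. The pivots 2, 2, 3/2, 5/6, 4/5, 3/4, 2/3, 1/2 have product 1, the determinant of
  E8.\<close>

lemma e8form_sos:
  fixes X :: "nat \<Rightarrow> real"
  shows "- e8form X X = 2*(X 0-X 2/2)\<^sup>2+2*(X 1-X 3/2)\<^sup>2+3/2*(X 2-2/3*X 3)\<^sup>2+5/6*(X 3-6/5*X 4)\<^sup>2+4/5*(X 4-5/4*X 5)\<^sup>2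
    +3/4*(X 5-4/3*X 6)\<^sup>2+2/3*(X 6-3/2*X 7)\<^sup>2+1/2*(X 7)\<^sup>2"
  unfolding e8form_def by (simp add: power2_eq_square field_simps)

lemma e8form_nonpos: "e8form X X \<le> (0::real)"
proof -
  have "0 \<le> - e8form X X" unfolding e8form_sos by (intro add_nonneg_nonneg mult_nonneg_nonneg zero_le_power2) auto
  then show ?thesis by simp
qed

lemma e8form_eq_0:
  assumes "e8form X X = (0::real)" "k < 8" shows "X k = 0"
proof -
  have z: "- e8form X X = 0" using assms by simp
  have nn: "0 \<le> 2*(X 0-X 2/2)\<^sup>2" "0 \<le> 2*(X 1-X 3/2)\<^sup>2" "0 \<le> 3/2*(X 2-2/3*X 3)\<^sup>2" "0 \<le> 5/6*(X 3-6/5*X 4)\<^sup>2"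
    "0 \<le> 4/5*(X 4-5/4*X 5)\<^sup>2" "0 \<le> 3/4*(X 5-4/3*X 6)\<^sup>2" "0 \<le> 2/3*(X 6-3/2*X 7)\<^sup>2" "0 \<le> 1/2*(X 7)\<^sup>2" by auto
  have "(X 7)\<^sup>2 = 0" "(X 6-3/2*X 7)\<^sup>2 = 0" "(X 5-4/3*X 6)\<^sup>2 = 0" "(X 4-5/4*X 5)\<^sup>2 = 0" "(X 3-6/5*X 4)\<^sup>2 = 0"
     "(X 2-2/3*X 3)\<^sup>2 = 0" "(X 1-X 3/2)\<^sup>2 = 0" "(X 0-X 2/2)\<^sup>2 = 0"
    using z nn unfolding e8form_sos by linarith+
  then have "X 7 = 0 \<and> X 6 = 0 \<and> X 5 = 0 \<and> X 4 = 0 \<and> X 3 = 0 \<and> X 2 = 0 \<and> X 1 = 0 \<and> X 0 = 0" by simp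
  moreover have "k \<in> {0,1,2,3,4,5,6,7}" using assms(2) lt8 by blast
  ultimately show ?thesis by auto
qed

lemma e8form_of_int: "e8form (\<lambda>k. of_int (X k)) (\<lambda>k. of_int (Y k)) = (of_int (e8form X Y) :: 'a::comm_ring_1)"
  unfolding e8form_def by simp

lemma vec8_eq_iff: "x = y \<longleftrightarrow> (\<forall>k<8. x $ of_nat k = (y::'a^8) $ of_nat k)"
  unfolding vec_eq_iff by (metis of_nat_ix8 ix8_less)

definition pe :: "int^8 \<Rightarrow> int^8 \<Rightarrow> int" where "pe x y = - e8 x y"

lemma pe_form: "pe x y = - e8form (\<lambda>k. x $ of_nat k) (\<lambda>k. y $ of_nat k)"
  by (simp add: pe_def e8_form)

lemmas pe_expand = pe_form[unfolded e8form_def, simplified]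

lemma pe_sym: "pe x y = pe y x"
  unfolding pe_expand by simp

lemma pe_add: "pe (x + y) z = pe x z + pe y z" "pe z (x + y) = pe z x + pe z y"
  unfolding pe_expand by (simp_all add: algebra_simps)

lemma pe_diff: "pe (x - y) z = pe x z - pe y z" "pe z (x - y) = pe z x - pe z y"
  unfolding pe_expand by (simp_all add: algebra_simps)

lemma pe_smult: "pe (c *s x) z = c * pe x z" "pe z (c *s x) = c * pe z x"
  unfolding pe_expand by (simp_all add: algebra_simps)

lemma pe_uminus: "pe (- x) z = - pe x z" "pe z (- x) = - pe z x"
  unfolding pe_expand by (simp_all add: algebra_simps)

lemma pe_nonneg: "pe x x \<ge> 0"
  using e8form_nonpos[of "\<lambda>k. real_of_int (x $ of_nat k)"] unfolding e8form_of_int pe_form by simp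

lemma pe_eq_0: "pe x x = 0 \<Longrightarrow> x = 0"
  using e8form_eq_0[of "\<lambda>k. real_of_int (x $ of_nat k)"] unfolding e8form_of_int pe_form vec8_eq_iff by simp

lemma pe_cauchy_schwarz: "(pe x y)\<^sup>2 \<le> pe x x * pe y y"
proof (cases "pe y y = 0")
  case True
  then have "y = 0" by (rule pe_eq_0)
  then show ?thesis by (simp add: pe_expand)
next
  case False
  then have p: "pe y y > 0" using pe_nonneg[of y] by simp
  have "0 \<le> pe (pe y y *s x - pe x y *s y) (pe y y *s x - pe x y *s y)" by (rule pe_nonneg)
  also have "\<dots> = pe y y * (pe x x * pe y y - (pe x y)\<^sup>2)"
    by (simp add: pe_diff pe_smult pe_sym[of y x] power2_eq_square algebra_simps)
  finally show ?thesis using p by (simp add: zero_le_mult_iff)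
qed

definition mk8 :: "int list \<Rightarrow> int^8" where "mk8 xs = (\<chi> i. xs ! ix8 i)"

lemma mk8_nth: "k < 8 \<Longrightarrow> mk8 xs $ of_nat k = xs ! k"
  by (simp add: mk8_def ix8_of_nat)

lemma mk8_nths: "mk8 xs $ 0 = xs ! 0" "mk8 xs $ 1 = xs ! 1" "mk8 xs $ 2 = xs ! 2" "mk8 xs $ 3 = xs ! 3"
  "mk8 xs $ 4 = xs ! 4" "mk8 xs $ 5 = xs ! 5" "mk8 xs $ 6 = xs ! 6" "mk8 xs $ 7 = xs ! 7"
  using mk8_nth[of 0 xs] mk8_nth[of 1 xs] mk8_nth[of 2 xs] mk8_nth[of 3 xs] mk8_nth[of 4 xs] mk8_nth[of 5 xs] mk8_nth[of 6 xs] mk8_nth[of 7 xs]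
  by simp_all

lemma nth8: "[a,b,c,d,e,f,g,h] ! 0 = a" "[a,b,c,d,e,f,g,h] ! 1 = b" "[a,b,c,d,e,f,g,h] ! 2 = c" "[a,b,c,d,e,f,g,h] ! 3 = d"
  "[a,b,c,d,e,f,g,h] ! 4 = e" "[a,b,c,d,e,f,g,h] ! 5 = f" "[a,b,c,d,e,f,g,h] ! 6 = g" "[a,b,c,d,e,f,g,h] ! 7 = h"
  by (simp_all add: numeral_eq_Suc)

lemmas mk8_simps = mk8_nths[of "[a,b,c,d,e,f,g,h]" for a b c d e f g h, unfolded nth8]

definition al :: "nat \<Rightarrow> int^8" where
  "al k = mk8 [if k = 0 then 1 else 0, if k = 1 then 1 else 0, if k = 2 then 1 else 0, if k = 3 then 1 else 0,
     if k = 4 then 1 else 0, if k = 5 then 1 else 0, if k = 6 then 1 else 0, if k = 7 then 1 else 0]"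

text \<open>The highest root, whose coordinates are the marks of the diagram. It is also the
  fundamental weight dual to \<open>al 7\<close>, hence the formula in
  \<open>pe_hroot\<close>.\<close>

definition hroot :: "int^8" where "hroot = mk8 [2,3,4,6,5,4,3,2]"
text \<open>The Weyl vector, half the sum of the positive roots: it pairs to 1 with every
  \<open>al k\<close>, so pairing with it gives the height.\<close>

definition wvec :: "int^8" where "wvec = mk8 [46,68,91,135,110,84,57,29]"

lemma pe_al:
  "pe x (al 0) = 2 * x$0 - x$2" "pe x (al 1) = 2 * x$1 - x$3" "pe x (al 2) = 2 * x$2 - x$0 - x$3"
  "pe x (al 3) = 2 * x$3 - x$1 - x$2 - x$4" "pe x (al 4) = 2 * x$4 - x$3 - x$5" "pe x (al 5) = 2 * x$5 - x$4 - x$6"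
  "pe x (al 6) = 2 * x$6 - x$5 - x$7" "pe x (al 7) = 2 * x$7 - x$6"
  unfolding pe_expand al_def mk8_simps by simp_all

lemma pe_al_al: "k < 8 \<Longrightarrow> pe (al k) (al k) = 2"
  using lt8 by (auto simp: pe_expand al_def mk8_simps lessThan_iff[symmetric] simp del: lessThan_iff)

lemma pe_hroot: "pe x hroot = x $ 7" "pe hroot hroot = 2"
  unfolding pe_expand hroot_def mk8_simps by simp_all

lemma hroot7: "hroot $ 7 = 2"
  by (simp add: hroot_def mk8_simps)

lemma pe_wvec: "pe x wvec = x$0 + x$1 + x$2 + x$3 + x$4 + x$5 + x$6 + x$7" "pe wvec wvec = 620"
  unfolding pe_expand wvec_def mk8_simps by simp_all

lemma vec8_sum: "(u::int^8) = u$0 *s al 0 + u$1 *s al 1 + u$2 *s al 2 + u$3 *s al 3 + u$4 *s al 4 + u$5 *s al 5 + u$6 *s al 6 + u$7 *s al 7"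
  unfolding vec8_eq_iff
proof (intro allI impI)
  fix k :: nat assume "k < 8"
  then have "k \<in> {0,1,2,3,4,5,6,7}" using lt8 by blast
  then show "u $ of_nat k = (u$0 *s al 0 + u$1 *s al 1 + u$2 *s al 2 + u$3 *s al 3 + u$4 *s al 4 + u$5 *s al 5 + u$6 *s al 6 + u$7 *s al 7) $ of_nat k"
    by (elim insertE emptyE) (simp_all add: al_def mk8_simps)
qed

lemma additive_int_smult:
  fixes f :: "int^'n \<Rightarrow> int" assumes "\<And>x y. f (x + y) = f x + f y" shows "f (k *s x) = k * f x"
proof -
  have f0: "f 0 = 0" using assms[of 0 0] by simp
  have n: "f (of_nat n *s x) = of_nat n * f x" for n
  proof (induction n)
    case 0 show ?case by (simp add: f0)
  next
    case (Suc n)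
    have "(of_nat (Suc n) *s x :: int^'n) = of_nat n *s x + x" by (simp add: vec_eq_iff algebra_simps)
    then show ?case using Suc assms by (simp add: algebra_simps)
  qed
  have fm: "f (- y) = - f y" for y using assms[of y "-y"] f0 by simp
  show ?thesis
  proof (cases "k \<ge> 0")
    case True then show ?thesis using n[of "nat k"] by simp
  next
    case False
    have "k *s x = - (of_nat (nat (-k)) *s x)" using False by (simp add: vec_eq_iff)
    then show ?thesis using n[of "nat (-k)"] fm False by simp
  qed
qed

lemma additive8:
  fixes f :: "int^8 \<Rightarrow> int" assumes "\<And>x y. f (x + y) = f x + f y"
  shows "f u = u$0 * f (al 0) + u$1 * f (al 1) + u$2 * f (al 2) + u$3 * f (al 3) + u$4 * f (al 4) + u$5 * f (al 5) + u$6 * f (al 6) + u$7 * f (al 7)"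
  by (subst vec8_sum) (simp only: assms additive_int_smult[of f, OF assms])

text \<open>Reflecting \<open>v\<close> by the affine Weyl group of level 2 makes it dominant with \<open>(v, hroot) \<le> 2\<close>; since
  the marks of \<open>E\<^sub>8\<close> are at least 2, at most one of the \<open>(v, \<alpha>\<^sub>i)\<close> is then non-zero.\<close>
lemma even_root_aux:
  fixes \<rho> :: "int^8 \<Rightarrow> int"
  assumes "\<And>x y. \<rho> (x + y) = \<rho> x + \<rho> y" "\<rho> w \<noteq> 0"
  shows "\<exists>u. pe u u = 2 \<and> even (pe v u) \<and> \<rho> u \<noteq> 0"
  using assms
proof (induction "nat (8 * pe v v - pe v wvec + 20)" arbitrary: v \<rho> w rule: less_induct)
  case less
  \<comment> \<open>Essentially the squared distance from \<open>v\<close> to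
    \<open>wvec / 16\<close>, since \<open>32 * m v - 20\<close> is the norm of
    \<open>16 *s v - wvec\<close>. That point lies inside the alcove: it pairs positively with the
    simple roots and to \<open>29/16 < 2\<close> with \<open>hroot\<close>. So reflecting in a
    violated wall decreases \<open>m\<close>.\<close>
  define m where "m = (\<lambda>v. 8 * pe v v - pe v wvec + 20)"
  have m_pos: "m v \<ge> 0" for v
  proof -
    have "0 \<le> pe (16 *s v - wvec) (16 *s v - wvec)" by (rule pe_nonneg)
    also have "\<dots> = 256 * pe v v - 32 * pe v wvec + 620"
      by (simp add: pe_diff pe_smult pe_sym[of wvec v] pe_wvec(2))
    finally show ?thesis by (simp add: m_def)
  qed
  \<comment> \<open>\<open>v\<close> is reflected and shifted by twice a lattice vector, and the
    functional is composed with the reflection. The shift does not affect parities, and the same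
    reflection carries a solution back.\<close>
  have refl: ?case if r: "pe r r = 2" and lt: "m (v - pe v r *s r + 2 *s t) < m v" for r t
  proof -
    define \<rho>' where "\<rho>' = (\<lambda>x. \<rho> (x - pe x r *s r))"
    have sm: "\<rho> (k *s x) = k * \<rho> x" for k x using additive_int_smult[of \<rho>] less.prems(1) by blast
    have df: "\<rho> (x - y) = \<rho> x - \<rho> y" for x y using less.prems(1)[of "x - y" y] by simp
    have add': "\<rho>' (x + y) = \<rho>' x + \<rho>' y" for x y
      by (simp add: \<rho>'_def df less.prems(1) sm pe_add algebra_simps)
    have inv: "(x - pe x r *s r) - pe (x - pe x r *s r) r *s r = x" for x
      by (simp add: pe_diff pe_smult r vec_eq_iff algebra_simps)
    have nz: "\<rho>' (w - pe w r *s r) \<noteq> 0" unfolding \<rho>'_def inv by (rule less.prems(2))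
    have "nat (8 * pe (v - pe v r *s r + 2 *s t) (v - pe v r *s r + 2 *s t) - pe (v - pe v r *s r + 2 *s t) wvec + 20) < nat (8 * pe v v - pe v wvec + 20)"
      using lt m_pos[of v] m_pos[of "v - pe v r *s r + 2 *s t"] unfolding m_def by linarith
    from less.hyps[OF this add' nz] obtain u where u: "pe u u = 2" "even (pe (v - pe v r *s r + 2 *s t) u)" "\<rho>' u \<noteq> 0" by blast
    define u' where "u' = u - pe u r *s r"
    have "pe u' u' = pe u u" by (simp add: u'_def pe_diff pe_smult r pe_sym[of r u] algebra_simps)
    moreover have "pe (v - pe v r *s r + 2 *s t) u = pe v u' + 2 * pe t u"
      by (simp add: u'_def pe_diff pe_smult pe_add pe_sym[of r u] algebra_simps)
    ultimately show ?thesis using u unfolding \<rho>'_def u'_def by (intro exI[of _ u']) (auto simp: u'_def)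
  qed
  show ?case
  proof (cases "\<exists>k<8. pe v (al k) < 0")
    case True
    then obtain k where k: "k < 8" "pe v (al k) < 0" by blast
    have w1: "pe (al k) wvec = 1" using k(1) lt8 by (auto simp: pe_wvec al_def mk8_simps lessThan_iff[symmetric] simp del: lessThan_iff)
    show ?thesis
    proof (rule refl[of "al k" 0])
      show r: "pe (al k) (al k) = 2" using pe_al_al k by blast
      show "m (v - pe v (al k) *s al k + 2 *s 0) < m v" using k(2)
        by (simp add: m_def pe_diff pe_smult r pe_sym[of "al k" v] w1 algebra_simps)
    qed
  next
    case False
    then have nn: "pe v (al k) \<ge> 0" if "k < 8" for k using that by force
    have n: "pe v (al 0) \<ge> 0" "pe v (al 1) \<ge> 0" "pe v (al 2) \<ge> 0" "pe v (al 3) \<ge> 0" "pe v (al 4) \<ge> 0" "pe v (al 5) \<ge> 0"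
      "pe v (al 6) \<ge> 0" "pe v (al 7) \<ge> 0" using nn by auto
    have x7: "v $ 7 = 2 * pe v (al 0) + 3 * pe v (al 1) + 4 * pe v (al 2) + 6 * pe v (al 3) + 5 * pe v (al 4) + 4 * pe v (al 5) + 3 * pe v (al 6) + 2 * pe v (al 7)"
      unfolding pe_al by simp
    show ?thesis
    proof (cases "v $ 7 > 2")
      case True
      \<comment> \<open>With \<open>r\<close> and \<open>t\<close> both equal to
        \<open>hroot\<close> the move is the reflection in the affine wall
        \<open>pe v hroot = 2\<close>.\<close>
      show ?thesis
      proof (rule refl[of hroot hroot])
        have wh: "pe hroot wvec = 29" unfolding pe_wvec by (simp add: hroot_def mk8_simps)
        have h7: "hroot $ 7 = 2" by (simp add: hroot_def mk8_simps)
        show "m (v - pe v hroot *s hroot + 2 *s hroot) < m v" using True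
          by (simp add: m_def pe_diff pe_add pe_smult pe_sym[of hroot v] pe_hroot wh h7 algebra_simps)
      qed (rule pe_hroot)
    next
      case False
      have z: "pe v (al 1) = 0" "pe v (al 2) = 0" "pe v (al 3) = 0" "pe v (al 4) = 0" "pe v (al 5) = 0" "pe v (al 6) = 0"
        using n x7 False by linarith+
      have z07: "pe v (al 0) = 0 \<and> pe v (al 7) = 0 \<or> pe v (al 0) = 1 \<and> pe v (al 7) = 0 \<or> pe v (al 0) = 0 \<and> pe v (al 7) = 1"
        using n x7 False z by linarith
      note \<rho>u = additive8[of \<rho>, OF less.prems(1)]
      \<comment> \<open>If no simple root works, \<open>\<rho>\<close> is supported on the one
        simple root of odd pairing, which is \<open>al 0\<close> or \<open>al 7\<close> and has mark
        2. Then \<open>\<rho> hroot\<close> is twice its value there, hence nonzero, and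
        \<open>hroot\<close> pairs evenly with \<open>v\<close>.\<close>
      have h: "\<rho> hroot = 2 * \<rho> (al 0) + 3 * \<rho> (al 1) + 4 * \<rho> (al 2) + 6 * \<rho> (al 3) + 5 * \<rho> (al 4) + 4 * \<rho> (al 5) + 3 * \<rho> (al 6) + 2 * \<rho> (al 7)"
        unfolding \<rho>u[of hroot] by (simp add: hroot_def mk8_simps)
      have he: "even (pe v hroot)" unfolding pe_hroot x7 using z by simp
      show ?thesis
      proof (cases "\<exists>k<8. \<rho> (al k) \<noteq> 0 \<and> even (pe v (al k))")
        case True then show ?thesis using pe_al_al by blast
      next
        case no: False
        have no': "\<rho> (al k) = 0" if "k < 8" "even (pe v (al k))" for k using no that by blast
        have "\<rho> (al 1) = 0" "\<rho> (al 2) = 0" "\<rho> (al 3) = 0" "\<rho> (al 4) = 0" "\<rho> (al 5) = 0" "\<rho> (al 6) = 0"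
          using no'[of 1] no'[of 2] no'[of 3] no'[of 4] no'[of 5] no'[of 6] z by (simp_all del: One_nat_def)
        moreover have "\<rho> (al 0) = 0 \<or> odd (pe v (al 0))" "\<rho> (al 7) = 0 \<or> odd (pe v (al 7))" using no'[of 0] no'[of 7] by auto
        moreover have "\<rho> w = w$0 * \<rho> (al 0) + w$1 * \<rho> (al 1) + w$2 * \<rho> (al 2) + w$3 * \<rho> (al 3) + w$4 * \<rho> (al 4) + w$5 * \<rho> (al 5) + w$6 * \<rho> (al 6) + w$7 * \<rho> (al 7)" by (rule \<rho>u)
        ultimately have "\<rho> hroot \<noteq> 0" using z07 less.prems(2) h by auto
        then show ?thesis using he pe_hroot(2) by blast
      qed
    qed
  qed
qed

text \<open>Since E8 is unimodular, \<open>\<chi>'\<close> is the pairing with a vector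
  \<open>v\<close>; the coefficients in its definition form the inverse Cartan matrix.\<close>

lemma even_root:
  fixes \<rho> \<chi>' :: "int^8 \<Rightarrow> int"
  assumes "\<And>x y. \<rho> (x + y) = \<rho> x + \<rho> y" "\<rho> w \<noteq> 0" and \<chi>: "\<And>x y. \<chi>' (x + y) = \<chi>' x + \<chi>' y"
  shows "\<exists>u. pe u u = 2 \<and> even (\<chi>' u) \<and> \<rho> u \<noteq> 0"
proof -
  define c where "c = (\<lambda>k. \<chi>' (al k))"
  define v where "v = mk8 [4*c 0+5*c 1+7*c 2+10*c 3+8*c 4+6*c 5+4*c 6+2*c 7,
    5*c 0+8*c 1+10*c 2+15*c 3+12*c 4+9*c 5+6*c 6+3*c 7,
    7*c 0+10*c 1+14*c 2+20*c 3+16*c 4+12*c 5+8*c 6+4*c 7,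
    10*c 0+15*c 1+20*c 2+30*c 3+24*c 4+18*c 5+12*c 6+6*c 7,
    8*c 0+12*c 1+16*c 2+24*c 3+20*c 4+15*c 5+10*c 6+5*c 7,
    6*c 0+9*c 1+12*c 2+18*c 3+15*c 4+12*c 5+8*c 6+4*c 7,
    4*c 0+6*c 1+8*c 2+12*c 3+10*c 4+8*c 5+6*c 6+3*c 7,
    2*c 0+3*c 1+4*c 2+6*c 3+5*c 4+4*c 5+3*c 6+2*c 7]"
  have "pe v u = \<chi>' u" for u
    unfolding additive8[of \<chi>' u, OF \<chi>] additive8[of "\<lambda>u. pe v u" u, OF pe_add(2)] pe_al
    unfolding v_def mk8_simps c_def by (simp add: algebra_simps)
  then show ?thesis using even_root_aux[OF assms(1,2), of v] by auto
qed

text \<open>The inverse Cartan matrix is integral, so every coordinate is an integral combination of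
  the pairings with simple roots.\<close>

lemma E8_coprime_coords:
  fixes x :: "int^8" assumes "\<And>k. k < 8 \<Longrightarrow> p dvd pe x (al k)" shows "p dvd x $ i"
proof -
  have n: "p dvd pe x (al 0)" "p dvd pe x (al 1)" "p dvd pe x (al 2)" "p dvd pe x (al 3)" "p dvd pe x (al 4)" "p dvd pe x (al 5)"
      "p dvd pe x (al 6)" "p dvd pe x (al 7)" using assms by auto
  define c where "c = (\<lambda>k. pe x (al k))"
  have cc: "x$0 = 4*c 0+5*c 1+7*c 2+10*c 3+8*c 4+6*c 5+4*c 6+2*c 7"
    "x$1 = 5*c 0+8*c 1+10*c 2+15*c 3+12*c 4+9*c 5+6*c 6+3*c 7"
    "x$2 = 7*c 0+10*c 1+14*c 2+20*c 3+16*c 4+12*c 5+8*c 6+4*c 7"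
    "x$3 = 10*c 0+15*c 1+20*c 2+30*c 3+24*c 4+18*c 5+12*c 6+6*c 7"
    "x$4 = 8*c 0+12*c 1+16*c 2+24*c 3+20*c 4+15*c 5+10*c 6+5*c 7"
    "x$5 = 6*c 0+9*c 1+12*c 2+18*c 3+15*c 4+12*c 5+8*c 6+4*c 7"
    "x$6 = 4*c 0+6*c 1+8*c 2+12*c 3+10*c 4+8*c 5+6*c 6+3*c 7"
    "x$7 = 2*c 0+3*c 1+4*c 2+6*c 3+5*c 4+4*c 5+3*c 6+2*c 7" unfolding c_def pe_al by simp_all
  have nc: "p dvd c 0" "p dvd c 1" "p dvd c 2" "p dvd c 3" "p dvd c 4" "p dvd c 5" "p dvd c 6" "p dvd c 7" using n by (simp_all add: c_def)
  have "p dvd x $ of_nat (ix8 i)"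
  proof -
    have "ix8 i \<in> {0,1,2,3,4,5,6,7}" using ix8_less[of i] lt8 by blast
    then show ?thesis by (elim insertE emptyE) (auto simp: cc simp del: One_nat_def intro!: dvd_add dvd_mult nc)
  qed
  then show ?thesis by (simp add: of_nat_ix8)
qed

section \<open>The Lorentzian lattice U + E8 and its isotropic vectors\<close>

type_synonym lam = "int \<times> int \<times> (int^8)"

text \<open>The even unimodular form of signature (9,1); the sign of U is chosen so that E8 is
  positive and roots have norm 2.\<close>

definition lform :: "lam \<Rightarrow> lam \<Rightarrow> int" where
  "lform x y = pe (snd (snd x)) (snd (snd y)) - fst x * fst (snd y) - fst (snd x) * fst y"

definition lsm :: "int \<Rightarrow> lam \<Rightarrow> lam" where
  "lsm k x = (k * fst x, k * fst (snd x), k *s snd (snd x))"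

lemma lform_simp [simp]: "lform (a,b,u) (a',b',u') = pe u u' - a * b' - b * a'"
  by (simp add: lform_def)

lemma lsm_simp [simp]: "lsm k (a,b,u) = (k * a, k * b, k *s u)"
  by (simp add: lsm_def)

lemma lform_lin: "lform (x + y) z = lform x z + lform y z" "lform (x - y) z = lform x z - lform y z" "lform (lsm k x) z = k * lform x z"
  "lform z (x + y) = lform z x + lform z y" "lform z (x - y) = lform z x - lform z y" "lform z (lsm k x) = k * lform z x"
  by (simp_all add: lform_def lsm_def pe_add pe_diff pe_smult algebra_simps)

lemma lform_sym: "lform x y = lform y x"
  by (simp add: lform_def pe_sym algebra_simps)

definition iso :: "(lam \<Rightarrow> lam) \<Rightarrow> bool" where
  "iso \<psi> \<longleftrightarrow> bij \<psi> \<and> (\<forall>x y. \<psi> (x + y) = \<psi> x + \<psi> y) \<and> (\<forall>x y. lform (\<psi> x) (\<psi> y) = lform x y)"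

lemma iso_comp: "iso \<psi> \<Longrightarrow> iso \<phi> \<Longrightarrow> iso (\<psi> \<circ> \<phi>)"
  unfolding iso_def by (auto simp: bij_comp simp del: split_paired_All)

lemma iso_involution:
  assumes "\<And>x. \<psi> (\<psi> x) = x" "\<And>x y. \<psi> (x + y) = \<psi> x + \<psi> y" "\<And>x y. lform (\<psi> x) (\<psi> y) = lform x y"
  shows "iso \<psi>"
  using assms by (auto simp: iso_def intro: involuntory_imp_bij)

lemma iso_uminus: "iso uminus"
  by (rule iso_involution) (auto simp: pe_uminus)

lemma iso_swap: "iso (\<lambda>(a,b,u). (b,a,u))"
  by (rule iso_involution) (auto simp: algebra_simps)

lemma iso_reflection: assumes "lform r r = 2" shows "iso (\<lambda>x. x - lsm (lform x r) r)"
proof (rule iso_involution)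
  have l: "lsm (j + k) x = lsm j x + lsm k x" "lsm (- j) x = - lsm j x" for j k x
    by (auto simp: lsm_def algebra_simps vec_eq_iff)
  show "x - lsm (lform x r) r - lsm (lform (x - lsm (lform x r) r) r) r = x" for x
    using assms by (simp add: lform_lin l(2))
  show "x + y - lsm (lform (x + y) r) r = (x - lsm (lform x r) r) + (y - lsm (lform y r) r)" for x y
    by (simp add: lform_lin l(1))
  show "lform (x - lsm (lform x r) r) (y - lsm (lform y r) r) = lform x y" for x y
    using assms by (simp add: lform_lin lform_sym[of r y] algebra_simps)
qed

text \<open>Descent of an isotropic vector to the fundamental chamber of the Weyl group of \<open>E\<^sub>1\<^sub>0\<close>; the height
  \<open>31 a + 30 b - (u, \<rho>)\<close> is the pairing with the Weyl vector.\<close>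
lemma isotropic_descent:
  assumes "a \<ge> 0" "b \<ge> 0" "lform (a,b,u) (a,b,u) = 0"
  shows "\<exists>\<psi> k. iso \<psi> \<and> \<psi> (k,0,0) = (a,b,u)"
  using assms
proof (induction "nat (31 * a + 30 * b - pe u wvec)" arbitrary: a b u rule: less_induct)
  case less
  have uu: "pe u u = 2 * a * b" using less.prems(3) by (simp add: algebra_simps)
  \<comment> \<open>The height is minus the pairing with \<open>(30, 31, wvec)\<close>, the vector
    pairing to 1 with the simple roots of E8, with \<open>(0,-1,-hroot)\<close> and with
    \<open>(-1,1,0)\<close>. Cauchy-Schwarz makes it nonnegative, as
    \<open>(31*a + 30*b)^2 - 1240*a*b = (31*a - 30*b)^2 + 2480*a*b\<close>.\<close>
  have height: "31 * a + 30 * b - pe u wvec \<ge> 0" if "a \<ge> 0" "b \<ge> 0" "pe u u = 2 * a * b" for a b :: int and u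
  proof (rule ccontr)
    assume "\<not> 31 * a + 30 * b - pe u wvec \<ge> 0"
    then have "31 * a + 30 * b < pe u wvec" by simp
    then have "(31 * a + 30 * b)\<^sup>2 < (pe u wvec)\<^sup>2" using that by (intro power_strict_mono) auto
    also have "\<dots> \<le> 2 * a * b * 620" using pe_cauchy_schwarz[of u wvec] by (simp add: that pe_wvec(2))
    finally have "(31 * a - 30 * b)\<^sup>2 + 2480 * (a * b) < 0" by (simp add: power2_eq_square algebra_simps)
    moreover have "a * b \<ge> 0" using that by simp
    moreover have "(31 * a - 30 * b)\<^sup>2 \<ge> 0" by simp
    ultimately show False by linarith
  qed
  have step: ?case if "iso \<phi>" "\<phi> (a',b',u') = (a,b,u)" "a' \<ge> 0" "b' \<ge> 0"
    "31 * a' + 30 * b' - pe u' wvec < 31 * a + 30 * b - pe u wvec" for \<phi> a' b' u'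
  proof -
    have l: "lform (a',b',u') (a',b',u') = 0" using that(1,2) less.prems(3) unfolding iso_def by metis
    then have "pe u' u' = 2 * a' * b'" by (simp add: algebra_simps)
    from height[OF that(3,4) this] that(5) have "nat (31 * a' + 30 * b' - pe u' wvec) < nat (31 * a + 30 * b - pe u wvec)" by linarith
    from less.hyps[OF this that(3,4) l] obtain \<psi> k where "iso \<psi>" "\<psi> (k,0,0) = (a',b',u')" by blast
    then show ?thesis using that(1,2) by (intro exI[of _ "\<phi> \<circ> \<psi>"] exI[of _ k]) (auto intro: iso_comp)
  qed
  show ?case
  proof (cases "b < a")
    case True
    show ?thesis by (rule step[OF iso_swap, of b a u]) (use True less.prems in auto)
  next
    case ba: False
    show ?thesis
    proof (cases "\<exists>k<8. pe u (al k) < 0")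
      case True
      then obtain k where k: "k < 8" "pe u (al k) < 0" by blast
      have w1: "pe (al k) wvec = 1" using k(1) lt8 by (auto simp: pe_wvec al_def mk8_simps lessThan_iff[symmetric] simp del: lessThan_iff)
      have r: "lform (0,0,al k) (0,0,al k) = 2" using pe_al_al[OF k(1)] by simp
      show ?thesis
        by (rule step[OF iso_reflection[OF r], of a b "u - pe u (al k) *s al k"])
          (use k less.prems pe_al_al[OF k(1)] in \<open>auto simp: pe_diff pe_smult w1 vec_eq_iff algebra_simps\<close>)
    next
      case False
      then have nn: "pe u (al k) \<ge> 0" if "k < 8" for k using that by force
      have n: "pe u (al 0) \<ge> 0" "pe u (al 1) \<ge> 0" "pe u (al 2) \<ge> 0" "pe u (al 3) \<ge> 0" "pe u (al 4) \<ge> 0" "pe u (al 5) \<ge> 0"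
        "pe u (al 6) \<ge> 0" "pe u (al 7) \<ge> 0" using nn by auto
      have bd: "u$0 \<le> 2 * u$7" "u$1 \<le> 3 * u$7" "u$2 \<le> 4 * u$7" "u$3 \<le> 6 * u$7" "u$4 \<le> 5 * u$7" "u$5 \<le> 4 * u$7" "u$6 \<le> 3 * u$7" "u$7 \<le> 2 * u$7" "u$7 \<ge> 0"
        using n unfolding pe_al by linarith+
      \<comment> \<open>In the chamber each coordinate of \<open>u\<close> is at most its mark times
        \<open>u$7\<close>, and the pairings are nonnegative. Summing bounds \<open>pe u u\<close>
        by \<open>u$7 * pe u hroot\<close>, the square of \<open>u$7\<close>.\<close>
      have "pe u u = u$0 * pe u (al 0) + u$1 * pe u (al 1) + u$2 * pe u (al 2) + u$3 * pe u (al 3) + u$4 * pe u (al 4) + u$5 * pe u (al 5) + u$6 * pe u (al 6) + u$7 * pe u (al 7)"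
        by (rule additive8[of "pe u" u, OF pe_add(2)])
      also have "\<dots> \<le> (2*u$7) * pe u (al 0) + (3*u$7) * pe u (al 1) + (4*u$7) * pe u (al 2) + (6*u$7) * pe u (al 3) + (5*u$7) * pe u (al 4) + (4*u$7) * pe u (al 5) + (3*u$7) * pe u (al 6) + (2*u$7) * pe u (al 7)"
        by (intro add_mono mult_right_mono bd n)
      also have "\<dots> = u$7 * u$7" unfolding pe_al by (simp add: algebra_simps)
      finally have u7: "2 * a * b \<le> u$7 * u$7" by (simp add: uu)
      show ?thesis
      proof (cases "u$7 > a")
        case True
        have "a > 0"
        proof (rule ccontr)
          assume "\<not> a > 0"
          then have "a = 0" using less.prems by simp
          then have "u = 0" using uu pe_eq_0 by simp
          then show False using True \<open>a = 0\<close> by simp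
        qed
        \<comment> \<open>The affine simple root; reflecting in it lowers the height when
          \<open>u$7 > a\<close>.\<close>
        have r: "lform (0,-1,-hroot) (0,-1,-hroot) = 2" by (simp add: pe_uminus pe_hroot hroot7)
        define b' where "b' = b + (a - u$7)"
        define u' where "u' = u + (a - u$7) *s hroot"
        have uu': "pe u' u' = 2 * a * b'"
        proof -
          have "pe (u + c *s hroot) (u + c *s hroot) = pe u u + 2 * c * u$7 + 2 * c * c" for c
            by (simp add: pe_add pe_smult pe_hroot pe_sym[of hroot u] hroot7 algebra_simps)
          from this[of "a - u$7"] have e: "pe u' u' = pe u u + 2 * (a - u$7) * u$7 + 2 * (a - u$7) * (a - u$7)"
            unfolding u'_def .
          show ?thesis unfolding e uu b'_def by (simp add: algebra_simps)
        qed
        have wh: "pe hroot wvec = 29" unfolding pe_wvec by (simp add: hroot_def mk8_simps)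
        have "2 * a * b' \<ge> 0" using pe_nonneg[of u'] uu' by simp
        then have "b' \<ge> 0" using \<open>a > 0\<close> by (simp add: zero_le_mult_iff)
        show ?thesis
        proof (rule step[OF iso_reflection[OF r], of a b' u'])
          have L1: "lform (a,b',u') (0,-1,-hroot) = u$7 - a"
            by (simp add: u'_def pe_uminus pe_add pe_smult pe_hroot hroot7 algebra_simps)
          show "(a,b',u') - lsm (lform (a,b',u') (0,-1,-hroot)) (0,-1,-hroot) = (a,b,u)"
            unfolding L1 by (auto simp: b'_def u'_def vec_eq_iff algebra_simps)
          show "31 * a + 30 * b' - pe u' wvec < 31 * a + 30 * b - pe u wvec"
          proof -
            have "pe u' wvec = pe u wvec + (a - u$7) * 29" unfolding u'_def pe_add pe_smult wh ..
            then show ?thesis using True by (simp add: b'_def algebra_simps)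
          qed
        qed (use less.prems \<open>b' \<ge> 0\<close> in auto)
      next
        case False
        \<comment> \<open>For \<open>a > 0\<close> one would have
          \<open>2*a*b \<le> u$7 * u$7 \<le> a*a \<le> a*b\<close>, a contradiction. With
          \<open>a = 0\<close> also \<open>u = 0\<close>, and swapping the two isotropic coordinates
          ends the descent.\<close>
        have "a = 0"
        proof (rule ccontr)
          assume "a \<noteq> 0"
          then have "a > 0" using less.prems by simp
          have "u$7 * u$7 \<le> a * a" using False bd(9) by (intro mult_mono) auto
          moreover have "a * a \<le> a * b" using ba \<open>a > 0\<close> by (intro mult_left_mono) auto
          moreover have "a * a > 0" using \<open>a > 0\<close> by simp
          ultimately show False using u7 by linarith
        qed
        then have "u = 0" using uu pe_eq_0 by simp
        then show ?thesis using \<open>a = 0\<close> by (intro exI[of _ "\<lambda>(a,b,u). (b,a,u)"] exI[of _ b]) (auto intro: iso_swap)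
      qed
    qed
  qed
qed

lemma isotropic_standard:
  assumes "lform f f = 0" shows "\<exists>\<psi> k. iso \<psi> \<and> \<psi> (k,0,0) = f"
proof -
  obtain a b u where f: "f = (a,b,u)" by (cases f) auto
  have "2 * (a * b) = pe u u" using assms by (simp add: f algebra_simps)
  then have "a * b \<ge> 0" using pe_nonneg[of u] by linarith
  then consider "a \<ge> 0" "b \<ge> 0" | "a \<le> 0" "b \<le> 0" by (auto simp: zero_le_mult_iff)
  then show ?thesis
  proof cases
    case 1 then show ?thesis using isotropic_descent assms f by blast
  next
    case 2
    have "lform (-a,-b,-u) (-a,-b,-u) = 0" using assms by (simp add: f pe_uminus)
    then obtain \<psi> k where "iso \<psi>" "\<psi> (k,0,0) = (-a,-b,-u)" using isotropic_descent[of "-a" "-b" "-u"] 2 by auto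
    then show ?thesis by (intro exI[of _ "uminus \<circ> \<psi>"] exI[of _ k]) (auto intro: iso_comp iso_uminus simp: f)
  qed
qed

text \<open>The roots of the rank 8 lattice \<open>{(j,u). N (u,l) = 2 t j}\<close> with form \<open>(u,u) - 2 e j\<^sup>2\<close> are not all orthogonal to \<open>l\<close>:
  the lattice has index at most 2 in \<open>f\<^sup>\<bottom>/f \<cong> E\<^sub>8\<close> for the isotropic vector \<open>f = (t+1, (t-1)e, N e l)\<close> of \<open>U + E\<^sub>8\<close>,
  and \<open>f' = (t-1, (t+1)e, N e l)\<close> spans its orthogonal complement together with \<open>f\<close>.\<close>
lemma glued_root_pos:
  fixes l :: "int^8"
  assumes l: "pe l l = 2 * d" and d: "d > 0" and t: "t\<^sup>2 = 1 + d * N\<^sup>2 * e" "t > 0"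
  shows "\<exists>u j. N * pe u l = 2 * t * j \<and> pe u u - 2 * e * j\<^sup>2 = 2 \<and> pe u l \<noteq> 0"
proof (cases "e = 0")
  case True
  \<comment> \<open>With \<open>e = 0\<close> the condition on \<open>j\<close> only says that
    \<open>N * pe u l\<close> is even, so \<open>even_root\<close> applies to E8 itself.\<close>
  then have "t = 1" using t by (simp add: power2_eq_1_iff)
  have "\<exists>u. pe u u = 2 \<and> even (N * pe u l) \<and> pe u l \<noteq> 0"
    by (rule even_root[of "\<lambda>u. pe u l" l]) (use l d in \<open>auto simp: pe_add algebra_simps\<close>)
  then obtain u where "pe u u = 2" "even (N * pe u l)" "pe u l \<noteq> 0" by blast
  then show ?thesis using True \<open>t = 1\<close> by (intro exI[of _ u] exI[of _ "N * pe u l div 2"]) auto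
next
  case e: False
  define f :: lam where "f = (t+1, (t-1)*e, (N*e) *s l)"
  have tt: "t * t = 1 + d * N * N * e" using t(1) by (simp add: power2_eq_square)
  have "lform f f = 2 * d * N * N * e * e - 2 * (t*t - 1) * e"
    by (simp add: f_def pe_smult l algebra_simps)
  then have "lform f f = 0" by (simp add: tt)
  then obtain \<psi> k where \<psi>: "iso \<psi>" "\<psi> (k,0,0) = f" using isotropic_standard by blast
  have add: "\<psi> (x + y) = \<psi> x + \<psi> y" and pres: "lform (\<psi> x) (\<psi> y) = lform x y" for x y using \<psi>(1) unfolding iso_def by blast+
  have surj: "\<exists>y. \<psi> y = x" for x using \<psi>(1) unfolding iso_def bij_def by (metis surjD)
  have inj: "\<psi> x = \<psi> y \<Longrightarrow> x = y" for x y using \<psi>(1) unfolding iso_def bij_def by (simp add: inj_eq)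
  have \<psi>0: "\<psi> 0 = 0" using add[of 0 0] by simp
  have \<psi>m: "\<psi> (- x) = - \<psi> x" for x using add[of x "-x"] \<psi>0 by (simp add: eq_neg_iff_add_eq_0 add.commute)
  have \<psi>n: "\<psi> (lsm (int n) x) = lsm (int n) (\<psi> x)" for n x
  proof (induction n)
    case 0 show ?case using \<psi>0 by (simp add: lsm_def zero_prod_def)
  next
    case (Suc n)
    have "lsm (int (Suc n)) y = lsm (int n) y + y" for y by (cases y) (auto simp: algebra_simps vec_eq_iff)
    then show ?case using Suc by (simp add: add)
  qed
  have lsmm: "lsm (- j) y = - lsm j y" for j y by (cases y) (auto simp: vec_eq_iff)
  have \<psi>s: "\<psi> (lsm j x) = lsm j (\<psi> x)" for j x
  proof (cases "j \<ge> 0")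
    case True then show ?thesis using \<psi>n[of "nat j" x] by simp
  next
    case False then show ?thesis using \<psi>n[of "nat (-j)" x] lsmm[of "-j"] \<psi>m by simp
  qed
  have k0: "k \<noteq> 0"
  proof
    assume "k = 0"
    then have "f = 0" using \<psi>(2) \<psi>0 by (simp add: zero_prod_def)
    then show False using t(2) by (simp add: f_def zero_prod_def)
  qed
  define g where "g = \<psi> (1,0,0)"
  have fg: "f = lsm k g" using \<psi>s[of k "(1,0,0)"] \<psi>(2) by (simp add: g_def)
  \<comment> \<open>\<open>Q x = 2 c f\<close>, where \<open>x - c f\<close> is the projection of \<open>x \<in> f\<^sup>\<bottom>\<close> along \<open>f\<close> to the orthogonal complement of \<open>f'\<close>\<close>
  define Q :: "lam \<Rightarrow> lam" where "Q = (\<lambda>(X,Y,u). (2*t*X - N * pe u l, (X*e-Y)*(t-1), ((X*e-Y)*N) *s l))"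
  have Qadd: "Q (x + y) = Q x + Q y" for x y
    by (cases x, cases y) (simp add: Q_def pe_add vec_eq_iff algebra_simps)
  have Qf: "lsm e (Q x) = lsm (fst x * e - fst (snd x)) f" if "lform x f = 0" for x
  proof -
    obtain X Y u where x: "x = (X,Y,u)" by (cases x) auto
    have "N * e * pe u l - X * ((t-1)*e) - Y * (t+1) = 0" using that by (simp add: x f_def pe_smult)
    then have "e * (2*t*X - N * pe u l) = (X*e-Y)*(t+1)" by (simp add: algebra_simps)
    then show ?thesis by (simp add: x Q_def f_def vec_eq_iff algebra_simps)
  qed
  \<comment> \<open>\<open>g\<close> is primitive, being the image of \<open>(1,0,0)\<close>, so an
    integral vector with a nonzero multiple on the line of \<open>f\<close> is an integral multiple
    of \<open>g\<close>.\<close>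
  have Qg: "\<exists>c. Q x = lsm c g" if "lform x f = 0" for x
  proof -
    obtain A B v where y: "\<psi> (A,B,v) = Q x" using surj[of "Q x"] by auto
    have "\<psi> (lsm e (A,B,v)) = \<psi> (lsm ((fst x * e - fst (snd x)) * k) (1,0,0))"
      unfolding \<psi>s y Qf[OF that] fg g_def[symmetric] by (cases g) (auto simp: vec_eq_iff)
    from inj[OF this] have "e * B = 0" "e *s v = 0" by auto
    then have "B = 0" "v = 0" using e by (auto simp: vec_eq_iff)
    then have "Q x = \<psi> (lsm A (1,0,0))" using y by simp
    then show ?thesis unfolding \<psi>s g_def by blast
  qed
  define em where "em = (\<lambda>u. \<psi> (0,0,u))"
  have em_add: "em (u + v) = em u + em v" for u v using add[of "(0,0,u)" "(0,0,v)"] by (simp add: em_def)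
  have em_f: "lform (em u) f = 0" for u using pres[of "(0,0,u)" "(k,0,0)"] \<psi>(2) by (simp add: em_def pe_expand)
  define c where "c = (\<lambda>u. SOME c. Q (em u) = lsm c g)"
  have c: "Q (em u) = lsm (c u) g" for u unfolding c_def using someI_ex[OF Qg[OF em_f]] .
  have lsm_inj: "i = j" if "lsm i g = lsm j g" for i j
    using inj[of "lsm i (1,0,0)" "lsm j (1,0,0)", unfolded \<psi>s g_def[symmetric], OF that] by simp
  have c_add: "c (u + v) = c u + c v" for u v
  proof (rule lsm_inj)
    have "lsm (i + j) g = lsm i g + lsm j g" for i j by (cases g) (auto simp: algebra_simps vec_eq_iff)
    then show "lsm (c (u + v)) g = lsm (c u + c v) g" by (simp flip: c add: em_add Qadd)
  qed
  \<comment> \<open>\<open>R\<close> vanishes on \<open>f\<close>, hence depends only on the class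
    modulo \<open>g\<close>, and it equals \<open>pe u l\<close> on vectors with
    \<open>Y = X * e\<close>. It is the functional that must not vanish on the root.\<close>
  define R :: "lam \<Rightarrow> int" where "R = (\<lambda>(X,Y,u). pe u l - N * d * (X*e - Y))"
  have Radd: "R (x + y) = R x + R y" for x y by (cases x, cases y) (simp add: R_def pe_add algebra_simps)
  have Rs: "R (lsm j x) = j * R x" for j x by (cases x) (simp add: R_def pe_smult algebra_simps)
  have Rf: "R f = 0" by (simp add: R_def f_def pe_smult l algebra_simps)
  have Rg: "R g = 0" using Rf k0 unfolding fg Rs by simp
  obtain w where w: "R (em w) \<noteq> 0"
  proof -
    \<comment> \<open>Orthogonal to \<open>f\<close> with \<open>R r = 2 * d * t\<close>, so it
      witnesses that \<open>R\<close> is nonzero on the copy of E8 formed by the vectors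
      \<open>em v\<close>.\<close>
    define r :: lam where "r = (d*N, d*N*e, t *s l)"
    have rf: "lform r f = 0" by (simp add: r_def f_def pe_smult l algebra_simps)
    have Rr: "R r = 2 * d * t" by (simp add: R_def r_def pe_smult l)
    obtain A B v where y: "\<psi> (A,B,v) = r" using surj by (metis prod_cases3)
    have "lform (A,B,v) (k,0,0) = 0" using pres[of "(A,B,v)" "(k,0,0)"] rf by (simp only: y \<psi>(2))
    then have "B = 0" using k0 by (simp add: pe_expand)
    then have "r = \<psi> (lsm A (1,0,0) + (0,0,v))" using y by simp
    also have "\<dots> = lsm A g + em v" unfolding add \<psi>s by (simp add: g_def em_def)
    finally have "R r = R (em v)" by (simp add: Radd Rs Rg)
    moreover have "2 * d * t > 0" using d t(2) by simp
    ultimately have "R (em v) \<noteq> 0" using Rr by linarith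
    then show ?thesis using that by blast
  qed
  have Rem_add: "R (em (x + y)) = R (em x) + R (em y)" for x y by (simp add: em_add Radd)
  obtain u0 where u0: "pe u0 u0 = 2" "even (c u0)" "R (em u0) \<noteq> 0"
    using even_root[of "\<lambda>u. R (em u)" w c, OF Rem_add w c_add] by blast
  \<comment> \<open>Since \<open>Q\<close> doubles \<open>g\<close>, subtracting
    \<open>c u0 div 2\<close> times \<open>g\<close> makes \<open>Q x\<close> zero; evenness of
    \<open>c u0\<close> makes the division exact.\<close>
  define x where "x = em u0 - lsm (c u0 div 2) g"
  have gg: "lform g g = 0" and eg: "lform (em u) g = 0" for u
    unfolding g_def em_def pres by (simp_all add: pe_expand)
  have ge: "lform g (em u) = 0" for u using eg[of u] unfolding lform_sym[of g "em u"] .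
  have xx: "lform x x = 2"
  proof -
    have "lform (em u0) (em u0) = 2" using pres[of "(0,0,u0)" "(0,0,u0)"] u0(1) by (simp add: em_def)
    then show ?thesis by (simp add: x_def lform_lin gg eg ge)
  qed
  have xf: "lform x f = 0" by (simp add: x_def lform_lin fg gg eg)
  have Qx: "Q x = 0"
  proof -
    have s1: "Q (lsm j y) = lsm j (Q y)" for j y by (cases y) (simp add: Q_def pe_smult vec_eq_iff algebra_simps)
    have s2: "Q (y - z) = Q y - Q z" for y z using Qadd[of "y - z" z] by simp
    have "lsm k (Q g) = lsm (2 * k) g"
    proof -
      have "2 * (t * t) = 2 + 2 * (d * N * N * e)" using tt by simp
      then have "Q f = lsm 2 f" by (simp add: Q_def f_def pe_smult l vec_eq_iff algebra_simps)
      then show ?thesis unfolding fg s1[symmetric] by (cases g) (simp add: vec_eq_iff)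
    qed
    then have "Q g = lsm 2 g" using k0 by (cases g, cases "Q g") (auto simp: vec_eq_iff)
    then have "Q x = lsm (c u0) g - lsm (c u0 div 2 * 2) g"
      unfolding x_def s2 s1 c by (cases g) (simp add: vec_eq_iff)
    then show ?thesis using u0(2) by simp
  qed
  obtain X Y u where x': "x = (X,Y,u)" by (cases x) auto
  have q1: "2 * t * X = N * pe u l" using Qx by (simp add: x' Q_def zero_prod_def)
  have q2: "Y = X * e"
  proof -
    have "lsm (X * e - Y) f = 0" using Qf[OF xf] Qx by (simp add: x' zero_prod_def)
    then have "(X * e - Y) * (t + 1) = 0" by (simp add: f_def zero_prod_def)
    then show ?thesis using t(2) by simp
  qed
  have "R x = R (em u0)" by (simp add: x_def Rs Rg Radd[of "em u0 - lsm (c u0 div 2) g" "lsm (c u0 div 2) g", simplified])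
  then have "pe u l \<noteq> 0" using u0(3) by (simp add: x' R_def q2)
  moreover have "pe u u - 2 * e * X\<^sup>2 = 2" using xx by (simp add: x' q2 power2_eq_square algebra_simps)
  ultimately show ?thesis using q1 by (intro exI[of _ u] exI[of _ X]) auto
qed

lemma glued_root:
  fixes l :: "int^8"
  assumes l: "pe l l = 2 * d" and d: "d > 0" and t: "t\<^sup>2 = 1 + d * N\<^sup>2 * e" "t \<noteq> 0"
  shows "\<exists>u j. N * pe u l = 2 * t * j \<and> pe u u - 2 * e * j\<^sup>2 = 2 \<and> pe u l \<noteq> 0"
proof (cases "t > 0")
  case True then show ?thesis using glued_root_pos assms by blast
next
  case False
  then obtain u j where "(-N) * pe u l = 2 * (-t) * j" "pe u u - 2 * e * j\<^sup>2 = 2" "pe u l \<noteq> 0"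
    using glued_root_pos[of l d "-t" "-N" e] assms by auto
  then show ?thesis by (intro exI[of _ u] exI[of _ j]) auto
qed

section \<open>Quadratic spaces of signature (2,n)\<close>

definition rbil :: "('n::finite \<Rightarrow> 'n \<Rightarrow> int) \<Rightarrow> real^'n \<Rightarrow> real^'n \<Rightarrow> real" where
  "rbil gr x y = (\<Sum>i\<in>UNIV. \<Sum>j\<in>UNIV. x$i * of_int (gr i j) * y$j)"

definition ibil :: "('n::finite \<Rightarrow> 'n \<Rightarrow> int) \<Rightarrow> int^'n \<Rightarrow> int^'n \<Rightarrow> int" where
  "ibil gr x y = (\<Sum>i\<in>UNIV. \<Sum>j\<in>UNIV. x$i * gr i j * y$j)"

definition ivec :: "int^'n \<Rightarrow> real^'n" where "ivec v = (\<chi> i. of_int (v$i))"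
definition rev :: "complex^'n \<Rightarrow> real^'n" where "rev w = (\<chi> i. Re (w$i))"
definition imv :: "complex^'n \<Rightarrow> real^'n" where "imv w = (\<chi> i. Im (w$i))"

lemma cvec_ivec: "cvec v = rvec (ivec v)"
  by (simp add: cvec_def rvec_def ivec_def)

lemma vec_parts: "w = rvec (rev w) + \<i> *s rvec (imv w)"
  by (simp add: vec_eq_iff rvec_def rev_def imv_def complex_eq_iff)

lemma conjv_parts: "conjv w = rvec (rev w) - \<i> *s rvec (imv w)"
  by (simp add: vec_eq_iff rvec_def rev_def imv_def complex_eq_iff conjv_def)

lemma rvec_lin: "rvec (x + y) = rvec x + rvec y" "rvec (x - y) = rvec x - rvec y" "rvec (c *\<^sub>R x) = of_real c *s rvec x" "rvec 0 = 0" "rvec (- x) = - rvec x"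
  by (simp_all add: vec_eq_iff rvec_def)

lemma ivec_lin: "ivec (x + y) = ivec x + ivec y" "ivec (x - y) = ivec x - ivec y" "ivec (c *s x) = of_int c *\<^sub>R ivec x" "ivec 0 = 0" "ivec (- x) = - ivec x"
  by (simp_all add: vec_eq_iff ivec_def)

lemma cvec_lin: "cvec (x + y) = cvec x + cvec y" "cvec (x - y) = cvec x - cvec y" "cvec (c *s x) = of_int c *s cvec x" "cvec 0 = 0" "cvec (- x) = - cvec x"
  by (simp_all add: vec_eq_iff cvec_def)

lemma rvec_inject: "rvec x = rvec y \<longleftrightarrow> x = y"
  by (simp add: vec_eq_iff rvec_def)

lemma ivec_inject: "ivec x = ivec y \<longleftrightarrow> x = y"
  by (simp add: vec_eq_iff ivec_def)

lemma rev_imv_lin: "rev (x + y) = rev x + rev y" "imv (x + y) = imv x + imv y" "rev (x - y) = rev x - rev y" "imv (x - y) = imv x - imv y"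
  "rev (rvec a) = a" "imv (rvec a) = 0" "rev (\<i> *s x) = - imv x" "imv (\<i> *s x) = rev x"
  "rev (of_real c *s x) = c *\<^sub>R rev x" "imv (of_real c *s x) = c *\<^sub>R imv x"
  by (simp_all add: vec_eq_iff rvec_def rev_def imv_def)

lemma conjv_lin: "conjv (x + y) = conjv x + conjv y" "conjv (x - y) = conjv x - conjv y" "conjv (c *s x) = cnj c *s conjv x"
  "conjv (rvec a) = rvec a" "conjv (conjv x) = x"
  by (simp_all add: vec_eq_iff conjv_def rvec_def)

lemma bil_add: "bil gr (x + y) z = bil gr x z + bil gr y z" "bil gr z (x + y) = bil gr z x + bil gr z y"
  by (simp_all add: bil_def algebra_simps sum.distrib)

lemma bil_diff: "bil gr (x - y) z = bil gr x z - bil gr y z" "bil gr z (x - y) = bil gr z x - bil gr z y"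
  by (simp_all add: bil_def algebra_simps sum_subtractf)

lemma bil_smult: "bil gr (c *s x) z = c * bil gr x z" "bil gr z (c *s x) = c * bil gr z x"
  by (simp_all add: bil_def algebra_simps sum_distrib_left)

lemma bil_zero: "bil gr 0 z = 0" "bil gr z 0 = 0"
  by (simp_all add: bil_def)

lemma bil_uminus: "bil gr (- x) z = - bil gr x z" "bil gr z (- x) = - bil gr z x"
  by (simp_all add: bil_def sum_negf)

lemma rbil_add: "rbil gr (x + y) z = rbil gr x z + rbil gr y z" "rbil gr z (x + y) = rbil gr z x + rbil gr z y"
  by (simp_all add: rbil_def algebra_simps sum.distrib)

lemma rbil_diff: "rbil gr (x - y) z = rbil gr x z - rbil gr y z" "rbil gr z (x - y) = rbil gr z x - rbil gr z y"
  by (simp_all add: rbil_def algebra_simps sum_subtractf)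

lemma rbil_scale: "rbil gr (c *\<^sub>R x) z = c * rbil gr x z" "rbil gr z (c *\<^sub>R x) = c * rbil gr z x"
  by (simp_all add: rbil_def algebra_simps sum_distrib_left)

lemma rbil_zero: "rbil gr 0 z = 0" "rbil gr z 0 = 0"
  by (simp_all add: rbil_def)

lemma rbil_uminus: "rbil gr (- x) z = - rbil gr x z" "rbil gr z (- x) = - rbil gr z x"
  by (simp_all add: rbil_def sum_negf)

lemmas rbil_lin = rbil_add rbil_diff rbil_scale rbil_zero rbil_uminus
lemmas bil_lin = bil_add bil_diff bil_smult bil_zero bil_uminus

lemma bil_rvec: "bil gr (rvec x) (rvec y) = of_real (rbil gr x y)"
  by (simp add: bil_def rbil_def rvec_def)

lemma rbil_ivec: "rbil gr (ivec x) (ivec y) = of_int (ibil gr x y)"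
  by (simp add: rbil_def ibil_def ivec_def)

lemma bil_cvec: "bil gr (cvec x) (cvec y) = of_int (ibil gr x y)"
  unfolding cvec_ivec bil_rvec rbil_ivec by simp

lemma ibil_lin: "ibil gr (x + y) z = ibil gr x z + ibil gr y z" "ibil gr z (x + y) = ibil gr z x + ibil gr z y"
   "ibil gr (x - y) z = ibil gr x z - ibil gr y z" "ibil gr z (x - y) = ibil gr z x - ibil gr z y"
   "ibil gr (c *s x) z = c * ibil gr x z" "ibil gr z (c *s x) = c * ibil gr z x"
  by (simp_all add: ibil_def algebra_simps sum.distrib sum_subtractf sum_distrib_left)

lemma linear_rbil: "linear (\<lambda>x. rbil gr x y)"
  by (rule linearI) (simp_all add: rbil_lin)

lemma bil_conjv: "bil gr (conjv x) (conjv y) = cnj (bil gr x y)"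
  by (simp add: bil_def conjv_def)

lemma bil_conjv_rvec: "bil gr (conjv w) (rvec r) = cnj (bil gr w (rvec r))"
  using bil_conjv[of gr w "rvec r"] by (simp add: conjv_lin)

lemma bil_rvec_right: "bil gr w (rvec r) = Complex (rbil gr (rev w) r) (rbil gr (imv w) r)"
proof -
  have "bil gr w (rvec r) = bil gr (rvec (rev w) + \<i> *s rvec (imv w)) (rvec r)" using vec_parts[of w] by simp
  then show ?thesis by (simp add: bil_lin bil_rvec complex_eq_iff)
qed

lemma continuous_on_conjv [continuous_intros]: "continuous_on S f \<Longrightarrow> continuous_on S (\<lambda>x. conjv (f x))"
  unfolding conjv_def by (intro continuous_on_vec_lambda continuous_on_cnj continuous_on_component)

lemma continuous_on_rvec [continuous_intros]: "continuous_on S f \<Longrightarrow> continuous_on S (\<lambda>x. rvec (f x))"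
  unfolding rvec_def by (intro continuous_on_vec_lambda continuous_on_of_real continuous_on_component)

lemma continuous_on_bil [continuous_intros]:
  "continuous_on S f \<Longrightarrow> continuous_on S g \<Longrightarrow> continuous_on S (\<lambda>x. bil gr (f x) (g x))"
  unfolding bil_def by (intro continuous_on_sum continuous_on_mult continuous_on_component continuous_on_const)

lemma cholo_on_bil:
  "(\<And>i. cholo_on (\<lambda>x. f x $ i) U) \<Longrightarrow> (\<And>i. cholo_on (\<lambda>x. g x $ i) U) \<Longrightarrow> cholo_on (\<lambda>x. bil gr (f x) (g x)) U"
  unfolding bil_def by (intro cholo_on_sum cholo_on_mult cholo_on_const)

text \<open>The cross product solves both equations; when it vanishes the rows are dependent and one
  equation suffices. An arbitrary integral domain is allowed because both real and integral
  solutions are wanted.\<close>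

lemma two_equations_three_unknowns:
  fixes p1 p2 p3 q1 q2 q3 :: "'a::idom"
  obtains a b c where "(a,b,c) \<noteq> (0,0,0)" "a * p1 + b * p2 + c * p3 = 0" "a * q1 + b * q2 + c * q3 = 0"
proof (cases "(p2*q3-p3*q2, p3*q1-p1*q3, p1*q2-p2*q1) = (0,0,0)")
  case False
  show ?thesis by (rule that[OF False]) (simp_all add: algebra_simps)
next
  case True
  then have z: "p2*q3 = p3*q2" "p3*q1 = p1*q3" "p1*q2 = p2*q1" by auto
  consider "p1 \<noteq> 0 \<or> p2 \<noteq> 0" | "q1 \<noteq> 0 \<or> q2 \<noteq> 0" | "p1 = 0" "p2 = 0" "q1 = 0" "q2 = 0" by blast
  then show ?thesis
  proof cases
    case 1 show ?thesis by (rule that[of p2 "-p1" 0]) (use 1 z in \<open>auto simp: algebra_simps\<close>)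
  next
    case 2 show ?thesis by (rule that[of q2 "-q1" 0]) (use 2 z in \<open>auto simp: algebra_simps\<close>)
  next
    case 3 show ?thesis by (rule that[of 1 0 0]) (use 3 in auto)
  qed
qed

lemma avoid_finitely_many_kernels:
  fixes V :: "'v::real_vector set" and \<phi> :: "'r \<Rightarrow> 'v \<Rightarrow> real"
  assumes "finite R" and V: "0 \<in> V" "\<And>x y s. x \<in> V \<Longrightarrow> y \<in> V \<Longrightarrow> x + s *\<^sub>R y \<in> V"
    and lin: "\<And>r. r \<in> R \<Longrightarrow> linear (\<phi> r)" and ne: "\<And>r. r \<in> R \<Longrightarrow> \<exists>x\<in>V. \<phi> r x \<noteq> 0"
  shows "\<exists>x\<in>V. \<forall>r\<in>R. \<phi> r x \<noteq> 0"
  using assms(1) lin ne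
proof (induction R rule: finite_induct)
  case empty then show ?case using V by auto
next
  case (insert r R)
  then obtain x y where x: "x \<in> V" "\<And>q. q \<in> R \<Longrightarrow> \<phi> q x \<noteq> 0" and y: "y \<in> V" "\<phi> r y \<noteq> 0" by (metis insert_iff)
  \<comment> \<open>Each functional excludes at most one \<open>s\<close>, the ratio at which it
    vanishes on \<open>x + s *\<^sub>R y\<close>.\<close>
  have "finite ((\<lambda>q. - \<phi> q x / \<phi> q y) ` insert r R)" using insert.hyps by simp
  then obtain s where s: "s \<notin> (\<lambda>q. - \<phi> q x / \<phi> q y) ` insert r R"
    using ex_new_if_finite[OF infinite_UNIV_char_0[where 'a=real]] by blast
  have "\<phi> q (x + s *\<^sub>R y) \<noteq> 0" if q: "q \<in> insert r R" for q
  proof -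
    have e: "\<phi> q (x + s *\<^sub>R y) = \<phi> q x + s * \<phi> q y" using insert.prems(1)[OF q] by (simp add: linear_add linear_scale)
    have "s \<noteq> - \<phi> q x / \<phi> q y" using s q by blast
    then show ?thesis unfolding e using q x(2) y(2) by (cases "\<phi> q y = 0") (auto simp: field_simps add_eq_0_iff)
  qed
  then show ?case using V(2)[OF x(1) y(1)] by blast
qed

lemma holo_on_continuous: assumes "holo_on F A" shows "continuous_on A F"
  unfolding continuous_on_eq_continuous_within
proof
  fix w assume w: "w \<in> A"
  have "\<exists>U G. open U \<and> w \<in> U \<and> cholo_on G U \<and> (\<forall>z\<in>U \<inter> A. G z = F z)" using assms w unfolding holo_on_def by simp
  then obtain U G where UG: "open U" "w \<in> U" "cholo_on G U" "\<forall>z\<in>U \<inter> A. G z = F z" by (elim exE conjE)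
  have "continuous_on U G" by (rule cholo_on_continuous[OF UG(3)])
  then have "continuous (at w) G" using UG by (simp add: continuous_on_eq_continuous_at)
  then have "continuous (at w within A) G" by (rule continuous_at_imp_continuous_at_within)
  then have "(G \<longlongrightarrow> F w) (at w within A)" using UG(2,4) w by (simp add: continuous_within)
  moreover have "\<forall>\<^sub>F z in at w within A. G z = F z"
    unfolding eventually_at_topological using UG(1,2,4) by auto
  ultimately show "continuous (at w within A) F"
    unfolding continuous_within by (rule Lim_transform_eventually)
qed

lemma continuous_zero_closure:
  fixes F :: "'a::metric_space \<Rightarrow> complex"
  assumes "continuous_on A F" "S \<subseteq> A" "\<And>z. z \<in> S \<Longrightarrow> F z = 0" "w \<in> closure S" "w \<in> A" shows "F w = 0"
proof -
  obtain f where f: "\<And>n. f n \<in> S" "f \<longlonglongrightarrow> w" using assms(4) unfolding closure_sequential by blast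
  have "(F \<circ> f) \<longlonglongrightarrow> F w" using assms(1,2,5) f unfolding continuous_on_sequentially by blast
  moreover have "F \<circ> f = (\<lambda>n. 0)" using f(1) assms(3) by (auto simp: o_def)
  ultimately show ?thesis by (metis LIMSEQ_unique tendsto_const)
qed

lemma act_lin: "act g (x + y) = act g x + act g y" "act g (x - y) = act g x - act g y" "act g (c *s x) = c *s act g x"
  by (simp_all add: act_def matrix_vector_right_distrib matrix_vector_mult_diff_distrib vector_scalar_commute)

lemma continuous_on_act [continuous_intros]: "continuous_on S f \<Longrightarrow> continuous_on S (\<lambda>x. act g (f x))"
  unfolding act_def matrix_vector_mult_def
  by (intro continuous_on_vec_lambda continuous_on_sum continuous_on_mult continuous_on_component continuous_on_const)

lemma act_nth: "act g x $ i = (\<Sum>j\<in>UNIV. of_int (g$i$j) * x$j)"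
  by (simp add: act_def cmat_def matrix_vector_mult_def)

lemma act_conjv: "act g (conjv x) = conjv (act g x)"
  by (simp add: vec_eq_iff act_nth conjv_def)

lemma act_mult: "act (g ** h) x = act g (act h x)"
proof -
  have "cmat (g ** h) = cmat g ** cmat h" by (simp add: cmat_def matrix_matrix_mult_def vec_eq_iff)
  then show ?thesis by (simp add: act_def matrix_vector_mul_assoc)
qed

lemma act_1: "act (mat 1) x = x"
proof -
  have "cmat (mat 1 :: int^'a^'a) = mat 1" by (simp add: cmat_def mat_def vec_eq_iff)
  then show ?thesis by (simp add: act_def)
qed

lemma act_eq_1: assumes "\<And>x. act g x = x" shows "g = mat 1"
proof -
  have "cmat g = mat 1" unfolding matrix_eq using assms by (simp add: act_def)
  then show ?thesis by (simp add: cmat_def mat_def vec_eq_iff) (metis of_int_0 of_int_1 of_int_eq_iff)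
qed

lemma act_rvec: "act g (rvec x) = rvec (rmat g *v x)"
  by (simp add: vec_eq_iff act_nth rvec_def rmat_def matrix_vector_mult_def)

text \<open>The signature enters through two real functionals on whose common kernel the form is
  negative definite, which bounds the positive directions by two. For both lattices they are the
  coordinate sums of the two hyperbolic planes, so the condition is read off the Gram
  matrix.\<close>

locale quad =
  fixes gr :: "'n::finite \<Rightarrow> 'n \<Rightarrow> int" and u1 u2 :: "real^'n \<Rightarrow> real"
  assumes sym: "gr i j = gr j i" and lin: "linear u1" "linear u2"
    and neg: "\<And>x. x \<noteq> 0 \<Longrightarrow> u1 x = 0 \<Longrightarrow> u2 x = 0 \<Longrightarrow> rbil gr x x < 0"
begin

lemma bil_sym: "bil gr x y = bil gr y x"
  unfolding bil_def by (subst sum.swap) (simp add: sym mult_ac)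

lemma rbil_sym: "rbil gr x y = rbil gr y x"
  unfolding rbil_def by (subst sum.swap) (simp add: sym mult_ac)

lemma ibil_sym: "ibil gr x y = ibil gr y x"
  unfolding ibil_def by (subst sum.swap) (simp add: sym mult_ac)

lemma bil_self: "bil gr w w = Complex (rbil gr (rev w) (rev w) - rbil gr (imv w) (imv w)) (2 * rbil gr (rev w) (imv w))"
proof -
  have "bil gr w w = bil gr (rvec (rev w) + \<i> *s rvec (imv w)) (rvec (rev w) + \<i> *s rvec (imv w))" using vec_parts[of w] by simp
  then show ?thesis using rbil_sym by (simp add: bil_lin bil_rvec complex_eq_iff algebra_simps)
qed

lemma bil_self_conjv: "bil gr w (conjv w) = of_real (rbil gr (rev w) (rev w) + rbil gr (imv w) (imv w))"
proof -
  have "bil gr w (conjv w) = bil gr (rvec (rev w) + \<i> *s rvec (imv w)) (rvec (rev w) - \<i> *s rvec (imv w))" using vec_parts[of w] conjv_parts[of w] by simp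
  then show ?thesis using rbil_sym[of "imv w" "rev w"] by (simp add: bil_lin bil_rvec complex_eq_iff algebra_simps)
qed

lemma cone_iff: "w \<in> cone gr \<longleftrightarrow> rbil gr (rev w) (rev w) = rbil gr (imv w) (imv w) \<and> rbil gr (rev w) (imv w) = 0 \<and> rbil gr (imv w) (imv w) > 0"
  unfolding cone_def by (auto simp: bil_self bil_self_conjv complex_eq_iff)

text \<open>Two linear conditions on three coefficients, in place of a dimension count.\<close>

lemma kernel_combination:
  obtains a b c where "(a,b,c) \<noteq> (0,0,0)" "a *\<^sub>R x + b *\<^sub>R y + c *\<^sub>R z = 0 \<or>
    rbil gr (a *\<^sub>R x + b *\<^sub>R y + c *\<^sub>R z) (a *\<^sub>R x + b *\<^sub>R y + c *\<^sub>R z) < 0"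
proof -
  obtain a b c where abc: "(a,b,c) \<noteq> (0,0,0)" "a * u1 x + b * u1 y + c * u1 z = 0" "a * u2 x + b * u2 y + c * u2 z = 0"
    using two_equations_three_unknowns[of "u1 x" "u1 y" "u1 z" "u2 x" "u2 y" "u2 z"] by metis
  then have "u1 (a *\<^sub>R x + b *\<^sub>R y + c *\<^sub>R z) = 0" "u2 (a *\<^sub>R x + b *\<^sub>R y + c *\<^sub>R z) = 0"
    using lin by (simp_all add: linear_add linear_scale)
  then show ?thesis using neg that abc(1) by blast
qed

text \<open>If \<open>x\<close> had norm \<ge> 0, every combination of \<open>x\<close>,
  \<open>X\<close>, \<open>Y\<close> would have norm \<ge> 0. The one from
  \<open>kernel_combination\<close> is then 0, its part in the positive plane vanishes, and
  \<open>x = 0\<close> remains.\<close>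

lemma orthogonal_to_plane:
  assumes X: "rbil gr X X = rbil gr Y Y" "rbil gr X Y = 0" "rbil gr Y Y > 0" and x: "rbil gr x X = 0" "rbil gr x Y = 0"
  shows "rbil gr x x \<le> 0" "rbil gr x x = 0 \<Longrightarrow> x = 0"
proof -
  have "x = 0" if nn: "rbil gr x x \<ge> 0"
  proof -
    obtain a b c where abc: "(a,b,c) \<noteq> (0,0,0)" "a *\<^sub>R x + b *\<^sub>R X + c *\<^sub>R Y = 0 \<or>
      rbil gr (a *\<^sub>R x + b *\<^sub>R X + c *\<^sub>R Y) (a *\<^sub>R x + b *\<^sub>R X + c *\<^sub>R Y) < 0" by (rule kernel_combination)
    let ?v = "a *\<^sub>R x + b *\<^sub>R X + c *\<^sub>R Y"
    have e: "rbil gr ?v ?v = a\<^sup>2 * rbil gr x x + (b\<^sup>2 + c\<^sup>2) * rbil gr Y Y"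
      using x X(2) by (simp add: rbil_lin rbil_sym[of X x] rbil_sym[of Y x] rbil_sym[of Y X] X(1) power2_eq_square algebra_simps)
    have ge: "a\<^sup>2 * rbil gr x x \<ge> 0" "(b\<^sup>2 + c\<^sup>2) * rbil gr Y Y \<ge> 0" using nn X(3) by auto
    then have v0: "?v = 0" using abc(2) e by linarith
    have "rbil gr ?v ?v = 0" unfolding v0 by (rule rbil_zero)
    then have "(b\<^sup>2 + c\<^sup>2) * rbil gr Y Y = 0" using e ge by linarith
    then have "b = 0" "c = 0" using X(3) by (auto simp: sum_power2_eq_zero_iff)
    then show ?thesis using v0 abc(1) by auto
  qed
  then show "rbil gr x x \<le> 0" "rbil gr x x = 0 \<Longrightarrow> x = 0" by (force simp: rbil_zero)+
qed

text \<open>The form on \<open>c\<^sup>\<bottom>\<close> has radical spanned by \<open>c\<close> and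
  is Lorentzian modulo it, so it is negative semidefinite on the complement of a positive
  \<open>y\<close>.\<close>

lemma hyperbolic_orthogonal:
  assumes c: "rbil gr c c = 0" "c \<noteq> 0" and y: "rbil gr y y > 0" "rbil gr y c = 0" and x: "rbil gr x c = 0" "rbil gr x y = 0"
  shows "rbil gr x x \<le> 0" "rbil gr x x = 0 \<Longrightarrow> \<exists>k. x = k *\<^sub>R c"
proof -
  have *: "\<exists>k. x = k *\<^sub>R c" if nn: "rbil gr x x \<ge> 0"
  proof -
    obtain p q r where abc: "(p,q,r) \<noteq> (0,0,0)" "p *\<^sub>R x + q *\<^sub>R y + r *\<^sub>R c = 0 \<or>
      rbil gr (p *\<^sub>R x + q *\<^sub>R y + r *\<^sub>R c) (p *\<^sub>R x + q *\<^sub>R y + r *\<^sub>R c) < 0" by (rule kernel_combination)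
    let ?v = "p *\<^sub>R x + q *\<^sub>R y + r *\<^sub>R c"
    have e: "rbil gr ?v ?v = p\<^sup>2 * rbil gr x x + q\<^sup>2 * rbil gr y y"
      using x y c by (simp add: rbil_lin rbil_sym[of y x] rbil_sym[of c x] rbil_sym[of c y] power2_eq_square algebra_simps)
    have ge: "p\<^sup>2 * rbil gr x x \<ge> 0" "q\<^sup>2 * rbil gr y y \<ge> 0" using nn y by auto
    then have v0: "?v = 0" using abc(2) e by linarith
    have "rbil gr ?v ?v = 0" unfolding v0 by (rule rbil_zero)
    then have "q\<^sup>2 * rbil gr y y = 0" using e ge by linarith
    then have "q = 0" using y by auto
    then have "p *\<^sub>R x = - (r *\<^sub>R c)" using v0 by (simp add: eq_neg_iff_add_eq_0)
    moreover have "p \<noteq> 0" using abc(1) \<open>q = 0\<close> v0 c(2) by auto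
    ultimately have "x = (- r / p) *\<^sub>R c" by (metis divide_inverse mult.commute mult_minus_right scaleR_left.minus scaleR_one scaleR_scaleR left_inverse)
    then show ?thesis by blast
  qed
  show "rbil gr x x = 0 \<Longrightarrow> \<exists>k. x = k *\<^sub>R c" using * by simp
  show "rbil gr x x \<le> 0"
  proof (rule ccontr)
    assume n: "\<not> rbil gr x x \<le> 0"
    then obtain k where "x = k *\<^sub>R c" using * by auto
    then show False using n c by (simp add: rbil_lin)
  qed
qed

lemma Dom_subset_cone: "Dom gr w0 \<subseteq> cone gr"
  unfolding Dom_def by (rule connected_component_subset)

lemma Dom_connected: "connected (Dom gr w0)"
  unfolding Dom_def by (rule connected_connected_component)

lemma Dom_maximal:
  assumes "connected S" "S \<subseteq> cone gr" "w \<in> S" "w \<in> Dom gr w0" shows "S \<subseteq> Dom gr w0"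
proof -
  have "Dom gr w0 = connected_component_set (cone gr) w"
    using assms(4) unfolding Dom_def by (metis connected_component_eq)
  then show ?thesis using connected_component_maximal[OF assms(3,1,2)] by simp
qed

lemma Dom_smult: assumes "w \<in> Dom gr w0" "t \<noteq> 0" shows "t *s w \<in> Dom gr w0"
proof -
  let ?S = "(\<lambda>t. t *s w) ` (- {0})"
  have "connected (- {0::complex})" by (rule connected_punctured_universe) simp
  then have "connected ?S" by (intro connected_continuous_image continuous_intros)
  moreover have "?S \<subseteq> cone gr"
  proof
    fix x assume "x \<in> ?S"
    then obtain s where s: "s \<noteq> 0" "x = s *s w" by auto
    have w: "bil gr w w = 0" "0 < Re (bil gr w (conjv w))" using assms(1) Dom_subset_cone unfolding cone_def by blast+
    have c: "s * cnj s = of_real ((norm s)\<^sup>2)" by (rule complex_norm_square[symmetric])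
    have "bil gr x (conjv x) = (s * cnj s) * bil gr w (conjv w)"
      unfolding s(2) conjv_lin(3) bil_smult(1)[of gr s w] bil_smult(2)[of gr w] by (rule mult.assoc[symmetric])
    then have "Re (bil gr x (conjv x)) = (norm s)\<^sup>2 * Re (bil gr w (conjv w))" unfolding c by simp
    moreover have "(norm s)\<^sup>2 > 0" using s(1) by simp
    ultimately have "Re (bil gr x (conjv x)) > 0" using w(2) by simp
    moreover have "bil gr x x = 0" unfolding s(2) bil_smult w(1) by simp
    ultimately show "x \<in> cone gr" by (simp add: cone_def)
  qed
  moreover have "w \<in> ?S" by (rule image_eqI[of _ _ 1]) auto
  ultimately show ?thesis using Dom_maximal[of ?S w w0] assms by blast
qed

lemma act_cone:
  assumes "\<And>x y. bil gr (act g x) (act g y) = bil gr x y" shows "w \<in> cone gr \<Longrightarrow> act g w \<in> cone gr"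
  unfolding cone_def using assms by (simp flip: act_conjv)

lemma act_Dom_subset:
  assumes "\<And>x y. bil gr (act g x) (act g y) = bil gr x y" "w \<in> Dom gr w0" "act g w \<in> Dom gr w0"
  shows "act g ` Dom gr w0 \<subseteq> Dom gr w0"
proof (rule Dom_maximal[of _ "act g w"])
  show "connected (act g ` Dom gr w0)" by (intro connected_continuous_image Dom_connected continuous_intros)
  show "act g ` Dom gr w0 \<subseteq> cone gr" using act_cone[OF assms(1)] Dom_subset_cone by blast
qed (use assms in auto)

text \<open>An isometry permutes the components of the cone, so carrying one point of the component
  into it is enough, for \<open>g\<close> and for its inverse.\<close>

lemma OplusI:
  assumes gh: "g ** h = mat 1" "h ** g = mat 1" and inv: "\<And>x y. bil gr (act g x) (act g y) = bil gr x y"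
    and w: "w \<in> Dom gr w0" "act g w \<in> Dom gr w0"
  shows "g \<in> Oplus gr w0"
proof -
  have hg: "act h (act g x) = x" "act g (act h x) = x" for x using gh by (simp_all flip: act_mult add: act_1)
  have "bil gr (act h x) (act h y) = bil gr x y" for x y using inv[of "act h x" "act h y"] by (simp add: hg)
  from act_Dom_subset[OF this w(2)] w(1) hg have "act h ` Dom gr w0 \<subseteq> Dom gr w0" by simp
  moreover have "act g ` Dom gr w0 \<subseteq> Dom gr w0" by (rule act_Dom_subset[OF inv w])
  ultimately have "act g ` Dom gr w0 = Dom gr w0" using hg by (metis image_subset_iff subsetI subset_antisym image_eqI)
  then show ?thesis using gh inv unfolding Oplus_def by blast
qed

text \<open>Move \<open>z\<close> along the isotropic vector \<open>conjv w\<close> until its norm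
  is 0. A real functional vanishing at \<open>w\<close> also vanishes at \<open>conjv w\<close>, so
  the motion preserves it. The retraction turns functions on the cone into functions on an open set,
  where division by linear forms is possible.\<close>

lemma holomorphic_retraction:
  assumes w0: "w \<in> Dom gr w0"
  shows "\<exists>U \<rho>. open U \<and> w \<in> U \<and> (\<forall>i. cholo_on (\<lambda>z. \<rho> z $ i) U) \<and> (\<forall>z\<in>U. \<rho> z \<in> Dom gr w0) \<and>
    (\<forall>z\<in>U. bil gr z z = 0 \<longrightarrow> \<rho> z = z) \<and>
    (\<forall>z\<in>U. \<forall>r. bil gr w (rvec r) = 0 \<longrightarrow> bil gr (\<rho> z) (rvec r) = bil gr z (rvec r))"
proof -
  have w: "bil gr w w = 0" "0 < Re (bil gr w (conjv w))" using w0 Dom_subset_cone unfolding cone_def by blast+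
  define c where "c = conjv w"
  have cc: "bil gr c c = 0" using w by (simp add: c_def bil_conjv)
  define \<rho> where "\<rho> = (\<lambda>z. z - (bil gr z z / (2 * bil gr z c)) *s c)"
  define U0 where "U0 = {z. bil gr z c \<noteq> 0}"
  have oU0: "open U0" unfolding U0_def by (intro open_Collect_neq continuous_intros)
  have c\<rho>: "continuous_on U0 \<rho>" unfolding \<rho>_def U0_def by (intro continuous_intros) auto
  define U1 where "U1 = U0 \<inter> (\<lambda>z. Re (bil gr (\<rho> z) (conjv (\<rho> z)))) -` {0<..}"
  have oU1: "open U1" unfolding U1_def by (intro continuous_open_preimage oU0 continuous_intros c\<rho> open_greaterThan)
  have \<rho>w: "\<rho> w = w" using w by (simp add: \<rho>_def)
  have wU1: "w \<in> U1" using w by (auto simp: U1_def U0_def \<rho>w c_def)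
  obtain e where e: "e > 0" "ball w e \<subseteq> U1" using oU1 wU1 open_contains_ball by blast
  show ?thesis
  proof (intro exI[of _ "ball w e"] exI[of _ \<rho>] conjI allI ballI impI)
    have nz: "bil gr z c \<noteq> 0" if "z \<in> ball w e" for z using that e unfolding U1_def U0_def by blast
    show "cholo_on (\<lambda>z. \<rho> z $ i) (ball w e)" for i
    proof -
      have "(\<lambda>z. \<rho> z $ i) = (\<lambda>z. z $ i + bil gr z z / bil gr z c * (- c $ i / 2))" by (auto simp: \<rho>_def)
      then show ?thesis by (simp only:) (intro cholo_on_add cholo_on_nth cholo_on_mult cholo_on_const cholo_on_divide cholo_on_bil nz)
    qed
    have "\<rho> ` ball w e \<subseteq> Dom gr w0"
    proof (rule Dom_maximal)
      show "connected (\<rho> ` ball w e)"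
        by (intro connected_continuous_image continuous_on_subset[OF c\<rho>] connected_ball) (use e in \<open>auto simp: U1_def\<close>)
      show "\<rho> ` ball w e \<subseteq> cone gr"
      proof
        fix x assume "x \<in> \<rho> ` ball w e"
        then obtain z where z: "z \<in> ball w e" "x = \<rho> z" by blast
        have "bil gr x x = 0" using nz[OF z(1)] cc unfolding z(2) \<rho>_def by (simp add: bil_lin bil_sym[of c z])
        moreover have "0 < Re (bil gr x (conjv x))" using e(2) z unfolding U1_def by auto
        ultimately show "x \<in> cone gr" by (simp add: cone_def)
      qed
      show "w \<in> \<rho> ` ball w e" using \<rho>w e by (metis centre_in_ball image_eqI)
    qed (rule w0)
    then show "\<rho> z \<in> Dom gr w0" if "z \<in> ball w e" for z using that by blast
    show "\<rho> z = z" if "bil gr z z = 0" for z using that by (simp add: \<rho>_def)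
    show "bil gr (\<rho> z) (rvec r) = bil gr z (rvec r)" if "bil gr w (rvec r) = 0" for z r
      using that by (simp add: \<rho>_def bil_lin c_def bil_conjv_rvec)
  qed (use e in auto)
qed

text \<open>Leave \<open>w\<close> in a real direction \<open>\<xi>\<close> that is orthogonal to
  \<open>x\<close> but to no \<open>r\<close>, and retract to the cone. Pairings that vanish at
  \<open>w\<close> are preserved by the retraction; the others stay nonzero by continuity.\<close>

lemma Dom_dense_avoiding:
  assumes w: "w \<in> Dom gr w0" "bil gr w (rvec x) = 0" and R: "finite R" "\<And>r. r \<in> R \<Longrightarrow> \<exists>\<xi>. rbil gr \<xi> x = 0 \<and> rbil gr \<xi> r \<noteq> 0"
  shows "w \<in> closure {z \<in> Dom gr w0. bil gr z (rvec x) = 0 \<and> (\<forall>r\<in>R. bil gr z (rvec r) \<noteq> 0)}" (is "w \<in> closure ?S")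
proof -
  obtain U \<rho> where "open U \<and> w \<in> U \<and> (\<forall>i. cholo_on (\<lambda>z. \<rho> z $ i) U) \<and> (\<forall>z\<in>U. \<rho> z \<in> Dom gr w0) \<and>
    (\<forall>z\<in>U. bil gr z z = 0 \<longrightarrow> \<rho> z = z) \<and>
    (\<forall>z\<in>U. \<forall>r. bil gr w (rvec r) = 0 \<longrightarrow> bil gr (\<rho> z) (rvec r) = bil gr z (rvec r))"
    using holomorphic_retraction[OF w(1)] by (elim exE)
  then have \<rho>: "open U" "w \<in> U" "\<And>i. cholo_on (\<lambda>z. \<rho> z $ i) U" "\<And>z. z \<in> U \<Longrightarrow> \<rho> z \<in> Dom gr w0"
    "\<And>z. z \<in> U \<Longrightarrow> bil gr z z = 0 \<Longrightarrow> \<rho> z = z"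
    "\<And>z r. z \<in> U \<Longrightarrow> bil gr w (rvec r) = 0 \<Longrightarrow> bil gr (\<rho> z) (rvec r) = bil gr z (rvec r)" by simp_all
  have ww: "bil gr w w = 0" using w(1) Dom_subset_cone unfolding cone_def by blast
  have "\<exists>\<xi>\<in>{\<xi>. rbil gr \<xi> x = 0}. \<forall>r\<in>R. rbil gr \<xi> r \<noteq> 0"
    by (rule avoid_finitely_many_kernels[OF R(1)]) (use R(2) in \<open>auto simp: rbil_lin linear_rbil\<close>)
  then obtain \<xi> where \<xi>: "rbil gr \<xi> x = 0" "\<And>r. r \<in> R \<Longrightarrow> rbil gr \<xi> r \<noteq> 0" by blast
  define p where "p = (\<lambda>s::real. w + of_real s *s rvec \<xi>)"
  have pc: "continuous_on UNIV p" unfolding p_def by (intro continuous_intros)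
  have p0: "p 0 = w" by (simp add: p_def)
  have pU: "\<forall>\<^sub>F s in at 0. p s \<in> U"
  proof -
    have "open (p -` U)" using open_vimage[OF \<rho>(1) pc] .
    moreover have "0 \<in> p -` U" using \<rho>(2) p0 by simp
    ultimately show ?thesis unfolding eventually_at_topological by blast
  qed
  have c\<rho>: "continuous_on U \<rho>"
  proof -
    have "continuous_on U (\<lambda>z. \<chi> i. \<rho> z $ i)" by (intro continuous_on_vec_lambda cholo_on_continuous \<rho>(3))
    then show ?thesis by simp
  qed
  have lim: "((\<lambda>s. \<rho> (p s)) \<longlongrightarrow> w) (at 0)"
  proof -
    have "isCont \<rho> (p 0)" using c\<rho> \<rho>(1,2) p0 by (simp add: continuous_on_eq_continuous_at)
    moreover have "isCont p 0" using pc by (simp add: continuous_on_eq_continuous_at)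
    ultimately have "isCont (\<lambda>s. \<rho> (p s)) 0" by (rule isCont_o2[rotated])
    then show ?thesis using \<rho>(5)[OF \<rho>(2) ww] by (simp add: isCont_def p0)
  qed
  have "\<forall>\<^sub>F s in at 0. bil gr (\<rho> (p s)) (rvec r) \<noteq> 0" if r: "r \<in> R" for r
  proof (cases "bil gr w (rvec r) = 0")
    case True
    have "\<forall>\<^sub>F s::real in at 0. s \<noteq> 0" by (simp add: eventually_at_filter)
    with pU show ?thesis
    proof eventually_elim
      case (elim s)
      have "bil gr (\<rho> (p s)) (rvec r) = bil gr (p s) (rvec r)" by (rule \<rho>(6)[OF elim(1) True])
      also have "\<dots> = of_real (s * rbil gr \<xi> r)" by (simp add: p_def bil_lin True bil_rvec)
      finally show ?case using \<xi>(2)[OF r] elim(2) by simp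
    qed
  next
    case False
    have "((\<lambda>s. bil gr (\<rho> (p s)) (rvec r)) \<longlongrightarrow> bil gr w (rvec r)) (at 0)"
    proof (rule continuous_on_tendsto_compose[OF _ lim])
      show "continuous_on UNIV (\<lambda>z. bil gr z (rvec r))" by (intro continuous_intros)
    qed auto
    then show ?thesis using False by (rule tendsto_imp_eventually_ne)
  qed
  then have "\<forall>\<^sub>F s in at 0. \<forall>r\<in>R. bil gr (\<rho> (p s)) (rvec r) \<noteq> 0" using R(1) by (simp add: eventually_ball_finite_distrib)
  with pU have ev: "\<forall>\<^sub>F s in at 0. \<rho> (p s) \<in> closure ?S"
  proof eventually_elim
    case (elim s)
    have "bil gr (\<rho> (p s)) (rvec x) = bil gr (p s) (rvec x)" by (rule \<rho>(6)[OF elim(1) w(2)])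
    also have "\<dots> = 0" by (simp add: p_def bil_lin w(2) bil_rvec \<xi>(1))
    finally have "\<rho> (p s) \<in> ?S" using \<rho>(4)[OF elim(1)] elim(2) by simp
    then show ?case by (rule subsetD[OF closure_subset])
  qed
  show ?thesis by (rule Lim_in_closed_set[OF closed_closure ev _ lim]) simp
qed

end

section \<open>The two lattices and the embedding\<close>

text \<open>In the Leibniz formula only permutations fixing every index outside
  \<open>range j\<close> contribute.\<close>

lemma det_identity_rows:
  fixes M :: "'a::comm_ring_1^'n::finite^'n" and j :: "'m::finite \<Rightarrow> 'n"
  assumes j: "inj j" and M: "\<And>i i'. i \<notin> range j \<Longrightarrow> M$i$i' = (if i = i' then 1 else 0)"
  shows "det M = det (\<chi> a b. M$(j a)$(j b))"
proof -
  have "det M = (\<Sum>p\<in>{p. p permutes range j}. of_int (sign p) * (\<Prod>i\<in>UNIV. M$i$p i))"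
    unfolding det_def
  proof (rule sum.mono_neutral_right)
    show "{p. p permutes range j} \<subseteq> {p. p permutes (UNIV::'n set)}" using permutes_subset by blast
    show "\<forall>p\<in>{p. p permutes UNIV} - {p. p permutes range j}. of_int (sign p) * (\<Prod>i\<in>UNIV. M$i$p i) = 0"
    proof
      fix p assume p: "p \<in> {p. p permutes (UNIV::'n set)} - {p. p permutes range j}"
      then have "\<not> (\<forall>i. i \<notin> range j \<longrightarrow> p i = i)" by (auto simp: permutes_def)
      then obtain i where "i \<notin> range j" "p i \<noteq> i" by blast
      then have "M$i$p i = 0" using M by simp
      then have "(\<Prod>i\<in>UNIV. M$i$p i) = 0" by (intro prod_zero) auto
      then show "of_int (sign p) * (\<Prod>i\<in>UNIV. M$i$p i) = 0" by simp
    qed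
  qed (simp add: finite_permutations)
  also have "\<dots> = (\<Sum>p\<in>{p. p permutes (UNIV::'m set)}. of_int (sign (map_permutation UNIV j p)) * (\<Prod>i\<in>UNIV. M$i$map_permutation UNIV j p i))"
  proof (rule sum.reindex_bij_betw[symmetric])
    show "bij_betw (map_permutation UNIV j) {p. p permutes UNIV} {p. p permutes range j}"
      
    proof -
      have "map_permutation UNIV j = (\<lambda>\<pi> x. if x \<in> range j then j (\<pi> (inv_into UNIV j x)) else x)"
        by (auto simp: map_permutation_def restrict_id_def fun_eq_iff)
      then show ?thesis using bij_betw_permutations[of j UNIV "range j"] j by (simp add: bij_betw_def)
    qed
  qed
  also have "\<dots> = det (\<chi> a b. M$(j a)$(j b))"
    unfolding det_def
  proof (rule sum.cong)
    fix p assume p: "p \<in> {p. p permutes (UNIV::'m set)}"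
    have "(\<Prod>i\<in>UNIV. M$i$map_permutation UNIV j p i) = (\<Prod>i\<in>range j. M$i$map_permutation UNIV j p i)"
      by (rule prod.mono_neutral_right) (auto simp: map_permutation_def M)
    also have "\<dots> = (\<Prod>a\<in>UNIV. M$(j a)$(j (p a)))"
      by (subst prod.reindex[OF j]) (simp add: map_permutation_apply[OF j])
    finally show "of_int (sign (map_permutation UNIV j p)) * (\<Prod>i\<in>UNIV. M$i$map_permutation UNIV j p i) =
        of_int (sign p) * (\<Prod>a\<in>UNIV. (\<chi> a b. M$(j a)$(j b))$a$p a)"
      using sign_map_permutation[OF j, of p] p by simp
  qed simp
  finally show ?thesis .
qed

text \<open>Sylvester's identity det(1 + BC) = det(1 + CB). In the basis where
  \<open>B (axis a 1)\<close> replaces the basis vector of index \<open>j a\<close>, the map 1 + BC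
  has identity rows outside \<open>range j\<close> and the block 1 + CB inside.\<close>

lemma det_one_plus:
  fixes A :: "real^'n::finite^'n" and B :: "real^'m::finite \<Rightarrow> real^'n" and C :: "real^'n \<Rightarrow> real^'m"
  assumes j: "inj j" and lin: "linear B" "linear C"
    and B: "\<And>a b. a \<noteq> b \<Longrightarrow> B (axis a 1) $ j b = 0" "\<And>a. B (axis a 1) $ j a \<noteq> 0"
    and A: "\<And>x. A *v x = x + B (C x)"
  shows "det A = det (matrix (\<lambda>v. v + C (B v)))"
proof -
  define Q where "Q = (\<lambda>x::real^'n. (\<chi> i. if i \<in> range j then 0 else x$i) + B (\<chi> a. x$(j a)))"
  define J where "J = (\<lambda>v::real^'m. \<chi> i. \<Sum>a\<in>UNIV. if j a = i then v$a else 0)"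
  have Jj: "J v $ j b = v $ b" for v b
  proof -
    have "J v $ j b = (\<Sum>a\<in>UNIV. if a = b then v$a else 0)" unfolding J_def using j by (simp add: inj_eq)
    then show ?thesis by simp
  qed
  have Jn: "J v $ i = 0" if "i \<notin> range j" for v i
    unfolding J_def using that by (auto intro!: sum.neutral)
  have QJ: "Q (J v) = B v" for v
  proof -
    have "(\<chi> i. if i \<in> range j then 0 else J v $ i) = 0" using Jn by (auto simp: vec_eq_iff)
    moreover have "(\<chi> a. J v $ j a) = v" by (simp add: vec_eq_iff Jj)
    ultimately show ?thesis by (simp add: Q_def)
  qed
  have linQ: "linear Q"
  proof (rule linearI)
    fix x y :: "real^'n" and r :: real
    have P: "(\<chi> a. (x + y) $ j a) = (\<chi> a. x $ j a) + (\<chi> a. y $ j a)" "(\<chi> a. (r *\<^sub>R x) $ j a) = r *\<^sub>R (\<chi> a. x $ j a)"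
      by (simp_all add: vec_eq_iff)
    have Z: "(\<chi> i. if i \<in> range j then 0 else (x + y) $ i) = (\<chi> i. if i \<in> range j then 0 else x $ i) + (\<chi> i. if i \<in> range j then 0 else y $ i)"
      "(\<chi> i. if i \<in> range j then 0 else (r *\<^sub>R x) $ i) = r *\<^sub>R (\<chi> i. if i \<in> range j then 0 else x $ i)"
      by (simp_all add: vec_eq_iff)
    show "Q (x + y) = Q x + Q y" unfolding Q_def P Z linear_add[OF lin(1)] by (simp only: add.assoc add.left_commute)
    show "Q (r *\<^sub>R x) = r *\<^sub>R Q x" unfolding Q_def P Z linear_scale[OF lin(1)] by (simp only: scaleR_add_right)
  qed
  have Qj: "Q (axis (j a) 1) = B (axis a 1)" for a
  proof -
    have P: "(\<chi> b. axis (j a) 1 $ j b) = (axis a 1 :: real^'m)" using j by (auto simp: vec_eq_iff axis_def inj_eq)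
    have Z: "(\<chi> i. if i \<in> range j then 0 else axis (j a) 1 $ i) = (0::real^'n)" by (auto simp: vec_eq_iff axis_def)
    show ?thesis unfolding Q_def P Z by simp
  qed
  have linJ: "linear J"
    by (rule linearI) (auto simp: J_def vec_eq_iff sum.distrib[symmetric] sum_distrib_left intro!: sum.cong)
  define M where "M = matrix (\<lambda>x. x + J (C (Q x)))"
  have linM: "linear (\<lambda>x. x + J (C (Q x)))"
    using lin(2) linQ linJ by (intro linearI) (simp_all add: linear_add linear_scale algebra_simps)
  have "A ** matrix Q = matrix Q ** M"
    unfolding matrix_eq
  proof
    fix x
    have "(A ** matrix Q) *v x = A *v Q x" by (simp add: matrix_vector_mul_assoc[symmetric] matrix_works linQ)
    also have "\<dots> = Q x + Q (J (C (Q x)))" by (simp add: A QJ)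
    also have "\<dots> = Q (x + J (C (Q x)))" using linQ by (simp add: linear_add)
    also have "\<dots> = (matrix Q ** M) *v x" by (simp add: matrix_vector_mul_assoc[symmetric] matrix_works linQ linM M_def)
    finally show "(A ** matrix Q) *v x = (matrix Q ** M) *v x" .
  qed
  then have "det A * det (matrix Q) = det (matrix Q) * det M" by (metis det_mul)
  moreover have "det (matrix Q) \<noteq> 0"
  proof -
    have Qa: "Q (axis i 1) = axis i 1" if "i \<notin> range j" for i
    proof -
      have P: "(\<chi> a. axis i 1 $ j a) = (0 :: real^'m)" using that by (auto simp: vec_eq_iff axis_def)
      have Z: "(\<chi> i'. if i' \<in> range j then 0 else axis i 1 $ i') = (axis i 1 :: real^'n)" using that by (auto simp: vec_eq_iff axis_def)
      show ?thesis unfolding Q_def P Z linear_0[OF lin(1)] by simp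
    qed
    have "det (transpose (matrix Q)) = det (\<chi> a b. transpose (matrix Q)$(j a)$(j b))"
    proof (rule det_identity_rows[OF j])
      fix i i' assume i: "i \<notin> range j"
      have "transpose (matrix Q) $ i $ i' = Q (axis i 1) $ i'" by (simp only: transpose_def matrix_def vec_lambda_beta)
      then show "transpose (matrix Q) $ i $ i' = (if i = i' then 1 else 0)" unfolding Qa[OF i] by (simp add: axis_def eq_commute)
    qed
    also have "(\<chi> a b. transpose (matrix Q)$(j a)$(j b)) = (\<chi> a b. B (axis a 1) $ j b)"
      by (simp only: transpose_def matrix_def Qj vec_lambda_beta)
    also have "det \<dots> = (\<Prod>a\<in>UNIV. B (axis a 1) $ j a)"
      by (subst det_diagonal) (use B in auto)
    finally show ?thesis using B(2) by (simp add: det_transpose)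
  qed
  ultimately have "det A = det M" by simp
  also have "\<dots> = det (\<chi> a b. M$(j a)$(j b))"
  proof (rule det_identity_rows[OF j])
    fix i i' assume i: "i \<notin> range j"
    have "M $ i $ i' = axis i' 1 $ i + J (C (Q (axis i' 1))) $ i" unfolding M_def matrix_def by simp
    then show "M $ i $ i' = (if i = i' then 1 else 0)" by (simp add: Jn[OF i] axis_def)
  qed
  also have "(\<chi> a b. M$(j a)$(j b)) = matrix (\<lambda>v. v + C (B v))"
  proof -
    have "axis (j b) (1::real) $ j a = axis b 1 $ a" for a b using j by (auto simp: axis_def inj_eq)
    then have "M $ j a $ j b = axis b 1 $ a + C (B (axis b 1)) $ a" for a b by (simp add: M_def matrix_def Jj Qj)
    then show ?thesis by (simp add: matrix_def vec_eq_iff)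
  qed
  finally show ?thesis .
qed

lemma det_rank_one:
  fixes A :: "real^'n::finite^'n"
  assumes A: "\<And>x. A *v x = x + \<phi> x *\<^sub>R y" and lin: "linear \<phi>" and y: "y \<noteq> 0"
  shows "det A = 1 + \<phi> y"
proof -
  obtain k where k: "y $ k \<noteq> 0" using y by (auto simp: vec_eq_iff)
  have "det A = det (matrix (\<lambda>v::real^1. v + (\<chi> a. \<phi> (v$1 *\<^sub>R y))))"
  proof (rule det_one_plus[of "\<lambda>_. k"])
    show "inj (\<lambda>_::1. k)" by (simp add: inj_def)
    show "linear (\<lambda>v::real^1. v$1 *\<^sub>R y)" by (rule linearI) (simp_all add: algebra_simps)
    show "linear (\<lambda>x. \<chi> a. \<phi> x)" using lin by (intro linearI) (simp_all add: vec_eq_iff linear_add linear_scale)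
    show "A *v x = x + (\<chi> a. \<phi> x) $ 1 *\<^sub>R y" for x by (simp add: A)
  qed (use k in \<open>auto simp: axis_def num1_eqI\<close>)
  also have "\<dots> = 1 + \<phi> y" by (simp add: det_1 matrix_def)
  finally show ?thesis .
qed

lemma det_rmat: "det (rmat g) = of_int (det g)"
  by (simp add: det_def rmat_def)

section \<open>Coordinates and Gram matrices of the two lattices\<close>

lemma ix28_of_nat: "k < 28 \<Longrightarrow> ix28 (of_nat k) = k"
  unfolding ix28_def bit0.of_nat_eq by (subst bit0.Rep_Abs_mod) simp

lemma ix28_less: "ix28 i < 28"
proof -
  have "0 \<le> Rep_bit0 i \<and> Rep_bit0 i < 28" using Rep_bit0[of i] by simp
  then show ?thesis unfolding ix28_def by linarith
qed

lemma of_nat_ix28: "of_nat (ix28 i) = i"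
proof -
  have "int (ix28 i) = Rep_bit0 i" using Rep_bit0[of i] by (simp add: ix28_def)
  then show ?thesis unfolding bit0.of_nat_eq using bit0.Rep_mod[of i] by (simp add: Rep_bit0_inverse)
qed

lemma ix21_of_nat: "k < 21 \<Longrightarrow> ix21 (of_nat k) = k"
  unfolding ix21_def bit1.of_nat_eq by (subst bit1.Rep_Abs_mod) simp

lemma ix21_less: "ix21 i < 21"
proof -
  have "0 \<le> Rep_bit1 i \<and> Rep_bit1 i < 21" using Rep_bit1[of i] by simp
  then show ?thesis unfolding ix21_def by linarith
qed

lemma of_nat_ix21: "of_nat (ix21 i) = i"
proof -
  have "int (ix21 i) = Rep_bit1 i" using Rep_bit1[of i] by (simp add: ix21_def)
  then show ?thesis unfolding bit1.of_nat_eq using bit1.Rep_mod[of i] by (simp add: Rep_bit1_inverse)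
qed

lemma sum28: "(\<Sum>i\<in>(UNIV::28 set). f i) = (\<Sum>k<28. f (of_nat k))"
  by (rule sum.reindex_bij_witness[of _ of_nat ix28]) (auto simp: ix28_of_nat of_nat_ix28 ix28_less)

lemma sum21: "(\<Sum>i\<in>(UNIV::21 set). f i) = (\<Sum>k<21. f (of_nat k))"
  by (rule sum.reindex_bij_witness[of _ of_nat ix21]) (auto simp: ix21_of_nat of_nat_ix21 ix21_less)

lemma vec28_eq_iff: "x = y \<longleftrightarrow> (\<forall>k<28. x $ of_nat k = (y::'a^28) $ of_nat k)"
  unfolding vec_eq_iff by (metis of_nat_ix28 ix28_less)

lemma vec21_eq_iff: "x = y \<longleftrightarrow> (\<forall>k<21. x $ of_nat k = (y::'a^21) $ of_nat k)"
  unfolding vec_eq_iff by (metis of_nat_ix21 ix21_less)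

lemma sum_blocks: "(\<Sum>a<4 + 8 * m. f a) = (\<Sum>a<4. f a) + (\<Sum>i<m. \<Sum>k<8. f (4 + 8 * i + k))" for f :: "nat \<Rightarrow> 'a::comm_monoid_add"
proof (induction m)
  case (Suc m)
  have "(\<Sum>a<4 + 8 * Suc m. f a) = (\<Sum>a<4 + 8 * m. f a) + (\<Sum>a\<in>{4 + 8 * m..<4 + 8 * m + 8}. f a)"
    by (subst sum.union_disjoint[symmetric]) (auto intro!: sum.cong)
  also have "(\<Sum>a\<in>{4 + 8 * m..<4 + 8 * m + 8}. f a) = (\<Sum>k<8. f (4 + 8 * m + k))"
    by (rule sum.reindex_bij_witness[of _ "\<lambda>k. 4 + 8 * m + k" "\<lambda>a. a - (4 + 8 * m)"]) auto
  finally show ?case using Suc by (simp add: add.assoc)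
qed simp

definition bform :: "nat \<Rightarrow> (nat \<Rightarrow> 'a::comm_ring_1) \<Rightarrow> (nat \<Rightarrow> 'a) \<Rightarrow> 'a" where
  "bform m X Y = X 0 * Y 1 + X 1 * Y 0 + X 2 * Y 3 + X 3 * Y 2 + (\<Sum>i<m. e8form (\<lambda>k. X (4 + 8 * i + k)) (\<lambda>k. Y (4 + 8 * i + k)))"

lemma lt4: "{..<4::nat} = {0,1,2,3}"
  by auto

lemma blockgram_sum: "(\<Sum>a<4 + 8 * m. \<Sum>b<4 + 8 * m. X a * of_int (blockgram a b) * Y b) = bform m X (Y :: nat \<Rightarrow> 'a::comm_ring_1)"
proof -
  have b1: "(\<Sum>b<4 + 8 * m. X a * of_int (blockgram a b) * Y b) = X a * (if a = 0 then Y 1 else if a = 1 then Y 0 else if a = 2 then Y 3 else Y 2)"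
    if "a < 4" for a
  proof -
    have "(\<Sum>b<4. X a * of_int (blockgram a b) * Y b) = X a * (if a = 0 then Y 1 else if a = 1 then Y 0 else if a = 2 then Y 3 else Y 2)"
    proof -
      have "a \<in> {0,1,2,3}" using that lt4 by blast
      then show ?thesis unfolding lt4 by (elim insertE emptyE) (simp_all add: blockgram_def doubleton_eq_iff)
    qed
    moreover have "blockgram a (4 + 8 * i + k) = 0" for i k
      using that by (auto simp: blockgram_def doubleton_eq_iff)
    ultimately show ?thesis unfolding sum_blocks by simp
  qed
  have b2: "(\<Sum>b<4 + 8 * m. X (4 + 8 * i + k) * of_int (blockgram (4 + 8 * i + k) b) * Y b) =
     (\<Sum>k'<8. X (4 + 8 * i + k) * of_int (e8m k k') * Y (4 + 8 * i + k'))" if "i < m" "k < 8" for i k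
  proof -
    have z: "blockgram (4 + 8 * i + k) b = 0" if "b < 4" for b
      using that by (auto simp: blockgram_def doubleton_eq_iff)
    have nz: "blockgram (4 + 8 * i + k) (4 + 8 * i' + k') = (if i' = i then e8m k k' else 0)" if "k' < 8" for i' k'
      using that \<open>k < 8\<close> by (simp add: blockgram_def)
    have "(\<Sum>b<4 + 8 * m. X (4 + 8 * i + k) * of_int (blockgram (4 + 8 * i + k) b) * Y b) =
      (\<Sum>i'<m. if i' = i then (\<Sum>k'<8. X (4 + 8 * i + k) * of_int (e8m k k') * Y (4 + 8 * i + k')) else 0)"
    proof -
      have "(\<Sum>b<4. X (4 + 8 * i + k) * of_int (blockgram (4 + 8 * i + k) b) * Y b) = 0"
        by (rule sum.neutral) (simp add: z)
      moreover have "(\<Sum>k'<8. X (4 + 8 * i + k) * of_int (blockgram (4 + 8 * i + k) (4 + 8 * i' + k')) * Y (4 + 8 * i' + k')) =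
         (if i' = i then (\<Sum>k'<8. X (4 + 8 * i + k) * of_int (e8m k k') * Y (4 + 8 * i + k')) else 0)" for i'
      proof (cases "i' = i")
        case True
        have "X (4 + 8 * i + k) * of_int (blockgram (4 + 8 * i + k) (4 + 8 * i + k')) * Y (4 + 8 * i + k') =
          X (4 + 8 * i + k) * of_int (e8m k k') * Y (4 + 8 * i + k')" if "k' \<in> {..<8}" for k'
          using nz[of k' i] that by (simp only: lessThan_iff if_True refl)
        then show ?thesis unfolding True if_P[OF refl] by (rule sum.cong[OF refl])
      next
        case False
        then have "X (4 + 8 * i + k) * of_int (blockgram (4 + 8 * i + k) (4 + 8 * i' + k')) * Y (4 + 8 * i' + k') = 0" if "k' \<in> {..<8}" for k'
          using nz[of k' i'] that by (simp only: lessThan_iff if_False of_int_0 mult_zero_right mult_zero_left)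
        then show ?thesis unfolding if_not_P[OF False] by (intro sum.neutral ballI)
      qed
      ultimately show ?thesis unfolding sum_blocks by (simp only: add_0_left)
    qed
    then show ?thesis using that by simp
  qed
  have "(\<Sum>a<4 + 8 * m. \<Sum>b<4 + 8 * m. X a * of_int (blockgram a b) * Y b) =
     (\<Sum>a<4. X a * (if a = 0 then Y 1 else if a = 1 then Y 0 else if a = 2 then Y 3 else Y 2)) +
     (\<Sum>i<m. \<Sum>k<8. \<Sum>k'<8. X (4 + 8 * i + k) * of_int (e8m k k') * Y (4 + 8 * i + k'))"
    by (subst sum_blocks[of _ m]) (intro arg_cong2[where f="(+)"] sum.cong refl b1 b2; simp)
  also have "(\<Sum>i<m. \<Sum>k<8. \<Sum>k'<8. X (4 + 8 * i + k) * of_int (e8m k k') * Y (4 + 8 * i + k')) =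
     (\<Sum>i<m. e8form (\<lambda>k. X (4 + 8 * i + k)) (\<lambda>k. Y (4 + 8 * i + k)))"
    by (rule sum.cong[OF refl]) (rule e8form_sum)
  finally show ?thesis unfolding bform_def lt4 by (simp add: algebra_simps)
qed

lemma g28_sum: "(\<Sum>i\<in>UNIV. \<Sum>j\<in>UNIV. x$i * of_int (g28 i j) * y$j) = bform 3 (\<lambda>k. x $ of_nat k) (\<lambda>k. (y::'a::comm_ring_1^28) $ of_nat k)"
proof -
  have "(\<Sum>i\<in>UNIV. \<Sum>j\<in>UNIV. x$i * of_int (g28 i j) * y$j) = (\<Sum>a<4 + 8 * 3. \<Sum>b<4 + 8 * 3. x $ of_nat a * of_int (blockgram a b) * y $ of_nat b)"
    unfolding sum28 by (intro sum.cong refl) (simp_all add: g28_def ix28_of_nat)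
  then show ?thesis by (simp only: blockgram_sum)
qed

lemma g21_sum: "(\<Sum>i\<in>UNIV. \<Sum>j\<in>UNIV. x$i * of_int (g21 d i j) * y$j) =
   bform 2 (\<lambda>k. x $ of_nat k) (\<lambda>k. (y::'a::comm_ring_1^21) $ of_nat k) - 2 * of_nat d * x $ 20 * y $ 20"
proof -
  have s: "(\<Sum>k<21. f k) = (\<Sum>k<4 + 8 * 2. f k) + f 20" for f :: "nat \<Rightarrow> 'a"
    using sum.lessThan_Suc[of f 20] by simp
  have "(\<Sum>i\<in>UNIV. \<Sum>j\<in>UNIV. x$i * of_int (g21 d i j) * y$j) =
    (\<Sum>a<21. \<Sum>b<21. x $ of_nat a * of_int (if a < 20 \<and> b < 20 then blockgram a b else if a = 20 \<and> b = 20 then - 2 * int d else 0) * y $ of_nat b)"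
    unfolding sum21 by (intro sum.cong refl) (use ix21_of_nat[of 20] in \<open>simp add: g21_def ix21_of_nat\<close>)
  also have "\<dots> = (\<Sum>a<4 + 8 * 2. \<Sum>b<4 + 8 * 2. x $ of_nat a * of_int (blockgram a b) * y $ of_nat b) - 2 * of_nat d * x $ 20 * y $ 20"
    unfolding s by simp
  finally show ?thesis by (simp only: blockgram_sum)
qed

lemma bil28: "bil g28 x y = bform 3 (\<lambda>k. x $ of_nat k) (\<lambda>k. y $ of_nat k)"
  unfolding bil_def by (rule g28_sum)
lemma rbil28: "rbil g28 x y = bform 3 (\<lambda>k. x $ of_nat k) (\<lambda>k. y $ of_nat k)"
  unfolding rbil_def by (rule g28_sum)
lemma ibil28: "ibil g28 x y = bform 3 (\<lambda>k. x $ of_nat k) (\<lambda>k. y $ of_nat k)"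
  unfolding ibil_def using g28_sum[of x y] by simp
lemma bil21: "bil (g21 d) x y = bform 2 (\<lambda>k. x $ of_nat k) (\<lambda>k. y $ of_nat k) - 2 * of_nat d * x $ 20 * y $ 20"
  unfolding bil_def by (rule g21_sum)
lemma rbil21: "rbil (g21 d) x y = bform 2 (\<lambda>k. x $ of_nat k) (\<lambda>k. y $ of_nat k) - 2 * of_nat d * x $ 20 * y $ 20"
  unfolding rbil_def by (rule g21_sum)
lemma ibil21: "ibil (g21 d) x y = bform 2 (\<lambda>k. x $ of_nat k) (\<lambda>k. y $ of_nat k) - 2 * of_nat d * x $ 20 * y $ 20"
  unfolding ibil_def using g21_sum[of x d y] by simp

text \<open>Under the two linear conditions each hyperbolic plane contributes minus twice a square,
  and the copies of E8(-1) are negative definite.\<close>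

lemma bform_neg:
  fixes X :: "nat \<Rightarrow> real" assumes "X 0 + X 1 = 0" "X 2 + X 3 = 0"
  shows "bform m X X \<le> 0" "bform m X X = 0 \<Longrightarrow> k < 4 + 8 * m \<Longrightarrow> X k = 0"
proof -
  have x: "X 1 = - X 0" "X 3 = - X 2" using assms by auto
  have e: "bform m X X = - 2 * (X 0)\<^sup>2 - 2 * (X 2)\<^sup>2 + (\<Sum>i<m. e8form (\<lambda>k. X (4 + 8 * i + k)) (\<lambda>k. X (4 + 8 * i + k)))"
    unfolding bform_def x by (simp add: power2_eq_square)
  have s: "(\<Sum>i<m. e8form (\<lambda>k. X (4 + 8 * i + k)) (\<lambda>k. X (4 + 8 * i + k))) \<le> 0" by (intro sum_nonpos e8form_nonpos)
  have sq: "(X 0)\<^sup>2 \<ge> 0" "(X 2)\<^sup>2 \<ge> 0" by auto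
  show "bform m X X \<le> 0" using e s sq by linarith
  assume z: "bform m X X = 0" and k: "k < 4 + 8 * m"
  have "(X 0)\<^sup>2 = 0" "(X 2)\<^sup>2 = 0" "(\<Sum>i<m. e8form (\<lambda>k. X (4 + 8 * i + k)) (\<lambda>k. X (4 + 8 * i + k))) = 0" using z e s sq by linarith+
  then have X: "X 0 = 0" "X 1 = 0" "X 2 = 0" "X 3 = 0" and "\<forall>i<m. e8form (\<lambda>k. X (4 + 8 * i + k)) (\<lambda>k. X (4 + 8 * i + k)) = 0"
    using x sum_nonneg_eq_0_iff[of "{..<m}" "\<lambda>i. - e8form (\<lambda>k. X (4 + 8 * i + k)) (\<lambda>k. X (4 + 8 * i + k))"] e8form_nonpos by (auto simp: sum_negf)
  then have E: "X (4 + 8 * i + k) = 0" if "i < m" "k < 8" for i k using e8form_eq_0[of "\<lambda>k. X (4 + 8 * i + k)"] that by blast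
  show "X k = 0"
  proof (cases "k < 4")
    case True
    then have "k \<in> {0,1,2,3}" using lt4 by blast
    then show ?thesis using X by auto
  next
    case False
    have "k = 4 + 8 * ((k - 4) div 8) + (k - 4) mod 8" using False by simp
    then show ?thesis using E[of "(k-4) div 8" "(k-4) mod 8"] k False by (metis add.commute div_less_iff_less_mult less_diff_conv2 mod_less_divisor mult.commute not_less zero_less_numeral)
  qed
qed

lemma e8form_sym: "e8form X Y = e8form Y X"
  unfolding e8form_def by (simp add: algebra_simps)

lemma blockgram_sym: "blockgram a b = blockgram b a"
proof -
  have "e8m a b = e8m b a" for a b by (simp add: e8m_def e8edge_def insert_commute)
  then show ?thesis by (auto simp: blockgram_def insert_commute)
qed

definition "p28 (x::real^28) = x $ 0 + x $ 1"
definition "q28 (x::real^28) = x $ 2 + x $ 3"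
definition "p21 (x::real^21) = x $ 0 + x $ 1"
definition "q21 (x::real^21) = x $ 2 + x $ 3"

lemma quad28: "quad g28 p28 q28"
proof (rule quad.intro)
  show "g28 i j = g28 j i" for i j by (simp add: g28_def blockgram_sym)
  show "linear p28" by (rule linearI) (simp_all add: p28_def algebra_simps)
  show "linear q28" by (rule linearI) (simp_all add: q28_def algebra_simps)
  show "rbil g28 x x < 0" if "x \<noteq> 0" "p28 x = 0" "q28 x = 0" for x
  proof -
    let ?X = "\<lambda>k. x $ of_nat k"
    have X: "?X 0 + ?X 1 = 0" "?X 2 + ?X 3 = 0" using that by (simp_all add: p28_def q28_def)
    have "rbil g28 x x \<noteq> 0"
    proof
      assume "rbil g28 x x = 0"
      then have "?X k = 0" if "k < 28" for k using bform_neg(2)[of ?X 3 k, OF X] that by (simp add: rbil28)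
      then show False using \<open>x \<noteq> 0\<close> by (simp add: vec28_eq_iff)
    qed
    moreover have "rbil g28 x x \<le> 0" unfolding rbil28 by (rule bform_neg(1)[of ?X, OF X])
    ultimately show ?thesis by simp
  qed
qed

interpretation Q28: quad g28 p28 q28 by (rule quad28)

lemma quad21: assumes "d \<ge> 1" shows "quad (g21 d) p21 q21"
proof (rule quad.intro)
  show "g21 d i j = g21 d j i" for i j by (simp add: g21_def blockgram_sym conj_commute)
  show "linear p21" by (rule linearI) (simp_all add: p21_def algebra_simps)
  show "linear q21" by (rule linearI) (simp_all add: q21_def algebra_simps)
  show "rbil (g21 d) x x < 0" if "x \<noteq> 0" "p21 x = 0" "q21 x = 0" for x
  proof -
    let ?X = "\<lambda>k. x $ of_nat k"
    have X: "?X 0 + ?X 1 = 0" "?X 2 + ?X 3 = 0" using that by (simp_all add: p21_def q21_def)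
    have e: "rbil (g21 d) x x = bform 2 ?X ?X - 2 * real d * (x $ 20)\<^sup>2" by (simp add: rbil21 power2_eq_square)
    have le: "bform 2 ?X ?X \<le> 0" "2 * real d * (x $ 20)\<^sup>2 \<ge> 0" by (rule bform_neg(1)[of ?X, OF X]) simp
    have "rbil (g21 d) x x \<noteq> 0"
    proof
      assume "rbil (g21 d) x x = 0"
      then have z: "bform 2 ?X ?X = 0" "2 * real d * (x $ 20)\<^sup>2 = 0" using e le by linarith+
      then have "?X k = 0" if "k < 20" for k using bform_neg(2)[of ?X 2 k, OF X] that by simp
      moreover have "?X 20 = 0" using z(2) assms by simp
      ultimately have "?X k = 0" if "k < 21" for k using that by (cases "k = 20") auto
      then show False using \<open>x \<noteq> 0\<close> by (simp add: vec21_eq_iff)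
    qed
    then show ?thesis using e le by linarith
  qed
qed

text \<open>\<open>iota\<close> over an arbitrary ring, for integral, real and complex vectors
  alike.\<close>

definition giota :: "int^8 \<Rightarrow> 'a::comm_ring_1^21 \<Rightarrow> 'a^28" where
  "giota l w = (\<chi> i. if ix28 i < 20 then w $ of_nat (ix28 i) else w $ of_nat 20 * of_int (l $ of_nat (ix28 i - 20)))"

text \<open>Orthogonal projection onto the span of the smaller lattice, in its own coordinates: the
  last one is the coefficient \<open>(y,l) / (l,l)\<close> along \<open>l\<close>.\<close>

definition gpi :: "nat \<Rightarrow> int^8 \<Rightarrow> 'a::field^28 \<Rightarrow> 'a^21" where
  "gpi d l y = (\<chi> a. if ix21 a < 20 then y $ of_nat (ix21 a)
     else - e8form (\<lambda>k. of_int (l $ of_nat k)) (\<lambda>k. y $ of_nat (20 + k)) / (2 * of_nat d))"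

definition iemb :: "int^8 \<Rightarrow> int^28" where
  "iemb r = (\<chi> i. if ix28 i < 20 then 0 else r $ of_nat (ix28 i - 20))"

lemma iota_giota: "iota l w = giota l w"
  by (simp add: iota_def giota_def)

lemma emb8_cvec: "emb8 r = cvec (iemb r)"
  by (simp add: emb8_def iemb_def cvec_def vec_eq_iff)

lemma giota_nth: "k < 28 \<Longrightarrow> giota l w $ of_nat k = (if k < 20 then w $ of_nat k else w $ 20 * of_int (l $ of_nat (k - 20)))"
  by (simp add: giota_def ix28_of_nat)

lemma iemb_nth: "k < 28 \<Longrightarrow> iemb r $ of_nat k = (if k < 20 then 0 else r $ of_nat (k - 20))"
  by (simp add: iemb_def ix28_of_nat)

lemma gpi_nth: "k < 20 \<Longrightarrow> gpi d l y $ of_nat k = y $ of_nat k"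
  by (simp add: gpi_def ix21_of_nat)

lemma gpi_20: "gpi d l y $ 20 = - e8form (\<lambda>k. of_int (l $ of_nat k)) (\<lambda>k. y $ of_nat (20 + k)) / (2 * of_nat d)"
proof -
  have "gpi d l y $ of_nat 20 = - e8form (\<lambda>k. of_int (l $ of_nat k)) (\<lambda>k. y $ of_nat (20 + k)) / (2 * of_nat d)"
    unfolding gpi_def using ix21_of_nat[of 20] by simp
  then show ?thesis by simp
qed

lemma e8form_cong: "(\<And>k. k < 8 \<Longrightarrow> X k = X' k) \<Longrightarrow> (\<And>k. k < 8 \<Longrightarrow> Y k = Y' k) \<Longrightarrow> e8form X Y = e8form X' Y'"
  unfolding e8form_def by simp

lemma bform_cong: "(\<And>k. k < 4 + 8 * m \<Longrightarrow> X k = X' k) \<Longrightarrow> (\<And>k. k < 4 + 8 * m \<Longrightarrow> Y k = Y' k) \<Longrightarrow> bform m X Y = bform m X' Y'"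
  unfolding bform_def by (intro arg_cong2[where f="(+)"] sum.cong refl e8form_cong) auto

lemma bform_3: "bform 3 X Y = bform 2 X Y + e8form (\<lambda>k. X (20 + k)) (\<lambda>k. Y (20 + k))"
  unfolding bform_def by (simp add: numeral_3_eq_3 numeral_2_eq_2 lessThan_Suc algebra_simps)

lemma e8form_scale: "e8form (\<lambda>k. c * X k) Y = c * e8form X Y" "e8form X (\<lambda>k. c * Y k) = c * e8form X Y"
  unfolding e8form_def by (simp_all add: algebra_simps)

lemma giota_lin: "giota l (x + y) = giota l x + giota l y" "giota l (x - y) = giota l x - giota l y" "giota l (c *s x) = c *s giota l x" "giota l 0 = 0"
  by (simp_all add: giota_def vec_eq_iff algebra_simps)

lemma e8form_add: "e8form X (\<lambda>k. Y k + Z k) = e8form X Y + e8form X Z"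
  unfolding e8form_def by (simp add: algebra_simps)

lemma gpi_lin: "gpi d l (x + y) = gpi d l x + gpi d l y" "gpi d l (c *s x) = c *s gpi d l x"
  by (simp_all add: gpi_def vec_eq_iff e8form_add e8form_scale algebra_simps add_divide_distrib diff_divide_distrib)

lemma giota_cvec: "giota l (cvec z) = cvec (giota l z)"
  by (simp add: giota_def cvec_def vec_eq_iff)

lemma giota_rvec: "giota l (rvec z) = rvec (giota l z)"
  by (simp add: giota_def rvec_def vec_eq_iff)

lemma giota_ivec: "giota l (ivec z) = ivec (giota l z)"
  by (simp add: giota_def ivec_def vec_eq_iff)

lemma giota_conjv: "giota l (conjv z) = conjv (giota l z)"
  by (simp add: giota_def conjv_def vec_eq_iff)

lemma gpi_rvec: "gpi d l (rvec z) = rvec (gpi d l z)"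
  by (simp add: gpi_def rvec_def vec_eq_iff e8form_def)

lemma linear_giota: "linear (giota l :: real^21 \<Rightarrow> real^28)"
  by (rule linearI) (simp_all add: giota_def vec_eq_iff algebra_simps)

lemma linear_gpi: "linear (gpi d l :: real^28 \<Rightarrow> real^21)"
proof (rule linearI)
  fix x y :: "real^28" and r :: real
  show "gpi d l (x + y) = gpi d l x + gpi d l y" by (rule gpi_lin)
  have "r *\<^sub>R x = r *s x" "r *\<^sub>R gpi d l x = r *s gpi d l x" by (simp_all add: vec_eq_iff)
  then show "gpi d l (r *\<^sub>R x) = r *\<^sub>R gpi d l x" by (simp only: gpi_lin)
qed

lemma continuous_on_iota: "continuous_on S (iota l)"
proof -
  have "continuous_on S (\<lambda>w. \<chi> i. if ix28 i < 20 then w $ of_nat (ix28 i) else w $ of_nat 20 * of_int (l $ of_nat (ix28 i - 20)))"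
  proof (rule continuous_on_vec_lambda)
    fix i :: 28
    show "continuous_on S (\<lambda>w. if ix28 i < 20 then w $ of_nat (ix28 i) else w $ of_nat 20 * of_int (l $ of_nat (ix28 i - 20)))"
      by (cases "ix28 i < 20") (auto intro!: continuous_intros continuous_on_component)
  qed
  then show ?thesis unfolding iota_def[abs_def] by simp
qed

lemma cholo_iota_nth: "cholo_on (\<lambda>w. iota l w $ i) U"
  unfolding iota_def by (cases "ix28 i < 20") (auto intro!: cholo_on_mult cholo_on_const cholo_on_nth)

lemma ibil_iemb: "ibil g28 (iemb r) (iemb s) = e8 r s"
proof -
  have "bform 2 (\<lambda>k. iemb r $ of_nat k) (\<lambda>k. iemb s $ of_nat k) = bform 2 (\<lambda>k. 0) (\<lambda>k. 0)"
    by (rule bform_cong) (simp_all add: iemb_nth)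
  moreover have "bform 2 (\<lambda>k. 0) (\<lambda>k. 0) = (0::int)" by (simp add: bform_def e8form_def)
  moreover have "e8form (\<lambda>k. iemb r $ of_nat (20 + k)) (\<lambda>k. iemb s $ of_nat (20 + k)) = e8form (\<lambda>k. r $ of_nat k) (\<lambda>k. s $ of_nat k)"
    by (rule e8form_cong) (simp_all add: iemb_nth del: of_nat_add)
  ultimately show ?thesis unfolding ibil28 bform_3 e8_form by simp
qed

locale embedding =
  fixes d :: nat and l :: "int^8"
  assumes d1: "d \<ge> 1" and l2: "e8 l l = - 2 * int d"
begin

sublocale Q21: quad "g21 d" p21 q21
  by (rule quad21[OF d1])

lemma l_form: "e8form (\<lambda>k. of_int (l $ of_nat k)) (\<lambda>k. of_int (l $ of_nat k)) = (- 2 * of_nat d :: 'a::comm_ring_1)"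
  unfolding e8form_of_int e8_form[symmetric] l2 by simp

lemma form_adjoint:
  "bform 3 (\<lambda>k. giota l w $ of_nat k) (\<lambda>k. y $ of_nat k) =
   bform 2 (\<lambda>k. w $ of_nat k) (\<lambda>k. gpi d l y $ of_nat k) - 2 * of_nat d * w $ 20 * gpi d l (y::'a::field_char_0^28) $ 20"
proof -
  have "bform 2 (\<lambda>k. giota l w $ of_nat k) (\<lambda>k. y $ of_nat k) = bform 2 (\<lambda>k. w $ of_nat k) (\<lambda>k. gpi d l y $ of_nat k)"
    by (rule bform_cong) (simp_all add: giota_nth gpi_nth)
  moreover have "e8form (\<lambda>k. giota l w $ of_nat (20 + k)) (\<lambda>k. y $ of_nat (20 + k)) =
     e8form (\<lambda>k. w $ 20 * of_int (l $ of_nat k)) (\<lambda>k. y $ of_nat (20 + k))"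
    by (rule e8form_cong) (simp_all add: giota_nth del: of_nat_add)
  ultimately show ?thesis unfolding bform_3 gpi_20 e8form_scale using d1 by simp
qed

lemma bil_adjoint: "bil g28 (iota l w) y = bil (g21 d) w (gpi d l y)"
  unfolding bil28 bil21 iota_giota by (rule form_adjoint)

lemma rbil_adjoint: "rbil g28 (giota l w) y = rbil (g21 d) w (gpi d l y)"
  unfolding rbil28 rbil21 by (rule form_adjoint)

lemma gpi_giota: "gpi d l (giota l w) = (w::'a::field_char_0^21)"
  unfolding vec21_eq_iff
proof (intro allI impI)
  fix k :: nat assume "k < 21"
  show "gpi d l (giota l w) $ of_nat k = w $ of_nat k"
  proof (cases "k = 20")
    case True
    have "e8form (\<lambda>k. of_int (l $ of_nat k)) (\<lambda>k. giota l w $ of_nat (20 + k)) = e8form (\<lambda>k. of_int (l $ of_nat k)) (\<lambda>k. w $ 20 * of_int (l $ of_nat k))"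
      by (rule e8form_cong) (simp_all add: giota_nth del: of_nat_add)
    then show ?thesis using d1 by (simp add: True gpi_20 e8form_scale l_form)
  next
    case False
    then show ?thesis using \<open>k < 21\<close> by (simp add: gpi_nth giota_nth)
  qed
qed

lemma bil_iota: "bil g28 (iota l w) (iota l w') = bil (g21 d) w w'"
  unfolding bil_adjoint unfolding iota_giota gpi_giota ..

lemma rbil_giota: "rbil g28 (giota l w) (giota l w') = rbil (g21 d) w w'"
  unfolding rbil_adjoint gpi_giota ..

lemma ibil_giota: "ibil g28 (giota l w) (giota l w') = ibil (g21 d) w w'"
proof -
  have "real_of_int (ibil g28 (giota l w) (giota l w')) = real_of_int (ibil (g21 d) w w')"
    unfolding rbil_ivec[symmetric] giota_ivec[symmetric] rbil_giota ..
  then show ?thesis by simp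
qed

lemma bil_iota_emb8: "bil g28 (iota l w) (emb8 r) = w $ 20 * of_int (e8 r l)"
proof -
  have "bform 2 (\<lambda>k. giota l w $ of_nat k) (\<lambda>k. emb8 r $ of_nat k) = bform 2 (\<lambda>k. giota l w $ of_nat k) (\<lambda>k. 0)"
    by (rule bform_cong) (simp_all add: emb8_cvec cvec_def iemb_nth)
  moreover have "\<dots> = 0" by (simp add: bform_def e8form_def)
  moreover have "e8form (\<lambda>k. giota l w $ of_nat (20 + k)) (\<lambda>k. emb8 r $ of_nat (20 + k)) =
     e8form (\<lambda>k. w $ 20 * of_int (l $ of_nat k)) (\<lambda>k. of_int (r $ of_nat k))"
    by (rule e8form_cong) (simp_all add: giota_nth emb8_cvec cvec_def iemb_nth del: of_nat_add)
  moreover have "e8 l r = e8 r l" unfolding e8_form by (rule e8form_sym)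
  ultimately show ?thesis unfolding bil28 bform_3 iota_giota e8form_scale e8form_of_int e8_form[symmetric] by simp
qed

lemma gpi_emb8: assumes "e8 r l = 0" shows "gpi d l (emb8 r) = 0"
  unfolding vec21_eq_iff
proof (intro allI impI)
  fix k :: nat assume "k < 21"
  show "gpi d l (emb8 r) $ of_nat k = 0 $ of_nat k"
  proof (cases "k = 20")
    case True
    have "e8form (\<lambda>k. of_int (l $ of_nat k)) (\<lambda>k. emb8 r $ of_nat (20 + k)) = e8form (\<lambda>k. of_int (l $ of_nat k)) (\<lambda>k. of_int (r $ of_nat k))"
      by (rule e8form_cong) (simp_all add: emb8_cvec cvec_def iemb_nth del: of_nat_add)
    also have "\<dots> = of_int (e8 l r)" unfolding e8form_of_int e8_form ..
    also have "e8 l r = e8 r l" unfolding e8_form by (rule e8form_sym)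
    finally show ?thesis by (simp add: True gpi_20 assms)
  next
    case False
    then show ?thesis using \<open>k < 21\<close> by (simp add: gpi_nth emb8_cvec cvec_def iemb_nth)
  qed
qed

lemma iota_w21: "iota l w21 = w28"
  unfolding vec28_eq_iff
proof (intro allI impI)
  fix k :: nat assume "k < 28"
  have "w21 $ of_nat 20 = 0" unfolding w21_def using ix21_of_nat[of 20] by simp
  then have "w21 $ 20 = 0" by simp
  then show "iota l w21 $ of_nat k = w28 $ of_nat k"
    using \<open>k < 28\<close> by (simp add: iota_giota giota_nth w28_def w21_def ix28_of_nat ix21_of_nat)
qed

lemma w28_cone: "w28 \<in> cone g28"
proof -
  have n: "w28 $ of_nat k = (if k < 2 then 1 else if k < 4 then \<i> else 0)" if "k < 28" for k
    using that by (simp add: w28_def ix28_of_nat)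
  have "bform 3 (\<lambda>k. w28 $ of_nat k) (\<lambda>k. w28 $ of_nat k) = bform 3 (\<lambda>k. if k < 2 then 1 else if k < 4 then \<i> else 0) (\<lambda>k. if k < 2 then 1 else if k < 4 then \<i> else 0)"
    by (rule bform_cong) (simp_all add: n)
  then have "bil g28 w28 w28 = 0" unfolding bil28 by (simp add: bform_def e8form_def)
  moreover have "bform 3 (\<lambda>k. w28 $ of_nat k) (\<lambda>k. conjv w28 $ of_nat k) = bform 3 (\<lambda>k. if k < 2 then 1 else if k < 4 then \<i> else 0) (\<lambda>k. if k < 2 then 1 else if k < 4 then - \<i> else 0)"
    by (rule bform_cong) (simp_all add: n conjv_def)
  then have "bil g28 w28 (conjv w28) = 4" unfolding bil28 by (simp add: bform_def e8form_def)
  ultimately show ?thesis by (simp add: cone_def)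
qed

lemma w28_Dom: "w28 \<in> Dom g28 w28"
  unfolding Dom_def using w28_cone by (simp add: connected_component_refl_eq)

lemma iota_cone: "w \<in> cone (g21 d) \<longleftrightarrow> iota l w \<in> cone g28"
  unfolding cone_def by (simp add: bil_iota flip: iota_giota) (simp add: iota_giota flip: giota_conjv bil_iota[unfolded iota_giota])

lemma w21_Dom: "w21 \<in> Dom (g21 d) w21"
  unfolding Dom_def using w28_cone iota_cone[of w21] by (simp add: connected_component_refl_eq iota_w21)

lemma iota_Dom: assumes "w \<in> Dom (g21 d) w21" shows "iota l w \<in> Dom g28 w28"
proof -
  have "iota l ` Dom (g21 d) w21 \<subseteq> Dom g28 w28"
  proof (rule Q28.Dom_maximal[of _ w28])
    show "connected (iota l ` Dom (g21 d) w21)" by (intro connected_continuous_image continuous_on_iota Q21.Dom_connected)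
    show "iota l ` Dom (g21 d) w21 \<subseteq> cone g28" using iota_cone Q21.Dom_subset_cone by blast
    show "w28 \<in> iota l ` Dom (g21 d) w21" using iota_w21 w21_Dom by (metis image_eqI)
  qed (rule w28_Dom)
  then show ?thesis using assms by blast
qed

text \<open>The condition of \<open>Otilde\<close> in isolation, since it must also be shown for the
  inverse of a stable isometry.\<close>

definition discrete :: "int^21^21 \<Rightarrow> bool" where
  "discrete g \<longleftrightarrow> (\<forall>v::real^21. (\<forall>i. (\<Sum>j\<in>UNIV. of_int (g21 d i j) * v$j) \<in> \<int>) \<longrightarrow> (\<forall>i. (rmat g *v v - v)$i \<in> \<int>))"

text \<open>Displacement of the projected basis vector under \<open>g\<close>. For
  \<open>discrete g\<close> the entries are integers, and the floor only changes their type.\<close>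

definition extz :: "int^21^21 \<Rightarrow> 28 \<Rightarrow> int^21" where
  "extz g j = (\<chi> a. \<lfloor>(rmat g *v gpi d l (axis j 1) - gpi d l (axis j 1)) $ a\<rfloor>)"

definition ext :: "int^21^21 \<Rightarrow> int^28^28" where
  "ext g = (\<chi> i j. (if i = j then 1 else 0) + giota l (extz g j) $ i)"

text \<open>The projection of an integral vector lies in the dual lattice, because
  \<open>gpi\<close> is adjoint to the integral map \<open>giota\<close>; stability then makes the
  displacement integral.\<close>

lemma extz: assumes "discrete g" shows "ivec (extz g j) = rmat g *v gpi d l (axis j 1) - gpi d l (axis j 1)"
proof -
  let ?p = "gpi d l (axis j 1) :: real^21"
  have "(\<Sum>a\<in>UNIV. of_int (g21 d i a) * ?p $ a) \<in> \<int>" for i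
  proof -
    have "(\<Sum>a\<in>UNIV. of_int (g21 d i a) * ?p $ a) = rbil (g21 d) (axis i 1) ?p"
    proof -
      have "rbil (g21 d) (axis i 1) ?p = (\<Sum>b\<in>UNIV. if b = i then (\<Sum>a\<in>UNIV. of_int (g21 d i a) * ?p $ a) else 0)"
        unfolding rbil_def by (rule sum.cong[OF refl]) (simp add: axis_def)
      then show ?thesis by simp
    qed
    moreover have "rbil (g21 d) (axis i 1) ?p = rbil g28 (giota l (axis i 1)) (axis j 1)" by (rule rbil_adjoint[symmetric])
    moreover have "giota l (axis i 1) = ivec (giota l (axis i 1))"
    proof -
      have "(axis i 1 :: real^21) = ivec (axis i 1)" by (simp add: ivec_def axis_def vec_eq_iff)
      then show ?thesis using giota_ivec[of l "axis i 1"] by simp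
    qed
    moreover have "(axis j 1 :: real^28) = ivec (axis j 1)" by (simp add: ivec_def axis_def vec_eq_iff)
    ultimately have "(\<Sum>a\<in>UNIV. of_int (g21 d i a) * ?p $ a) = of_int (ibil g28 (giota l (axis i 1)) (axis j 1))"
      using rbil_ivec[of g28 "giota l (axis i 1)" "axis j 1"] by metis
    then show ?thesis by simp
  qed
  then have "\<forall>i. (\<Sum>a\<in>UNIV. of_int (g21 d i a) * ?p $ a) \<in> \<int>" by (rule allI)
  then have D: "\<forall>a. (rmat g *v ?p - ?p) $ a \<in> \<int>" using assms unfolding discrete_def by (elim allE[of _ ?p] impE)
  have "(rmat g *v ?p - ?p) $ a \<in> \<int>" for a using D by (rule spec)
  moreover have "of_int \<lfloor>x\<rfloor> = x" if "x \<in> \<int>" for x :: real using that by (auto elim!: Ints_cases)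
  ultimately have "of_int \<lfloor>(rmat g *v ?p - ?p) $ a\<rfloor> = (rmat g *v ?p - ?p) $ a" for a by metis
  then have "ivec (extz g j) $ a = (rmat g *v ?p - ?p) $ a" for a unfolding ivec_def extz_def by (simp only: vec_lambda_beta)
  then show ?thesis unfolding vec_eq_iff by blast
qed

lemma act_ext: assumes "discrete g" shows "act (ext g) y = y + iota l (act g (gpi d l y) - gpi d l y)"
proof -
  define T where "T = (\<lambda>y. iota l (act g (gpi d l y) - gpi d l y))"
  have T: "T (x + y) = T x + T y" "T (c *s x) = c *s T x" for x y c
    unfolding T_def iota_giota gpi_lin act_lin giota_lin by (simp_all add: vec_eq_iff algebra_simps)
  have Ts: "T (\<Sum>j\<in>S. f j) = (\<Sum>j\<in>S. T (f j))" for f :: "28 \<Rightarrow> complex^28" and S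
    by (induction S rule: infinite_finite_induct) (use T(1) T(2)[of 0 0] in auto)
  have y: "y = (\<Sum>j\<in>UNIV. y $ j *s axis j 1)" by (simp add: vec_eq_iff axis_def if_distrib cong: if_cong)
  have Ta: "T (axis j 1) = cvec (giota l (extz g j))" for j
  proof -
    have a: "axis j 1 = rvec (axis j 1)" by (simp add: vec_eq_iff rvec_def axis_def)
    have "act g (gpi d l (axis j 1)) - gpi d l (axis j 1) = rvec (ivec (extz g j))"
      unfolding a gpi_rvec act_rvec extz[OF assms] rvec_lin ..
    then show ?thesis unfolding T_def iota_giota by (simp add: giota_cvec flip: cvec_ivec)
  qed
  have "T y = (\<Sum>j\<in>UNIV. y $ j *s cvec (giota l (extz g j)))"
    by (subst y) (simp add: Ts T(2) Ta)
  then have "T y $ i = (\<Sum>j\<in>UNIV. of_int (giota l (extz g j) $ i) * y $ j)" for i by (simp add: cvec_def mult.commute)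
  moreover have "act (ext g) y $ i = y $ i + (\<Sum>j\<in>UNIV. of_int (giota l (extz g j) $ i) * y $ j)" for i
  proof -
    have "act (ext g) y $ i = (\<Sum>j\<in>UNIV. (if i = j then y $ j else 0) + of_int (giota l (extz g j) $ i) * y $ j)"
      unfolding act_nth by (rule sum.cong) (auto simp: ext_def algebra_simps)
    then show ?thesis by (simp add: sum.distrib)
  qed
  ultimately have "act (ext g) y = y + T y" by (simp add: vec_eq_iff)
  then show ?thesis unfolding T_def .
qed

text \<open>Sylvester's identity with \<open>giota l\<close> as \<open>B\<close> and the
  displacement of \<open>gpi\<close> under \<open>g\<close> as \<open>C\<close>: since
  \<open>gpi\<close> inverts \<open>giota\<close> on the left, the small matrix is \<open>g\<close>
  itself.\<close>

lemma det_ext: assumes "discrete g" shows "det (ext g) = det g"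
proof -
  have "l \<noteq> 0" using l2 d1 by (auto simp: e8_def)
  then obtain k0 where k0: "k0 < 8" "l $ of_nat k0 \<noteq> 0" unfolding vec8_eq_iff by auto
  \<comment> \<open>The first 20 coordinates are shared. The last one is matched with a coordinate
    where \<open>l\<close> is nonzero, so that the diagonal entries required by
    \<open>det_one_plus\<close> do not vanish.\<close>
  define j :: "21 \<Rightarrow> 28" where "j = (\<lambda>a. if ix21 a < 20 then of_nat (ix21 a) else of_nat (20 + k0))"
  have ixj: "ix28 (j a) = (if ix21 a < 20 then ix21 a else 20 + k0)" for a
    using k0(1) ix21_less[of a] by (simp add: j_def ix28_of_nat del: of_nat_add)
  have eq20: "ix21 a = 20" if "\<not> ix21 a < 20" for a using that ix21_less[of a] by linarith
  have ixinj: "a = b" if "ix21 a = ix21 b" for a b using of_nat_ix21[of a] of_nat_ix21[of b] unfolding that by (rule trans[OF sym])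
  have injj: "inj j"
  proof (rule injI)
    fix a b assume "j a = j b"
    then have "ix28 (j a) = ix28 (j b)" by simp
    then have "(if ix21 a < 20 then ix21 a else 20 + k0) = (if ix21 b < 20 then ix21 b else 20 + k0)" by (simp only: ixj)
    then have "ix21 a = ix21 b"
      by (cases "ix21 a < 20"; cases "ix21 b < 20") (use ix21_less[of a] ix21_less[of b] in simp_all)
    then show "a = b" by (rule ixinj)
  qed
  have linC: "linear (\<lambda>x. rmat g *v gpi d l x - gpi d l x)"
    using linear_gpi[of d l] by (intro linearI) (simp_all add: linear_add linear_scale matrix_vector_right_distrib algebra_simps matrix_vector_mult_scaleR)
  have of20: "of_nat (ix21 c) = c" for c by (rule of_nat_ix21)
  have val: "giota l v $ j b = (if ix21 b < 20 then v $ b else v $ b * of_int (l $ of_nat k0))" for v :: "real^21" and b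
  proof (cases "ix21 b < 20")
    case True
    then show ?thesis by (simp add: giota_def ixj of20)
  next
    case False
    have "(of_nat 20 :: 21) = b" using of20[of b] unfolding eq20[OF False] .
    then show ?thesis using False by (simp add: giota_def ixj)
  qed
  have off: "giota l (axis a (1::real)) $ j b = 0" if "a \<noteq> b" for a b
    unfolding val using that by (simp add: axis_def)
  have diag: "giota l (axis a (1::real)) $ j a \<noteq> 0" for a
    unfolding val using k0(2) by (simp add: axis_def)
  have A: "rmat (ext g) *v x = x + giota l (rmat g *v gpi d l x - gpi d l x)" for x
  proof -
    have "rvec (rmat (ext g) *v x) = rvec (x + giota l (rmat g *v gpi d l x - gpi d l x))"
      unfolding act_rvec[symmetric] act_ext[OF assms] unfolding gpi_rvec act_rvec iota_giota by (simp only: rvec_lin giota_lin giota_rvec)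
    then show ?thesis by (simp only: rvec_inject)
  qed
  have "det (rmat (ext g)) = det (matrix (\<lambda>v. v + (rmat g *v gpi d l (giota l v) - gpi d l (giota l v))))"
    by (rule det_one_plus[OF injj linear_giota linC off diag A])
  also have "(\<lambda>v. v + (rmat g *v gpi d l (giota l v) - gpi d l (giota l v))) = (\<lambda>v. rmat g *v v)" unfolding gpi_giota by simp
  also have "matrix (\<lambda>v. rmat g *v v) = rmat g" by (rule matrix_of_matrix_vector_mul)
  finally show ?thesis by (simp add: det_rmat)
qed

text \<open>The extension restricts to \<open>g\<close> and moves vectors only within the span of
  the smaller lattice. So it preserves each linear form in the product over \<open>P\<close>, and
  equality of determinants carries the character over.\<close>

lemma ext_Oplus:
  assumes g: "g \<in> Otilde (g21 d) w21"
  shows "ext g \<in> Oplus g28 w28" "act (ext g) (iota l w) = iota l (act g w)"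
    "e8 r l = 0 \<Longrightarrow> bil g28 (act (ext g) y) (emb8 r) = bil g28 y (emb8 r)" "det (ext g) = det g"
proof -
  have O: "g \<in> Oplus (g21 d) w21" and dg: "discrete g" using g unfolding Otilde_def discrete_def by auto
  obtain h where gh: "g ** h = mat 1" "h ** g = mat 1" and inv: "\<And>x y. bil (g21 d) (act g x) (act g y) = bil (g21 d) x y"
    and im: "act g ` Dom (g21 d) w21 = Dom (g21 d) w21" using O unfolding Oplus_def by blast
  have hg: "act h (act g x) = x" "act g (act h x) = x" for x using gh by (simp_all flip: act_mult add: act_1)
  have dh: "discrete h" unfolding discrete_def
  proof (intro allI impI)
    fix v :: "real^21" and i assume v: "\<forall>i. (\<Sum>j\<in>UNIV. of_int (g21 d i j) * v$j) \<in> \<int>"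
    then have "(rmat g *v v - v) $ j \<in> \<int>" for j using dg unfolding discrete_def by blast
    then have "(rmat h *v (rmat g *v v - v)) $ i \<in> \<int>"
      by (auto simp: matrix_vector_mult_def rmat_def intro!: Ints_sum)
    moreover have "rmat h *v (rmat g *v v) = v"
    proof -
      have "rvec (rmat h *v (rmat g *v v)) = rvec v" unfolding act_rvec[symmetric] by (rule hg)
      then show ?thesis by (simp only: rvec_inject)
    qed
    ultimately have "(v - rmat h *v v) $ i \<in> \<int>" by (simp add: matrix_vector_mult_diff_distrib)
    then have "- ((v - rmat h *v v) $ i) \<in> \<int>" by (rule Ints_minus)
    then show "(rmat h *v v - v) $ i \<in> \<int>" by simp
  qed
  show det: "det (ext g) = det g" by (rule det_ext[OF dg])
  have pe: "gpi d l (act (ext g) y) = act g (gpi d l y)" if "discrete g" for g y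
    unfolding act_ext[OF that] gpi_lin iota_giota gpi_giota by simp
  show ei: "act (ext g) (iota l w) = iota l (act g w)" for w
    unfolding act_ext[OF dg] unfolding iota_giota gpi_giota giota_lin by simp
  have inv28: "bil g28 (act (ext g) x) (act (ext g) y) = bil g28 x y" for x y
  proof -
    have a: "bil g28 x (iota l v) = bil (g21 d) (gpi d l x) v" for x v
      unfolding Q28.bil_sym[of x] bil_adjoint by (rule Q21.bil_sym)
    let ?dx = "act g (gpi d l x) - gpi d l x" and ?dy = "act g (gpi d l y) - gpi d l y"
    have "bil g28 (act (ext g) x) (act (ext g) y) = bil g28 x y + bil (g21 d) (gpi d l x) ?dy + bil (g21 d) ?dx (gpi d l y) + bil (g21 d) ?dx ?dy"
      unfolding act_ext[OF dg] bil_add a bil_adjoint by (simp add: iota_giota gpi_giota)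
    also have "\<dots> = bil g28 x y" unfolding bil_diff inv by simp
    finally show ?thesis .
  qed
  have comp: "act (ext h) (act (ext g) y) = y" if "discrete g" "discrete h" "\<And>x. act h (act g x) = x" for g h y
    unfolding act_ext[OF that(2)] pe[OF that(1)] that(3) unfolding act_ext[OF that(1)] iota_giota giota_lin by simp
  have "ext g ** ext h = mat 1" by (rule act_eq_1) (simp add: act_mult comp[OF dh dg hg(2)])
  moreover have "ext h ** ext g = mat 1" by (rule act_eq_1) (simp add: act_mult comp[OF dg dh hg(1)])
  moreover have "act (ext g) w28 \<in> Dom g28 w28" unfolding iota_w21[symmetric] ei
    unfolding iota_w21 by (rule iota_Dom) (use im w21_Dom in blast)
  ultimately show "ext g \<in> Oplus g28 w28" by (rule Q28.OplusI[OF _ _ inv28 w28_Dom])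
  show "bil g28 (act (ext g) y) (emb8 r) = bil g28 y (emb8 r)" if "e8 r l = 0" for y
    unfolding act_ext[OF dg] bil_add bil_adjoint gpi_emb8[OF that] by (simp add: bil_zero)
qed

end

section \<open>The quasi-pullback\<close>

context quad begin

text \<open>Induction on the number of forms. The quotient by the other forms vanishes on the
  hyperplane of \<open>r\<close>: nearby points of it avoid the remaining hyperplanes,
  \<open>f\<close> is 0 there, and the quotient is continuous.\<close>

lemma divide_linear_forms:
  fixes v :: "'r \<Rightarrow> real^'n"
  assumes "finite R" "open U" "w \<in> U" "cholo_on f U" "\<And>r. r \<in> R \<Longrightarrow> bil gr w (rvec (v r)) = 0"
    "\<And>r z. r \<in> R \<Longrightarrow> z \<in> U \<Longrightarrow> bil gr z (rvec (v r)) = 0 \<Longrightarrow> f z = 0"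
    "\<And>r. r \<in> R \<Longrightarrow> \<exists>\<xi>. rbil gr \<xi> (v r) \<noteq> 0"
    "\<And>r s. r \<in> R \<Longrightarrow> s \<in> R \<Longrightarrow> r \<noteq> s \<Longrightarrow> \<exists>\<xi>. rbil gr \<xi> (v r) = 0 \<and> rbil gr \<xi> (v s) \<noteq> 0"
  shows "\<exists>V g. open V \<and> w \<in> V \<and> V \<subseteq> U \<and> cholo_on g V \<and> (\<forall>z\<in>V. f z = g z * (\<Prod>r\<in>R. bil gr z (rvec (v r))))"
  using assms
proof (induction R rule: finite_induct)
  case empty
  then show ?case by (intro exI[of _ U] exI[of _ f]) auto
next
  case (insert r R)
  have "\<exists>V g. open V \<and> w \<in> V \<and> V \<subseteq> U \<and> cholo_on g V \<and> (\<forall>z\<in>V. f z = g z * (\<Prod>r\<in>R. bil gr z (rvec (v r))))"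
    by (rule insert.IH) (use insert.prems in auto)
  then obtain V g where V: "open V" "w \<in> V" "V \<subseteq> U" "cholo_on g V" "\<forall>z\<in>V. f z = g z * (\<Prod>r\<in>R. bil gr z (rvec (v r)))" by (elim exE conjE)
  have gz: "g z = 0" if z: "z \<in> V" "bil gr z (rvec (v r)) = 0" for z
  proof -
    have "\<exists>\<xi>\<in>{\<xi>. rbil gr \<xi> (v r) = 0}. \<forall>s\<in>R. rbil gr \<xi> (v s) \<noteq> 0"
    proof (rule avoid_finitely_many_kernels[OF insert.hyps(1)])
      fix s assume s: "s \<in> R"
      then have "r \<noteq> s" using insert.hyps(2) by blast
      then show "\<exists>x\<in>{\<xi>. rbil gr \<xi> (v r) = 0}. rbil gr x (v s) \<noteq> 0" using insert.prems(7)[of r s] s by blast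
    qed (simp_all add: rbil_lin linear_rbil)
    then obtain \<xi> where \<xi>: "rbil gr \<xi> (v r) = 0" "\<forall>s\<in>R. rbil gr \<xi> (v s) \<noteq> 0" by blast
    define p where "p = (\<lambda>t::real. z + of_real t *s rvec \<xi>)"
    have pc: "isCont p 0" unfolding p_def by (intro continuous_on_interior[of UNIV] continuous_intros) auto
    have pl: "(p \<longlongrightarrow> z) (at 0)" using pc by (simp add: isCont_def p_def)
    have pV: "\<forall>\<^sub>F t in at 0. p t \<in> V" using topological_tendstoD[OF pl V(1) z(1)] .
    have "isCont g z" using cholo_on_continuous[OF V(4)] V(1) z(1) by (simp add: continuous_on_eq_continuous_at)
    then have lim: "((\<lambda>t. g (p t)) \<longlongrightarrow> g z) (at 0)" by (rule isCont_tendsto_compose[OF _ pl])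
    have ne: "\<forall>\<^sub>F t in at 0. bil gr (p t) (rvec (v s)) \<noteq> 0" if s: "s \<in> R" for s
    proof (cases "bil gr z (rvec (v s)) = 0")
      case True
      have "\<forall>\<^sub>F t::real in at 0. t \<noteq> 0" by (simp add: eventually_at_filter)
      then show ?thesis by (rule eventually_mono) (use \<xi>(2) s in \<open>simp add: p_def bil_lin True bil_rvec\<close>)
    next
      case False
      have "continuous_on UNIV (\<lambda>z. bil gr z (rvec (v s)))" by (intro continuous_intros)
      then have "((\<lambda>t. bil gr (p t) (rvec (v s))) \<longlongrightarrow> bil gr z (rvec (v s))) (at 0)"
        by (rule continuous_on_tendsto_compose[OF _ pl]) auto
      then show ?thesis using False by (rule tendsto_imp_eventually_ne)
    qed
    have "\<forall>\<^sub>F t in at 0. \<forall>s\<in>R. bil gr (p t) (rvec (v s)) \<noteq> 0" using ne insert.hyps(1) by (simp add: eventually_ball_finite_distrib)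
    with pV have "\<forall>\<^sub>F t in at 0. g (p t) = 0"
    proof eventually_elim
      case (elim t)
      have "bil gr (p t) (rvec (v r)) = 0" using z(2) \<xi>(1) by (simp add: p_def bil_lin bil_rvec)
      then have "f (p t) = 0" using insert.prems(5)[of r "p t"] elim(1) V(3) by blast
      moreover have "f (p t) = g (p t) * (\<Prod>s\<in>R. bil gr (p t) (rvec (v s)))" using V(5) elim(1) by blast
      moreover have "(\<Prod>s\<in>R. bil gr (p t) (rvec (v s))) \<noteq> 0" using elim(2) insert.hyps(1) by simp
      ultimately show ?case by simp
    qed
    then have "((\<lambda>t. g (p t)) \<longlongrightarrow> 0) (at 0)" by (rule tendsto_eventually)
    from tendsto_unique[OF _ lim this] show ?thesis by simp
  qed
  obtain \<xi>0 where \<xi>0: "rbil gr \<xi>0 (v r) \<noteq> 0" using insert.prems(6)[of r] by blast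
  have "\<exists>V' g'. open V' \<and> w \<in> V' \<and> V' \<subseteq> V \<and> cholo_on g' V' \<and> (\<forall>z\<in>V'. g z = g' z * bil gr z (rvec (v r)))"
  proof (rule cholo_divide_linear[OF V(4,1,2)])
    show "bil gr w (rvec (v r)) = 0" using insert.prems(4)[of r] by blast
    show "bil gr (of_real (1 / rbil gr \<xi>0 (v r)) *s rvec \<xi>0) (rvec (v r)) = 1" using \<xi>0 by (simp add: bil_lin bil_rvec)
  qed (simp_all add: bil_lin gz)
  then obtain V' g' where V': "open V'" "w \<in> V'" "V' \<subseteq> V" "cholo_on g' V'" "\<forall>z\<in>V'. g z = g' z * bil gr z (rvec (v r))" by (elim exE conjE)
  have "f z = g' z * (\<Prod>r\<in>insert r R. bil gr z (rvec (v r)))" if "z \<in> V'" for z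
    using that V(5) V'(3,5) insert.hyps by (simp add: subset_iff mult.assoc)
  then show ?case using V' V(3) by (intro exI[of _ V'] exI[of _ g']) auto
qed

context
  fixes R :: "'r set" and v :: "'r \<Rightarrow> real^'n" and w0 :: "complex^'n"
  assumes R: "finite R"
    and ne: "\<And>r. r \<in> R \<Longrightarrow> \<exists>\<xi>. rbil gr \<xi> (v r) \<noteq> 0"
    and indep: "\<And>r s. r \<in> R \<Longrightarrow> s \<in> R \<Longrightarrow> r \<noteq> s \<Longrightarrow> \<exists>\<xi>. rbil gr \<xi> (v r) = 0 \<and> rbil gr \<xi> (v s) \<noteq> 0"
begin

abbreviation "PR z \<equiv> (\<Prod>r\<in>R. bil gr z (rvec (v r)))"

lemma dense_PR: "z \<in> Dom gr w0 \<Longrightarrow> z \<in> closure {z \<in> Dom gr w0. PR z \<noteq> 0}"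
proof -
  assume z: "z \<in> Dom gr w0"
  have "z \<in> closure {z \<in> Dom gr w0. bil gr z (rvec 0) = 0 \<and> (\<forall>r\<in>v ` R. bil gr z (rvec r) \<noteq> 0)}"
    by (rule Dom_dense_avoiding[OF z]) (use R ne in \<open>auto simp: rvec_lin bil_zero rbil_zero\<close>)
  also have "{z \<in> Dom gr w0. bil gr z (rvec 0) = 0 \<and> (\<forall>r\<in>v ` R. bil gr z (rvec r) \<noteq> 0)} = {z \<in> Dom gr w0. PR z \<noteq> 0}"
    using R by (simp add: rvec_lin bil_zero)
  finally show ?thesis .
qed

text \<open>Where the product is nonzero it cancels, and such points are dense in the
  domain.\<close>

lemma PR_cancel:
  assumes O: "open O'" "continuous_on (O' \<inter> Dom gr w0) A" "continuous_on (O' \<inter> Dom gr w0) B"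
    and eq: "\<And>z. z \<in> O' \<inter> Dom gr w0 \<Longrightarrow> A z * PR z = B z * PR z" and z: "z \<in> O'" "z \<in> Dom gr w0"
  shows "A z = (B z :: complex)"
proof -
  have "A z - B z = 0"
  proof (rule continuous_zero_closure[of "O' \<inter> Dom gr w0" "\<lambda>z. A z - B z" "O' \<inter> {z \<in> Dom gr w0. PR z \<noteq> 0}"])
    show "continuous_on (O' \<inter> Dom gr w0) (\<lambda>z. A z - B z)" using O by (intro continuous_intros)
    show "A y - B y = 0" if "y \<in> O' \<inter> {z \<in> Dom gr w0. PR z \<noteq> 0}" for y using eq[of y] that by auto
    show "z \<in> closure (O' \<inter> {z \<in> Dom gr w0. PR z \<noteq> 0})"
      using open_Int_closure_subset[OF O(1)] dense_PR[OF z(2)] z(1) by blast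
  qed (use z in auto)
  then show ?thesis by simp
qed

text \<open>The retraction turns \<open>F\<close> into a holomorphic function on an open set, still
  zero on the hyperplanes through \<open>w\<close>. Only these forms are divided out; the others are
  invertible near \<open>w\<close>.\<close>

lemma local_quotient:
  assumes F: "holo_on F (Dom gr w0)" and zero: "\<And>r z. r \<in> R \<Longrightarrow> z \<in> Dom gr w0 \<Longrightarrow> bil gr z (rvec (v r)) = 0 \<Longrightarrow> F z = 0"
    and w: "w \<in> Dom gr w0"
  shows "\<exists>U g. open U \<and> w \<in> U \<and> cholo_on g U \<and> (\<forall>z\<in>U \<inter> Dom gr w0. F z = g z * PR z)"
proof -
  have "\<exists>U G. open U \<and> w \<in> U \<and> cholo_on G U \<and> (\<forall>z\<in>U \<inter> Dom gr w0. G z = F z)" using F w unfolding holo_on_def by simp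
  then obtain U1 G0 where U1: "open U1" "w \<in> U1" "cholo_on G0 U1" "\<forall>z\<in>U1 \<inter> Dom gr w0. G0 z = F z" by (elim exE conjE)
  obtain U2 \<rho> where "open U2 \<and> w \<in> U2 \<and> (\<forall>i. cholo_on (\<lambda>z. \<rho> z $ i) U2) \<and> (\<forall>z\<in>U2. \<rho> z \<in> Dom gr w0) \<and>
    (\<forall>z\<in>U2. bil gr z z = 0 \<longrightarrow> \<rho> z = z) \<and>
    (\<forall>z\<in>U2. \<forall>r. bil gr w (rvec r) = 0 \<longrightarrow> bil gr (\<rho> z) (rvec r) = bil gr z (rvec r))"
    using holomorphic_retraction[OF w] by (elim exE)
  then have U2: "open U2" "w \<in> U2" and \<rho>: "\<And>i. cholo_on (\<lambda>z. \<rho> z $ i) U2" "\<And>z. z \<in> U2 \<Longrightarrow> \<rho> z \<in> Dom gr w0"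
    "\<And>z. z \<in> U2 \<Longrightarrow> bil gr z z = 0 \<Longrightarrow> \<rho> z = z"
    "\<And>z r. z \<in> U2 \<Longrightarrow> bil gr w (rvec r) = 0 \<Longrightarrow> bil gr (\<rho> z) (rvec r) = bil gr z (rvec r)" by simp_all
  have iso0: "bil gr z z = 0" if "z \<in> Dom gr w0" for z using that Dom_subset_cone unfolding cone_def by blast
  define U where "U = U2 \<inter> \<rho> -` U1"
  have c\<rho>: "continuous_on U2 \<rho>"
  proof -
    have "continuous_on U2 (\<lambda>z. \<chi> i. \<rho> z $ i)" by (intro continuous_on_vec_lambda cholo_on_continuous \<rho>(1))
    then show ?thesis by simp
  qed
  have oU: "open U" unfolding U_def by (rule continuous_open_preimage[OF c\<rho> U2(1) U1(1)])
  have wU: "w \<in> U" using U2(2) U1(2) \<rho>(3)[OF U2(2) iso0[OF w]] by (simp add: U_def)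
  define f where "f = (\<lambda>z. G0 (\<rho> z))"
  have fU: "cholo_on f U" unfolding f_def
    by (rule cholo_on_compose[OF U1(3)]) (use \<rho>(1) cholo_on_subset in \<open>auto simp: U_def intro: cholo_on_subset\<close>)
  define R0 where "R0 = {r\<in>R. bil gr w (rvec (v r)) = 0}"
  have fin0: "finite R0" using R by (simp add: R0_def)
  have f0: "f z = 0" if "r \<in> R0" "z \<in> U" "bil gr z (rvec (v r)) = 0" for r z
  proof -
    have "bil gr (\<rho> z) (rvec (v r)) = 0" using \<rho>(4)[of z "v r"] that by (simp add: R0_def U_def)
    then have "F (\<rho> z) = 0" using zero[of r "\<rho> z"] \<rho>(2)[of z] that by (simp add: R0_def U_def)
    then show ?thesis using U1(4) \<rho>(2)[of z] that by (simp add: f_def U_def)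
  qed
  have "\<exists>V g. open V \<and> w \<in> V \<and> V \<subseteq> U \<and> cholo_on g V \<and> (\<forall>z\<in>V. f z = g z * (\<Prod>r\<in>R0. bil gr z (rvec (v r))))"
    by (rule divide_linear_forms[OF fin0 oU wU fU _ f0]) (use ne indep in \<open>auto simp: R0_def\<close>)
  then obtain V g where V: "open V" "w \<in> V" "V \<subseteq> U" "cholo_on g V" "\<forall>z\<in>V. f z = g z * (\<Prod>r\<in>R0. bil gr z (rvec (v r)))" by (elim exE conjE)
  define N where "N = (\<lambda>z. \<Prod>r\<in>R - R0. bil gr z (rvec (v r)))"
  have cN: "cholo_on N S" for S unfolding N_def by (intro cholo_on_prod cholo_on_bil cholo_on_nth cholo_on_const)
  define W where "W = V \<inter> N -` (- {0})"
  have oW: "open W" unfolding W_def by (rule continuous_open_preimage[OF cholo_on_continuous[OF cN] V(1)], rule open_Compl, rule closed_singleton)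
  have wW: "w \<in> W" using V(2) R by (simp add: W_def N_def R0_def)
  have "cholo_on (\<lambda>z. g z / N z) W"
    by (rule cholo_on_divide[OF _ cN]) (use V(4) cholo_on_subset in \<open>auto simp: W_def intro: cholo_on_subset\<close>)
  moreover have "F z = g z / N z * PR z" if z: "z \<in> W \<inter> Dom gr w0" for z
  proof -
    have zV: "z \<in> V" "N z \<noteq> 0" "z \<in> U2" using z V(3) by (auto simp: W_def U_def)
    have "\<rho> z = z" using \<rho>(3)[OF zV(3)] iso0 z by blast
    moreover have "\<rho> z \<in> U1" using zV(1) V(3) by (auto simp: U_def)
    ultimately have "f z = F z" using U1(4) z by (simp add: f_def)
    moreover have "PR z = (\<Prod>r\<in>R0. bil gr z (rvec (v r))) * N z"
      unfolding N_def using R by (subst prod.union_disjoint[symmetric]) (auto simp: R0_def intro!: prod.cong)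
    ultimately show ?thesis using V(5) zV by simp
  qed
  ultimately show ?thesis using oW wW by (intro exI[of _ W] exI[of _ "\<lambda>z. g z / N z"] conjI ballI)
qed

text \<open>Local quotients agree on overlaps by \<open>PR_cancel\<close>, so evaluating at
  \<open>w\<close> the quotient chosen for \<open>w\<close> defines a global one.\<close>

lemma quotient_exists:
  assumes F: "holo_on F (Dom gr w0)" and zero: "\<And>r z. r \<in> R \<Longrightarrow> z \<in> Dom gr w0 \<Longrightarrow> bil gr z (rvec (v r)) = 0 \<Longrightarrow> F z = 0"
  shows "\<exists>G. holo_on G (Dom gr w0) \<and> (\<forall>w\<in>Dom gr w0. F w = G w * PR w)"
proof -
  have "\<forall>w\<in>Dom gr w0. \<exists>U g. open (U) \<and> w \<in> U \<and> cholo_on (g) (U) \<and> (\<forall>z\<in>U \<inter> Dom gr w0. F z = g z * PR z)"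
    by (rule ballI, rule local_quotient[OF F zero])
  from bchoice[OF this] obtain U where "\<forall>w\<in>Dom gr w0. \<exists>g. open (U w) \<and> w \<in> U w \<and> cholo_on (g) (U w) \<and> (\<forall>z\<in>U w \<inter> Dom gr w0. F z = g z * PR z)" by (elim exE)
  from bchoice[OF this] obtain g where Ugb: "\<forall>w\<in>Dom gr w0. open (U w) \<and> w \<in> U w \<and> cholo_on (g w) (U w) \<and> (\<forall>z\<in>U w \<inter> Dom gr w0. F z = g w z * PR z)" by (elim exE)
  note Ug = bspec[OF Ugb]
  note Uo = Ug[THEN conjunct1] and Uw = Ug[THEN conjunct2, THEN conjunct1] and Uc = Ug[THEN conjunct2, THEN conjunct2, THEN conjunct1]
  have Ue: "F y = g w y * PR y" if "w \<in> Dom gr w0" "y \<in> U w \<inter> Dom gr w0" for w y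
  proof -
    have "\<forall>z\<in>U w \<inter> Dom gr w0. F z = g w z * PR z" using Ug[OF that(1)] by (elim conjE)
    then show ?thesis by (rule bspec[OF _ that(2)])
  qed
  define G where "G = (\<lambda>w. g w w)"
  have "g w z = G z" if w: "w \<in> Dom gr w0" and z: "z \<in> U w \<inter> Dom gr w0" for w z
  proof -
    have zD: "z \<in> Dom gr w0" using z by blast
    have o: "open (U w \<inter> U z)" using Uo[OF w] Uo[OF zD] by (rule open_Int)
    have c1: "continuous_on (U w \<inter> U z \<inter> Dom gr w0) (g w)"
      by (rule continuous_on_subset[OF cholo_on_continuous[OF Uc[OF w]]]) auto
    have c2: "continuous_on (U w \<inter> U z \<inter> Dom gr w0) (g z)"
      by (rule continuous_on_subset[OF cholo_on_continuous[OF Uc[OF zD]]]) auto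
    have eq: "g w y * PR y = g z y * PR y" if y: "y \<in> U w \<inter> U z \<inter> Dom gr w0" for y
    proof -
      have y1: "y \<in> U w \<inter> Dom gr w0" and y2: "y \<in> U z \<inter> Dom gr w0" using y by auto
      show ?thesis unfolding Ue[OF w y1, symmetric] Ue[OF zD y2, symmetric] ..
    qed
    have zz: "z \<in> U w \<inter> U z" using z Uw[OF zD] by simp
    show ?thesis unfolding G_def by (rule PR_cancel[OF o c1 c2 eq zz zD])
  qed
  then have "\<forall>w\<in>Dom gr w0. open (U w) \<and> w \<in> U w \<and> cholo_on (g w) (U w) \<and> (\<forall>z\<in>U w \<inter> Dom gr w0. g w z = G z)"
    using Uo Uw Uc by simp
  then have "holo_on G (Dom gr w0)" unfolding holo_on_def by metis
  moreover have "\<forall>w\<in>Dom gr w0. F w = G w * PR w"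
  proof
    fix w assume w: "w \<in> Dom gr w0"
    show "F w = G w * PR w" unfolding G_def by (rule Ue[OF w]) (simp add: w Uw[OF w])
  qed
  ultimately show ?thesis by (intro exI[of _ G] conjI)
qed

end

end

section \<open>Finiteness and independence of the roots, and the quotient of the Borcherds
  form\<close>

lemma nondeg28: assumes "\<And>y. rbil g28 x y = 0" shows "x = 0"
proof (rule ccontr)
  assume x: "x \<noteq> 0"
  have c: "rbil g28 x (\<chi> i. if ix28 i = k then 1 else 0) = bform 3 (\<lambda>k. x $ of_nat k) (\<lambda>a. if a = k then 1 else 0)" for k
    unfolding rbil28 by (rule bform_cong) (simp_all add: ix28_of_nat)
  have "x $ of_nat 0 = 0" "x $ of_nat 1 = 0" "x $ of_nat 2 = 0" "x $ of_nat 3 = 0"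
    using c[of 1] c[of 0] c[of 3] c[of 2] assms by (simp_all add: bform_def e8form_def)
  then have "p28 x = 0" "q28 x = 0" by (simp_all add: p28_def q28_def)
  then have "rbil g28 x x < 0" by (rule Q28.neg[OF x])
  then show False using assms[of x] by simp
qed

lemma independent_functionals:
  assumes "x \<noteq> 0" "\<And>c. r \<noteq> c *\<^sub>R x" shows "\<exists>\<xi>. rbil g28 \<xi> x = 0 \<and> rbil g28 \<xi> r \<noteq> 0"
proof (rule ccontr)
  assume "\<not> ?thesis"
  then have H: "rbil g28 \<xi> r = 0" if "rbil g28 \<xi> x = 0" for \<xi> using that by blast
  obtain y where y: "rbil g28 x y \<noteq> 0" using nondeg28[of x] assms(1) by blast
  define c where "c = rbil g28 y r / rbil g28 y x"
  have yx: "rbil g28 y x \<noteq> 0" using y Q28.rbil_sym[of y x] by simp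
  have "rbil g28 (r - c *\<^sub>R x) \<xi> = 0" for \<xi>
  proof -
    have "rbil g28 (\<xi> - (rbil g28 \<xi> x / rbil g28 y x) *\<^sub>R y) x = 0" using yx by (simp add: rbil_lin)
    from H[OF this] have "rbil g28 \<xi> r = c * rbil g28 \<xi> x" by (simp add: rbil_lin c_def)
    then show ?thesis unfolding Q28.rbil_sym[of "r - c *\<^sub>R x"] by (simp add: rbil_lin)
  qed
  then have "r - c *\<^sub>R x = 0" by (rule nondeg28)
  then show False using assms(2)[of c] by simp
qed

text \<open>Cauchy-Schwarz bounds the pairings of a root with the simple roots by 2, and by
  unimodularity these pairings determine the vector.\<close>

lemma finite_Rl: "finite (Rl l)"
proof (rule finite_imageD)
  let ?f = "\<lambda>r. map (\<lambda>k. pe r (al k)) [0..<8]"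
  show "finite (?f ` Rl l)"
  proof (rule finite_subset)
    show "?f ` Rl l \<subseteq> {xs. set xs \<subseteq> {-2..2} \<and> length xs = 8}"
    proof
      fix y assume "y \<in> ?f ` Rl l"
      then obtain r where r: "e8 r r = -2" "y = ?f r" by (auto simp: Rl_def)
      have "pe r (al k) \<in> {-2..2}" if "k < 8" for k
      proof -
        have "(pe r (al k))\<^sup>2 \<le> 2\<^sup>2" using pe_cauchy_schwarz[of r "al k"] r(1) pe_al_al[OF that] by (simp add: pe_def)
        then have "\<bar>pe r (al k)\<bar> \<le> 2" using abs_le_square_iff[of "pe r (al k)" 2] by simp
        then show ?thesis by auto
      qed
      then show "y \<in> {xs. set xs \<subseteq> {-2..2} \<and> length xs = 8}" unfolding r(2) by auto
    qed
    show "finite {xs::int list. set xs \<subseteq> {-2..2} \<and> length xs = 8}" by (rule finite_lists_length_eq) simp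
  qed
  show "inj_on ?f (Rl l)"
  proof (rule inj_onI)
    fix r s assume "?f r = ?f s"
    then have "pe r (al k) = pe s (al k)" if "k < 8" for k using that by (simp add: list_eq_iff_nth_eq)
    then have "0 dvd pe (r - s) (al k)" if "k < 8" for k using that by (simp add: pe_diff)
    then have "0 dvd (r - s) $ i" for i by (rule E8_coprime_coords)
    then show "r = s" by (simp add: vec_eq_iff)
  qed
qed

lemma e8_uminus: "e8 (- r) s = - e8 r s" "e8 r (- s) = - e8 r s"
  using pe_uminus[of r s] pe_uminus[of s r] by (simp_all add: pe_def)

locale quasi_pullback = embedding d l for d l +
  fixes \<Phi> :: "complex^28 \<Rightarrow> complex" and P :: "(int^8) set"
  assumes Phi_mod: "ModForm g28 w28 (Oplus g28 w28) 12 detchar \<Phi>"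
    and Phi_zeros: "\<forall>w\<in>Dom g28 w28. \<Phi> w = 0 \<longleftrightarrow> (\<exists>r::int^28. bil g28 (cvec r) (cvec r) = -2 \<and> bil g28 w (cvec r) = 0)"
    and P_sub: "P \<subseteq> Rl l"
    and P_reps: "\<forall>r\<in>Rl l. (r \<in> P) \<noteq> (- r \<in> P)"
begin

abbreviation "D28 \<equiv> Dom g28 w28"
abbreviation "D21 \<equiv> Dom (g21 d) w21"
abbreviation "pv r \<equiv> ivec (iemb r)"

lemma finite_P: "finite P"
  using finite_Rl P_sub by (rule finite_subset[rotated])

lemma card_Rl: "card (Rl l) = 2 * card P"
proof -
  have m: "- r \<in> Rl l" if "r \<in> Rl l" for r using that by (simp add: Rl_def e8_uminus)
  have "Rl l = P \<union> uminus ` P"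
  proof
    show "P \<union> uminus ` P \<subseteq> Rl l" using P_sub m by blast
    show "Rl l \<subseteq> P \<union> uminus ` P"
    proof
      fix r assume "r \<in> Rl l"
      then have "r \<in> P \<or> - r \<in> P" using P_reps by blast
      then show "r \<in> P \<union> uminus ` P" by (metis UnCI image_eqI minus_minus)
    qed
  qed
  moreover have "P \<inter> uminus ` P = {}"
  proof -
    have "- r \<notin> P" if "r \<in> P" for r using that P_reps P_sub by blast
    then show ?thesis by auto
  qed
  moreover have "card (uminus ` P) = card P" by (rule card_image) (simp add: inj_on_def)
  ultimately show ?thesis using finite_P by (simp add: card_Un_disjoint)
qed

lemma P_root: "r \<in> P \<Longrightarrow> e8 r r = -2" "r \<in> P \<Longrightarrow> e8 r l = 0"
  using P_sub by (auto simp: Rl_def)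

lemma emb8_pv: "emb8 r = rvec (pv r)"
  unfolding emb8_cvec cvec_ivec ..

lemma pv_form: "rbil g28 (pv r) (pv s) = of_int (e8 r s)"
  unfolding rbil_ivec ibil_iemb ..

lemma P_ne: "r \<in> P \<Longrightarrow> \<exists>\<xi>. rbil g28 \<xi> (pv r) \<noteq> 0"
  using P_root(1)[of r] by (intro exI[of _ "pv r"]) (simp add: pv_form)

text \<open>\<open>r\<close> and \<open>s\<close> are neither equal nor opposite, so
  \<open>m\<close> is not 2 or -2, and the component of \<open>s\<close> orthogonal to
  \<open>r\<close> still pairs nontrivially with \<open>s\<close>.\<close>

lemma P_indep: assumes "r \<in> P" "s \<in> P" "r \<noteq> s" shows "\<exists>\<xi>. rbil g28 \<xi> (pv r) = 0 \<and> rbil g28 \<xi> (pv s) \<noteq> 0"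
proof -
  define m where "m = pe r s"
  have m: "m \<noteq> 2" "m \<noteq> -2"
  proof -
    have p: "pe r r = 2" "pe s s = 2" using P_root(1) assms by (simp_all add: pe_def)
    have "pe (r - s) (r - s) = 4 - 2 * m" "pe (r + s) (r + s) = 4 + 2 * m"
      using p by (simp_all add: pe_diff pe_add m_def pe_sym[of s r])
    moreover have "r - s \<noteq> 0" using assms by simp
    moreover have "r + s \<noteq> 0"
    proof
      assume "r + s = 0"
      then have "s = - r" by (simp add: eq_neg_iff_add_eq_0 add.commute)
      then show False using P_reps P_sub assms by blast
    qed
    ultimately show "m \<noteq> 2" "m \<noteq> -2" using pe_eq_0[of "r - s"] pe_eq_0[of "r + s"] by auto
  qed
  have f: "rbil g28 (pv r) (pv r) = -2" "rbil g28 (pv s) (pv s) = -2" "rbil g28 (pv r) (pv s) = - of_int m" "rbil g28 (pv s) (pv r) = - of_int m"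
    using P_root(1) assms by (simp_all add: pv_form m_def pe_def pe_sym[of s r, unfolded pe_def, simplified])
  let ?x = "pv s - (of_int m / 2) *\<^sub>R pv r"
  have "rbil g28 ?x (pv r) = 0" by (simp add: rbil_lin f)
  moreover have "rbil g28 ?x (pv s) = ((of_int m)\<^sup>2 - 4) / 2" by (simp add: rbil_lin f power2_eq_square field_simps)
  moreover have "(real_of_int m)\<^sup>2 \<noteq> 4"
  proof
    assume "(real_of_int m)\<^sup>2 = 4"
    then have "m\<^sup>2 = 2\<^sup>2" by (metis of_int_eq_iff of_int_numeral of_int_power power2_eq_square num_double numeral_times_numeral)
    then show False using m unfolding power2_eq_iff by simp
  qed
  ultimately show ?thesis by (intro exI[of _ ?x]) simp
qed

lemma Phi_holo: "holo_on \<Phi> D28"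
  using Phi_mod by (simp add: ModForm_def)

lemma Phi_smult: "t \<noteq> 0 \<Longrightarrow> w \<in> D28 \<Longrightarrow> \<Phi> (t *s w) = inverse t ^ 12 * \<Phi> w"
  using Phi_mod by (simp add: ModForm_def)

lemma Phi_act: "g \<in> Oplus g28 w28 \<Longrightarrow> w \<in> D28 \<Longrightarrow> \<Phi> (act g w) = detchar g * \<Phi> w"
  using Phi_mod by (simp add: ModForm_def)

lemma Phi_root: "w \<in> D28 \<Longrightarrow> ibil g28 r r = -2 \<Longrightarrow> bil g28 w (cvec r) = 0 \<Longrightarrow> \<Phi> w = 0"
  using Phi_zeros bil_cvec[of g28 r r] by force

lemma quotient: "\<exists>G. holo_on G D28 \<and> (\<forall>w\<in>D28. \<Phi> w = G w * (\<Prod>r\<in>P. bil g28 w (emb8 r)))"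
  unfolding emb8_pv
proof (rule Q28.quotient_exists[OF finite_P P_ne P_indep Phi_holo])
  fix r z assume "r \<in> P" "z \<in> D28" "bil g28 z (rvec (pv r)) = 0"
  then show "\<Phi> z = 0" using Phi_root[of z "iemb r"] P_root(1)[of r] by (simp add: ibil_iemb cvec_ivec)
qed

context
  fixes G assumes Gh: "holo_on G D28" and GP: "\<And>w. w \<in> D28 \<Longrightarrow> \<Phi> w = G w * (\<Prod>r\<in>P. bil g28 w (emb8 r))"
begin

lemma G_cont: "continuous_on D28 G"
  by (rule holo_on_continuous[OF Gh])

lemma cancel:
  assumes "continuous_on D28 A" "continuous_on D28 B" "\<And>z. z \<in> D28 \<Longrightarrow> A z * (\<Prod>r\<in>P. bil g28 z (emb8 r)) = B z * (\<Prod>r\<in>P. bil g28 z (emb8 r))" "z \<in> D28"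
  shows "A z = B z"
  by (rule Q28.PR_cancel[OF finite_P P_ne P_indep, where O'=UNIV and z=z]) (use assms in \<open>simp_all add: emb8_pv\<close>)

lemma G_smult: assumes "t \<noteq> 0" "w \<in> D28" shows "G (t *s w) = inverse t ^ (12 + card P) * G w"
proof -
  have "t ^ (12 + card P) * G (t *s w) = G w"
  proof (rule cancel[of "\<lambda>w. t ^ (12 + card P) * G (t *s w)" G])
    show "continuous_on D28 (\<lambda>w. t ^ (12 + card P) * G (t *s w))"
      by (intro continuous_intros continuous_on_compose2[OF G_cont]) (use Q28.Dom_smult assms in auto)
    fix z assume z: "z \<in> D28"
    have pr: "(\<Prod>r\<in>P. bil g28 (t *s z) (emb8 r)) = t ^ card P * (\<Prod>r\<in>P. bil g28 z (emb8 r))"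
      by (simp add: bil_smult prod.distrib)
    have "inverse t ^ 12 * (G z * (\<Prod>r\<in>P. bil g28 z (emb8 r))) = G (t *s z) * (t ^ card P * (\<Prod>r\<in>P. bil g28 z (emb8 r)))"
      using Phi_smult[OF assms(1) z] unfolding GP[OF z] GP[OF Q28.Dom_smult[OF z assms(1)]] pr by (rule sym)
    then have e: "t ^ 12 * (inverse t ^ 12 * (G z * (\<Prod>r\<in>P. bil g28 z (emb8 r)))) = t ^ 12 * (G (t *s z) * (t ^ card P * (\<Prod>r\<in>P. bil g28 z (emb8 r))))" by simp
    have c: "t ^ 12 * (inverse t ^ 12 * x) = x" for x using assms(1) by (simp add: power_inverse)
    show "t ^ (12 + card P) * G (t *s z) * (\<Prod>r\<in>P. bil g28 z (emb8 r)) = G z * (\<Prod>r\<in>P. bil g28 z (emb8 r))"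
      using e unfolding c power_add by (simp only: mult_ac)
  qed (use assms G_cont in auto)
  moreover have "inverse t ^ (12 + card P) * (t ^ (12 + card P) * x) = x" for x using assms(1) by (simp add: power_inverse)
  ultimately show ?thesis by metis
qed

lemma G_ext: assumes g: "g \<in> Otilde (g21 d) w21" and w: "w \<in> D28" shows "G (act (ext g) w) = detchar g * G w"
proof (rule cancel[of "\<lambda>w. G (act (ext g) w)" "\<lambda>w. detchar g * G w"])
  have O: "ext g \<in> Oplus g28 w28" by (rule ext_Oplus(1)[OF g])
  have im: "act (ext g) z \<in> D28" if "z \<in> D28" for z using O that unfolding Oplus_def by blast
  show "continuous_on D28 (\<lambda>w. G (act (ext g) w))"
    by (intro continuous_on_compose2[OF G_cont] continuous_intros) (use im in auto)
  show "continuous_on D28 (\<lambda>w. detchar g * G w)" by (intro continuous_intros G_cont)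
  fix z assume z: "z \<in> D28"
  have "(\<Prod>r\<in>P. bil g28 (act (ext g) z) (emb8 r)) = (\<Prod>r\<in>P. bil g28 z (emb8 r))"
    by (rule prod.cong[OF refl]) (rule ext_Oplus(3)[OF g P_root(2)])
  then have "G (act (ext g) z) * (\<Prod>r\<in>P. bil g28 z (emb8 r)) = \<Phi> (act (ext g) z)" using GP[OF im[OF z]] by simp
  also have "\<dots> = detchar (ext g) * \<Phi> z" by (rule Phi_act[OF O z])
  also have "detchar (ext g) = detchar g" by (simp add: detchar_def ext_Oplus(4)[OF g])
  finally show "G (act (ext g) z) * (\<Prod>r\<in>P. bil g28 z (emb8 r)) = detchar g * G z * (\<Prod>r\<in>P. bil g28 z (emb8 r))"
    by (simp only: GP[OF z] mult.assoc)
qed (rule w)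

lemma F_holo: "holo_on (G \<circ> iota l) D21"
  unfolding holo_on_def
proof (rule ballI)
  fix w assume w: "w \<in> D21"
  have "\<exists>U G'. open U \<and> iota l w \<in> U \<and> cholo_on G' U \<and> (\<forall>z\<in>U \<inter> D28. G' z = G z)"
    using bspec[OF Gh[unfolded holo_on_def] iota_Dom[OF w]] .
  then obtain U G' where U: "open U" "iota l w \<in> U" "cholo_on G' U" "\<forall>z\<in>U \<inter> D28. G' z = G z" by (elim exE conjE)
  have "cholo_on (\<lambda>z. G' (iota l z)) (iota l -` U)"
    by (rule cholo_on_compose[OF U(3) cholo_iota_nth]) auto
  moreover have "open (iota l -` U)" by (rule open_vimage[OF U(1) continuous_on_iota])
  moreover have "\<forall>z\<in>iota l -` U \<inter> D21. G' (iota l z) = (G \<circ> iota l) z"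
  proof
    fix z assume z: "z \<in> iota l -` U \<inter> D21"
    then have "iota l z \<in> U \<inter> D28" using iota_Dom[of z] by simp
    then show "G' (iota l z) = (G \<circ> iota l) z" using U(4) by simp
  qed
  ultimately show "\<exists>U G'. open U \<and> w \<in> U \<and> cholo_on G' U \<and> (\<forall>z\<in>U \<inter> D21. G' z = (G \<circ> iota l) z)"
    using U(2) by (intro exI[of _ "iota l -` U"] exI[of _ "\<lambda>z. G' (iota l z)"] conjI) simp_all
qed

lemma F_modular: "ModForm (g21 d) w21 (Otilde (g21 d) w21) (12 + card (Rl l) div 2) detchar (G \<circ> iota l)"
proof -
  have k: "12 + card (Rl l) div 2 = 12 + card P" by (simp add: card_Rl)
  have "(G \<circ> iota l) (t *s w) = inverse t ^ (12 + card P) * (G \<circ> iota l) w" if "t \<noteq> 0" "w \<in> D21" for t w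
    using G_smult[OF that(1) iota_Dom[OF that(2)]] by (simp add: iota_giota giota_lin)
  moreover have "(G \<circ> iota l) (act g w) = detchar g * (G \<circ> iota l) w" if "g \<in> Otilde (g21 d) w21" "w \<in> D21" for g w
    using G_ext[OF that(1) iota_Dom[OF that(2)]] ext_Oplus(2)[OF that(1), of w] by simp
  ultimately show ?thesis unfolding ModForm_def k using F_holo by simp
qed

lemma G_root:
  assumes x: "ibil g28 x x = -2" "\<And>r c. r \<in> P \<Longrightarrow> pv r \<noteq> c *\<^sub>R ivec x" and z: "z \<in> D28" "bil g28 z (cvec x) = 0"
  shows "G z = 0"
proof (rule continuous_zero_closure[OF G_cont])
  have x0: "ivec x \<noteq> 0"
  proof
    assume "ivec x = 0"
    then have "rbil g28 (ivec x) (ivec x) = 0" by (simp add: rbil_zero)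
    then show False unfolding rbil_ivec x(1) by simp
  qed
  let ?S = "{z \<in> D28. bil g28 z (rvec (ivec x)) = 0 \<and> (\<forall>r\<in>pv ` P. bil g28 z (rvec r) \<noteq> 0)}"
  show "z \<in> closure ?S"
  proof (rule Q28.Dom_dense_avoiding[OF z(1)])
    show "bil g28 z (rvec (ivec x)) = 0" using z(2) by (simp add: cvec_ivec)
    show "finite (pv ` P)" using finite_P by simp
    fix r assume "r \<in> pv ` P"
    then obtain s where s: "s \<in> P" "r = pv s" by blast
    show "\<exists>\<xi>. rbil g28 \<xi> (ivec x) = 0 \<and> rbil g28 \<xi> r \<noteq> 0"
      unfolding s(2) by (rule independent_functionals[OF x0 x(2)[OF s(1)]])
  qed
  show "?S \<subseteq> D28" by blast
  fix y assume y: "y \<in> ?S"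
  then have "\<Phi> y = 0" using Phi_root[of y x] x(1) by (simp add: cvec_ivec)
  moreover have "(\<Prod>r\<in>P. bil g28 y (emb8 r)) \<noteq> 0" using y finite_P by (simp add: emb8_pv)
  ultimately show "G y = 0" using GP[of y] y by simp
qed (rule z(1))

lemma F_root: assumes r: "bil (g21 d) (cvec r) (cvec r) = -2" and w: "w \<in> D21" "bil (g21 d) w (cvec r) = 0"
  shows "(G \<circ> iota l) w = 0"
proof -
  have "complex_of_int (ibil (g21 d) r r) = complex_of_int (-2)" using r unfolding bil_cvec by simp
  then have r2: "ibil (g21 d) r r = -2" by (simp only: of_int_eq_iff)
  have "G (iota l w) = 0"
  proof (rule G_root[of "giota l r"])
    show "ibil g28 (giota l r) (giota l r) = -2" by (simp add: ibil_giota r2)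
    show "bil g28 (iota l w) (cvec (giota l r)) = 0"
      unfolding giota_cvec[symmetric] iota_giota[symmetric] bil_iota by (rule w(2))
    show "iota l w \<in> D28" by (rule iota_Dom[OF w(1)])
    fix s c assume s: "s \<in> P"
    show "pv s \<noteq> c *\<^sub>R ivec (giota l r)"
    proof
      assume e: "pv s = c *\<^sub>R ivec (giota l r)"
      have "complex_of_real (rbil g28 (giota l (ivec r)) (pv s)) = 0"
        unfolding bil_rvec[symmetric] emb8_pv[symmetric] giota_rvec[symmetric] iota_giota[symmetric] bil_iota_emb8 by (simp add: P_root(2)[OF s])
      then have "rbil g28 (pv s) (pv s) = 0" by (subst e) (simp add: rbil_lin giota_ivec)
      then show False by (simp add: pv_form P_root(1)[OF s])
    qed
  qed
  then show ?thesis by simp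
qed

end

end

section \<open>The branch divisor\<close>

lemma linear_kernel_nontrivial:
  fixes f :: "real^'n::finite \<Rightarrow> 'b::euclidean_space"
  assumes "linear f" "DIM('b) < CARD('n)" shows "\<exists>x. x \<noteq> 0 \<and> f x = 0"
proof (rule ccontr)
  assume "\<not> ?thesis"
  then have "inj f" using assms(1) by (auto simp: linear_injective_0)
  then have "dim (f ` UNIV) = dim (UNIV :: (real^'n) set)" using dim_image_eq[OF assms(1), of UNIV] by simp
  moreover have "dim (f ` UNIV) \<le> DIM('b)" by (rule dim_subset_UNIV)
  ultimately show False using assms(2) by simp
qed

lemma rvec_axis1: "rvec (axis k 1) = axis k 1"
  by (simp add: vec_eq_iff rvec_def axis_def)

context quad begin

text \<open>Adding a multiple of an isotropic \<open>x\<close> orthogonal to \<open>z\<close> keeps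
  the norm 0, and positivity is open. The hermitian product with \<open>z\<close> stays nonzero so
  that eigenvalues at the two points can be compared.\<close>

lemma small_perturbation:
  assumes z: "z \<in> Dom gr w0" and x: "bil gr x z = 0" "bil gr x x = 0"
  shows "\<exists>\<epsilon>>0. z + of_real \<epsilon> *s x \<in> Dom gr w0 \<and> bil gr z (conjv (z + of_real \<epsilon> *s x)) \<noteq> 0"
proof -
  define p where "p = (\<lambda>s::real. z + of_real s *s x)"
  have zc: "bil gr z z = 0" "0 < Re (bil gr z (conjv z))" using z Dom_subset_cone unfolding cone_def by blast+
  have pc: "continuous_on UNIV p" unfolding p_def by (intro continuous_intros)
  have piso: "bil gr (p s) (p s) = 0" for s
    unfolding p_def by (simp add: bil_lin x zc bil_sym[of z x])
  define O1 where "O1 = {s. 0 < Re (bil gr (p s) (conjv (p s)))} \<inter> {s. 0 < Re (bil gr z (conjv (p s)))}"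
  have "open O1" unfolding O1_def by (intro open_Int open_Collect_less continuous_intros pc)
  moreover have "0 \<in> O1" using zc by (simp add: O1_def p_def)
  ultimately obtain e where e: "e > 0" "ball 0 e \<subseteq> O1" using open_contains_ball by blast
  have sub: "p ` ball 0 e \<subseteq> Dom gr w0"
  proof (rule Dom_maximal[of _ z])
    show "connected (p ` ball 0 e)" by (intro connected_continuous_image continuous_on_subset[OF pc] connected_ball) simp
    show "p ` ball 0 e \<subseteq> cone gr"
    proof
      fix y assume "y \<in> p ` ball 0 e"
      then obtain s where s: "s \<in> O1" "y = p s" using e by blast
      then show "y \<in> cone gr" using piso unfolding cone_def O1_def by simp
    qed
    show "z \<in> p ` ball 0 e" using e(1) by (intro image_eqI[of _ _ 0]) (auto simp: p_def)
  qed (rule z)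
  have h: "e/2 \<in> ball 0 e" using e(1) by simp
  then have "p (e/2) \<in> Dom gr w0" "e/2 \<in> O1" using sub e(2) by blast+
  then show ?thesis using e(1) unfolding O1_def p_def by (intro exI[of _ "e/2"]) auto
qed

text \<open>The isotropic vectors orthogonal to \<open>v\<close> and \<open>z\<close> are eigenvectors of \<open>g\<close> and span \<open>{v,z}\<^sup>\<bottom>\<close>; the image of
  \<open>g - \<lambda>\<close> is orthogonal to its kernel, so it is a line.\<close>
lemma divisor_fixing_is_reflection:
  assumes n: "6 < CARD('n)" and inv: "\<And>x y. bil gr (act g x) (act g y) = bil gr x y"
    and z: "z \<in> Dom gr w0" "bil gr z v = 0"
    and fx: "\<And>z. z \<in> Dom gr w0 \<Longrightarrow> bil gr z v = 0 \<Longrightarrow> parallel (act g z) z"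
    and nt: "w \<in> Dom gr w0" "\<not> parallel (act g w) w"
  shows "\<exists>s y. (s = 1 \<or> s = -1) \<and> rbil gr (ivec y) (ivec y) < 0 \<and> bil gr z (cvec y) = 0 \<and> act g z = of_real s *s z \<and>
    (\<forall>b. rmat g *v b = s *\<^sub>R b - (2 * s * rbil gr b (ivec y) / rbil gr (ivec y) (ivec y)) *\<^sub>R ivec y)"
proof -
  have zc: "z \<in> cone gr" using z Dom_subset_cone by blast
  define X where "X = rev z"
  define Y where "Y = imv z"
  have XY: "rbil gr X X = rbil gr Y Y" "rbil gr X Y = 0" "rbil gr Y Y > 0" using zc unfolding cone_iff X_def Y_def by auto
  have zz: "bil gr z (conjv z) \<noteq> 0" using zc unfolding cone_def by auto
  obtain t where t: "act g z = t *s z" using fx[OF z] unfolding parallel_def by blast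
  have invc: "bil gr (act g x) (conjv (act g y)) = bil gr x (conjv y)" for x y
    using inv[of x "conjv y"] unfolding act_conjv .
  have tt: "t * cnj t = 1" using invc[of z z] zz unfolding t conjv_lin bil_smult by (simp add: mult.assoc[symmetric] mult.commute)
  have iso: "act g x = t *s x" if x: "bil gr x v = 0" "bil gr x z = 0" "bil gr x x = 0" for x
  proof -
    obtain e where e: "e > 0" "z + of_real e *s x \<in> Dom gr w0" "bil gr z (conjv (z + of_real e *s x)) \<noteq> 0"
      using small_perturbation[OF z(1) x(2,3)] by blast
    have "bil gr (z + of_real e *s x) v = 0" by (simp add: bil_lin z x)
    from fx[OF e(2) this] obtain t' where t': "act g (z + of_real e *s x) = t' *s (z + of_real e *s x)" unfolding parallel_def by blast
    \<comment> \<open>Hermitian products are preserved and \<open>z\<close> has nonzero product with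
      the nearby point, so \<open>t * cnj t' = 1\<close>; as \<open>t\<close> has modulus 1, the two
      eigenvalues coincide.\<close>
    have "t * cnj t' * bil gr z (conjv (z + of_real e *s x)) = bil gr z (conjv (z + of_real e *s x))"
      using invc[of z "z + of_real e *s x"] unfolding t t' conjv_lin(3) bil_smult by (simp only: mult.assoc mult.left_commute)
    then have "t * cnj t' = 1" using e(3) by simp
    then have "cnj t' = cnj t" using tt by (metis mult_cancel_left mult_zero_left zero_neq_one)
    then have "t' = t" by simp
    then have "of_real e *s act g x = of_real e *s (t *s x)" using t' unfolding act_lin t by (simp add: vec_eq_iff algebra_simps)
    then show ?thesis using e(1) by (simp add: vec_eq_iff)
  qed
  \<comment> \<open>Six real conditions: two from the plane of \<open>z\<close> and two from each of
    the complex vectors \<open>v\<close> and \<open>x\<close>. Hence the bound on the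
    dimension.\<close>
  have realvec: "\<exists>w. w \<noteq> 0 \<and> rbil gr w X = 0 \<and> rbil gr w Y = 0 \<and> bil gr (rvec w) v = 0 \<and> bil gr (rvec w) x = 0" for x
  proof -
    let ?f = "\<lambda>w. (rbil gr w X, rbil gr w Y, bil gr (rvec w) v, bil gr (rvec w) x)"
    have "linear ?f" by (rule linearI) (simp_all add: rbil_lin bil_lin rvec_lin scaleR_conv_of_real[where 'a=complex])
    from linear_kernel_nontrivial[OF this] n show ?thesis by (auto simp: zero_prod_def)
  qed
  have bilz: "bil gr (rvec w) z = 0" if "rbil gr w X = 0" "rbil gr w Y = 0" for w
    using that unfolding bil_sym[of _ z] bil_rvec_right X_def Y_def by (simp add: rbil_sym[of w] complex_eq_iff)
  have eig: "act g x = t *s x" if x: "bil gr x v = 0" "bil gr x z = 0" for x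
  proof -
    obtain w where w: "w \<noteq> 0" "rbil gr w X = 0" "rbil gr w Y = 0" "bil gr (rvec w) v = 0" "bil gr (rvec w) x = 0"
      using realvec[of x] by blast
    have ww: "rbil gr w w \<noteq> 0" using orthogonal_to_plane(2)[OF XY w(2,3)] w(1) by blast
    \<comment> \<open>Chosen so that \<open>x + k *s rvec w\<close> and
      \<open>x - k *s rvec w\<close> are both isotropic; \<open>x\<close> is half their sum.\<close>
    define k where "k = csqrt (- bil gr x x / of_real (rbil gr w w))"
    have k2: "k * k = - bil gr x x / of_real (rbil gr w w)" unfolding k_def by (metis power2_csqrt power2_eq_square)
    have "bil gr (x + c *s rvec w) (x + c *s rvec w) = 0" if "c = k \<or> c = - k" for c
    proof -
      have "c * c = k * k" using that by auto
      then show ?thesis using ww by (simp add: bil_lin bil_rvec w(5) bil_sym[of x "rvec w"] mult.assoc[symmetric] k2)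
    qed
    moreover have "bil gr (x + c *s rvec w) v = 0" "bil gr (x + c *s rvec w) z = 0" for c using x w(4) bilz[OF w(2,3)] by (simp_all add: bil_lin)
    ultimately have "act g (x + k *s rvec w) = t *s (x + k *s rvec w)" "act g (x + (- k) *s rvec w) = t *s (x + (- k) *s rvec w)"
      using iso by blast+
    then have "act g x + k *s act g (rvec w) = t *s (x + k *s rvec w)" "act g x + (- k) *s act g (rvec w) = t *s (x + (- k) *s rvec w)"
      by (simp_all only: act_lin)
    then have "(act g x + k *s act g (rvec w)) + (act g x + (- k) *s act g (rvec w)) = t *s (x + k *s rvec w) + t *s (x + (- k) *s rvec w)"
      by simp
    then have "((act g x + k *s act g (rvec w)) + (act g x + (- k) *s act g (rvec w))) $ i = (t *s (x + k *s rvec w) + t *s (x + (- k) *s rvec w)) $ i" for i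
      by (simp only:)
    then have "2 * (act g x $ i) = 2 * ((t *s x) $ i)" for i by (simp add: algebra_simps)
    then show ?thesis by (simp add: vec_eq_iff)
  qed
  \<comment> \<open>There is a real eigenvector, and a real matrix maps it to a real vector, so the
    eigenvalue is real.\<close>
  obtain s where s: "t = of_real s"
  proof -
    obtain w where w: "w \<noteq> 0" "rbil gr w X = 0" "rbil gr w Y = 0" "bil gr (rvec w) v = 0" using realvec[of 0] by blast
    obtain i where i: "w $ i \<noteq> 0" using w(1) by (auto simp: vec_eq_iff)
    have "rvec (rmat g *v w) = t *s rvec w" using eig[OF w(4) bilz[OF w(2,3)]] unfolding act_rvec .
    then have "complex_of_real ((rmat g *v w) $ i) = t * of_real (w $ i)" by (simp add: vec_eq_iff rvec_def)
    then have "t = of_real ((rmat g *v w) $ i / w $ i)" using i by (simp add: field_simps)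
    then show ?thesis using that by blast
  qed
  have "complex_of_real (s * s) = complex_of_real 1" using tt by (simp add: s)
  then have s1: "s * s = 1" by (simp only: of_real_eq_iff)
  then have spm: "s = 1 \<or> s = -1" by (metis mult_1 power2_eq_1_iff power2_eq_square)
  define N where "N = (\<lambda>b. rmat g *v b - s *\<^sub>R b)"
  have N: "rvec (N b) = act g (rvec b) - t *s rvec b" for b unfolding N_def rvec_lin act_rvec s ..
  have Nlin: "linear N" unfolding N_def by (intro linearI) (simp_all add: matrix_vector_right_distrib scaleR_matrix_vector_assoc[symmetric] algebra_simps)
  have orth: "bil gr (rvec (N b)) y = 0" if y: "act g y = t *s y" for b y
  proof -
    have "bil gr (act g (rvec b)) y = t * (t * bil gr (act g (rvec b)) y)" using s1 by (simp add: s mult.assoc[symmetric] flip: of_real_mult)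
    also have "\<dots> = t * bil gr (act g (rvec b)) (act g y)" unfolding y bil_smult ..
    also have "\<dots> = t * bil gr (rvec b) y" unfolding inv ..
    finally show ?thesis unfolding N bil_diff bil_smult by simp
  qed
  have NX: "rbil gr (N b) X = 0" "rbil gr (N b) Y = 0" for b
  proof -
    have "Complex (rbil gr X (N b)) (rbil gr Y (N b)) = 0" using orth[OF t, of b] unfolding bil_sym[of _ z] bil_rvec_right X_def Y_def .
    then show "rbil gr (N b) X = 0" "rbil gr (N b) Y = 0" unfolding rbil_sym[of "N b"] by (simp_all add: complex_eq_iff)
  qed
  \<comment> \<open>Some combination \<open>x\<close> of two image vectors is orthogonal to
    \<open>v\<close>, hence an eigenvector, hence orthogonal to the image that contains it. Its real
    and imaginary parts lie in a negative definite space, so \<open>x = 0\<close>.\<close>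
  have dep: "\<exists>c. N b = c *\<^sub>R N a" if na: "N a \<noteq> 0" for a b
  proof -
    obtain k1 k2 where k: "(k1,k2) \<noteq> (0,0)" "k1 * bil gr (rvec (N a)) v + k2 * bil gr (rvec (N b)) v = 0"
    proof (cases "bil gr (rvec (N a)) v = 0")
      case True then show ?thesis using that[of 1 0] by simp
    next
      case False then show ?thesis using that[of "- bil gr (rvec (N b)) v" "bil gr (rvec (N a)) v"] by (simp add: mult.commute)
    qed
    define x where "x = k1 *s rvec (N a) + k2 *s rvec (N b)"
    have "bil gr x v = 0" using k(2) by (simp add: x_def bil_lin)
    moreover have "bil gr x z = 0" using bilz[OF NX] by (simp add: x_def bil_lin)
    ultimately have ex: "act g x = t *s x" by (rule eig)
    have "bil gr x (conjv x) = cnj k1 * bil gr (rvec (N a)) x + cnj k2 * bil gr (rvec (N b)) x"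
    proof -
      have "conjv x = cnj k1 *s rvec (N a) + cnj k2 *s rvec (N b)" unfolding x_def conjv_lin by simp
      have "bil gr x (conjv x) = bil gr (conjv x) x" by (rule bil_sym)
      also have "\<dots> = bil gr (cnj k1 *s rvec (N a) + cnj k2 *s rvec (N b)) x" by (rule arg_cong[where f="\<lambda>u. bil gr u x"]) fact
      finally show ?thesis by (simp only: bil_add bil_smult)
    qed
    then have xx: "rbil gr (rev x) (rev x) + rbil gr (imv x) (imv x) = 0"
      using orth[OF ex] bil_self_conjv[of x] by (simp flip: of_real_add)
    have rx: "rev x = Re k1 *\<^sub>R N a + Re k2 *\<^sub>R N b" "imv x = Im k1 *\<^sub>R N a + Im k2 *\<^sub>R N b"
      by (simp_all add: x_def vec_eq_iff rev_def imv_def rvec_def)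
    have o1: "rbil gr (rev x) X = 0" "rbil gr (rev x) Y = 0" "rbil gr (imv x) X = 0" "rbil gr (imv x) Y = 0" unfolding rx by (simp_all add: rbil_lin NX)
    have "rbil gr (rev x) (rev x) \<le> 0" "rbil gr (imv x) (imv x) \<le> 0"
      using orthogonal_to_plane(1)[OF XY o1(1,2)] orthogonal_to_plane(1)[OF XY o1(3,4)] .
    then have "rbil gr (rev x) (rev x) = 0" "rbil gr (imv x) (imv x) = 0" using xx by linarith+
    then have "rev x = 0" "imv x = 0" using orthogonal_to_plane(2)[OF XY o1(1,2)] orthogonal_to_plane(2)[OF XY o1(3,4)] by blast+
    then have r0: "Re k1 *\<^sub>R N a + Re k2 *\<^sub>R N b = 0" "Im k1 *\<^sub>R N a + Im k2 *\<^sub>R N b = 0" using rx by simp_all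
    have sol: "\<exists>c. N b = c *\<^sub>R N a" if "p *\<^sub>R N a + q *\<^sub>R N b = 0" "p \<noteq> 0 \<or> q \<noteq> 0" for p q :: real
    proof -
      have "q \<noteq> 0" using that na by auto
      have "q *\<^sub>R N b = (- p) *\<^sub>R N a" using that(1) by (simp add: eq_neg_iff_add_eq_0 add.commute)
      then have "inverse q *\<^sub>R (q *\<^sub>R N b) = inverse q *\<^sub>R ((- p) *\<^sub>R N a)" by simp
      then have "N b = (inverse q * (- p)) *\<^sub>R N a" using \<open>q \<noteq> 0\<close> by simp
      then show ?thesis by blast
    qed
    show ?thesis
    proof (cases "Re k1 \<noteq> 0 \<or> Re k2 \<noteq> 0")
      case True then show ?thesis using sol[OF r0(1)] by blast
    next
      case False
      then have "Im k1 \<noteq> 0 \<or> Im k2 \<noteq> 0" using k(1) by (auto simp: complex_eq_iff)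
      then show ?thesis using sol[OF r0(2)] by blast
    qed
  qed
  obtain k where k: "N (axis k 1) \<noteq> 0"
  proof -
    have "\<exists>k. N (axis k 1) \<noteq> 0"
    proof (rule ccontr)
      assume "\<not> ?thesis"
      then have "N (axis k 1) = 0" for k by blast
      then have col: "act g (axis k 1) = t *s axis k 1" for k
        using N[of "axis k 1"] unfolding rvec_axis1 by (simp add: rvec_lin)
      have "act g w = t *s w"
      proof -
        have w: "w = (\<Sum>k\<in>UNIV. w $ k *s axis k 1)" by (simp add: vec_eq_iff axis_def if_distrib cong: if_cong)
        have sm: "act g (\<Sum>k\<in>S. f k) = (\<Sum>k\<in>S. act g (f k))" for f :: "'n \<Rightarrow> complex^'n" and S
          by (induction S rule: infinite_finite_induct) (simp_all add: act_lin act_lin(3)[of g 0 0, simplified])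
        have "act g w = (\<Sum>k\<in>UNIV. w $ k *s (t *s axis k 1))" by (subst w) (simp add: sm act_lin col)
        also have "\<dots> = t *s w" by (subst (2) w) (simp add: vec_eq_iff sum_distrib_left mult.assoc mult.left_commute)
        finally show ?thesis .
      qed
      then show False using nt(2) unfolding parallel_def by blast
    qed
    then show ?thesis using that by blast
  qed
  obtain s' :: int where s': "s = of_int s'" using spm by (metis of_int_1 of_int_minus)
  \<comment> \<open>A column of \<open>g - s\<close>, so the normal vector is integral.\<close>
  define y :: "int^'n" where "y = (\<chi> i. g$i$k - s' * (if i = k then 1 else 0))"
  have yN: "ivec y = N (axis k 1)"
    by (simp add: vec_eq_iff ivec_def y_def N_def rmat_def s' matrix_vector_mult_def axis_def if_distrib cong: if_cong)
  have y0: "ivec y \<noteq> 0" using k yN by simp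
  have yXY: "rbil gr (ivec y) X = 0" "rbil gr (ivec y) Y = 0" unfolding yN by (rule NX)+
  have yy: "rbil gr (ivec y) (ivec y) < 0"
    using orthogonal_to_plane[OF XY yXY] y0 by (metis order_less_le)
  have rinv: "rbil gr (rmat g *v a) (rmat g *v b) = rbil gr a b" for a b
  proof -
    have "complex_of_real (rbil gr (rmat g *v a) (rmat g *v b)) = of_real (rbil gr a b)"
      unfolding bil_rvec[symmetric] act_rvec[symmetric] inv ..
    then show ?thesis by (simp only: of_real_eq_iff)
  qed
  have refl: "rmat g *v b = s *\<^sub>R b - (2 * s * rbil gr b (ivec y) / rbil gr (ivec y) (ivec y)) *\<^sub>R ivec y" for b
  proof -
    let ?y = "ivec y" and ?e = "axis k 1 :: real^'n"
    obtain c where c: "N b = c *\<^sub>R ?y" using dep[OF k, of b] yN by auto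
    have gb: "rmat g *v b = s *\<^sub>R b + c *\<^sub>R ?y" using c unfolding N_def by (simp add: algebra_simps)
    have ge: "rmat g *v ?e = s *\<^sub>R ?e + ?y" using yN unfolding N_def by (simp add: algebra_simps)
    have "s * s * rbil gr b ?e + s * rbil gr b ?y + c * (s * rbil gr ?y ?e) + c * rbil gr ?y ?y = rbil gr b ?e"
      using rinv[of b ?e] unfolding gb ge by (simp add: rbil_lin algebra_simps)
    then have e1: "s * rbil gr b ?y + c * (s * rbil gr ?y ?e) + c * rbil gr ?y ?y = 0" using s1 by simp
    have "s * s * rbil gr ?e ?e + s * rbil gr ?e ?y + s * rbil gr ?y ?e + rbil gr ?y ?y = rbil gr ?e ?e"
      using rinv[of ?e ?e] unfolding ge by (simp add: rbil_lin algebra_simps)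
    then have "2 * (s * rbil gr ?y ?e) + rbil gr ?y ?y = 0" using s1 by (simp add: rbil_sym[of ?e ?y])
    then have "c * rbil gr ?y ?y = - 2 * s * rbil gr b ?y" using e1 by algebra
    then have "c = - (2 * s * rbil gr b ?y / rbil gr ?y ?y)" using yy by (simp add: field_simps)
    then show ?thesis unfolding gb by simp
  qed
  have "bil gr z (cvec y) = 0" unfolding cvec_ivec bil_sym[of z] by (rule bilz[OF yXY])
  then show ?thesis using spm yy t refl unfolding s by (intro exI[of _ s] exI[of _ y] conjI allI)
qed

end

section \<open>Negatives of reflections in the stable group\<close>

lemma Gcd_square_dvd:
  fixes f :: "'i \<Rightarrow> int" assumes "\<And>i j. s dvd q * f i * f j" shows "s dvd q * (Gcd (range f))\<^sup>2"
proof -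
  have g: "s dvd c * Gcd (range f)" if "\<And>j. s dvd c * f j" for c
  proof -
    have "s dvd Gcd ((*) c ` range f)" by (rule Gcd_greatest) (use that in auto)
    then show ?thesis by (simp add: Gcd_mult)
  qed
  have "s dvd q * f i * Gcd (range f)" for i by (rule g) (rule assms)
  then have "s dvd (q * Gcd (range f)) * f i" for i by (simp add: mult_ac)
  then have "s dvd (q * Gcd (range f)) * Gcd (range f)" by (rule g)
  then show ?thesis by (simp add: power2_eq_square mult_ac)
qed

lemma coprime_mult_square:
  fixes s w n :: int assumes "coprime s w" "s * w = n\<^sup>2" "s \<ge> 0" shows "(gcd s n)\<^sup>2 = s"
proof -
  have "(gcd s n)\<^sup>2 = gcd (s\<^sup>2) (n\<^sup>2)" by simp
  also have "\<dots> = gcd (s * s) (s * w)" by (simp add: assms(2) power2_eq_square)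
  also have "\<dots> = \<bar>s\<bar> * gcd s w" by (simp add: gcd_mult_distrib_int)
  finally show ?thesis using assms by simp
qed

lemma form21_even: "even (ibil (g21 d) m m)"
proof -
  have "even (e8form X X)" for X :: "nat \<Rightarrow> int" unfolding e8form_def by (simp add: mult.commute)
  then have "even (bform 2 X X)" for X :: "nat \<Rightarrow> int" unfolding bform_def by (auto intro!: dvd_sum simp: mult.commute)
  then show ?thesis unfolding ibil21 by simp
qed

text \<open>The summand 2U + 2E8(-1) is unimodular: test vectors supported in one hyperbolic plane
  or one copy of E8(-1) recover the coordinates.\<close>

lemma form21_unimodular_part:
  assumes m: "m $ 20 = 0" and H: "\<And>y. y $ 20 = 0 \<Longrightarrow> p dvd q * ibil (g21 d) y m" shows "p dvd q * m $ a"
proof -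
  have f: "p dvd q * bform 2 Y (\<lambda>k. m $ of_nat k)" for Y
  proof -
    define y :: "int^21" where "y = (\<chi> b. if ix21 b < 20 then Y (ix21 b) else 0)"
    have y: "y $ of_nat k = (if k < 20 then Y k else 0)" if "k < 21" for k using that by (simp add: y_def ix21_of_nat)
    have "y $ 20 = 0" using y[of 20] by simp
    moreover have "bform 2 (\<lambda>k. y $ of_nat k) (\<lambda>k. m $ of_nat k) = bform 2 Y (\<lambda>k. m $ of_nat k)"
      by (rule bform_cong) (simp_all add: y)
    ultimately show ?thesis using H[of y] m by (simp add: ibil21)
  qed
  have c4: "p dvd q * m $ of_nat k" if "k < 4" for k
  proof -
    have "k \<in> {0,1,2,3}" using that lt4 by blast
    then show ?thesis
      using f[of "\<lambda>a. if a = 0 then 1 else 0"] f[of "\<lambda>a. if a = 1 then 1 else 0"] f[of "\<lambda>a. if a = 2 then 1 else 0"] f[of "\<lambda>a. if a = 3 then 1 else 0"]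
      by (elim insertE emptyE) (simp_all add: bform_def e8form_def)
  qed
  have blk: "p dvd q * m $ of_nat (4 + 8 * i + k)" if i: "i < 2" and k: "k < 8" for i k
  proof -
    define x :: "int^8" where "x = (\<chi> c. q * m $ of_nat (4 + 8 * i + ix8 c))"
    have xk: "x $ of_nat k = q * m $ of_nat (4 + 8 * i + k)" if "k < 8" for k using that by (simp add: x_def ix8_of_nat)
    have "p dvd x $ c" for c
    proof (rule E8_coprime_coords)
      fix k' :: nat assume k': "k' < 8"
      define Y where "Y = (\<lambda>a. if 4 + 8 * i \<le> a \<and> a < 12 + 8 * i then al k' $ of_nat (a - (4 + 8 * i)) else 0)"
      have b: "e8form (\<lambda>k. Y (4 + 8 * i' + k)) Z = (if i' = i then e8form (\<lambda>k. al k' $ of_nat k) Z else 0)" for i' and Z :: "nat \<Rightarrow> int"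
      proof (cases "i' = i")
        case True
        show ?thesis unfolding True by (simp only: if_True refl) (rule e8form_cong, auto simp: Y_def simp del: of_nat_add of_nat_diff)
      next
        case False
        have "e8form (\<lambda>k. Y (4 + 8 * i' + k)) Z = e8form (\<lambda>k. 0) Z"
        proof (rule e8form_cong)
          fix k :: nat assume "k < 8"
          then have "\<not> (4 + 8 * i \<le> 4 + 8 * i' + k \<and> 4 + 8 * i' + k < 12 + 8 * i)" using False by presburger
          then show "Y (4 + 8 * i' + k) = 0" unfolding Y_def by (rule if_not_P)
        qed simp
        then show ?thesis using False by (simp add: e8form_def)
      qed
      have "Y 0 = 0" "Y 1 = 0" "Y 2 = 0" "Y 3 = 0" by (simp_all add: Y_def)
      then have "bform 2 Y (\<lambda>k. m $ of_nat k) = (\<Sum>i'<2. if i' = i then e8form (\<lambda>k. al k' $ of_nat k) (\<lambda>k. m $ of_nat (4 + 8 * i' + k)) else 0)"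
        unfolding bform_def b by simp
      also have "\<dots> = e8form (\<lambda>k. al k' $ of_nat k) (\<lambda>k. m $ of_nat (4 + 8 * i + k))" using i by simp
      finally have "q * bform 2 Y (\<lambda>k. m $ of_nat k) = e8form (\<lambda>k. al k' $ of_nat k) (\<lambda>k. q * m $ of_nat (4 + 8 * i + k))"
        by (simp only: e8form_scale)
      also have "\<dots> = e8form (\<lambda>k. al k' $ of_nat k) (\<lambda>k. x $ of_nat k)"
        by (rule e8form_cong[OF refl]) (simp only: xk)
      finally have "q * bform 2 Y (\<lambda>k. m $ of_nat k) = - pe x (al k')" unfolding pe_form by (simp add: e8form_sym[of "\<lambda>k. x $ of_nat k"])
      then show "p dvd pe x (al k')" using f[of Y] by simp
    qed
    then show ?thesis using xk[OF k] by metis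
  qed
  have "p dvd q * m $ of_nat (ix21 a)"
  proof (cases "ix21 a < 4")
    case True then show ?thesis by (rule c4)
  next
    case False
    show ?thesis
    proof (cases "ix21 a = 20")
      case True then show ?thesis using m by simp
    next
      case F: False
      have "ix21 a = 4 + 8 * ((ix21 a - 4) div 8) + (ix21 a - 4) mod 8" using False by simp
      moreover have "(ix21 a - 4) div 8 < 2" using F False ix21_less[of a] by linarith
      ultimately show ?thesis using blk[of "(ix21 a - 4) div 8" "(ix21 a - 4) mod 8"] by (metis mod_less_divisor zero_less_numeral)
    qed
  qed
  then show ?thesis by (simp add: of_nat_ix21)
qed

lemma rmat_ivec: "rmat g *v ivec x = ivec (g *v x)"
  by (simp add: vec_eq_iff rmat_def ivec_def matrix_vector_mult_def)

lemma primitive_multiple: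
  fixes y :: "int^'n"
  assumes "y \<noteq> 0" shows "\<exists>n y'. y = n *s y' \<and> n > 0 \<and> n = Gcd (range (($) y)) \<and> Gcd (range (($) y')) = 1"
proof -
  define n where "n = Gcd (range (($) y))"
  obtain i where "y $ i \<noteq> 0" using assms by (auto simp: vec_eq_iff)
  then have n0: "n \<noteq> 0" unfolding n_def by (auto simp: Gcd_0_iff)
  moreover have "n \<ge> 0" unfolding n_def by simp
  ultimately have np: "n > 0" by simp
  define y' where "y' = (\<chi> i. y $ i div n)"
  have y: "y $ i = n * y' $ i" for i unfolding y'_def n_def by simp
  have "range (($) y) = (*) n ` range (($) y')" using y by auto
  then have "n = n * Gcd (range (($) y'))" unfolding n_def[symmetric] by (metis Gcd_mult abs_of_pos n_def normalize_int_def normalize_mult np normalize_Gcd)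
  then have "Gcd (range (($) y')) = 1" using n0 by simp
  moreover have "y = n *s y'" using y by (simp add: vec_eq_iff)
  ultimately show ?thesis using np n_def by blast
qed

lemma coprime_one_plus: "coprime (1 + a * b) (a::int)"
proof (rule coprimeI)
  fix c assume "c dvd 1 + a * b" "c dvd a"
  then have "c dvd (1 + a * b) - a * b" by (intro dvd_diff dvd_mult2)
  then show "is_unit c" by simp
qed

lemma dvd_from_Ints: assumes "s \<noteq> 0" "real_of_int a / of_int s \<in> \<int>" shows "s dvd a"
proof -
  obtain k where "real_of_int a / of_int s = of_int k" using assms(2) by (rule Ints_cases)
  then have "real_of_int a = of_int (k * s)" using assms(1) by (simp add: field_simps)
  then have "a = k * s" by (simp only: of_int_eq_iff)
  then show ?thesis by simp
qed

context embedding begin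

abbreviation "K21 \<equiv> rbil (g21 d)"

lemma rbil_axis20: "K21 b (axis 20 a) = - 2 * real d * a * b $ 20"
proof -
  have "bform 2 (\<lambda>k. b $ of_nat k) (\<lambda>k. (axis 20 a :: real^21) $ of_nat k) = bform 2 (\<lambda>k. b $ of_nat k) (\<lambda>k. 0)"
  proof (rule bform_cong)
    fix k :: nat assume k: "k < 4 + 8 * 2"
    have "(of_nat k :: 21) \<noteq> 20"
    proof
      assume "(of_nat k :: 21) = 20"
      then have "ix21 (of_nat k) = ix21 (of_nat 20)" by simp
      then show False using k ix21_of_nat[of k] ix21_of_nat[of 20] by simp
    qed
    then show "(axis 20 a :: real^21) $ of_nat k = 0" by (simp add: axis_def)
  qed simp
  moreover have "bform 2 (\<lambda>k. b $ of_nat k) (\<lambda>k. 0) = 0" by (simp add: bform_def e8form_def)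
  ultimately show ?thesis unfolding rbil21 by (simp add: axis_def)
qed

lemma dual_axis20: "(\<Sum>j\<in>UNIV. of_int (g21 d i j) * axis 20 (1 / (2 * real d)) $ j) \<in> \<int>"
proof -
  have "(\<Sum>j\<in>UNIV. of_int (g21 d i j) * axis 20 (1 / (2 * real d)) $ j) = of_int (g21 d i 20) * (1 / (2 * real d))"
    by (simp add: axis_def if_distrib cong: if_cong)
  moreover have "g21 d i 20 = 0 \<or> g21 d i 20 = - 2 * int d" using ix21_of_nat[of 20] unfolding g21_def by simp
  ultimately show ?thesis using d1 by auto
qed

text \<open>For \<open>-\<sigma>\<^sub>y\<close> in the stable group, \<open>\<eta> y\<close> with \<open>\<eta> = -2y\<^sub>2\<^sub>0/y\<^sup>2\<close> is the defect of \<open>-\<sigma>\<^sub>y\<close> on the dual vector \<open>l/(2d)\<close>.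
  Either \<open>\<eta> = 0\<close> and \<open>y\<close> is proportional to a root, or \<open>\<eta> y\<close> has the shape below.\<close>
lemma minus_reflection:
  assumes g: "g \<in> Otilde (g21 d) w21" and Y: "K21 (ivec y) (ivec y) < 0"
    and R: "\<And>b. rmat g *v b = (2 * K21 b (ivec y) / K21 (ivec y) (ivec y)) *\<^sub>R ivec y - b"
  shows "(\<exists>r::int^21. \<exists>n. ibil (g21 d) r r = -2 \<and> y = n *s r \<and> n \<noteq> 0) \<or>
    (\<exists>\<eta> m t N e. \<eta> *\<^sub>R ivec y = ivec ((t * N) *s m) + axis 20 (of_int (t\<^sup>2) / real d) \<and> m $ 20 = 0 \<and> ibil (g21 d) m m = 2 * e
      \<and> t\<^sup>2 = 1 + int d * N\<^sup>2 * e \<and> t \<noteq> 0)"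
proof -
  define k where "k = K21 (ivec y) (ivec y)"
  have k0: "k < 0" using Y by (simp add: k_def)
  have int: "2 * K21 (ivec x) (ivec y) / k * of_int (y $ j) \<in> \<int>" for x j
  proof -
    have "ivec (g *v x) $ j = 2 * K21 (ivec x) (ivec y) / k * of_int (y $ j) - of_int (x $ j)"
      using arg_cong[OF R[of "ivec x"], of "\<lambda>v. v $ j"] unfolding rmat_ivec k_def by (simp add: ivec_def)
    then have "2 * K21 (ivec x) (ivec y) / k * of_int (y $ j) = of_int ((g *v x) $ j + x $ j)" by (simp add: ivec_def)
    then show ?thesis by (metis Ints_of_int)
  qed
  define v :: "real^21" where "v = axis 20 (1 / (2 * real d))"
  define \<eta> where "\<eta> = - 2 * of_int (y $ 20) / k"
  have "\<forall>i. (rmat g *v v - v) $ i \<in> \<int>" using g dual_axis20 unfolding Otilde_def v_def by blast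
  then have "\<exists>c. \<forall>i. (rmat g *v v - v) $ i = of_int (c i)" unfolding Ints_def by (intro choice) blast
  then obtain c where c: "\<And>i. (rmat g *v v - v) $ i = of_int (c i)" by blast
  have "K21 v (ivec y) = K21 (ivec y) v" by (rule Q21.rbil_sym)
  then have "K21 v (ivec y) = - of_int (y $ 20)" using d1 unfolding v_def rbil_axis20 by (simp add: ivec_def)
  then have gv: "rmat g *v v = \<eta> *\<^sub>R ivec y - v" unfolding R k_def[symmetric] \<eta>_def by simp
  then have cc: "\<eta> * of_int (y $ i) = of_int (c i) + (if i = 20 then 1 / real d else 0)" for i
    using c[of i] d1 unfolding gv by (simp add: v_def axis_def ivec_def split: if_splits)
  define m1 :: "int^21" where "m1 = (\<chi> i. if i = 20 then 0 else c i)"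
  \<comment> \<open>The last coordinate of \<open>\<eta> *\<^sub>R ivec y\<close> is
    \<open>c 20 + 1/d\<close>, which is \<open>s/d\<close>.\<close>
  define s where "s = 1 + int d * c 20"
  have m20: "m1 $ 20 = 0" by (simp add: m1_def)
  have eta: "\<eta> *\<^sub>R ivec y = ivec m1 + axis 20 (of_int s / real d)"
    using cc d1 by (simp add: vec_eq_iff ivec_def m1_def axis_def s_def field_simps)
  show ?thesis
  proof (cases "\<eta> = 0")
    case True
    \<comment> \<open>Here \<open>y\<close> lies in the unimodular part. For the primitive vector
      \<open>y'\<close> on its line, integrality of the reflection forces the norm \<open>k'\<close>
      to divide 2; being even and negative, it is -2.\<close>
    then have y20: "y $ 20 = 0" using k0 by (simp add: \<eta>_def)
    have "y \<noteq> 0" using Y by (auto simp: ivec_lin rbil_zero)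
    then obtain n y' where n: "y = n *s y'" "n > 0" "Gcd (range (($) y')) = 1" using primitive_multiple by metis
    define k' where "k' = ibil (g21 d) y' y'"
    have kk: "k = of_int (n * n * k')" unfolding k_def n ivec_lin rbil_lin rbil_ivec k'_def by simp
    have "n * n * k' < 0" using k0 unfolding kk of_int_less_0_iff .
    then have k'0: "k' < 0" using n(2) by (simp add: mult_less_0_iff)
    have d': "k' dvd 2 * y' $ j * ibil (g21 d) x y'" for x j
    proof -
      have "2 * K21 (ivec x) (ivec y) / k * of_int (y $ j) = of_int (2 * y' $ j * ibil (g21 d) x y') / of_int k'"
        unfolding kk n ivec_lin rbil_lin rbil_ivec using n(2) k'0 by (simp add: field_simps)
      then have "real_of_int (2 * y' $ j * ibil (g21 d) x y') / of_int k' \<in> \<int>" using int[of x j] by simp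
      then show ?thesis by (rule dvd_from_Ints[rotated]) (use k'0 in simp)
    qed
    have y'20: "y' $ 20 = 0" using y20 n by simp
    have "k' dvd 2 * (Gcd (range (($) y')))\<^sup>2"
      by (rule Gcd_square_dvd) (rule form21_unimodular_part[OF y'20 d'])
    then have "k' dvd 2" unfolding n by simp
    then have "\<bar>k'\<bar> \<le> 2" using dvd_imp_le_int[of 2 k'] by simp
    moreover have "even k'" unfolding k'_def by (rule form21_even)
    ultimately have "k' = -2" using k'0 by presburger
    then show ?thesis using n(1,2) unfolding k'_def by (intro disjI1 exI[of _ y'] exI[of _ n]) simp
  next
    case False
    have kn: "\<eta> * \<eta> * k = - 2 * of_int s / real d"
    proof -
      have "\<eta> * k = - 2 * of_int (y $ 20)" using k0 by (simp add: \<eta>_def)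
      then have "\<eta> * \<eta> * k = - 2 * (\<eta> * of_int (y $ 20))" by (simp add: mult.assoc)
      also have "\<eta> * of_int (y $ 20) = of_int s / real d" using cc[of 20] d1 by (simp add: s_def field_simps)
      finally show ?thesis by simp
    qed
    have "\<eta> * \<eta> * k < 0" using False k0 by (simp add: mult_less_0_iff zero_less_mult_iff not_less) (metis linorder_neqE_linordered_idom)
    then have "2 * of_int s / real d > 0" unfolding kn by simp
    then have s0: "s > 0" using d1 by (simp add: zero_less_divide_iff)
    have xm: "\<eta> * K21 (ivec x) (ivec y) = of_int (ibil (g21 d) x m1)" if "x $ 20 = 0" for x
    proof -
      have "\<eta> * K21 (ivec x) (ivec y) = K21 (ivec x) (\<eta> *\<^sub>R ivec y)" by (simp add: rbil_lin)
      also have "\<dots> = of_int (ibil (g21 d) x m1)" unfolding eta rbil_lin rbil_axis20 rbil_ivec using that by (simp add: ivec_def)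
      finally show ?thesis .
    qed
    have mm: "ibil (g21 d) m1 m1 = 2 * s * c 20"
    proof -
      have "\<eta> * \<eta> * k = K21 (\<eta> *\<^sub>R ivec y) (\<eta> *\<^sub>R ivec y)" unfolding k_def by (simp add: rbil_lin)
      also have "\<dots> = of_int (ibil (g21 d) m1 m1) - 2 * of_int s * of_int s / real d"
        unfolding eta rbil_add rbil_axis20 Q21.rbil_sym[of "axis 20 _"] rbil_ivec using m20 d1 by (simp add: ivec_def axis_def)
      finally have "real d * of_int (ibil (g21 d) m1 m1) = 2 * of_int s * (of_int s - 1)" unfolding kn using d1 by (simp add: field_simps)
      also have "\<dots> = real d * of_int (2 * s * c 20)" by (simp add: s_def)
      finally have "real_of_int (ibil (g21 d) m1 m1) = of_int (2 * s * c 20)" using d1 by (simp del: of_int_mult)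
      then show ?thesis by (simp only: of_int_eq_iff)
    qed
    have cop: "coprime s (int d)" unfolding s_def by (rule coprime_one_plus)
    \<comment> \<open>Integrality of the reflection gives divisibility of \<open>d\<close> times
      this product by \<open>s\<close>, and \<open>d\<close> is prime to
      \<open>s = 1 + d * c 20\<close>.\<close>
    have "s dvd m1 $ j * ibil (g21 d) x m1" if x: "x $ 20 = 0" for x j
    proof (cases "j = 20")
      case True then show ?thesis by (simp add: m20)
    next
      case j: False
      have yj: "\<eta> * of_int (y $ j) = of_int (m1 $ j)" using cc[of j] j by (simp add: m1_def)
      have "2 * K21 (ivec x) (ivec y) / k * of_int (y $ j) = 2 * (\<eta> * K21 (ivec x) (ivec y)) * (\<eta> * of_int (y $ j)) / (\<eta> * \<eta> * k)"
        using False by simp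
      also have "\<dots> = - (of_int (int d * (m1 $ j * ibil (g21 d) x m1)) / of_int s)"
        unfolding kn xm[OF x] yj using d1 s0 by (simp add: field_simps)
      finally have "real_of_int (int d * (m1 $ j * ibil (g21 d) x m1)) / of_int s \<in> \<int>" using int[of x j] by (metis Ints_minus minus_minus)
      then have "s dvd int d * (m1 $ j * ibil (g21 d) x m1)" by (rule dvd_from_Ints[rotated]) (use s0 in simp)
      then show ?thesis using cop by (simp add: coprime_dvd_mult_right_iff)
    qed
    then have "s dvd m1 $ j * m1 $ i" for i j by (rule form21_unimodular_part[OF m20])
    then have sG: "s dvd 1 * (Gcd (range (($) m1)))\<^sup>2" by (intro Gcd_square_dvd) (simp add: mult.commute)
    \<comment> \<open>Write \<open>m1 = n *s m\<close> with \<open>m\<close> primitive;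
      \<open>s\<close> divides \<open>n^2\<close>, say \<open>n^2 = s * w\<close>. The norm of
      \<open>m1\<close> gives \<open>s = 1 + d * w * e\<close>, so \<open>s\<close> and
      \<open>w\<close> are coprime with square product and are squares \<open>t^2\<close> and
      \<open>N^2\<close>.\<close>
    have "\<exists>m t N e. m1 = (t * N) *s m \<and> s = t\<^sup>2 \<and> m $ 20 = 0 \<and> ibil (g21 d) m m = 2 * e \<and> t\<^sup>2 = 1 + int d * N\<^sup>2 * e \<and> t \<noteq> 0"
    proof (cases "m1 = 0")
      case True
      then have "s * c 20 = 0" using mm by (simp add: ibil_def)
      then have "c 20 = 0" using s0 by simp
      then have "s = 1" by (simp add: s_def)
      then show ?thesis using True by (intro exI[of _ 0] exI[of _ 1]) (simp add: ibil_def)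
    next
      case False
      then obtain n m where n: "m1 = n *s m" "n > 0" "n = Gcd (range (($) m1))" using primitive_multiple by metis
      obtain w where w: "n\<^sup>2 = s * w" using sG n(3) by (auto elim: dvdE)
      obtain e where e: "ibil (g21 d) m m = 2 * e" using form21_even[of d m] by (auto elim: evenE)
      have "ibil (g21 d) m1 m1 = n\<^sup>2 * (2 * e)" unfolding n(1) ibil_lin e by (simp add: power2_eq_square)
      then have "s * (w * e) = s * c 20" using mm w by auto
      then have we: "c 20 = w * e" using s0 by simp
      then have s1: "s = 1 + int d * w * e" by (simp add: s_def)
      have "coprime s w" unfolding s1 using coprime_one_plus[of w "int d * e"] by (simp add: mult_ac)
      have "s * w \<ge> 0" unfolding w[symmetric] by simp
      then have w0: "w \<ge> 0" using s0 by (simp add: zero_le_mult_iff)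
      define t where "t = gcd s n"
      define N where "N = gcd w n"
      have t2: "t\<^sup>2 = s" unfolding t_def by (rule coprime_mult_square[OF \<open>coprime s w\<close> w[symmetric]]) (use s0 in simp)
      have N2: "N\<^sup>2 = w" unfolding N_def by (rule coprime_mult_square[of w s]) (use w w0 \<open>coprime s w\<close> in \<open>simp_all add: coprime_commute mult.commute\<close>)
      have "n\<^sup>2 = (t * N)\<^sup>2" unfolding w power_mult_distrib t2 N2 ..
      moreover have "t * N \<ge> 0" by (simp add: t_def N_def)
      ultimately have nt: "n = t * N" using n(2) by (simp add: power2_eq_iff_nonneg)
      have "n * m $ 20 = 0" using m20 unfolding n(1) by simp
      then have m': "m $ 20 = 0" using n(2) by simp
      have t': "t\<^sup>2 = 1 + int d * N\<^sup>2 * e" unfolding t2 N2 by (rule s1)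
      have t0: "t \<noteq> 0" using t2 s0 by (metis less_irrefl zero_power2)
      show ?thesis
        by (intro exI[of _ m] exI[of _ t] exI[of _ N] exI[of _ e] conjI n(1)[unfolded nt] t2[symmetric] m' e t' t0)
    qed
    then obtain m t N e where m: "m1 = (t * N) *s m" "s = t\<^sup>2" "m $ 20 = 0" "ibil (g21 d) m m = 2 * e" "t\<^sup>2 = 1 + int d * N\<^sup>2 * e" "t \<noteq> 0"
      by (elim exE conjE)
    show ?thesis
      by (intro disjI2 exI[of _ \<eta>] exI[of _ m] exI[of _ t] exI[of _ N] exI[of _ e] conjI eta[unfolded m(1,2)] m(3-6))
  qed
qed

lemma bil_iota_glued: "bil g28 (iota l z) (cvec (j *s giota l m + iemb u)) = of_int j * bil (g21 d) z (cvec m) + z $ 20 * of_int (e8 u l)"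
proof -
  have "bil g28 (iota l z) (cvec (giota l m)) = bil (g21 d) z (cvec m)"
    unfolding giota_cvec[symmetric] iota_giota[symmetric] bil_iota ..
  then show ?thesis unfolding cvec_lin bil_lin using bil_iota_emb8[of z u] by (simp add: emb8_cvec)
qed

lemma ibil_glued: assumes "m $ 20 = 0" shows "ibil g28 (j *s giota l m + iemb u) (j *s giota l m + iemb u) = j * j * ibil (g21 d) m m + e8 u u"
proof -
  have "complex_of_int (ibil g28 (giota l m) (iemb u)) = bil g28 (iota l (cvec m)) (emb8 u)"
    by (simp add: bil_cvec iota_giota giota_cvec emb8_cvec)
  also have "\<dots> = 0" using assms by (simp add: bil_iota_emb8 cvec_def)
  finally have "ibil g28 (giota l m) (iemb u) = 0" by simp
  then show ?thesis using Q28.ibil_sym[of "iemb u" "giota l m"] by (simp add: ibil_lin ibil_giota ibil_iemb)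
qed

end

context quasi_pullback begin

text \<open>With \<open>u\<close>, \<open>j\<close> from \<open>glued_root\<close>, the sum of
  \<open>j\<close> times \<open>m\<close> and \<open>u\<close> has norm
  \<open>2*e*j^2 - pe u u = -2\<close>. The linear relation for \<open>z\<close> and the one for
  \<open>(u, j)\<close> have the same coefficients \<open>N\<close> and \<open>2*t\<close>, which
  makes this root orthogonal to \<open>z\<close>.\<close>

lemma F_vanishes_on_glued_root:
  assumes Gh: "holo_on G D28" and GP: "\<And>w. w \<in> D28 \<Longrightarrow> \<Phi> w = G w * (\<Prod>r\<in>P. bil g28 w (emb8 r))"
    and m: "m $ 20 = 0" "ibil (g21 d) m m = 2 * e" and t: "t\<^sup>2 = 1 + int d * N\<^sup>2 * e" "t \<noteq> 0"
    and z: "z \<in> D21" "of_int N * bil (g21 d) z (cvec m) = 2 * of_int t * z $ 20"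
  shows "(G \<circ> iota l) z = 0"
proof -
  have "pe l l = 2 * int d" "int d > 0" using l2 d1 by (simp_all add: pe_def)
  from glued_root[OF this t] obtain u j where u: "N * pe u l = 2 * t * j" "pe u u - 2 * e * j\<^sup>2 = 2" "pe u l \<noteq> 0" by blast
  have "G (iota l z) = 0"
  proof (rule G_root[OF Gh GP, of "j *s giota l m + iemb u"])
    show "ibil g28 (j *s giota l m + iemb u) (j *s giota l m + iemb u) = -2"
      unfolding ibil_glued[OF m(1)] m(2) using u(2) by (simp add: pe_def power2_eq_square algebra_simps)
    show "iota l z \<in> D28" by (rule iota_Dom[OF z(1)])
    have eu: "e8 u l = - pe u l" by (simp add: pe_def)
    show "bil g28 (iota l z) (cvec (j *s giota l m + iemb u)) = 0"
    proof (cases "N = 0")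
      case True
      then have "z $ 20 = 0" "j = 0" using z(2) u(1) t(2) by simp_all
      then show ?thesis unfolding bil_iota_glued by simp
    next
      case False
      have "of_int N * complex_of_int (pe u l) = 2 * of_int t * of_int j" using arg_cong[OF u(1), of complex_of_int] by simp
      then have "of_int N * (of_int j * bil (g21 d) z (cvec m) + z $ 20 * complex_of_int (e8 u l)) = 0"
        unfolding eu of_int_minus using z(2) by algebra
      then show ?thesis unfolding bil_iota_glued using False by simp
    qed
    fix r c assume r: "r \<in> P"
    show "pv r \<noteq> c *\<^sub>R ivec (j *s giota l m + iemb u)"
    proof
      \<comment> \<open>Test vector along \<open>l\<close>: its image pairs to 0 with every element
        of \<open>P\<close> but to \<open>e8 u l\<close> with the glued root.\<close>
      let ?a = "rvec (axis 20 1)" and ?x = "cvec (j *s giota l m + iemb u)"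
      assume "pv r = c *\<^sub>R ivec (j *s giota l m + iemb u)"
      then have e: "emb8 r = of_real c *s ?x" unfolding emb8_pv cvec_ivec by (simp only: rvec_lin)
      have "bil (g21 d) ?a (cvec m) = 0" unfolding cvec_ivec bil_rvec Q21.rbil_sym[of "axis 20 1"] rbil_axis20 using m(1) by (simp add: ivec_def)
      then have "bil g28 (iota l ?a) ?x = of_int (e8 u l)" unfolding bil_iota_glued by (simp add: rvec_def axis_def)
      moreover have "bil g28 (iota l ?a) (emb8 r) = 0" unfolding bil_iota_emb8 P_root(2)[OF r] by simp
      ultimately have "c = 0" unfolding e bil_smult eu using u(3) by simp
      then have "bil g28 (emb8 r) (emb8 r) = 0" unfolding e bil_smult by simp
      then show False using P_root(1)[OF r] unfolding emb8_pv bil_rvec pv_form by simp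
    qed
  qed
  then show ?thesis by simp
qed

lemma F_branch:
  assumes Gh: "holo_on G D28" and GP: "\<And>w. w \<in> D28 \<Longrightarrow> \<Phi> w = G w * (\<Prod>r\<in>P. bil g28 w (emb8 r))"
  shows "VanishBranch (g21 d) w21 (Otilde (g21 d) w21) (G \<circ> iota l)"
  unfolding VanishBranch_def
proof (intro ballI allI impI, elim bexE)
  fix g w v z
  assume g: "g \<in> Otilde (g21 d) w21" and w: "w \<in> D21" "\<not> parallel (act g w) w"
    and fx: "\<forall>z\<in>D21. bil (g21 d) z v = 0 \<longrightarrow> parallel (act g z) z" and z: "z \<in> D21" "bil (g21 d) z v = 0"
  have inv: "bil (g21 d) (act g x) (act g y) = bil (g21 d) x y" for x y using g unfolding Otilde_def Oplus_def by blast
  have "\<exists>s y. (s = 1 \<or> s = -1) \<and> rbil (g21 d) (ivec y) (ivec y) < 0 \<and> bil (g21 d) z (cvec y) = 0 \<and> act g z = of_real s *s z \<and>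
    (\<forall>b. rmat g *v b = s *\<^sub>R b - (2 * s * rbil (g21 d) b (ivec y) / rbil (g21 d) (ivec y) (ivec y)) *\<^sub>R ivec y)"
    by (rule Q21.divisor_fixing_is_reflection[OF _ inv z _ w]) (use fx in simp_all)
  then obtain s y where s: "s = 1 \<or> s = -1" and Y: "K21 (ivec y) (ivec y) < 0" and zy: "bil (g21 d) z (cvec y) = 0"
    and gz: "act g z = of_real s *s z" and R: "\<And>b. rmat g *v b = s *\<^sub>R b - (2 * s * K21 b (ivec y) / K21 (ivec y) (ivec y)) *\<^sub>R ivec y"
    by (elim exE conjE) blast
  show "(G \<circ> iota l) z = 0"
  proof (cases "s = 1")
    case True
    have y0: "ivec y \<noteq> 0" using Y by (auto simp: rbil_zero)
    have "det (rmat g) = 1 + (- 2 * K21 (ivec y) (ivec y) / K21 (ivec y) (ivec y))"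
    proof (rule det_rank_one[where \<phi> = "\<lambda>b. - 2 * K21 b (ivec y) / K21 (ivec y) (ivec y)" and y = "ivec y"])
      show "rmat g *v x = x + (- 2 * K21 x (ivec y) / K21 (ivec y) (ivec y)) *\<^sub>R ivec y" for x unfolding R True by simp
      show "linear (\<lambda>b. - 2 * K21 b (ivec y) / K21 (ivec y) (ivec y))"
        using Y by (intro linearI) (simp_all add: rbil_lin field_simps)
    qed (rule y0)
    also have "\<dots> = -1" using Y by simp
    finally have "real_of_int (det g) = of_int (-1)" unfolding det_rmat by simp
    then have "det g = -1" by (simp only: of_int_eq_iff)
    moreover have "(G \<circ> iota l) (act g z) = detchar g * (G \<circ> iota l) z" using F_modular[OF Gh GP] g z(1) unfolding ModForm_def by blast
    moreover have "act g z = z" using gz True by simp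
    ultimately show ?thesis by (simp add: detchar_def)
  next
    case False
    then have sm: "s = -1" using s by blast
    have R': "rmat g *v b = (2 * K21 b (ivec y) / K21 (ivec y) (ivec y)) *\<^sub>R ivec y - b" for b unfolding R sm by simp
    from minus_reflection[OF g Y R'] show ?thesis
    proof (elim disjE exE conjE)
      fix r n assume r: "ibil (g21 d) r r = - 2" "y = n *s r" "n \<noteq> 0"
      show ?thesis
      proof (rule F_root[OF Gh GP _ z(1), of r])
        show "bil (g21 d) (cvec r) (cvec r) = - 2" by (simp add: bil_cvec r)
        show "bil (g21 d) z (cvec r) = 0" using zy r(3) unfolding r(2) cvec_lin bil_smult by simp
      qed
    next
      fix \<eta> m t N e
      assume a: "\<eta> *\<^sub>R ivec y = ivec ((t * N) *s m) + axis 20 (of_int (t\<^sup>2) / real d)" and m: "m $ 20 = 0" "ibil (g21 d) m m = 2 * e"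
        and t: "t\<^sup>2 = 1 + int d * N\<^sup>2 * e" "t \<noteq> 0"
      have ax: "bil (g21 d) z (rvec (axis 20 a)) = - 2 * of_nat d * of_real a * z $ 20" for a
        unfolding bil_rvec_right rbil_axis20 by (simp add: complex_eq_iff rev_def imv_def)
      have "0 = of_real \<eta> * bil (g21 d) z (cvec y)" using zy by simp
      also have "\<dots> = bil (g21 d) z (rvec (\<eta> *\<^sub>R ivec y))" by (simp add: rvec_lin bil_smult cvec_ivec)
      also have "\<dots> = of_int (t * N) * bil (g21 d) z (cvec m) - 2 * of_int (t\<^sup>2) * z $ 20"
        unfolding a rvec_lin bil_add ax cvec_ivec[symmetric] cvec_lin bil_smult using d1 by simp
      finally have "of_int t * (of_int N * bil (g21 d) z (cvec m)) = of_int t * (2 * of_int t * z $ 20)" by (simp add: power2_eq_square mult_ac)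
      then have zm: "of_int N * bil (g21 d) z (cvec m) = 2 * of_int t * z $ 20" using t(2) by simp
      show ?thesis by (rule F_vanishes_on_glued_root[OF Gh GP m t z(1) zm])
    qed
  qed
qed

end

section \<open>Fourier expansion at a cusp\<close>

lemma conjv_rvec: "conjv (rvec x) = rvec x"
  by (simp add: vec_eq_iff conjv_def rvec_def)

lemma rev_imv_conjv: "rev (conjv w) = rev w" "imv (conjv w) = - imv w"
  by (simp_all add: vec_eq_iff conjv_def rev_def imv_def)

lemma linear_rev: "linear rev" and linear_imv: "linear imv"
  by (intro linearI; simp add: vec_eq_iff rev_def imv_def)+

lemma bil_cvec_coordinates: "bil gr w (cvec e) = (\<Sum>k\<in>UNIV. w $ k * of_int (\<Sum>j\<in>UNIV. gr k j * e $ j))"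
  unfolding bil_def cvec_def by (simp add: sum_distrib_left mult.assoc)

context quad begin

text \<open>\<open>\<delta>\<close> is the determinant of \<open>u1\<close>, \<open>u2\<close> on
  the real and imaginary parts. A positive plane meets their common kernel trivially, so
  \<open>\<delta>\<close> has no zero on the cone, while conjugation reverses its sign; on a
  connected set this is impossible.\<close>

lemma conjv_not_in_Dom: assumes "w \<in> Dom gr w0" shows "conjv w \<notin> Dom gr w0"
proof
  assume c: "conjv w \<in> Dom gr w0"
  define \<delta> where "\<delta> = (\<lambda>w. u1 (rev w) * u2 (imv w) - u1 (imv w) * u2 (rev w))"
  have nz: "\<delta> x \<noteq> 0" if "x \<in> cone gr" for x
  proof
    assume d: "\<delta> x = 0"
    let ?X = "rev x" and ?Y = "imv x"
    have XY: "rbil gr ?X ?X = rbil gr ?Y ?Y" "rbil gr ?X ?Y = 0" "rbil gr ?Y ?Y > 0" using that unfolding cone_iff by auto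
    have pos: "rbil gr (a *\<^sub>R ?X + b *\<^sub>R ?Y) (a *\<^sub>R ?X + b *\<^sub>R ?Y) = (a\<^sup>2 + b\<^sup>2) * rbil gr ?Y ?Y" for a b
      using XY by (simp add: rbil_lin rbil_sym[of ?Y ?X] power2_eq_square algebra_simps)
    obtain a b where ab: "(a,b) \<noteq> (0,0)" "a * u1 ?X + b * u1 ?Y = 0" "a * u2 ?X + b * u2 ?Y = 0"
    proof (cases "u1 ?X = 0 \<and> u1 ?Y = 0")
      case True
      show ?thesis
      proof (cases "u2 ?X = 0 \<and> u2 ?Y = 0")
        case t: True then show ?thesis using that[of 1 0] True by simp
      next
        case False then show ?thesis using that[of "u2 ?Y" "- u2 ?X"] True by (auto simp: mult.commute)
      qed
    next
      case False then show ?thesis using that[of "u1 ?Y" "- u1 ?X"] d unfolding \<delta>_def by (auto simp: mult.commute)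
    qed
    then have u: "u1 (a *\<^sub>R ?X + b *\<^sub>R ?Y) = 0" "u2 (a *\<^sub>R ?X + b *\<^sub>R ?Y) = 0" using lin by (simp_all add: linear_add linear_scale)
    have "a\<^sup>2 + b\<^sup>2 > 0" using ab(1) by (simp add: sum_power2_gt_zero_iff)
    then have p: "rbil gr (a *\<^sub>R ?X + b *\<^sub>R ?Y) (a *\<^sub>R ?X + b *\<^sub>R ?Y) > 0" unfolding pos using XY(3) by simp
    then have "a *\<^sub>R ?X + b *\<^sub>R ?Y \<noteq> 0" by (auto simp only: rbil_zero)
    from neg[OF this u] p show False by simp
  qed
  have l: "linear (\<lambda>w. u (r w))" if "linear u" "linear (r :: complex^'n \<Rightarrow> real^'n)" for u :: "real^'n \<Rightarrow> real" and r
    using linear_compose[OF that(2,1)] by (simp add: o_def)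
  have "continuous_on UNIV \<delta>" unfolding \<delta>_def
    by (intro continuous_intros linear_continuous_on linear_conv_bounded_linear[THEN iffD1] l lin linear_rev linear_imv)
  then have con: "connected (\<delta> ` Dom gr w0)" by (intro connected_continuous_image Dom_connected) (rule continuous_on_subset, auto)
  have m: "\<delta> (conjv w) = - \<delta> w" using lin by (simp add: \<delta>_def rev_imv_conjv linear_neg)
  have "\<delta> w \<in> \<delta> ` Dom gr w0" "- \<delta> w \<in> \<delta> ` Dom gr w0" using assms c m by (blast, metis image_eqI)
  then have "{\<delta> w..- \<delta> w} \<subseteq> \<delta> ` Dom gr w0" "{- \<delta> w..\<delta> w} \<subseteq> \<delta> ` Dom gr w0" using connected_contains_Icc[OF con] by blast+
  moreover have "0 \<in> {\<delta> w..- \<delta> w} \<or> 0 \<in> {- \<delta> w..\<delta> w}" by auto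
  ultimately have "0 \<in> \<delta> ` Dom gr w0" by blast
  then show False using nz Dom_subset_cone by fastforce
qed

text \<open>The Eichler transvection attached to an isotropic vector \<open>e\<close> and \<open>a \<bottom> e\<close>.\<close>
definition tv :: "complex^'n \<Rightarrow> complex^'n \<Rightarrow> complex^'n \<Rightarrow> complex^'n" where
  "tv e a w = w + bil gr w e *s a - bil gr w a *s e - (bil gr a a / 2 * bil gr w e) *s e"

lemma tv_bil: assumes "bil gr e e = 0" "bil gr a e = 0" shows "bil gr (tv e a x) (tv e a y) = bil gr x y"
  using assms unfolding tv_def by (simp add: bil_lin bil_sym[of e a] bil_sym[of e x] bil_sym[of e y] bil_sym[of a x] bil_sym[of a y] algebra_simps)

lemma tv_add: assumes "bil gr e e = 0" "bil gr a e = 0" "bil gr b e = 0" shows "tv e a (tv e b x) = tv e (a + b) x"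
  using assms unfolding tv_def
  by (simp add: bil_lin bil_sym[of e a] bil_sym[of e b] bil_sym[of b a] vec_eq_iff algebra_simps add_divide_distrib diff_divide_distrib)

lemma tv_0: "tv e 0 x = x"
  by (simp add: tv_def bil_zero vec_eq_iff)

lemma tv_inverse: assumes "bil gr e e = 0" "bil gr a e = 0" shows "tv e a (tv e (- a) x) = x" "tv e (- a) (tv e a x) = x"
  using assms by (simp_all add: tv_add bil_uminus tv_0)

lemma tv_fixes: assumes "bil gr e e = 0" "bil gr a e = 0" shows "tv e a e = e"
  using assms bil_sym[of e a] by (simp add: tv_def vec_eq_iff)

lemma tv_conjv: "conjv (tv e a w) = tv (conjv e) (conjv a) (conjv w)"
  by (simp add: tv_def conjv_lin bil_conjv)

lemma tv_pair: assumes "bil gr e e = 0" "bil gr a e = 0" shows "bil gr (tv e a w) e = bil gr w e"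
  using tv_bil[OF assms, of w e] unfolding tv_fixes[OF assms] .

lemma continuous_on_tv [continuous_intros]: "continuous_on S f \<Longrightarrow> continuous_on S g \<Longrightarrow> continuous_on S (\<lambda>x. tv e (f x) (g x))"
  unfolding tv_def by (intro continuous_intros) simp_all

lemma tv_Dom:
  assumes e: "rbil gr e e = 0" "rbil gr a e = 0" and w: "w \<in> Dom gr w0"
  shows "tv (rvec e) (rvec a) w \<in> Dom gr w0"
proof -
  define S where "S = (\<lambda>s::real. tv (rvec e) (of_real s *s rvec a) w) ` {0..1}"
  have b: "bil gr (rvec e) (rvec e) = 0" "bil gr (of_real s *s rvec a) (rvec e) = 0" for s :: real
    using e by (simp_all add: bil_rvec bil_smult)
  have "S \<subseteq> Dom gr w0"
  proof (rule Dom_maximal)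
    show "connected S" unfolding S_def by (intro connected_continuous_image continuous_intros) simp
    show "S \<subseteq> cone gr"
    proof
      fix y assume "y \<in> S"
      then obtain s :: real where y: "y = tv (rvec e) (of_real s *s rvec a) w" unfolding S_def by blast
      have "conjv y = tv (rvec e) (of_real s *s rvec a) (conjv w)" unfolding y tv_conjv conjv_lin conjv_rvec by simp
      then have "bil gr y (conjv y) = bil gr w (conjv w)" "bil gr y y = bil gr w w" using tv_bil[OF b] y by simp_all
      then show "y \<in> cone gr" using w Dom_subset_cone unfolding cone_def by auto
    qed
    show "w \<in> S" unfolding S_def by (rule image_eqI[of _ _ 0]) (simp_all add: tv_0)
  qed (rule w)
  moreover have "tv (rvec e) (rvec a) w \<in> S" unfolding S_def by (rule image_eqI[of _ _ 1]) simp_all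
  ultimately show ?thesis by blast
qed

text \<open>Evenness makes \<open>(a,a)/2\<close> integral, and with it the matrix.\<close>

lemma tv_matrix:
  assumes "even (ibil gr a a)" shows "\<exists>g. \<forall>w. act g w = tv (cvec e) (cvec a) w"
proof -
  define E where "E = (\<lambda>k. \<Sum>j\<in>UNIV. gr k j * e $ j)"
  define A where "A = (\<lambda>k. \<Sum>j\<in>UNIV. gr k j * a $ j)"
  obtain q where q: "ibil gr a a = 2 * q" using assms by (rule evenE)
  have bE: "bil gr w (cvec e) = (\<Sum>k\<in>UNIV. w $ k * of_int (E k))" and bA: "bil gr w (cvec a) = (\<Sum>k\<in>UNIV. w $ k * of_int (A k))" for w
    unfolding E_def A_def by (rule bil_cvec_coordinates)+
  define g :: "int^'n^'n" where "g = (\<chi> i k. (if k = i then 1 else 0) + E k * a $ i - A k * e $ i - q * (E k * e $ i))"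
  have "act g w = tv (cvec e) (cvec a) w" for w
  proof -
    have "act g w $ i = tv (cvec e) (cvec a) w $ i" for i
    proof -
      have "act g w $ i = (\<Sum>k\<in>UNIV. (if k = i then w $ k else 0) + w $ k * of_int (E k) * of_int (a $ i)
          - w $ k * of_int (A k) * of_int (e $ i) - of_int q * (w $ k * of_int (E k)) * of_int (e $ i))"
        unfolding act_nth g_def by (rule sum.cong) (simp_all add: algebra_simps)
      also have "\<dots> = w $ i + bil gr w (cvec e) * of_int (a $ i) - bil gr w (cvec a) * of_int (e $ i) - of_int q * bil gr w (cvec e) * of_int (e $ i)"
        unfolding bE bA by (simp only: sum.distrib sum_subtractf sum_distrib_left sum_distrib_right) simp
      also have "\<dots> = tv (cvec e) (cvec a) w $ i"
        unfolding tv_def bil_cvec q by (simp add: cvec_def)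
      finally show ?thesis .
    qed
    then show ?thesis by (simp add: vec_eq_iff)
  qed
  then show ?thesis by blast
qed

text \<open>The transvection by \<open>2 *s a\<close> is the square of the one by \<open>a\<close>,
  so its determinant is 1 and the character is trivial on it. This is the source of the factor 2 in
  \<open>bet\<close>.\<close>

lemma tv_Oplus:
  assumes e: "ibil gr e e = 0" "ibil gr a e = 0" and ev: "even (ibil gr a a)" and w: "w \<in> Dom gr w0"
  shows "\<exists>g\<in>Oplus gr w0. det g = 1 \<and> (\<forall>w. act g w = tv (cvec e) (cvec (2 *s a)) w)"
proof -
  have b: "bil gr (cvec e) (cvec e) = 0" "bil gr (cvec a) (cvec e) = 0" using e by (simp_all add: bil_cvec)
  obtain g where g: "\<And>w. act g w = tv (cvec e) (cvec a) w" using tv_matrix[OF ev] by blast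
  have "even (ibil gr (- a) (- a))" using ev ibil_lin by (simp add: ibil_def sum_negf)
  from tv_matrix[OF this] obtain h where h: "\<And>w. act h w = tv (cvec e) (- cvec a) w" unfolding cvec_lin by blast
  have gh: "g ** h = mat 1" "h ** g = mat 1"
    by (rule act_eq_1, simp only: act_mult g h tv_inverse[OF b])+
  have "det g * det h = 1" using arg_cong[OF gh(1), of det] unfolding det_mul by simp
  then have d: "det (g ** g) = 1" unfolding det_mul by (metis mult.commute zmult_eq_1_iff mult_1 mult_minus_left minus_minus)
  have gg: "act (g ** g) w = tv (cvec e) (cvec (2 *s a)) w" for w
  proof -
    have "act (g ** g) w = tv (cvec e) (cvec a + cvec a) w" unfolding act_mult g by (rule tv_add[OF b b(2)])
    moreover have "cvec a + cvec a = cvec (2 *s a)" by (simp add: vec_eq_iff cvec_def)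
    ultimately show ?thesis by simp
  qed
  have "g ** g \<in> Oplus gr w0"
  proof (rule OplusI[OF _ _ _ w])
    show "(g ** g) ** (h ** h) = mat 1" by (metis gh(1) matrix_mul_assoc matrix_mul_lid)
    show "(h ** h) ** (g ** g) = mat 1" by (metis gh(2) matrix_mul_assoc matrix_mul_lid)
    have b2: "bil gr (cvec (2 *s a)) (cvec e) = 0" using b(2) by (simp add: cvec_lin bil_smult)
    show "bil gr (act (g ** g) x) (act (g ** g) y) = bil gr x y" for x y unfolding gg by (rule tv_bil[OF b(1) b2])
    have "rbil gr (ivec e) (ivec e) = 0" "rbil gr (ivec (2 *s a)) (ivec e) = 0" using e by (simp_all add: rbil_ivec ivec_lin rbil_lin)
    from tv_Dom[OF this w] show "act (g ** g) w \<in> Dom gr w0" unfolding gg cvec_ivec .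
  qed
  then show ?thesis using d gg by blast
qed

text \<open>One half of the positive cone in \<open>C\<^sup>\<bottom>\<close>, a space that is
  Lorentzian modulo \<open>C\<close>; the sign against \<open>y0\<close> selects the half.\<close>

definition halfcone :: "real^'n \<Rightarrow> real^'n \<Rightarrow> (real^'n) set" where
  "halfcone C y0 = {y. rbil gr y C = 0 \<and> rbil gr y y > 0 \<and> rbil gr y y0 > 0}"

context
  fixes C y0 assumes C: "rbil gr C C = 0" "C \<noteq> 0" and y0: "rbil gr y0 C = 0" "rbil gr y0 y0 > 0"
begin

text \<open>Reverse Cauchy-Schwarz: \<open>y - k *\<^sub>R x\<close> is orthogonal to
  \<open>y0\<close>, hence of norm \<le> 0, which bounds the mixed term from below by positive
  norms.\<close>

lemma halfcone_pair: assumes "x \<in> halfcone C y0" "y \<in> halfcone C y0" shows "rbil gr x y > 0"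
proof -
  define k where "k = rbil gr y y0 / rbil gr x y0"
  have k: "k > 0" using assms by (simp add: k_def halfcone_def)
  have xy: "rbil gr x C = 0" "rbil gr y C = 0" "rbil gr x x > 0" "rbil gr y y > 0" "rbil gr x y0 > 0" using assms by (simp_all add: halfcone_def)
  have "rbil gr (y - k *\<^sub>R x) C = 0" "rbil gr (y - k *\<^sub>R x) y0 = 0" using xy by (simp_all add: rbil_lin k_def)
  from hyperbolic_orthogonal(1)[OF C y0(2,1) this]
  have "rbil gr y y + k * k * rbil gr x x \<le> 2 * k * rbil gr x y" using rbil_sym[of y x] by (simp add: rbil_lin algebra_simps)
  moreover have "k * k * rbil gr x x > 0" using k xy by simp
  ultimately have "2 * k * rbil gr x y > 0" using xy by linarith
  then show ?thesis using k by (simp add: zero_less_mult_iff)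
qed

lemma halfcone_combination:
  assumes "x \<in> halfcone C y0" "y \<in> halfcone C y0" "s \<ge> 0" "t \<ge> 0" "s + t > 0" shows "s *\<^sub>R x + t *\<^sub>R y \<in> halfcone C y0"
proof -
  have xy: "rbil gr x C = 0" "rbil gr y C = 0" "rbil gr x x > 0" "rbil gr y y > 0" "rbil gr x y0 > 0" "rbil gr y y0 > 0" using assms by (simp_all add: halfcone_def)
  have e: "rbil gr (s *\<^sub>R x + t *\<^sub>R y) (s *\<^sub>R x + t *\<^sub>R y) = s * s * rbil gr x x + 2 * (s * t * rbil gr x y) + t * t * rbil gr y y"
    using rbil_sym[of y x] by (simp add: rbil_lin algebra_simps)
  have nn: "s * s * rbil gr x x \<ge> 0" "s * t * rbil gr x y \<ge> 0" "t * t * rbil gr y y \<ge> 0" "s * rbil gr x y0 \<ge> 0" "t * rbil gr y y0 \<ge> 0"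
    using assms(3,4) xy halfcone_pair[OF assms(1,2)] by simp_all
  have "s > 0 \<or> t > 0" using assms(3-5) by linarith
  then have "(s * s * rbil gr x x > 0 \<and> s * rbil gr x y0 > 0) \<or> (t * t * rbil gr y y > 0 \<and> t * rbil gr y y0 > 0)" using xy by auto
  then show ?thesis unfolding halfcone_def mem_Collect_eq e using nn xy(1,2) by (auto simp: rbil_lin simp del: mult_pos_pos)
qed

lemma halfcone_or_uminus: assumes "rbil gr y C = 0" "rbil gr y y > 0" shows "y \<in> halfcone C y0 \<or> - y \<in> halfcone C y0"
proof -
  have "rbil gr y y0 \<noteq> 0" using hyperbolic_orthogonal(1)[OF C y0(2,1) assms(1)] assms(2) by linarith
  then show ?thesis using assms by (auto simp: halfcone_def rbil_lin)
qed

end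

context
  fixes C c' assumes C: "rbil gr C C = 0" "C \<noteq> 0" and c': "rbil gr c' c' = 0" "rbil gr c' C = 1"
begin

text \<open>Tube coordinates at the cusp \<open>C\<close>: modulo \<open>C\<close> this is
  \<open>c' + z\<close>, corrected to be isotropic. With \<open>z\<close> in all of
  \<open>C\<^sup>\<bottom>\<close> no complement of \<open>C\<close> is chosen; the price is that
  \<open>psi\<close> is constant along \<open>C\<close>, see \<open>psi_C\<close>.\<close>

definition psi :: "complex^'n \<Rightarrow> complex^'n" where "psi z = tv (rvec C) z (rvec c')"

lemma bilC: "bil gr (rvec C) (rvec C) = 0" by (simp add: bil_rvec C)

lemma psi_bil: assumes "bil gr z (rvec C) = 0" shows "bil gr (psi z) (psi z) = 0" "bil gr (psi z) (rvec C) = 1"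
    "bil gr (psi z) (conjv (psi z)) = of_real (2 * rbil gr (imv z) (imv z))"
proof -
  show "bil gr (psi z) (psi z) = 0" unfolding psi_def tv_bil[OF bilC assms] by (simp add: bil_rvec c')
  show "bil gr (psi z) (rvec C) = 1" unfolding psi_def tv_pair[OF bilC assms] by (simp add: bil_rvec c')
  have zc: "bil gr (conjv z) (rvec C) = 0" unfolding bil_conjv_rvec assms by simp
  have cz: "conjv (psi z) = tv (rvec C) (conjv z) (rvec c')" unfolding psi_def tv_conjv conjv_rvec ..
  have zi: "conjv z - z = (- 2 * \<i>) *s rvec (imv z)" by (simp add: vec_eq_iff conjv_def rvec_def imv_def complex_eq_iff)
  \<comment> \<open>Translating by \<open>- z\<close>, an isometry, turns the first argument into
    \<open>c'\<close> and leaves in the second only \<open>conjv z - z\<close>, which is purely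
    imaginary.\<close>
  have "bil gr (psi z) (conjv (psi z)) = bil gr (tv (rvec C) (- z) (psi z)) (tv (rvec C) (- z) (conjv (psi z)))"
    by (rule tv_bil[symmetric, OF bilC]) (simp add: bil_uminus assms)
  also have "tv (rvec C) (- z) (psi z) = rvec c'" unfolding psi_def by (rule tv_inverse(2)[OF bilC assms])
  also have "tv (rvec C) (- z) (conjv (psi z)) = tv (rvec C) (conjv z - z) (rvec c')"
    unfolding cz by (subst tv_add[OF bilC]) (simp_all add: bil_uminus assms zc)
  also have "bil gr (rvec c') (tv (rvec C) (conjv z - z) (rvec c')) = - (bil gr (conjv z - z) (conjv z - z) / 2)"
    unfolding tv_def by (simp add: bil_lin bil_rvec c')
  also have "\<dots> = of_real (2 * rbil gr (imv z) (imv z))" unfolding zi by (simp add: bil_lin bil_rvec)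
  finally show "bil gr (psi z) (conjv (psi z)) = of_real (2 * rbil gr (imv z) (imv z))" .
qed

lemma psi_cone: "bil gr z (rvec C) = 0 \<Longrightarrow> psi z \<in> cone gr \<longleftrightarrow> rbil gr (imv z) (imv z) > 0"
  unfolding cone_def mem_Collect_eq psi_bil by simp

lemma psi_surj: assumes "bil gr w w = 0" "bil gr w (rvec C) = 1"
  shows "bil gr (w - rvec c') (rvec C) = 0" "psi (w - rvec c') = w"
  using assms bil_sym[of "rvec c'" w] by (simp_all add: psi_def tv_def bil_lin bil_rvec c' vec_eq_iff)

lemma psi_add: "bil gr z (rvec C) = 0 \<Longrightarrow> bil gr b (rvec C) = 0 \<Longrightarrow> psi (b + z) = tv (rvec C) b (psi z)"
  unfolding psi_def by (subst tv_add[OF bilC]) simp_all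

lemma psi_C: "bil gr z (rvec C) = 0 \<Longrightarrow> psi (z + s *s rvec C) = psi z"
  using bil_sym[of "rvec C" z] by (simp add: psi_def tv_def bil_lin bil_rvec c' C vec_eq_iff algebra_simps)

text \<open>The half cone is convex, so a segment inside it joins the two parameters. If the
  imaginary part lay in the opposite half, the conjugate point would lie in the domain, against
  \<open>conjv_not_in_Dom\<close>.\<close>

lemma psi_Dom:
  assumes z0: "bil gr z0 (rvec C) = 0" "psi z0 \<in> Dom gr w0" and z: "bil gr z (rvec C) = 0"
  shows "psi z \<in> Dom gr w0 \<longleftrightarrow> imv z \<in> halfcone C (imv z0)"
proof -
  have y0: "rbil gr (imv z0) (imv z0) > 0" using z0(2) Dom_subset_cone psi_cone[OF z0(1)] by blast
  have im: "rbil gr (imv z) C = 0" if "bil gr z (rvec C) = 0" for z using that unfolding bil_rvec_right by (simp add: complex_eq_iff)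
  have y00: "imv z0 \<in> halfcone C (imv z0)" using im[OF z0(1)] y0 by (simp add: halfcone_def)
  have *: "psi z \<in> Dom gr w0" if h: "imv z \<in> halfcone C (imv z0)" and z: "bil gr z (rvec C) = 0" for z
  proof -
    define p where "p = (\<lambda>u::real. of_real (1 - u) *s z0 + of_real u *s z)"
    have ip: "imv (p u) = (1 - u) *\<^sub>R imv z0 + u *\<^sub>R imv z" for u by (simp add: p_def vec_eq_iff imv_def algebra_simps)
    have bp: "bil gr (p u) (rvec C) = 0" for u by (simp add: p_def bil_lin z z0)
    have "psi ` (p ` {0..1}) \<subseteq> Dom gr w0"
    proof (rule Dom_maximal)
      show "connected (psi ` (p ` {0..1}))" unfolding psi_def p_def by (intro connected_continuous_image continuous_intros) simp
      show "psi ` (p ` {0..1}) \<subseteq> cone gr"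
      proof
        fix y assume "y \<in> psi ` (p ` {0..1})"
        then obtain u where u: "0 \<le> u" "u \<le> 1" "y = psi (p u)" by auto
        have "imv (p u) \<in> halfcone C (imv z0)" unfolding ip using u by (intro halfcone_combination[OF C im[OF z0(1)] y0 y00 h]) auto
        then show "y \<in> cone gr" unfolding u(3) psi_cone[OF bp] by (simp add: halfcone_def)
      qed
      show "psi z0 \<in> psi ` (p ` {0..1})" by (intro imageI image_eqI[of _ _ 0]) (simp_all add: p_def)
    qed (rule z0(2))
    moreover have "psi z \<in> psi ` (p ` {0..1})" by (intro imageI image_eqI[of _ _ 1]) (simp_all add: p_def)
    ultimately show ?thesis by blast
  qed
  show ?thesis
  proof
    assume D: "psi z \<in> Dom gr w0"
    then have y: "rbil gr (imv z) (imv z) > 0" using Dom_subset_cone psi_cone[OF z] by blast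
    show "imv z \<in> halfcone C (imv z0)"
    proof (rule ccontr)
      assume "imv z \<notin> halfcone C (imv z0)"
      then have "- imv z \<in> halfcone C (imv z0)" using halfcone_or_uminus[OF C im[OF z0(1)] y0 im[OF z] y] by blast
      then have "psi (conjv z) \<in> Dom gr w0" by (intro *) (simp_all add: rev_imv_conjv bil_conjv_rvec z)
      moreover have "psi (conjv z) = conjv (psi z)" unfolding psi_def tv_conjv conjv_rvec ..
      ultimately show False using conjv_not_in_Dom[OF D] by simp
    qed
  qed (rule *[OF _ z])
qed

end

end

lemma bounded_quadratic_exponent:
  fixes a B p q r :: real
  assumes "a > 0" "\<And>n::nat. a * exp (p + q * n + r * (real n)\<^sup>2) \<le> B" shows "r \<le> 0"
proof (rule ccontr)
  assume "\<not> r \<le> 0"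
  then have r: "r > 0" by simp
  define K where "K = \<bar>q\<bar> + \<bar>B / a\<bar> + \<bar>p\<bar> + 1"
  obtain n :: nat where n: "real n > K / r + 1" using reals_Archimedean2 by blast
  have "K \<ge> 1" by (simp add: K_def)
  then have n1: "real n \<ge> 1" using n r by (smt (verit) divide_nonneg_pos)
  have "real n * r \<ge> K" using n r by (simp add: field_simps)
  then have "real n * r + q \<ge> \<bar>B / a\<bar> + \<bar>p\<bar> + 1" unfolding K_def by linarith
  then have m: "1 * (\<bar>B / a\<bar> + \<bar>p\<bar> + 1) \<le> real n * (real n * r + q)" using n1 by (intro mult_mono) auto
  define X where "X = p + q * n + r * (real n)\<^sup>2"
  have "real n * (real n * r + q) = X - p" by (simp add: X_def power2_eq_square algebra_simps)
  then have "\<bar>B / a\<bar> + \<bar>p\<bar> + 1 \<le> X - p" using m by (simp only: mult_1)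
  then have "B / a < 1 + X" using abs_ge_self[of "B / a"] abs_ge_minus_self[of p] by linarith
  also have "\<dots> \<le> exp X" by (rule exp_ge_add_one_self)
  finally have "B < exp X * a" using assms(1) by (simp only: pos_divide_less_eq)
  moreover have "a * exp X \<le> B" unfolding X_def by (rule assms(2))
  ultimately show False unfolding mult.commute[of a] by linarith
qed

section \<open>Koecher principle at a zero-dimensional cusp\<close>

lemma form28_even: "even (ibil g28 m m)"
proof -
  have "even (e8form X X)" for X :: "nat \<Rightarrow> int" unfolding e8form_def by (simp add: mult.commute)
  then have "even (bform 3 X X)" for X :: "nat \<Rightarrow> int" unfolding bform_def by (auto intro!: dvd_sum simp: mult.commute)
  then show ?thesis unfolding ibil28 by simp
qed

lemma represent28: "\<exists>\<mu>. \<forall>y. rbil g28 \<mu> y = (\<Sum>b\<in>UNIV. \<nu> b * y $ b)"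
proof -
  define f :: "real^28 \<Rightarrow> real^28" where "f = (\<lambda>\<mu>. \<chi> j. \<Sum>i\<in>UNIV. \<mu> $ i * of_int (g28 i j))"
  have fr: "rbil g28 \<mu> y = (\<Sum>j\<in>UNIV. f \<mu> $ j * y $ j)" for \<mu> y
    unfolding rbil_def f_def by (subst sum.swap) (simp add: sum_distrib_right)
  have lf: "linear f" by (rule linearI) (simp_all add: f_def vec_eq_iff sum.distrib sum_distrib_left algebra_simps)
  have "inj f" unfolding linear_injective_0[OF lf] using nondeg28 by (simp add: fr)
  then have "surj f" using linear_injective_imp_surjective[OF lf] by simp
  then obtain \<mu> where "(\<chi> b. \<nu> b) = f \<mu>" by (metis surjD)
  then have "f \<mu> $ b = \<nu> b" for b by (metis vec_lambda_beta)
  then show ?thesis by (intro exI[of _ \<mu>]) (simp add: fr)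
qed

text \<open>\<open>c'\<close> completes the cusp \<open>C\<close> to a real hyperbolic plane,
  \<open>v\<close> serves to project integral vectors into \<open>C\<^sup>\<bottom>\<close>, and
  \<open>z0\<close> records which half of the cone belongs to the domain.\<close>

locale cusp_chart = quasi_pullback d l \<Phi> P for d l \<Phi> P +
  fixes C v :: "int^28" and c' :: "real^28" and z0 :: "complex^28"
  assumes C0: "C \<noteq> 0" and CC: "ibil g28 C C = 0" and c': "rbil g28 c' c' = 0" "rbil g28 c' (ivec C) = 1"
    and vC: "ibil g28 v C \<noteq> 0" and z0C: "bil g28 z0 (cvec C) = 0" and z0: "Q28.psi (ivec C) c' z0 \<in> D28"
begin

abbreviation "\<psi> \<equiv> Q28.psi (ivec C) c'"
abbreviation "\<Omega> \<equiv> Q28.halfcone (ivec C) (imv z0)"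
abbreviation "R \<equiv> rbil g28"
definition "slice = {w \<in> D28. bil g28 w (cvec C) = 1}"

lemma Cr: "R (ivec C) (ivec C) = 0" "ivec C \<noteq> 0"
  using C0 CC by (simp_all add: rbil_ivec flip: ivec_lin(4)) (simp add: ivec_inject)

lemma Omega_iff: "y \<in> \<Omega> \<longleftrightarrow> R y (ivec C) = 0 \<and> R y y > 0 \<and> R y (imv z0) > 0"
  unfolding Q28.halfcone_def by simp

lemma imC: "bil g28 z (cvec C) = 0 \<Longrightarrow> R (imv z) (ivec C) = 0"
  unfolding cvec_ivec bil_rvec_right by (simp add: complex_eq_iff)

lemma Omega_shift: "y + k *\<^sub>R ivec C \<in> \<Omega> \<longleftrightarrow> y \<in> \<Omega>"
proof -
  have "R (ivec C) (imv z0) = 0" using imC[OF z0C] Q28.rbil_sym by metis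
  then show ?thesis unfolding Omega_iff using Cr(1) Q28.rbil_sym[of "ivec C" y] by (auto simp: rbil_lin)
qed

lemma psi_slice: assumes "bil g28 z (cvec C) = 0" "imv z \<in> \<Omega>" shows "\<psi> z \<in> slice" "\<exists>k. imv (\<psi> z) = imv z + k *\<^sub>R ivec C"
proof -
  have z: "bil g28 z (rvec (ivec C)) = 0" and zz: "bil g28 z0 (rvec (ivec C)) = 0" using assms z0C by (simp_all add: cvec_ivec)
  have "bil g28 (\<psi> z) (cvec C) = 1" unfolding cvec_ivec by (rule Q28.psi_bil(2)[OF Cr c' z])
  moreover have "\<psi> z \<in> D28" using Q28.psi_Dom[OF Cr c' zz z0 z] assms(2) by simp
  ultimately show "\<psi> z \<in> slice" by (simp add: slice_def)
  define \<kappa> where "\<kappa> = bil g28 (rvec c') z + bil g28 z z / 2"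
  have "\<psi> z = rvec c' + z - \<kappa> *s rvec (ivec C)"
    unfolding Q28.psi_def[OF Cr c'] Q28.tv_def \<kappa>_def by (simp add: vec_eq_iff bil_rvec c' algebra_simps)
  then have "imv (\<psi> z) = imv (rvec c' + z - \<kappa> *s rvec (ivec C))" by simp
  also have "\<dots> = imv z + (- Im \<kappa>) *\<^sub>R ivec C"
    by (simp add: vec_eq_iff imv_def rvec_def)
  finally have "imv (\<psi> z) = imv z + (- Im \<kappa>) *\<^sub>R ivec C" .
  then show "\<exists>k. imv (\<psi> z) = imv z + k *\<^sub>R ivec C" by blast
qed

lemma slice_psi: assumes "w \<in> slice" shows "bil g28 (w - rvec c') (cvec C) = 0" "\<psi> (w - rvec c') = w" "imv w \<in> \<Omega>"
proof -
  have w: "bil g28 w w = 0" "bil g28 w (rvec (ivec C)) = 1" "w \<in> D28" using assms Q28.Dom_subset_cone unfolding slice_def cone_def cvec_ivec by auto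
  note p = Q28.psi_surj[OF Cr c' w(1,2)]
  show "bil g28 (w - rvec c') (cvec C) = 0" unfolding cvec_ivec by (rule p(1))
  show "\<psi> (w - rvec c') = w" by (rule p(2))
  have "imv (w - rvec c') \<in> \<Omega>" using Q28.psi_Dom[OF Cr c' z0C[unfolded cvec_ivec] z0 p(1)] p(2) w(3) by simp
  then show "imv w \<in> \<Omega>" by (simp add: rev_imv_lin)
qed

lemma Phi_tv: assumes "ibil g28 e e = 0" "ibil g28 a e = 0" "w \<in> D28"
  shows "\<Phi> (Q28.tv (cvec e) (cvec (2 *s a)) w) = \<Phi> w"
proof -
  obtain g where "g \<in> Oplus g28 w28" "det g = 1" "\<And>w. act g w = Q28.tv (cvec e) (cvec (2 *s a)) w"
    using Q28.tv_Oplus[OF assms(1,2) form28_even assms(3)] by blast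
  then show ?thesis using Phi_act[of g w] assms(3) by (simp add: detchar_def)
qed

definition "N0 = ibil g28 v C"
text \<open>Maps onto \<open>C\<^sup>\<bottom>\<close> and sends integral vectors to twice integral
  vectors, translation by which preserves \<open>\<Phi>\<close> according to \<open>Phi_tv\<close>.
  So the pullback \<open>f\<close> is periodic for the standard lattice in all 28
  coordinates.\<close>

definition "bet x = 2 *s (of_int N0 *s x - bil g28 x (cvec C) *s cvec v)"

lemma N0: "N0 \<noteq> 0" using vC by (simp add: N0_def)

lemma bet_lin: "bet (x + y) = bet x + bet y" "bet (c *s x) = c *s bet x"
  by (simp_all add: bet_def bil_lin vec_eq_iff algebra_simps)

lemma bet_C: "bil g28 (bet x) (cvec C) = 0"
  by (simp add: bet_def bil_lin bil_cvec N0_def)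

lemma bet_inverse: "bil g28 z (cvec C) = 0 \<Longrightarrow> bet ((1 / (2 * of_int N0)) *s z) = z"
  using N0 by (simp add: bet_def bil_lin vec_eq_iff)

lemma bet_cvec: "\<exists>a. bet (cvec n) = cvec (2 *s a) \<and> ibil g28 a C = 0"
proof (intro exI[of _ "N0 *s n - ibil g28 n C *s v"] conjI)
  show "bet (cvec n) = cvec (2 *s (N0 *s n - ibil g28 n C *s v))" by (simp add: bet_def cvec_lin bil_cvec)
  show "ibil g28 (N0 *s n - ibil g28 n C *s v) C = 0" by (simp add: ibil_lin N0_def)
qed

lemma bet_real: "rvec (rev (bet (rvec t))) = bet (rvec t)"
proof -
  have "bet (rvec t) = rvec (2 *\<^sub>R (of_int N0 *\<^sub>R t - R t (ivec C) *\<^sub>R ivec v))"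
    unfolding bet_def cvec_ivec bil_rvec by (simp add: rvec_lin)
  then show ?thesis by (simp add: vec_eq_iff rvec_def rev_def)
qed

lemma imv_bet: "imv (bet x) = rev (bet (rvec (imv x)))"
proof -
  have "bet x = bet (rvec (rev x)) + \<i> *s bet (rvec (imv x))" using vec_parts[of x] by (metis bet_lin)
  also have "\<dots> = rvec (rev (bet (rvec (rev x)))) + \<i> *s rvec (rev (bet (rvec (imv x))))" by (simp only: bet_real)
  finally have "imv (bet x) = imv (rvec (rev (bet (rvec (rev x)))) + \<i> *s rvec (rev (bet (rvec (imv x)))))" by simp
  then show ?thesis by (simp add: vec_eq_iff imv_def rvec_def)
qed

definition "T = {x. imv (bet x) \<in> \<Omega>}"
definition "f x = \<Phi> (\<psi> (bet x))"

lemma f_period: assumes "x \<in> T" shows "f (x + cvec n) = f x"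
proof -
  obtain a where a: "bet (cvec n) = cvec (2 *s a)" "ibil g28 a C = 0" using bet_cvec by blast
  have s: "\<psi> (bet x) \<in> D28" using psi_slice(1)[OF bet_C] assms unfolding slice_def T_def by blast
  have aC: "bil g28 (cvec (2 *s a)) (rvec (ivec C)) = 0" using a(2) by (simp add: bil_cvec ibil_lin flip: cvec_ivec)
  have "\<psi> (cvec (2 *s a) + bet x) = Q28.tv (cvec C) (cvec (2 *s a)) (\<psi> (bet x))"
    unfolding cvec_ivec[of C] by (rule Q28.psi_add[OF Cr c' bet_C[unfolded cvec_ivec] aC])
  then have "f (x + cvec n) = \<Phi> (Q28.tv (cvec C) (cvec (2 *s a)) (\<psi> (bet x)))" unfolding f_def bet_lin a(1) by (simp add: add.commute)
  also have "\<dots> = f x" unfolding f_def by (rule Phi_tv[OF CC a(2) s])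
  finally show ?thesis .
qed

lemma cont_bet: "continuous_on S bet"
  unfolding bet_def by (intro continuous_intros)

lemma cont_imv: "continuous_on S (\<lambda>x. imv (bet x))"
  using continuous_on_compose2[OF linear_continuous_on[OF linear_imv[unfolded linear_conv_bounded_linear], of UNIV] cont_bet] by simp

lemma cont_R: "continuous_on S a \<Longrightarrow> continuous_on S b \<Longrightarrow> continuous_on S (\<lambda>x. R (a x) (b x))"
  unfolding rbil_def by (intro continuous_intros)

lemma T_open: "open T"
proof -
  have "T = {x. 0 < R (imv (bet x)) (imv (bet x))} \<inter> {x. 0 < R (imv (bet x)) (imv z0)}"
    unfolding T_def Omega_iff using imC[OF bet_C] by auto
  also have "open \<dots>" by (intro open_Int open_Collect_less cont_R cont_imv continuous_intros)
  finally show ?thesis .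
qed

lemma y0: "R (imv z0) (ivec C) = 0" "R (imv z0) (imv z0) > 0"
proof -
  show "R (imv z0) (ivec C) = 0" by (rule imC[OF z0C])
  have "\<psi> z0 \<in> cone g28" using z0 Q28.Dom_subset_cone by blast
  then show "R (imv z0) (imv z0) > 0" using Q28.psi_cone[OF Cr c' z0C[unfolded cvec_ivec]] by simp
qed

lemma tube_T: "tube T"
proof
  show "open T" by (rule T_open)
  show "convex T"
  proof (rule convexI)
    fix x y and u w :: real assume a: "x \<in> T" "y \<in> T" "0 \<le> u" "0 \<le> w" "u + w = 1"
    have "imv (bet (u *\<^sub>R x + w *\<^sub>R y)) = u *\<^sub>R imv (bet x) + w *\<^sub>R imv (bet y)"
      unfolding scaleR_eq_vmult bet_lin by (simp add: vec_eq_iff imv_def)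
    moreover have "u *\<^sub>R imv (bet x) + w *\<^sub>R imv (bet y) \<in> \<Omega>"
      by (rule Q28.halfcone_combination[OF Cr y0]) (use a in \<open>simp_all add: T_def\<close>)
    ultimately show "u *\<^sub>R x + w *\<^sub>R y \<in> T" by (simp add: T_def)
  qed
  show "z + rvec t \<in> T" if "z \<in> T" for z t
  proof -
    have "imv (bet (z + rvec t)) = imv (bet z)" unfolding imv_bet by (rule arg_cong[where f="\<lambda>t. rev (bet (rvec t))"]) (simp add: vec_eq_iff imv_def rvec_def)
    then show ?thesis using that by (simp add: T_def)
  qed
qed

sublocale TT: tube T by (rule tube_T)

lemma f_cholo: "cholo_on f T"
proof (rule cholo_on_ball_cover)
  fix x assume x: "x \<in> T"
  have s: "\<psi> (bet x) \<in> D28" if "x \<in> T" for x using psi_slice(1)[OF bet_C] that unfolding slice_def T_def by blast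
  have "\<exists>U G. open U \<and> \<psi> (bet x) \<in> U \<and> cholo_on G U \<and> (\<forall>z\<in>U \<inter> D28. G z = \<Phi> z)"
    using Phi_holo s[OF x] unfolding holo_on_def by (rule bspec)
  then obtain U H where U: "open U" "\<psi> (bet x) \<in> U" "cholo_on H U" "\<forall>z\<in>U \<inter> D28. H z = \<Phi> z"
    by (elim exE conjE)
  define V where "V = T \<inter> (\<lambda>x. \<psi> (bet x)) -` U"
  have cp: "continuous_on S \<psi>" for S unfolding Q28.psi_def[OF Cr c'] by (intro continuous_intros)
  have "continuous_on T (\<lambda>x. \<psi> (bet x))" using continuous_on_compose2[OF cp[of UNIV] cont_bet] by simp
  then have oV: "open V" unfolding V_def by (rule continuous_open_preimage[OF _ T_open U(1)])
  have pc: "cholo_on (\<lambda>z. \<psi> z $ i) W" for i W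
  proof -
    have "(\<lambda>z. \<psi> z $ i) = (\<lambda>z. rvec c' $ i + z $ i + bil g28 z (rvec c') * (- rvec (ivec C) $ i) + bil g28 z z * (- rvec (ivec C) $ i / 2))"
      unfolding Q28.psi_def[OF Cr c'] Q28.tv_def by (rule ext) (simp add: bil_rvec c' Q28.bil_sym[of "rvec c'"])
    then show ?thesis by (simp only:) (intro cholo_on_add cholo_on_nth cholo_on_mult cholo_on_const cholo_on_bil)
  qed
  have bc: "cholo_on (\<lambda>z. bet z $ i) W" for i W by (rule cholo_on_clinear) (simp_all add: bet_lin)
  have "cholo_on (\<lambda>x. H (\<psi> (bet x))) V"
  proof (rule cholo_on_compose[where V="\<psi> -` U" and f="\<lambda>z. H (\<psi> z)"])
    show "cholo_on (\<lambda>z. H (\<psi> z)) (\<psi> -` U)" by (rule cholo_on_compose[OF U(3) pc]) auto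
  qed (auto intro: bc simp: V_def)
  then have "cholo_on f V" by (rule cholo_on_transform[OF _ oV]) (use U(4) s in \<open>auto simp: V_def f_def\<close>)
  moreover have "x \<in> V" unfolding V_def using x U(2) by simp
  ultimately show "\<exists>V. x \<in> V \<and> cholo_on f V" by (intro exI[of _ V] conjI)
qed

lemma f_nice: "TT.nice f"
  unfolding TT.nice_def
proof (intro conjI ballI allI f_cholo)
  have "cvec (axis b 1) = axis b 1" for b :: 28 by (simp add: vec_eq_iff cvec_def axis_def)
  then show "f (z + axis b 1) = f z" if "z \<in> T" for z b using f_period[OF that, of "axis b 1"] by simp
qed

text \<open>The imaginary part is prescribed only modulo \<open>C\<close>, since \<open>psi\<close>
  alters it by a multiple of \<open>C\<close>, see \<open>psi_slice\<close>.\<close>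

definition "bnd y B \<longleftrightarrow> (\<forall>w\<in>slice. (\<exists>k. imv w = y + k *\<^sub>R ivec C) \<longrightarrow> norm (\<Phi> w) \<le> B)"

text \<open>Periodicity of \<open>f\<close> reduces points with the given imaginary part to a
  compact cube of parameters.\<close>

lemma bnd_exists: assumes y: "y \<in> \<Omega>" shows "\<exists>B. bnd y B"
proof -
  define s where "s = (1 / (2 * of_int N0) :: complex)"
  define p where "p = (\<lambda>t. rvec t + s *s (\<i> *s rvec y))"
  have yC: "bil g28 (\<i> *s rvec y) (cvec C) = 0" using y unfolding Omega_iff cvec_ivec by (simp add: bil_smult bil_rvec)
  have pT: "p t \<in> T" for t
  proof -
    have "bet (p t) = bet (rvec t) + \<i> *s rvec y" unfolding p_def bet_lin(1) s_def bet_inverse[OF yC] ..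
    also have "\<dots> = rvec (rev (bet (rvec t))) + \<i> *s rvec y" by (simp only: bet_real)
    finally have "imv (bet (p t)) = imv (rvec (rev (bet (rvec t))) + \<i> *s rvec y)" by simp
    also have "\<dots> = y" by (simp add: vec_eq_iff imv_def rvec_def)
    finally show ?thesis using y by (simp add: T_def)
  qed
  have "compact (f ` p ` cbox 0 1)"
  proof (intro compact_continuous_image)
    show "continuous_on (p ` cbox 0 1) f" by (rule continuous_on_subset[OF cholo_on_continuous[OF f_cholo]]) (use pT in auto)
    show "continuous_on (cbox 0 1) p" unfolding p_def by (intro continuous_intros)
  qed (rule compact_cbox)
  then obtain B where B: "\<And>t. t \<in> cbox 0 1 \<Longrightarrow> norm (f (p t)) \<le> B" using compact_imp_bounded bounded_iff by (metis image_eqI)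
  have "norm (\<Phi> w) \<le> B" if w: "w \<in> slice" "imv w = y + k *\<^sub>R ivec C" for w k
  proof -
    define z where "z = w - rvec c' - (\<i> * of_real k) *s rvec (ivec C)"
    note wp = slice_psi[OF w(1)]
    have zC: "bil g28 z (cvec C) = 0" using wp(1) Cr(1) unfolding z_def cvec_ivec by (simp add: bil_diff bil_smult bil_rvec)
    have pz: "\<psi> z = w"
    proof -
      have "\<psi> ((w - rvec c') + (- (\<i> * of_real k)) *s rvec (ivec C)) = \<psi> (w - rvec c')"
        by (rule Q28.psi_C[OF Cr c']) (use wp(1) in \<open>simp add: cvec_ivec\<close>)
      moreover have "(w - rvec c') + (- (\<i> * of_real k)) *s rvec (ivec C) = z" by (simp add: z_def vec_eq_iff)
      ultimately show ?thesis using wp(2) by simp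
    qed
    have iz: "imv z = y" using w(2) by (simp add: z_def vec_eq_iff imv_def rvec_def)
    define t where "t = rev (s *s z)"
    define n :: "int^28" where "n = (\<chi> i. \<lfloor>t $ i\<rfloor>)"
    define r where "r = 1 / (2 * real_of_int N0)"
    have sr: "s = of_real r" by (simp add: s_def r_def)
    have sz: "s *s z = p (t - ivec n) + cvec n"
    proof -
      have "z = rvec (rev z) + \<i> *s rvec y" using vec_parts[of z] iz by simp
      moreover have "rvec t = s *s rvec (rev z)" unfolding t_def sr by (simp add: vec_eq_iff rvec_def rev_def)
      ultimately have "s *s z = rvec t + s *s (\<i> *s rvec y)" by (metis vector_add_ldistrib)
      then show ?thesis unfolding p_def by (simp add: rvec_lin cvec_ivec)
    qed
    have "\<Phi> w = f (s *s z)" unfolding f_def s_def bet_inverse[OF zC] pz ..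
    also have "\<dots> = f (p (t - ivec n))" unfolding sz by (rule f_period[OF pT])
    finally have e: "\<Phi> w = f (p (t - ivec n))" .
    have c: "t - ivec n \<in> cbox 0 1" unfolding mem_box_cart by (simp add: n_def ivec_def) (intro allI, linarith)
    show ?thesis unfolding e by (rule B[OF c])
  qed
  then show ?thesis unfolding bnd_def by (intro exI[of _ B] ballI impI) (elim exE)
qed

lemma bnd_shift: assumes "bnd y B" shows "bnd (y + s *\<^sub>R ivec C) B"
  unfolding bnd_def
proof (intro ballI impI, elim exE)
  fix w k assume w: "w \<in> slice" and "imv w = y + s *\<^sub>R ivec C + k *\<^sub>R ivec C"
  then have "imv w = y + (s + k) *\<^sub>R ivec C" by (simp add: scaleR_left_distrib add.assoc)
  then show "norm (\<Phi> w) \<le> B" using assms w unfolding bnd_def by (elim ballE[of _ _ w]) (auto simp only:)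
qed

text \<open>The transvection along \<open>e\<close> by \<open>2 *s a\<close> preserves
  \<open>\<Phi>\<close> and the slice, and \<open>y'\<close> is its effect on imaginary parts. Over
  multiples of \<open>a\<close>, \<open>y'\<close> grows quadratically in the direction of
  \<open>e\<close>.\<close>

lemma bnd_tv:
  assumes y: "y \<in> \<Omega>" "bnd y B" and e: "ibil g28 e e = 0" "ibil g28 e C = 0" and a: "ibil g28 a e = 0" "ibil g28 a C = 0"
  defines "y' \<equiv> y + (2 * R y (ivec e)) *\<^sub>R ivec a - (2 * R y (ivec a)) *\<^sub>R ivec e - (2 * R (ivec a) (ivec a) * R y (ivec e)) *\<^sub>R ivec e"
  shows "y' \<in> \<Omega>" "bnd y' B"
proof -
  have b: "bil g28 (cvec e) (cvec e) = 0" "bil g28 (cvec (2 *s a)) (cvec e) = 0" using e a by (simp_all add: bil_cvec ibil_lin)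
  have tS: "Q28.tv (cvec e) (cvec (2 *s b)) w \<in> slice" if "w \<in> slice" "ibil g28 b e = 0" "ibil g28 b C = 0" for w b
  proof -
    have "Q28.tv (rvec (ivec e)) (rvec (ivec (2 *s b))) w \<in> D28"
      by (rule Q28.tv_Dom) (use that e in \<open>simp_all add: slice_def rbil_ivec ibil_lin\<close>)
    moreover have "bil g28 (Q28.tv (cvec e) (cvec (2 *s b)) w) (cvec C) = 1"
      using that e unfolding Q28.tv_def slice_def by (simp add: bil_lin bil_cvec ibil_lin)
    ultimately show ?thesis unfolding slice_def cvec_ivec by simp
  qed
  have im: "imv (Q28.tv (cvec e) (cvec (2 *s a)) w) = y' + k *\<^sub>R ivec C" if "imv w = y + k *\<^sub>R ivec C" for w k
  proof -
    have eC: "R (ivec C) (ivec e) = 0" "R (ivec C) (ivec a) = 0" using e(2) a(2) Q28.ibil_sym by (simp_all add: rbil_ivec)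
    have bi: "Im (bil g28 w (cvec x)) = R (imv w) (ivec x)" for x unfolding cvec_ivec bil_rvec_right by simp
    have aa: "bil g28 (cvec (2 *s a)) (cvec (2 *s a)) = of_real (4 * R (ivec a) (ivec a))" unfolding cvec_lin bil_smult by (simp add: bil_cvec rbil_ivec)
    have "imv (Q28.tv (cvec e) (cvec (2 *s a)) w) = imv w + (2 * R (imv w) (ivec e)) *\<^sub>R ivec a - (2 * R (imv w) (ivec a)) *\<^sub>R ivec e
        - (2 * R (ivec a) (ivec a) * R (imv w) (ivec e)) *\<^sub>R ivec e"
      unfolding Q28.tv_def aa unfolding cvec_lin bil_smult bi[symmetric] by (simp add: vec_eq_iff imv_def cvec_def ivec_def)
    then show ?thesis unfolding that y'_def by (simp add: rbil_lin eC)
  qed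
  obtain k where k: "imv (\<psi> (\<i> *s rvec y)) = y + k *\<^sub>R ivec C" and ps: "\<psi> (\<i> *s rvec y) \<in> slice"
  proof -
    have "bil g28 (\<i> *s rvec y) (cvec C) = 0" using y unfolding Omega_iff cvec_ivec by (simp add: bil_smult bil_rvec)
    moreover have "imv (\<i> *s rvec y) = y" by (simp add: vec_eq_iff imv_def rvec_def)
    ultimately show ?thesis using psi_slice[of "\<i> *s rvec y"] y(1) that by auto
  qed
  have "y' + k *\<^sub>R ivec C \<in> \<Omega>" unfolding im[OF k, symmetric] by (rule slice_psi(3)[OF tS[OF ps a]])
  then show y'O: "y' \<in> \<Omega>" unfolding Omega_shift .
  show "bnd y' B" unfolding bnd_def
  proof (intro ballI impI, elim exE)
    fix w k assume w: "w \<in> slice" "imv w = y' + k *\<^sub>R ivec C"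
    define u where "u = Q28.tv (cvec e) (cvec (2 *s (- a))) w"
    have a': "ibil g28 (- a) e = 0" "ibil g28 (- a) C = 0" using a by (simp_all add: ibil_def sum_negf)
    have uS: "u \<in> slice" unfolding u_def by (rule tS[OF w(1) a'])
    have wD: "w \<in> D28" using w by (simp add: slice_def)
    have m: "cvec (2 *s (- a)) = - cvec (2 *s a)" by (simp add: vec_eq_iff cvec_def)
    have wu: "w = Q28.tv (cvec e) (cvec (2 *s a)) u" unfolding u_def m by (rule Q28.tv_inverse(1)[OF b, symmetric])
    define q where "q = y' + k *\<^sub>R ivec C"
    have bi: "Im (bil g28 w (cvec x)) = R q (ivec x)" for x unfolding cvec_ivec bil_rvec_right w(2) q_def by simp
    have aa: "bil g28 (cvec (2 *s (- a))) (cvec (2 *s (- a))) = of_real (4 * R (ivec a) (ivec a))" unfolding m bil_uminus cvec_lin bil_smult by (simp add: bil_cvec rbil_ivec)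
    have iu: "imv u = q - (2 * R q (ivec e)) *\<^sub>R ivec a + (2 * R q (ivec a)) *\<^sub>R ivec e - (2 * R (ivec a) (ivec a) * R q (ivec e)) *\<^sub>R ivec e"
      unfolding u_def Q28.tv_def aa unfolding m cvec_lin bil_smult bil_uminus bi[symmetric] unfolding q_def w(2)[symmetric]
      by (simp add: vec_eq_iff imv_def cvec_def ivec_def)
    have re: "R (ivec e) (ivec e) = 0" "R (ivec a) (ivec e) = 0" "R (ivec e) (ivec a) = 0" "R (ivec C) (ivec e) = 0" "R (ivec C) (ivec a) = 0"
      using e a Q28.ibil_sym by (simp_all add: rbil_ivec)
    have qe: "R q (ivec e) = R y (ivec e)" unfolding q_def y'_def by (simp add: rbil_lin re)
    have qa: "R q (ivec a) = R y (ivec a) + 2 * R y (ivec e) * R (ivec a) (ivec a)" unfolding q_def y'_def by (simp add: rbil_lin re)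
    have "imv u = y + k *\<^sub>R ivec C" unfolding iu qe qa unfolding q_def y'_def by (simp add: vec_eq_iff algebra_simps)
    then have "norm (\<Phi> u) \<le> B" using y(2) uS unfolding bnd_def by blast
    moreover have "\<Phi> w = \<Phi> u" using Phi_tv[OF e(1) a(1), of u] uS unfolding wu[symmetric] slice_def by simp
    ultimately show "norm (\<Phi> w) \<le> B" by simp
  qed
qed

text \<open>\<open>M \<nu>\<close> represents the exponent \<open>\<nu>\<close>: pairing with it is
  the character of index \<open>\<nu>\<close> in the coordinates of \<open>f\<close>. The
  denominator is that of \<open>bet_inverse\<close>.\<close>

definition "M = (SOME M. \<forall>\<nu>. \<forall>y. R (M \<nu>) y = (\<Sum>b\<in>UNIV. of_int (\<nu> $ b) / (2 * of_int N0) * y $ b))"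

lemma M: "R (M \<nu>) y = (\<Sum>b\<in>UNIV. of_int (\<nu> $ b) / (2 * of_int N0) * y $ b)"
proof -
  have "\<forall>\<nu>::int^28. \<exists>\<mu>. \<forall>y. R \<mu> y = (\<Sum>b\<in>UNIV. of_int (\<nu> $ b) / (2 * of_int N0) * y $ b)" by (intro allI represent28)
  then have "\<exists>M. \<forall>\<nu>::int^28. \<forall>y. R (M \<nu>) y = (\<Sum>b\<in>UNIV. of_int (\<nu> $ b) / (2 * of_int N0) * y $ b)" by (rule choice)
  from someI_ex[OF this] show ?thesis unfolding M_def by blast
qed

lemma M_complex: "(\<Sum>b\<in>UNIV. of_int (\<nu> $ b) * ((1 / (2 * of_int N0)) *s z) $ b) = bil g28 (rvec (M \<nu>)) z"
proof -
  have "bil g28 (rvec (M \<nu>)) z = Complex (R (M \<nu>) (rev z)) (R (M \<nu>) (imv z))"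
    unfolding Q28.bil_sym[of _ z] bil_rvec_right Q28.rbil_sym[of _ "M \<nu>"] ..
  also have "\<dots> = (\<Sum>b\<in>UNIV. of_int (\<nu> $ b) * ((1 / (2 * of_int N0)) *s z) $ b)"
  proof -
    have "of_int (\<nu> $ b) * ((1 / (2 * of_int N0)) *s z) $ b = of_real (of_int (\<nu> $ b) / (2 * of_int N0)) * z $ b" for b by simp
    then show ?thesis unfolding M by (simp add: complex_eq_iff Re_sum Im_sum rev_def imv_def del: of_real_divide of_real_mult)
  qed
  finally show ?thesis ..
qed

lemma expansion:
  "\<exists>A. (\<forall>z. bil g28 z (cvec C) = 0 \<longrightarrow> imv z \<in> \<Omega> \<longrightarrow> ((\<lambda>m. A m * ee (bil g28 (rvec (M m)) z)) has_sum \<Phi> (\<psi> z)) UNIV) \<and>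
    (\<forall>m y B. y \<in> \<Omega> \<longrightarrow> bnd y B \<longrightarrow> norm (A m) * exp (- 2 * pi * R (M m) y) \<le> B)"
proof (rule TT.fourier_expansion[OF f_nice])
  fix A assume A: "\<And>z. z \<in> T \<Longrightarrow> ((\<lambda>m. A m * ee (\<Sum>b\<in>UNIV. of_int (m $ b) * z $ b)) has_sum f z) UNIV"
    "\<And>m z B. z \<in> T \<Longrightarrow> (\<And>t. norm (f (z + rvec t)) \<le> B) \<Longrightarrow> norm (A m * ee (\<Sum>b\<in>UNIV. of_int (m $ b) * z $ b)) \<le> B"
  show ?thesis
  proof (intro exI[of _ A] conjI allI impI)
    fix z assume z: "bil g28 z (cvec C) = 0" "imv z \<in> \<Omega>"
    have "(1 / (2 * of_int N0)) *s z \<in> T" unfolding T_def mem_Collect_eq bet_inverse[OF z(1)] by (rule z(2))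
    from A(1)[OF this] show "((\<lambda>m. A m * ee (bil g28 (rvec (M m)) z)) has_sum \<Phi> (\<psi> z)) UNIV" unfolding M_complex f_def bet_inverse[OF z(1)] .
  next
    fix m y B assume y: "y \<in> \<Omega>" "bnd y B"
    define z where "z = \<i> *s rvec y"
    have z: "bil g28 z (cvec C) = 0" using y unfolding Omega_iff cvec_ivec z_def by (simp add: bil_smult bil_rvec)
    have iz: "imv z = y" by (simp add: z_def vec_eq_iff imv_def rvec_def)
    have zT: "(1 / (2 * of_int N0)) *s z \<in> T" unfolding T_def mem_Collect_eq bet_inverse[OF z] iz by (rule y(1))
    have "norm (f ((1 / (2 * of_int N0)) *s z + rvec t)) \<le> B" for t
    proof -
      have i: "imv (bet ((1 / (2 * of_int N0)) *s z + rvec t)) = y"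
      proof -
        have "bet ((1 / (2 * of_int N0)) *s z + rvec t) = z + rvec (rev (bet (rvec t)))" unfolding bet_lin(1) bet_inverse[OF z] bet_real ..
        then have "imv (bet ((1 / (2 * of_int N0)) *s z + rvec t)) = imv (z + rvec (rev (bet (rvec t))))" by simp
        then show ?thesis using iz by (simp add: vec_eq_iff imv_def rvec_def)
      qed
      from psi_slice[OF bet_C, of "(1 / (2 * of_int N0)) *s z + rvec t"] show ?thesis
        using y unfolding i f_def bnd_def by blast
    qed
    from A(2)[OF zT this] have "norm (A m * ee (bil g28 (rvec (M m)) z)) \<le> B" unfolding M_complex .
    moreover have "Im (bil g28 (rvec (M m)) z) = R (M m) y" unfolding Q28.bil_sym[of _ z] bil_rvec_right iz Q28.rbil_sym[of y] by simp
    ultimately show "norm (A m) * exp (- 2 * pi * R (M m) y) \<le> B" by (simp add: norm_mult norm_ee)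
  qed
qed

text \<open>Three independent vectors of the last, negative definite summand, and two linear
  conditions over the integers.\<close>

lemma orthogonal_negative_vector: "\<exists>a. ibil g28 a e = 0 \<and> ibil g28 a C = 0 \<and> ibil g28 a a < 0"
proof -
  let ?i = "\<lambda>k. iemb (axis k 1)"
  obtain a b c where abc: "(a,b,c) \<noteq> (0,0,0)"
    "a * ibil g28 (?i 0) e + b * ibil g28 (?i 1) e + c * ibil g28 (?i 2) e = 0"
    "a * ibil g28 (?i 0) C + b * ibil g28 (?i 1) C + c * ibil g28 (?i 2) C = 0" by (rule two_equations_three_unknowns)
  define u :: "int^8" where "u = a *s axis 0 1 + b *s axis 1 1 + c *s axis 2 1"
  have iu: "iemb u = a *s ?i 0 + b *s ?i 1 + c *s ?i 2" by (simp add: vec28_eq_iff iemb_nth u_def)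
  have "u $ 0 = a" "u $ 1 = b" "u $ 2 = c" by (simp_all add: u_def axis_def)
  then have "u \<noteq> 0" using abc(1) by auto
  then have "pe u u > 0" using pe_nonneg[of u] pe_eq_0[of u] by linarith
  then have "ibil g28 (iemb u) (iemb u) < 0" unfolding ibil_iemb pe_def by simp
  moreover have "ibil g28 (iemb u) e = 0" "ibil g28 (iemb u) C = 0" unfolding iu ibil_lin using abc by simp_all
  ultimately show ?thesis by blast
qed

text \<open>Shifting \<open>y\<close> by multiples of \<open>C\<close> of either sign leaves the
  bound unchanged, which forces \<open>R \<mu> (ivec C) = 0\<close>. Under transvections by
  multiples \<open>n\<close> of a \<open>b\<close> of negative norm, the exponent has
  \<open>n^2\<close>-coefficient \<open>4 * pi\<close> times
  \<open>(b,b) * (y,e) * (\<mu>,e)\<close>, which must be \<le> 0.\<close>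

lemma coefficient_support:
  assumes A: "\<And>y B. y \<in> \<Omega> \<Longrightarrow> bnd y B \<Longrightarrow> norm (a::complex) * exp (- 2 * pi * R \<mu> y) \<le> B" and a: "a \<noteq> 0"
  shows "R \<mu> (ivec C) = 0" "\<And>y e. y \<in> \<Omega> \<Longrightarrow> ibil g28 e e = 0 \<Longrightarrow> ibil g28 e C = 0 \<Longrightarrow> R y (ivec e) * R \<mu> (ivec e) \<ge> 0"
proof -
  have y0O: "imv z0 \<in> \<Omega>" using y0 by (simp add: Omega_iff)
  then obtain B where B: "bnd (imv z0) B" using bnd_exists by blast
  have "- 2 * pi * (s * R \<mu> (ivec C)) \<le> 0" if "s = 1 \<or> s = -1" for s
  proof (rule bounded_quadratic_exponent[where q=0])
    show "0 < norm a" using a by simp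
    fix n :: nat
    have "R \<mu> (imv z0 + (s * (real n)\<^sup>2) *\<^sub>R ivec C) = R \<mu> (imv z0) + s * (real n)\<^sup>2 * R \<mu> (ivec C)" by (simp add: rbil_lin)
    moreover have "norm a * exp (- 2 * pi * R \<mu> (imv z0 + (s * (real n)\<^sup>2) *\<^sub>R ivec C)) \<le> B"
      by (rule A) (use y0O bnd_shift[OF B] Omega_shift in auto)
    ultimately show "norm a * exp (- 2 * pi * R \<mu> (imv z0) + 0 * real n + - 2 * pi * (s * R \<mu> (ivec C)) * (real n)\<^sup>2) \<le> B"
      by (simp add: algebra_simps)
  qed
  from this[of 1] this[of "-1"] pi_gt_zero show C0: "R \<mu> (ivec C) = 0" by (auto simp: mult_le_0_iff zero_le_mult_iff)
  fix y e assume y: "y \<in> \<Omega>" and e: "ibil g28 e e = 0" "ibil g28 e C = 0"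
  obtain B where B: "bnd y B" using bnd_exists[OF y] by blast
  obtain b where b: "ibil g28 b e = 0" "ibil g28 b C = 0" "ibil g28 b b < 0" using orthogonal_negative_vector by blast
  define r where "r = 4 * pi * (R (ivec b) (ivec b) * (R y (ivec e) * R \<mu> (ivec e)))"
  have "r \<le> 0"
  proof (rule bounded_quadratic_exponent)
    show "0 < norm a" using a by simp
    fix n :: nat
    have nb: "ibil g28 (int n *s b) e = 0" "ibil g28 (int n *s b) C = 0" using b by (simp_all add: ibil_lin)
    from A[OF bnd_tv[OF y B e nb]]
    show "norm a * exp (- 2 * pi * R \<mu> y + (- 2 * pi * (2 * R y (ivec e) * R \<mu> (ivec b) - 2 * R y (ivec b) * R \<mu> (ivec e))) * real n + r * (real n)\<^sup>2) \<le> B"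
      by (simp add: ivec_lin rbil_lin r_def power2_eq_square algebra_simps)
  qed
  moreover have "R (ivec b) (ivec b) < 0" using b(3) by (simp add: rbil_ivec)
  then have "r > 0" if "R y (ivec e) * R \<mu> (ivec e) < 0" unfolding r_def using mult_neg_neg[OF _ that] by simp
  ultimately show "R y (ivec e) * R \<mu> (ivec e) \<ge> 0" by (meson not_le)
qed

end

section \<open>Exchange of Taylor and Fourier series\<close>

lemma power_series_leading:
  fixes c :: "nat \<Rightarrow> complex"
  assumes "\<epsilon> > 0" "\<And>s. s \<noteq> 0 \<Longrightarrow> norm s < \<epsilon> \<Longrightarrow> (\<lambda>k. c k * s ^ k) sums (s ^ m * g s)" "(g \<longlongrightarrow> L) (at 0)" shows "c m = L"
  using assms(2)
proof (induction m arbitrary: c)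
  case 0
  have "(g \<longlongrightarrow> c 0) (at 0)" by (rule powser_limit_0_strong[OF assms(1)]) (use 0 in simp)
  then show ?case using tendsto_unique[OF _ assms(3)] by simp
next
  case (Suc m)
  have "((\<lambda>s. s ^ Suc m * g s) \<longlongrightarrow> c 0) (at 0)" by (rule powser_limit_0_strong[OF assms(1)]) (rule Suc.prems)
  moreover have "((\<lambda>s. s ^ Suc m * g s) \<longlongrightarrow> 0 ^ Suc m * L) (at 0)" by (intro tendsto_intros assms(3))
  ultimately have c0: "c 0 = 0" using tendsto_unique[of "at (0::complex)"] by force
  have "c (Suc m) = L"
  proof (rule Suc.IH)
    fix s :: complex assume s: "s \<noteq> 0" "norm s < \<epsilon>"
    have "(\<lambda>k. c (Suc k) * s ^ Suc k) sums (s ^ Suc m * g s - c 0 * s ^ 0)"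
      by (subst sums_Suc_iff) (use Suc.prems[OF s] in simp)
    then have "(\<lambda>k. c (Suc k) * s ^ Suc k * inverse s) sums (s ^ Suc m * g s * inverse s)" using c0 by (intro sums_mult2) simp
    then show "(\<lambda>k. c (Suc k) * s ^ k) sums (s ^ m * g s)" using s(1) by (simp add: field_simps)
  qed
  then show ?case .
qed

lemma has_sum_exp: "((\<lambda>k. x ^ k / fact k) has_sum exp x) UNIV" for x :: "'a::{banach,real_normed_field}"
proof (rule norm_summable_imp_has_sum)
  have e: "x ^ k / fact k = x ^ k /\<^sub>R fact k" for k by (simp add: scaleR_conv_of_real field_simps)
  show "summable (\<lambda>n. norm (x ^ n / fact n))" unfolding e by (rule summable_norm_exp)
  show "(\<lambda>k. x ^ k / fact k) sums exp x" unfolding e by (rule exp_converges)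
qed

text \<open>Expand each exponential and interchange the sums; the double family is absolutely
  summable because its sum over the powers is the majorant in \<open>abs\<close>.\<close>

lemma exp_series_exchange:
  fixes B q :: "'i \<Rightarrow> complex"
  assumes s: "s \<noteq> 0" and abs: "(\<lambda>i. norm (B i) * exp (norm s * norm (q i))) summable_on UNIV"
    and h: "((\<lambda>i. B i * exp (s * q i)) has_sum h) UNIV"
  shows "\<And>k. (\<lambda>i. B i * (q i ^ k / fact k)) summable_on UNIV"
    and "(\<lambda>k. (\<Sum>\<^sub>\<infinity>i. B i * (q i ^ k / fact k)) * s ^ k) sums h"
proof -
  define F where "F = (\<lambda>i k. B i * ((s * q i) ^ k / fact k))"
  have "(\<lambda>(i,k). norm (F i k)) summable_on (UNIV \<times> UNIV)"
  proof (rule summable_on_SigmaI[OF _ abs])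
    fix i
    have "((\<lambda>k. norm (B i) * ((norm s * norm (q i)) ^ k / fact k)) has_sum norm (B i) * exp (norm s * norm (q i))) UNIV"
      by (intro has_sum_cmult_right has_sum_exp)
    then show "((\<lambda>k. case (i,k) of (i,k) \<Rightarrow> norm (F i k)) has_sum norm (B i) * exp (norm s * norm (q i))) UNIV"
      by (simp add: F_def norm_mult norm_divide norm_power)
  qed simp
  then have "(\<lambda>p. norm (case p of (i,k) \<Rightarrow> F i k)) summable_on (UNIV \<times> UNIV)" by (simp add: case_prod_unfold)
  then have "(\<lambda>(i,k). F i k) summable_on (UNIV \<times> UNIV)" by (rule abs_summable_summable)
  then obtain S where S: "((\<lambda>(i,k). F i k) has_sum S) (UNIV \<times> UNIV)" unfolding summable_on_def by blast
  have "((\<lambda>i. B i * exp (s * q i)) has_sum S) UNIV"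
    by (rule has_sum_SigmaD[OF S]) (unfold F_def prod.case, intro has_sum_cmult_right has_sum_exp)
  then have Sh: "S = h" using h has_sum_unique by blast
  have S': "((\<lambda>(k,i). F i k) has_sum h) (UNIV \<times> UNIV)" using S unfolding Sh by (subst has_sum_swap) simp
  have Fs: "(\<lambda>i. F i k) summable_on UNIV" for k
    by (rule summable_on_SigmaD1[of "\<lambda>k i. F i k" UNIV "\<lambda>_. UNIV"]) (use S' in \<open>auto simp: summable_on_def\<close>)
  have FB: "F i k = B i * (q i ^ k / fact k) * s ^ k" for i k by (simp add: F_def power_mult_distrib)
  show sm: "(\<lambda>i. B i * (q i ^ k / fact k)) summable_on UNIV" for k
  proof -
    have "(\<lambda>i. F i k * inverse (s ^ k)) summable_on UNIV" by (intro summable_on_cmult_left Fs)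
    moreover have "F i k * inverse (s ^ k) = B i * (q i ^ k / fact k)" for i unfolding FB using s by simp
    ultimately show ?thesis by (simp only:)
  qed
  have "((\<lambda>k. (\<Sum>\<^sub>\<infinity>i. B i * (q i ^ k / fact k)) * s ^ k) has_sum h) UNIV"
  proof (rule has_sum_SigmaD[OF S'])
    fix k
    show "((\<lambda>i. case (k,i) of (k,i) \<Rightarrow> F i k) has_sum (\<Sum>\<^sub>\<infinity>i. B i * (q i ^ k / fact k)) * s ^ k) UNIV"
      unfolding FB prod.case by (intro has_sum_cmult_left has_sum_infsum sm)
  qed
  then show "(\<lambda>k. (\<Sum>\<^sub>\<infinity>i. B i * (q i ^ k / fact k)) * s ^ k) sums h" by (rule has_sum_imp_sums)
qed

text \<open>Exponents with the same projection to the sublattice restrict to the same character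
  there, and their coefficients are added.\<close>

lemma has_sum_fibers:
  fixes b :: "'i \<Rightarrow> complex"
  assumes S: "((\<lambda>i. b i * E (p i)) has_sum S) UNIV" and E: "\<And>\<nu>. E \<nu> \<noteq> 0"
  shows "((\<lambda>\<nu>. (\<Sum>\<^sub>\<infinity>i\<in>{i. p i = \<nu>}. b i) * E \<nu>) has_sum S) UNIV"
proof -
  have inj: "inj_on (\<lambda>i. (p i, i)) UNIV" by (rule inj_onI) simp
  have im: "(\<lambda>i. (p i, i)) ` UNIV = Sigma UNIV (\<lambda>\<nu>. {i. p i = \<nu>})" by auto
  have T: "((\<lambda>(\<nu>,i). b i * E \<nu>) has_sum S) (Sigma UNIV (\<lambda>\<nu>. {i. p i = \<nu>}))"
    unfolding im[symmetric] has_sum_reindex[OF inj] using S by (simp add: o_def)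
  show ?thesis
  proof (rule has_sum_SigmaD[OF T])
    fix \<nu>
    have "(\<lambda>i. b i * E (p i)) summable_on {i. p i = \<nu>}" by (rule summable_on_subset_banach[of _ UNIV]) (use S in \<open>auto simp: summable_on_def\<close>)
    then have "(\<lambda>i. b i * E \<nu>) summable_on {i. p i = \<nu>}" by (rule summable_on_cong[THEN iffD1, rotated]) simp
    then have "(\<lambda>i. b i * E \<nu> * inverse (E \<nu>)) summable_on {i. p i = \<nu>}" by (rule summable_on_cmult_left)
    moreover have "b i * E \<nu> * inverse (E \<nu>) = b i" for i using E[of \<nu>] by simp
    ultimately have "b summable_on {i. p i = \<nu>}" by (simp only:)
    then show "((\<lambda>i. case (\<nu>,i) of (\<nu>,i) \<Rightarrow> b i * E \<nu>) has_sum (\<Sum>\<^sub>\<infinity>i\<in>{i. p i = \<nu>}. b i) * E \<nu>) {i. p i = \<nu>}"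
      unfolding prod.case by (intro has_sum_cmult_left has_sum_infsum)
  qed
qed

lemma floor_approximation: "(\<lambda>k. real_of_int \<lfloor>real (Suc k) * x\<rfloor> / real (Suc k)) \<longlonglongrightarrow> x"
proof (rule LIMSEQ_I)
  fix r :: real assume "r > 0"
  then obtain N where N: "inverse (real (Suc N)) < r" using reals_Archimedean by blast
  have "norm (real_of_int \<lfloor>real (Suc k) * x\<rfloor> / real (Suc k) - x) < r" if "k \<ge> N" for k
  proof -
    have "\<bar>real_of_int \<lfloor>real (Suc k) * x\<rfloor> - real (Suc k) * x\<bar> \<le> 1" by linarith
    moreover have "real_of_int \<lfloor>real (Suc k) * x\<rfloor> / real (Suc k) - x = (real_of_int \<lfloor>real (Suc k) * x\<rfloor> - real (Suc k) * x) / real (Suc k)"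
      by (simp add: field_simps del: of_nat_Suc)
    ultimately have "norm (real_of_int \<lfloor>real (Suc k) * x\<rfloor> / real (Suc k) - x) \<le> 1 / real (Suc k)" by (simp add: abs_divide divide_right_mono del: of_nat_Suc)
    also have "\<dots> \<le> inverse (real (Suc N))" unfolding inverse_eq_divide by (rule divide_left_mono) (use that in simp_all)
    finally show ?thesis using N by simp
  qed
  then show "\<exists>no. \<forall>k\<ge>no. norm (real_of_int \<lfloor>real (Suc k) * x\<rfloor> / real (Suc k) - x) < r" by (intro exI[of _ N] allI impI)
qed

section \<open>Exponents have nonnegative norm\<close>

context cusp_chart begin

text \<open>\<open>?a\<close> and \<open>?b\<close> span a totally isotropic plane. If both are
  orthogonal to \<open>C\<close>, one of them is not proportional to it; otherwise the combination
  orthogonal to \<open>C\<close> cannot be proportional to \<open>C\<close>, which is not orthogonal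
  to the plane.\<close>

lemma second_isotropic: "\<exists>e. ibil g28 e e = 0 \<and> ibil g28 e C = 0 \<and> (\<forall>k. ivec e \<noteq> k *\<^sub>R ivec C)"
proof -
  let ?a = "axis 0 1 :: int^28" and ?b = "axis 2 1 :: int^28"
  have ax: "(axis 0 1 :: int^28) $ of_nat k = (if k = 0 then 1 else 0)" "(axis 2 1 :: int^28) $ of_nat k = (if k = 2 then 1 else 0)" if "k < 28" for k
  proof -
    have "(of_nat k :: 28) = 0 \<longleftrightarrow> k = 0" using ix28_of_nat[OF that] ix28_of_nat[of 0] by (cases "k = 0") auto
    then show "(axis 0 1 :: int^28) $ of_nat k = (if k = 0 then 1 else 0)" by (simp add: axis_def)
    have "(of_nat k :: 28) = 2 \<longleftrightarrow> k = 2" using ix28_of_nat[OF that] ix28_of_nat[of 2] by (cases "k = 2") auto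
    then show "(axis 2 1 :: int^28) $ of_nat k = (if k = 2 then 1 else 0)" by (simp add: axis_def)
  qed
  have f: "ibil g28 ?a ?a = 0" "ibil g28 ?a ?b = 0" "ibil g28 ?b ?a = 0" "ibil g28 ?b ?b = 0"
  proof -
    have b0: "bform 3 (\<lambda>k. (axis 0 1 :: int^28) $ of_nat k) (\<lambda>k. (axis 0 1 :: int^28) $ of_nat k) = bform 3 (\<lambda>k. if k = 0 then 1 else 0) (\<lambda>k. if k = 0 then 1 else 0)"
      by (rule bform_cong; rule ax; simp)
    have b1: "bform 3 (\<lambda>k. (axis 0 1 :: int^28) $ of_nat k) (\<lambda>k. (axis 2 1 :: int^28) $ of_nat k) = bform 3 (\<lambda>k. if k = 0 then 1 else 0) (\<lambda>k. if k = 2 then 1 else 0)"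
      by (rule bform_cong; rule ax; simp)
    have b2: "bform 3 (\<lambda>k. (axis 2 1 :: int^28) $ of_nat k) (\<lambda>k. (axis 0 1 :: int^28) $ of_nat k) = bform 3 (\<lambda>k. if k = 2 then 1 else 0) (\<lambda>k. if k = 0 then 1 else 0)"
      by (rule bform_cong; rule ax; simp)
    have b3: "bform 3 (\<lambda>k. (axis 2 1 :: int^28) $ of_nat k) (\<lambda>k. (axis 2 1 :: int^28) $ of_nat k) = bform 3 (\<lambda>k. if k = 2 then 1 else 0) (\<lambda>k. if k = 2 then 1 else 0)"
      by (rule bform_cong; rule ax; simp)
    show "ibil g28 ?a ?a = 0" "ibil g28 ?a ?b = 0" "ibil g28 ?b ?a = 0" "ibil g28 ?b ?b = 0"
      unfolding ibil28 b0 b1 b2 b3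
      by (simp_all add: bform_def e8form_def)
  qed
  let ?p = "ibil g28 ?a C" and ?q = "ibil g28 ?b C"
  have c02: "ivec ?a $ 0 = 1" "ivec ?a $ 2 = 0" "ivec ?b $ 0 = 0" "ivec ?b $ 2 = 1" using ax(1)[of 0] ax(1)[of 2] ax(2)[of 0] ax(2)[of 2] by (simp_all add: ivec_def)
  show ?thesis
  proof (cases "?p = 0 \<and> ?q = 0")
    case True
    show ?thesis
    proof (cases "\<exists>k. ivec ?a = k *\<^sub>R ivec C")
      case t: True
      then obtain k where k: "ivec ?a = k *\<^sub>R ivec C" by blast
      have "ivec ?b \<noteq> j *\<^sub>R ivec C" for j
      proof
        assume j: "ivec ?b = j *\<^sub>R ivec C"
        have "k * ivec C $ 0 = 1" "k * ivec C $ 2 = 0" "j * ivec C $ 0 = 0" "j * ivec C $ 2 = 1"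
          using arg_cong[OF k, of "\<lambda>v. v $ 0"] arg_cong[OF k, of "\<lambda>v. v $ 2"] arg_cong[OF j, of "\<lambda>v. v $ 0"] arg_cong[OF j, of "\<lambda>v. v $ 2"] unfolding c02 by simp_all
        then show False by (metis mult_eq_0_iff zero_neq_one)
      qed
      then show ?thesis using f True by (intro exI[of _ ?b]) simp
    next
      case False then show ?thesis using f True by (intro exI[of _ ?a]) simp
    qed
  next
    case False
    let ?e = "?q *s ?a - ?p *s ?b"
    have ee: "ibil g28 ?e ?e = 0" "ibil g28 ?e C = 0" by (simp_all add: ibil_lin f)
    have "ivec ?e \<noteq> k *\<^sub>R ivec C" for k
    proof
      assume k: "ivec ?e = k *\<^sub>R ivec C"
      have i: "ivec ?e $ 0 = of_int ?q" "ivec ?e $ 2 = - of_int ?p" unfolding ivec_lin using c02 by simp_all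
      have "k \<noteq> 0"
      proof
        assume "k = 0"
        then have "real_of_int ?q = 0" "real_of_int ?p = 0" using i unfolding k by simp_all
        then show False using False by simp
      qed
      moreover have "R (ivec ?a) (ivec ?e) = 0" "R (ivec ?b) (ivec ?e) = 0" by (simp_all add: rbil_ivec ibil_lin f)
      ultimately have "R (ivec ?a) (ivec C) = 0" "R (ivec ?b) (ivec C) = 0" unfolding k rbil_scale by simp_all
      then show False using False unfolding rbil_ivec by simp
    qed
    then show ?thesis using ee by blast
  qed
qed

text \<open>The sign condition passes from integral to real isotropic vectors, because these are
  parametrised by quadratic expressions in a free vector. Testing it on the two isotropic vectors
  \<open>y \<plusminus> s \<nu>\<close>, with \<open>\<nu>\<close> the part of \<open>\<mu>\<close>
  orthogonal to \<open>y\<close>, bounds the negative part of the norm of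
  \<open>\<mu>\<close>.\<close>

lemma hyperbolic_nonneg:
  assumes y: "y \<in> \<Omega>" and \<mu>: "R \<mu> (ivec C) = 0" and H: "\<And>e. ibil g28 e e = 0 \<Longrightarrow> ibil g28 e C = 0 \<Longrightarrow> R y (ivec e) * R \<mu> (ivec e) \<ge> 0"
  shows "R \<mu> \<mu> \<ge> 0"
proof -
  have yy: "R y (ivec C) = 0" "R y y > 0" using y by (simp_all add: Omega_iff)
  obtain e1 where e1: "ibil g28 e1 e1 = 0" "ibil g28 e1 C = 0" "\<And>k. ivec e1 \<noteq> k *\<^sub>R ivec C" using second_isotropic by blast
  define E where "E = ivec e1"
  have E: "R E E = 0" "R E (ivec C) = 0" using e1 by (simp_all add: E_def rbil_ivec)
  \<comment> \<open>Up to a factor, the reflection of the isotropic vector \<open>E\<close> in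
    \<open>u\<close>. It is isotropic and quadratic in \<open>u\<close>, and for isotropic
    \<open>u\<close> it is a multiple of \<open>u\<close>.\<close>
  define e where "e = (\<lambda>u. (2 * R u E) *\<^sub>R u - R u u *\<^sub>R E)"
  define b where "b = (\<lambda>u. of_int N0 *\<^sub>R u - R u (ivec C) *\<^sub>R ivec v)"
  define Q where "Q = (\<lambda>u. R y (e (b u)) * R \<mu> (e (b u)))"
  have Qi: "Q (ivec n) \<ge> 0" for n
  proof -
    define bn where "bn = N0 *s n - ibil g28 n C *s v"
    define en where "en = (2 * ibil g28 bn e1) *s bn - ibil g28 bn bn *s e1"
    have bi: "b (ivec n) = ivec bn" by (simp add: b_def bn_def ivec_lin rbil_ivec)
    have ei: "e (b (ivec n)) = ivec en" unfolding bi e_def en_def E_def by (simp add: ivec_lin rbil_ivec)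
    have bC: "ibil g28 bn C = 0" by (simp add: bn_def ibil_lin N0_def)
    have "ibil g28 en en = 0" using e1(1) Q28.ibil_sym[of e1 bn] by (simp add: en_def ibil_lin)
    moreover have "ibil g28 en C = 0" using e1(2) bC by (simp add: en_def ibil_lin)
    ultimately show ?thesis unfolding Q_def ei by (rule H)
  qed
  \<comment> \<open>Homogeneity of degree 4 carries nonnegativity from integral to rational
    arguments.\<close>
  have Qs: "Q (c *\<^sub>R u) = (c\<^sup>2)\<^sup>2 * Q u" for c u
  proof -
    have "b (c *\<^sub>R u) = c *\<^sub>R b u" by (simp add: b_def rbil_lin algebra_simps)
    moreover have "e (c *\<^sub>R x) = (c * c) *\<^sub>R e x" for x by (simp add: e_def rbil_lin algebra_simps)
    ultimately show ?thesis by (simp add: Q_def rbil_lin power2_eq_square)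
  qed
  have Q: "Q u \<ge> 0" for u
  proof -
    define U where "U = (\<lambda>k::nat. (1 / real (Suc k)) *\<^sub>R ivec (\<chi> i. \<lfloor>real (Suc k) * u $ i\<rfloor>))"
    have "U \<longlonglongrightarrow> u"
    proof (rule vec_tendstoI)
      fix i
      have "(\<lambda>k. U k $ i) = (\<lambda>k. real_of_int \<lfloor>real (Suc k) * u $ i\<rfloor> / real (Suc k))" by (simp add: U_def ivec_def del: of_nat_Suc)
      then show "(\<lambda>k. U k $ i) \<longlonglongrightarrow> u $ i" using floor_approximation[of "u $ i"] by simp
    qed
    moreover have "continuous_on UNIV Q" unfolding Q_def e_def b_def by (intro continuous_intros cont_R)
    ultimately have "(\<lambda>k. Q (U k)) \<longlonglongrightarrow> Q u" by (metis UNIV_I continuous_on_eq_continuous_at isCont_tendsto_compose open_UNIV)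
    moreover have "Q (U k) \<ge> 0" for k unfolding U_def Qs by (intro mult_nonneg_nonneg Qi) simp
    ultimately show ?thesis by (intro LIMSEQ_le_const) auto
  qed
  have iso: "R y u * R \<mu> u \<ge> 0" if u: "R u (ivec C) = 0" "R u u = 0" for u
  proof (cases "R u E = 0")
    case False
    have "b u = of_int N0 *\<^sub>R u" by (simp add: b_def u)
    then have "e (b u) = (2 * of_int N0 * of_int N0 * R u E) *\<^sub>R u" by (simp add: e_def rbil_lin u)
    then have "Q u = (2 * of_int N0 * of_int N0 * R u E)\<^sup>2 * (R y u * R \<mu> u)" by (simp add: Q_def rbil_lin power2_eq_square)
    moreover have "(2 * of_int N0 * of_int N0 * R u E)\<^sup>2 > 0" using False N0 by simp
    ultimately show ?thesis using Q[of u] by (simp add: zero_le_mult_iff not_less)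
  next
    \<comment> \<open>The parametrisation misses isotropic vectors orthogonal to \<open>E\<close>.
      They are combinations of \<open>E\<close> and \<open>C\<close>, because the complement of
      \<open>y\<close> is negative semidefinite with radical \<open>C\<close>.\<close>
    case True
    have Ey: "R E y \<noteq> 0"
    proof
      assume "R E y = 0"
      from Q28.hyperbolic_orthogonal(2)[OF Cr yy(2,1) E(2) this E(1)] e1(3) show False unfolding E_def by blast
    qed
    define k where "k = R u y / R E y"
    have "R (u - k *\<^sub>R E) (ivec C) = 0" "R (u - k *\<^sub>R E) y = 0" "R (u - k *\<^sub>R E) (u - k *\<^sub>R E) = 0"
      using u E True Ey Q28.rbil_sym[of E u] by (simp_all add: rbil_lin k_def)
    from Q28.hyperbolic_orthogonal(2)[OF Cr yy(2,1) this] obtain j where "u - k *\<^sub>R E = j *\<^sub>R ivec C" by blast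
    then have "u = k *\<^sub>R E + j *\<^sub>R ivec C" by (simp add: algebra_simps)
    then have "R y u * R \<mu> u = k\<^sup>2 * (R y E * R \<mu> E)" using yy \<mu> by (simp add: rbil_lin power2_eq_square)
    moreover have "R y E * R \<mu> E \<ge> 0" unfolding E_def by (rule H[OF e1(1,2)])
    ultimately show ?thesis by simp
  qed
  define \<kappa> where "\<kappa> = R \<mu> y / R y y"
  define \<nu> where "\<nu> = \<mu> - \<kappa> *\<^sub>R y"
  have \<nu>: "R \<nu> (ivec C) = 0" "R \<nu> y = 0" using \<mu> yy by (simp_all add: \<nu>_def rbil_lin \<kappa>_def)
  have \<mu>e: "\<mu> = \<kappa> *\<^sub>R y + \<nu>" by (simp add: \<nu>_def)
  have y\<nu>: "R y \<nu> = 0" using \<nu>(2) Q28.rbil_sym by metis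
  have mm: "R \<mu> \<mu> = \<kappa>\<^sup>2 * R y y + R \<nu> \<nu>" unfolding \<mu>e by (simp add: rbil_lin y\<nu> \<nu> power2_eq_square)
  have "R \<nu> \<nu> \<le> 0" by (rule Q28.hyperbolic_orthogonal(1)[OF Cr yy(2,1) \<nu>])
  show ?thesis
  proof (cases "R \<nu> \<nu> = 0")
    case True then show ?thesis unfolding mm using yy by simp
  next
    case False
    define n where "n = - R \<nu> \<nu>"
    have n: "n > 0" using False \<open>R \<nu> \<nu> \<le> 0\<close> by (simp add: n_def)
    define s where "s = sqrt (R y y / n)"
    have s2: "s * s = R y y / n" and s0: "s > 0" using n yy by (simp_all add: s_def)
    have *: "\<kappa> * R y y - \<sigma> * n \<ge> 0" if "\<sigma> = s \<or> \<sigma> = - s" for \<sigma>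
    proof -
      have ss: "\<sigma> * \<sigma> = R y y / n" using that s2 by auto
      have "R (y + \<sigma> *\<^sub>R \<nu>) (ivec C) = 0" using yy \<nu> by (simp add: rbil_lin)
      moreover have "R (y + \<sigma> *\<^sub>R \<nu>) (y + \<sigma> *\<^sub>R \<nu>) = R y y - \<sigma> * \<sigma> * n" by (simp add: rbil_lin y\<nu> \<nu> n_def)
      then have "R (y + \<sigma> *\<^sub>R \<nu>) (y + \<sigma> *\<^sub>R \<nu>) = 0" using n by (simp add: ss)
      ultimately have "R y (y + \<sigma> *\<^sub>R \<nu>) * R \<mu> (y + \<sigma> *\<^sub>R \<nu>) \<ge> 0" by (rule iso)
      moreover have "R y (y + \<sigma> *\<^sub>R \<nu>) = R y y" by (simp add: rbil_lin y\<nu>)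
      moreover have "R \<mu> (y + \<sigma> *\<^sub>R \<nu>) = \<kappa> * R y y - \<sigma> * n" unfolding \<mu>e by (simp add: rbil_lin y\<nu> \<nu> n_def)
      ultimately show ?thesis using yy(2) by (simp add: zero_le_mult_iff)
    qed
    have "s * n \<le> \<bar>\<kappa> * R y y\<bar>" using *[of s] by simp
    then have "(s * n)\<^sup>2 \<le> \<bar>\<kappa> * R y y\<bar>\<^sup>2" using s0 n by (intro power_mono) auto
    then have "(s * s) * (n * n) \<le> \<kappa>\<^sup>2 * R y y * R y y" by (simp add: power2_eq_square mult_ac)
    then have "R y y * n \<le> R y y * (\<kappa>\<^sup>2 * R y y)" unfolding s2 using n by (simp add: mult_ac)
    then have "n \<le> \<kappa>\<^sup>2 * R y y" using yy(2) by simp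
    then show ?thesis unfolding mm n_def by simp
  qed
qed

lemma Omega_open_direction: assumes y: "y \<in> \<Omega>" and \<xi>: "R \<xi> (ivec C) = 0"
  shows "\<exists>\<epsilon>>0. \<forall>s. \<bar>s\<bar> < \<epsilon> \<longrightarrow> y + s *\<^sub>R \<xi> \<in> \<Omega>"
proof -
  let ?S = "{s. 0 < R (y + s *\<^sub>R \<xi>) (y + s *\<^sub>R \<xi>)} \<inter> {s. 0 < R (y + s *\<^sub>R \<xi>) (imv z0)}"
  have "open ?S" by (intro open_Int open_Collect_less cont_R continuous_intros)
  moreover have "0 \<in> ?S" using y by (simp add: Omega_iff)
  ultimately obtain \<epsilon> where e: "\<epsilon> > 0" "ball 0 \<epsilon> \<subseteq> ?S" using open_contains_ball by blast
  have "y + s *\<^sub>R \<xi> \<in> \<Omega>" if "\<bar>s\<bar> < \<epsilon>" for s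
  proof -
    have "s \<in> ?S" using e(2) that by (auto simp: dist_real_def)
    then show ?thesis using y \<xi> by (simp add: Omega_iff rbil_lin)
  qed
  then show ?thesis using e(1) by blast
qed

end

section \<open>Leading Taylor coefficient normal to the sublattice\<close>

context cusp_chart begin

lemma psi_normal:
  assumes z: "bil g28 z (cvec C) = 0" and \<xi>: "R \<xi> (ivec C) = 0" "R \<xi> c' = 0" "bil g28 z (rvec \<xi>) = 0"
  shows "\<psi> (z + s *s rvec \<xi>) = \<psi> z + s *s rvec \<xi> - (s * s * of_real (R \<xi> \<xi>) / 2) *s rvec (ivec C)"
proof -
  have "R c' \<xi> = 0" using \<xi>(2) Q28.rbil_sym by metis
  then have "bil g28 (rvec c') (z + s *s rvec \<xi>) = bil g28 (rvec c') z" by (simp add: bil_lin bil_rvec)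
  moreover have "bil g28 (z + s *s rvec \<xi>) (z + s *s rvec \<xi>) = bil g28 z z + s * s * of_real (R \<xi> \<xi>)"
    using \<xi>(3) Q28.bil_sym[of "rvec \<xi>" z] by (simp add: bil_lin bil_rvec)
  ultimately show ?thesis unfolding Q28.psi_def[OF Cr c'] Q28.tv_def
    by (simp add: vec_eq_iff bil_rvec c' algebra_simps add_divide_distrib)
qed

text \<open>Along \<open>z + s *s rvec \<xi>\<close> every form in the product is linear in
  \<open>s\<close> without constant term, because the quadratic correction in
  \<open>psi_normal\<close> points along \<open>C\<close>. The product is thus a constant times
  \<open>s ^ card P\<close>, and comparison with the power series from the Fourier expansion
  isolates that degree.\<close>

lemma leading_coefficient:
  assumes Gh: "holo_on G D28" and GP: "\<And>w. w \<in> D28 \<Longrightarrow> \<Phi> w = G w * (\<Prod>r\<in>P. bil g28 w (emb8 r))"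
    and A: "\<And>z. bil g28 z (cvec C) = 0 \<Longrightarrow> imv z \<in> \<Omega> \<Longrightarrow> ((\<lambda>m. A m * ee (bil g28 (rvec (M m)) z)) has_sum \<Phi> (\<psi> z)) UNIV"
    and \<xi>: "R \<xi> (ivec C) = 0" "R \<xi> c' = 0"
    and CP: "\<And>r. r \<in> P \<Longrightarrow> bil g28 (rvec (ivec C)) (emb8 r) = 0"
    and z: "bil g28 z (cvec C) = 0" "imv z \<in> \<Omega>" "bil g28 z (rvec \<xi>) = 0" "\<And>r. r \<in> P \<Longrightarrow> bil g28 (\<psi> z) (emb8 r) = 0"
  shows "((\<lambda>m. A m * ee (bil g28 (rvec (M m)) z) * ((2 * of_real pi * \<i> * of_real (R (M m) \<xi>)) ^ card P / fact (card P)))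
    has_sum (\<Prod>r\<in>P. bil g28 (rvec \<xi>) (emb8 r)) * G (\<psi> z)) UNIV"
proof -
  define B where "B = (\<lambda>m. A m * ee (bil g28 (rvec (M m)) z))"
  define q where "q = (\<lambda>m. 2 * of_real pi * \<i> * of_real (R (M m) \<xi>) :: complex)"
  define K where "K = (\<Prod>r\<in>P. bil g28 (rvec \<xi>) (emb8 r))"
  obtain \<epsilon> where e: "\<epsilon> > 0" "\<And>s. \<bar>s\<bar> < \<epsilon> \<Longrightarrow> imv z + s *\<^sub>R \<xi> \<in> \<Omega>" using Omega_open_direction[OF z(2) \<xi>(1)] by blast
  have zs: "bil g28 (z + s *s rvec \<xi>) (cvec C) = 0" for s using z(1) \<xi>(1) unfolding cvec_ivec by (simp add: bil_lin bil_rvec)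
  have zi: "imv (z + s *s rvec \<xi>) = imv z + Im s *\<^sub>R \<xi>" for s by (simp add: vec_eq_iff imv_def rvec_def)
  have zO: "imv (z + s *s rvec \<xi>) \<in> \<Omega>" if "norm s < \<epsilon>" for s
    unfolding zi by (rule e(2)) (use abs_Im_le_cmod[of s] that in linarith)
  have ee_q: "A m * ee (bil g28 (rvec (M m)) (z + s *s rvec \<xi>)) = B m * exp (s * q m)" for m s
    by (simp add: B_def q_def bil_lin bil_rvec ee_add mult.assoc) (simp add: ee_def mult_ac)
  have hs: "((\<lambda>m. B m * exp (s * q m)) has_sum \<Phi> (\<psi> (z + s *s rvec \<xi>))) UNIV" if "norm s < \<epsilon>" for s
    using A[OF zs zO[OF that]] unfolding ee_q .
  have abs: "(\<lambda>m. norm (B m) * exp (norm s * norm (q m))) summable_on UNIV" if s: "norm s < \<epsilon>" for s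
  proof -
    have sm: "(\<lambda>m. norm (B m * exp (t * q m))) summable_on UNIV" if "norm t < \<epsilon>" for t
    proof -
      have "(\<lambda>m. B m * exp (t * q m)) summable_on UNIV" using hs[OF that] unfolding summable_on_def by blast
      then show ?thesis unfolding summable_on_iff_abs_summable_on_complex .
    qed
    \<comment> \<open>\<open>q m\<close> is purely imaginary, so at plus and minus
      \<open>\<i>\<close> times \<open>norm s\<close> the exponentials are real exponentials with
      opposite exponents; their sum dominates \<open>exp (norm s * norm (q m))\<close>.\<close>
    have n: "norm (\<i> * of_real (norm s)) < \<epsilon>" "norm (- \<i> * of_real (norm s)) < \<epsilon>" using s by (simp_all add: norm_mult)
    have "(\<lambda>m. norm (B m * exp (\<i> * of_real (norm s) * q m)) + norm (B m * exp (- \<i> * of_real (norm s) * q m))) summable_on UNIV"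
      by (intro summable_on_add sm n)
    then show ?thesis
    proof (rule summable_on_comparison_test)
      fix m
      have x: "norm (exp (\<i> * of_real (norm s) * q m)) = exp (- (2 * pi * norm s * R (M m) \<xi>))"
        "norm (exp (- \<i> * of_real (norm s) * q m)) = exp (2 * pi * norm s * R (M m) \<xi>)" by (simp_all add: q_def)
      have ex: "exp \<bar>t\<bar> \<le> exp (- t) + exp t" for t :: real by (cases "t \<ge> 0") simp_all
      have nq: "norm s * norm (q m) = \<bar>2 * pi * norm s * R (M m) \<xi>\<bar>" by (simp add: q_def norm_mult abs_mult)
      have "exp (norm s * norm (q m)) \<le> norm (exp (\<i> * of_real (norm s) * q m)) + norm (exp (- \<i> * of_real (norm s) * q m))"
        unfolding x nq by (rule ex)
      then have "norm (B m) * exp (norm s * norm (q m)) \<le> norm (B m) * (norm (exp (\<i> * of_real (norm s) * q m)) + norm (exp (- \<i> * of_real (norm s) * q m)))"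
        by (rule mult_left_mono) simp
      then show "norm (B m) * exp (norm s * norm (q m)) \<le> norm (B m * exp (\<i> * of_real (norm s) * q m)) + norm (B m * exp (- \<i> * of_real (norm s) * q m))"
        unfolding norm_mult distrib_left .
    qed simp
  qed
  have D: "\<psi> (z + s *s rvec \<xi>) \<in> D28" if "norm s < \<epsilon>" for s using psi_slice(1)[OF zs zO[OF that]] unfolding slice_def by blast
  have PhiG: "\<Phi> (\<psi> (z + s *s rvec \<xi>)) = s ^ card P * (K * G (\<psi> (z + s *s rvec \<xi>)))" if "norm s < \<epsilon>" for s
  proof -
    have "bil g28 (\<psi> (z + s *s rvec \<xi>)) (emb8 r) = s * bil g28 (rvec \<xi>) (emb8 r)" if "r \<in> P" for r
      unfolding psi_normal[OF z(1) \<xi> z(3)] using z(4)[OF that] CP[OF that] by (simp add: bil_lin)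
    then have "(\<Prod>r\<in>P. bil g28 (\<psi> (z + s *s rvec \<xi>)) (emb8 r)) = (\<Prod>r\<in>P. s * bil g28 (rvec \<xi>) (emb8 r))" by (rule prod.cong[OF refl])
    then show ?thesis unfolding GP[OF D[OF that]] by (simp add: prod.distrib K_def)
  qed
  define c where "c = (\<lambda>k. \<Sum>\<^sub>\<infinity>m. B m * (q m ^ k / fact k))"
  have "c (card P) = K * G (\<psi> z)"
  proof (rule power_series_leading[OF e(1)])
    fix s :: complex assume s: "s \<noteq> 0" "norm s < \<epsilon>"
    show "(\<lambda>k. c k * s ^ k) sums (s ^ card P * (K * G (\<psi> (z + s *s rvec \<xi>))))"
      unfolding c_def PhiG[OF s(2), symmetric] by (rule exp_series_exchange(2)[OF s(1) abs[OF s(2)] hs[OF s(2)]])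
  next
    have p: "continuous_on (ball 0 \<epsilon>) (\<lambda>s. \<psi> (z + s *s rvec \<xi>))" unfolding Q28.psi_def[OF Cr c'] by (intro continuous_intros)
    have "continuous_on (ball 0 \<epsilon>) (\<lambda>s. K * G (\<psi> (z + s *s rvec \<xi>)))"
      by (intro continuous_on_mult continuous_on_const continuous_on_compose2[OF holo_on_continuous[OF Gh] p]) (use D in auto)
    then have "isCont (\<lambda>s. K * G (\<psi> (z + s *s rvec \<xi>))) 0" using e(1) by (simp add: continuous_on_eq_continuous_at)
    then show "((\<lambda>s. K * G (\<psi> (z + s *s rvec \<xi>))) \<longlongrightarrow> K * G (\<psi> z)) (at 0)" unfolding isCont_def by simp
  qed
  moreover define s where "s = complex_of_real (\<epsilon> / 2)"
  have s: "s \<noteq> 0" "norm s < \<epsilon>" using e(1) by (simp_all add: s_def norm_divide)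
  have "(\<lambda>m. B m * (q m ^ card P / fact (card P))) summable_on UNIV" by (rule exp_series_exchange(1)[OF s(1) abs[OF s(2)] hs[OF s(2)]])
  then have "((\<lambda>m. B m * (q m ^ card P / fact (card P))) has_sum c (card P)) UNIV" unfolding c_def by (rule has_sum_infsum)
  ultimately show ?thesis unfolding B_def q_def K_def by simp
qed

text \<open>The component \<open>h\<close> of \<open>\<mu>\<close> orthogonal to the sublattice has
  zero coordinates in both hyperbolic planes, so its norm is negative unless it vanishes; it is
  nonzero because it pairs with \<open>\<xi>\<close>. Removing it raises the norm.\<close>

lemma normal_projection:
  assumes \<xi>: "\<And>w. R \<xi> (giota l w) = 0" and \<mu>: "R \<mu> \<mu> \<ge> 0" "R \<mu> \<xi> \<noteq> 0"
  shows "K21 (gpi d l \<mu>) (gpi d l \<mu>) > 0"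
proof -
  define \<nu> where "\<nu> = gpi d l \<mu>"
  define h where "h = \<mu> - giota l \<nu>"
  have hw: "R (giota l w) h = 0" for w unfolding h_def rbil_diff rbil_adjoint \<nu>_def by (simp add: gpi_giota)
  have "R \<xi> h = R \<xi> \<mu>" unfolding h_def rbil_diff \<xi> by simp
  then have h0: "h \<noteq> 0" using \<mu>(2) Q28.rbil_sym[of \<xi> \<mu>] by (auto simp: rbil_zero)
  have hk: "h $ of_nat k = 0" if "k < 4" for k using that by (simp add: h_def giota_nth gpi_nth \<nu>_def)
  have "p28 h = 0" "q28 h = 0" using hk[of 0] hk[of 1] hk[of 2] hk[of 3] by (simp_all add: p28_def q28_def)
  then have "R h h < 0" by (rule Q28.neg[OF h0])
  have "\<mu> = giota l \<nu> + h" by (simp add: h_def)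
  then have "R \<mu> \<mu> = R (giota l \<nu> + h) (giota l \<nu> + h)" by simp
  also have "\<dots> = K21 \<nu> \<nu> + R h h" using hw[of \<nu>] Q28.rbil_sym[of h "giota l \<nu>"] by (simp add: rbil_lin rbil_giota)
  finally show ?thesis using \<mu>(1) \<open>R h h < 0\<close> unfolding \<nu>_def by linarith
qed

lemma pullback_expansion:
  assumes Gh: "holo_on G D28" and GP: "\<And>w. w \<in> D28 \<Longrightarrow> \<Phi> w = G w * (\<Prod>r\<in>P. bil g28 w (emb8 r))"
    and C: "C = giota l c" and cc: "c' = giota l c0" and P: "card P > 0"
  shows "\<exists>a::real^21 \<Rightarrow> complex.
        (\<forall>m. a m \<noteq> 0 \<longrightarrow> bil (g21 d) (rvec m) (cvec c) = 0 \<and> 0 < Re (bil (g21 d) (rvec m) (rvec m)))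
      \<and> (\<forall>w\<in>D21. bil (g21 d) w (cvec c) = 1 \<longrightarrow>
           ((\<lambda>\<mu>. a \<mu> * exp (2 * of_real pi * \<i> * bil (g21 d) (rvec \<mu>) w)) has_sum (G \<circ> iota l) w) UNIV)"
proof -
  obtain A where A0: "\<forall>z. bil g28 z (cvec C) = 0 \<longrightarrow> imv z \<in> \<Omega> \<longrightarrow> ((\<lambda>m. A m * ee (bil g28 (rvec (M m)) z)) has_sum \<Phi> (\<psi> z)) UNIV"
    "\<forall>m y B. y \<in> \<Omega> \<longrightarrow> bnd y B \<longrightarrow> norm (A m) * exp (- 2 * pi * R (M m) y) \<le> B"
    using expansion by (elim exE conjE)
  note A = A0[rule_format]
  have pw: "R (giota l w) (pv r) = 0" if "r \<in> P" for w r
  proof -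
    have "complex_of_real (R (giota l w) (pv r)) = bil g28 (iota l (rvec w)) (emb8 r)" by (simp add: bil_rvec[symmetric] iota_giota giota_rvec emb8_pv)
    also have "\<dots> = 0" unfolding bil_iota_emb8 P_root(2)[OF that] by simp
    finally show ?thesis by simp
  qed
  \<comment> \<open>The roots in \<open>P\<close> are themselves normal to the sublattice and have
    nonzero norm, so some normal direction pairs nontrivially with all of them; this makes
    \<open>K\<close> nonzero.\<close>
  have "\<exists>\<xi>\<in>{x. \<forall>w. R x (giota l w) = 0}. \<forall>r\<in>P. R \<xi> (pv r) \<noteq> 0"
  proof (rule avoid_finitely_many_kernels[where \<phi>="\<lambda>r x. R x (pv r)"])
    fix r assume r: "r \<in> P"
    show "linear (\<lambda>x. R x (pv r))" by (rule linear_rbil)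
    have "R (pv r) (pv r) \<noteq> 0" unfolding pv_form P_root(1)[OF r] by simp
    moreover have "R (pv r) (giota l w) = 0" for w using pw[OF r] Q28.rbil_sym by metis
    ultimately show "\<exists>x\<in>{x. \<forall>w. R x (giota l w) = 0}. R x (pv r) \<noteq> 0" by blast
  qed (simp_all add: finite_P rbil_lin)
  then obtain \<xi> where \<xi>: "\<And>w. R \<xi> (giota l w) = 0" "\<And>r. r \<in> P \<Longrightarrow> R \<xi> (pv r) \<noteq> 0" by blast
  have \<xi>C: "R \<xi> (ivec C) = 0" "R \<xi> c' = 0" unfolding C cc giota_ivec[symmetric] by (rule \<xi>(1))+
  define K where "K = (\<Prod>r\<in>P. bil g28 (rvec \<xi>) (emb8 r))"
  have K0: "K \<noteq> 0" unfolding K_def using \<xi>(2) finite_P by (simp add: emb8_pv bil_rvec)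
  \<comment> \<open>The factor with \<open>c'\<close> compensates for
    \<open>z = iota l w - rvec c'\<close>. As \<open>card P > 0\<close>, the power of
    \<open>R (M m) \<xi>\<close> removes the exponents orthogonal to \<open>\<xi>\<close>.\<close>
  define b where "b = (\<lambda>m. A m * ee (- of_real (R (M m) c')) * ((2 * of_real pi * \<i> * of_real (R (M m) \<xi>)) ^ card P / fact (card P)) * inverse K)"
  define p where "p = (\<lambda>m. gpi d l (M m) :: real^21)"
  define a where "a = (\<lambda>\<nu>. \<Sum>\<^sub>\<infinity>m\<in>{m. p m = \<nu>}. b m)"
  have supp: "bil (g21 d) (rvec \<nu>) (cvec c) = 0 \<and> 0 < Re (bil (g21 d) (rvec \<nu>) (rvec \<nu>))" if "a \<nu> \<noteq> 0" for \<nu>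
  proof -
    have "\<exists>m\<in>{m. p m = \<nu>}. b m \<noteq> 0"
    proof (rule ccontr)
      assume "\<not> ?thesis"
      then have "a \<nu> = 0" unfolding a_def by (intro infsum_0) blast
      then show False using that by simp
    qed
    then obtain m where m: "p m = \<nu>" "b m \<noteq> 0" by blast
    then have Am: "A m \<noteq> 0" and M\<xi>: "R (M m) \<xi> \<noteq> 0" using P unfolding b_def by auto
    note cs = coefficient_support[of "A m" "M m", OF A(2) Am]
    have MC: "R (M m) (ivec C) = 0" using cs(1) by simp
    have "imv z0 \<in> \<Omega>" using y0 by (simp add: Omega_iff)
    have "R (M m) (M m) \<ge> 0" by (rule hyperbolic_nonneg[OF \<open>imv z0 \<in> \<Omega>\<close> MC]) (rule cs(2), simp_all add: \<open>imv z0 \<in> \<Omega>\<close>)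
    from normal_projection[OF \<xi>(1) this M\<xi>] have pos: "K21 \<nu> \<nu> > 0" using m(1) unfolding p_def by simp
    have "K21 (ivec c) \<nu> = R (giota l (ivec c)) (M m)" unfolding rbil_adjoint using m(1) p_def by simp
    also have "\<dots> = 0" using MC Q28.rbil_sym[of "M m"] unfolding C giota_ivec by simp
    finally have "K21 \<nu> (ivec c) = 0" using Q21.rbil_sym[of \<nu>] by simp
    then show ?thesis using pos by (simp add: cvec_ivec bil_rvec)
  qed
  have sum: "((\<lambda>\<nu>. a \<nu> * exp (2 * of_real pi * \<i> * bil (g21 d) (rvec \<nu>) w)) has_sum (G \<circ> iota l) w) UNIV"
    if w: "w \<in> D21" "bil (g21 d) w (cvec c) = 1" for w
  proof -
    have WC: "bil g28 (iota l w) (cvec C) = 1" unfolding C giota_cvec[symmetric] iota_giota[symmetric] bil_iota by (rule w(2))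
    have W: "iota l w \<in> slice" using iota_Dom[OF w(1)] WC by (simp add: slice_def)
    define z where "z = iota l w - rvec c'"
    note sp = slice_psi[OF W, folded z_def]
    have iz: "imv z \<in> \<Omega>"
    proof -
      have "imv z = imv (iota l w)" unfolding z_def by (simp add: vec_eq_iff imv_def rvec_def)
      then show ?thesis using sp(3) by simp
    qed
    have zg: "z = giota l (w - rvec c0)" unfolding z_def cc iota_giota giota_lin giota_rvec ..
    have z\<xi>: "bil g28 z (rvec \<xi>) = 0"
    proof -
      have "rev z = giota l (rev (w - rvec c0))" "imv z = giota l (imv (w - rvec c0))"
        unfolding zg by (simp_all add: vec28_eq_iff giota_nth rev_def imv_def)
      then show ?thesis unfolding bil_rvec_right using \<xi>(1) Q28.rbil_sym[of _ \<xi>] by (simp add: complex_eq_iff)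
    qed
    have "((\<lambda>m. A m * ee (bil g28 (rvec (M m)) z) * ((2 * of_real pi * \<i> * of_real (R (M m) \<xi>)) ^ card P / fact (card P))) has_sum K * G (\<psi> z)) UNIV"
      unfolding K_def
    proof (rule leading_coefficient[OF Gh GP A(1) \<xi>C _ sp(1) iz z\<xi>])
      fix r assume r: "r \<in> P"
      show "bil g28 (rvec (ivec C)) (emb8 r) = 0" unfolding C giota_ivec[symmetric] emb8_pv bil_rvec pw[OF r] by simp
      show "bil g28 (\<psi> z) (emb8 r) = 0" unfolding sp(2) bil_iota_emb8 P_root(2)[OF r] by simp
    qed
    then have "((\<lambda>m. A m * ee (bil g28 (rvec (M m)) z) * ((2 * of_real pi * \<i> * of_real (R (M m) \<xi>)) ^ card P / fact (card P)) * inverse K)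
        has_sum K * G (\<psi> z) * inverse K) UNIV" by (rule has_sum_cmult_left)
    moreover have "K * G (\<psi> z) * inverse K = (G \<circ> iota l) w" using K0 unfolding sp(2) by simp
    moreover have "A m * ee (bil g28 (rvec (M m)) z) * ((2 * of_real pi * \<i> * of_real (R (M m) \<xi>)) ^ card P / fact (card P)) * inverse K
        = b m * exp (2 * of_real pi * \<i> * bil (g21 d) (rvec (p m)) w)" for m
    proof -
      have "bil g28 (rvec (M m)) (iota l w) = bil (g21 d) (rvec (p m)) w"
        unfolding Q28.bil_sym[of "rvec (M m)"] bil_adjoint gpi_rvec p_def by (rule Q21.bil_sym)
      then have "bil g28 (rvec (M m)) z = - of_real (R (M m) c') + bil (g21 d) (rvec (p m)) w"
        unfolding z_def bil_diff bil_rvec by simp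
      then have "ee (bil g28 (rvec (M m)) z) = ee (- of_real (R (M m) c')) * ee (bil (g21 d) (rvec (p m)) w)" by (simp only: ee_add)
      then show ?thesis unfolding b_def ee_def[of "bil (g21 d) (rvec (p m)) w"] by (simp only: mult_ac)
    qed
    ultimately have "((\<lambda>m. b m * exp (2 * of_real pi * \<i> * bil (g21 d) (rvec (p m)) w)) has_sum (G \<circ> iota l) w) UNIV" by (simp only:)
    from has_sum_fibers[of b "\<lambda>\<nu>. exp (2 * of_real pi * \<i> * bil (g21 d) (rvec \<nu>) w)" p, OF this] show ?thesis unfolding a_def by simp
  qed
  show ?thesis by (intro exI[of _ a] conjI allI impI ballI supp sum)
qed

end

lemma (in quasi_pullback) F_cusp:
  assumes Gh: "holo_on G D28" and GP: "\<And>w. w \<in> D28 \<Longrightarrow> \<Phi> w = G w * (\<Prod>r\<in>P. bil g28 w (emb8 r))" and P: "card P > 0"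
  shows "Cusp (g21 d) w21 (G \<circ> iota l)"
  unfolding Cusp_def
proof (intro allI impI)
  fix c :: "int^21" assume c: "c \<noteq> 0" "bil (g21 d) (cvec c) (cvec c) = 0"
  show "\<exists>a::real^21 \<Rightarrow> complex.
        (\<forall>m. a m \<noteq> 0 \<longrightarrow> bil (g21 d) (rvec m) (cvec c) = 0 \<and> 0 < Re (bil (g21 d) (rvec m) (rvec m)))
      \<and> (\<forall>w\<in>D21. bil (g21 d) w (cvec c) = 1 \<longrightarrow>
           ((\<lambda>\<mu>. a \<mu> * exp (2 * of_real pi * \<i> * bil (g21 d) (rvec \<mu>) w)) has_sum (G \<circ> iota l) w) UNIV)"
  proof (cases "\<exists>w\<in>D21. bil (g21 d) w (cvec c) = 1")
    \<comment> \<open>The condition on \<open>w\<close> is empty, and the zero family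
      serves.\<close>
    case False
    then show ?thesis by (intro exI[of _ "\<lambda>_. 0"]) simp
  next
    case True
    then obtain w where w: "w \<in> D21" "bil (g21 d) w (cvec c) = 1" by blast
    have c2: "ibil (g21 d) c c = 0" using c(2) by (simp add: bil_cvec)
    define X where "X = rev w"
    have Xc: "K21 X (ivec c) = 1" using w(2) unfolding cvec_ivec bil_rvec_right X_def by (simp add: complex_eq_iff)
    \<comment> \<open>The real part of \<open>w\<close> pairs to 1 with \<open>c\<close>;
      subtracting half its norm times the isotropic \<open>c\<close> makes it isotropic and keeps
      the pairing.\<close>
    define c0 where "c0 = X - (K21 X X / 2) *\<^sub>R ivec c"
    define C where "C = giota l c"
    define c' where "c' = giota l c0"
    have cc: "K21 (ivec c) (ivec c) = 0" using c2 by (simp add: rbil_ivec)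
    have c00: "K21 c0 c0 = 0" "K21 c0 (ivec c) = 1"
      using Xc cc Q21.rbil_sym[of "ivec c" X] by (simp_all add: c0_def rbil_lin)
    have WC: "bil g28 (iota l w) (cvec C) = 1" unfolding C_def giota_cvec[symmetric] iota_giota[symmetric] bil_iota by (rule w(2))
    obtain v where v: "ibil g28 v C \<noteq> 0"
    proof -
      have "\<exists>k. ibil g28 (axis k 1) C \<noteq> 0"
      proof (rule ccontr)
        assume n: "\<not> ?thesis"
        have "(\<Sum>j\<in>UNIV. g28 k j * C $ j) = ibil g28 (axis k 1) C" for k
          by (simp add: ibil_def axis_def if_distrib if_distribR sum.If_cases cong: if_cong)
        then have "bil g28 (iota l w) (cvec C) = 0" unfolding bil_cvec_coordinates using n by simp
        then show False using WC by simp
      qed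
      then show ?thesis using that by blast
    qed
    have C0: "C \<noteq> 0" using WC by (auto simp: cvec_lin bil_zero)
    have CC: "ibil g28 C C = 0" using c2 by (simp add: C_def ibil_giota)
    have c': "rbil g28 c' c' = 0" "rbil g28 c' (ivec C) = 1" using c00 by (simp_all add: c'_def C_def rbil_giota flip: giota_ivec)
    have Cr: "rbil g28 (ivec C) (ivec C) = 0" "ivec C \<noteq> 0" using CC C0 ivec_inject[of C 0] by (simp_all add: rbil_ivec ivec_lin)
    have "iota l w \<in> cone g28" using iota_Dom[OF w(1)] Q28.Dom_subset_cone by blast
    then have ww: "bil g28 (iota l w) (iota l w) = 0" unfolding cone_def by blast
    note ps = Q28.psi_surj[OF Cr c' ww WC[unfolded cvec_ivec]]
    have "cusp_chart d l \<Phi> P C v c' (iota l w - rvec c')"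
    proof (intro cusp_chart.intro cusp_chart_axioms.intro)
      show "quasi_pullback d l \<Phi> P" by (rule quasi_pullback_axioms)
      show "Q28.psi (ivec C) c' (iota l w - rvec c') \<in> D28" unfolding ps(2) by (rule iota_Dom[OF w(1)])
      show "bil g28 (iota l w - rvec c') (cvec C) = 0" unfolding cvec_ivec by (rule ps(1))
    qed (rule C0 CC c' v)+
    from cusp_chart.pullback_expansion[OF this Gh GP C_def c'_def P] show ?thesis .
  qed
qed

theorem theorem7p2:
  fixes d :: nat and l :: "int^8" and \<Phi> :: "complex^28 \<Rightarrow> complex" and P :: "(int^8) set"
  assumes d1: "d \<ge> 1"
    and l2: "e8 l l = - 2 * int d"
    and Phi_mod: "ModForm g28 w28 (Oplus g28 w28) 12 detchar \<Phi>"
    and Phi_nz: "\<exists>w\<in>Dom g28 w28. \<Phi> w \<noteq> 0"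
    and Phi_zeros: "\<forall>w\<in>Dom g28 w28. \<Phi> w = 0 \<longleftrightarrow>
                      (\<exists>r::int^28. bil g28 (cvec r) (cvec r) = -2 \<and> bil g28 w (cvec r) = 0)"
    and P_sub: "P \<subseteq> Rl l"
    and P_reps: "\<forall>r\<in>Rl l. (r \<in> P) \<noteq> (- r \<in> P)"
  shows "(\<exists>G. holo_on G (Dom g28 w28) \<and>
              (\<forall>w\<in>Dom g28 w28. \<Phi> w = G w * (\<Prod>r\<in>P. bil g28 w (emb8 r))))
       \<and> (\<forall>G. holo_on G (Dom g28 w28) \<and>
              (\<forall>w\<in>Dom g28 w28. \<Phi> w = G w * (\<Prod>r\<in>P. bil g28 w (emb8 r))) \<longrightarrow>
            (let F = G \<circ> iota l; N = card (Rl l) in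
              ModForm (g21 d) w21 (Otilde (g21 d) w21) (12 + N div 2) detchar F
            \<and> (\<forall>r::int^21. bil (g21 d) (cvec r) (cvec r) = -2 \<longrightarrow>
                 (\<forall>w\<in>Dom (g21 d) w21. bil (g21 d) w (cvec r) = 0 \<longrightarrow> F w = 0))
            \<and> (0 < N \<longrightarrow> Cusp (g21 d) w21 F)
            \<and> (N < 112 \<longrightarrow> VanishBranch (g21 d) w21 (Otilde (g21 d) w21) F)))"
proof -
  interpret quasi_pullback d l \<Phi> P
    by unfold_locales (fact d1 l2 Phi_mod Phi_zeros P_sub P_reps)+
  show ?thesis
  proof (intro conjI allI impI)
    show "\<exists>G. holo_on G D28 \<and> (\<forall>w\<in>D28. \<Phi> w = G w * (\<Prod>r\<in>P. bil g28 w (emb8 r)))" by (rule quotient)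
    fix G assume G: "holo_on G D28 \<and> (\<forall>w\<in>D28. \<Phi> w = G w * (\<Prod>r\<in>P. bil g28 w (emb8 r)))"
    have Gh: "holo_on G D28" and GP: "\<And>w. w \<in> D28 \<Longrightarrow> \<Phi> w = G w * (\<Prod>r\<in>P. bil g28 w (emb8 r))" using G by simp_all
    show "let F = G \<circ> iota l; N = card (Rl l) in
        ModForm (g21 d) w21 (Otilde (g21 d) w21) (12 + N div 2) detchar F
      \<and> (\<forall>r::int^21. bil (g21 d) (cvec r) (cvec r) = -2 \<longrightarrow> (\<forall>w\<in>D21. bil (g21 d) w (cvec r) = 0 \<longrightarrow> F w = 0))
      \<and> (0 < N \<longrightarrow> Cusp (g21 d) w21 F)
      \<and> (N < 112 \<longrightarrow> VanishBranch (g21 d) w21 (Otilde (g21 d) w21) F)"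
      unfolding Let_def
    proof (intro conjI allI impI ballI)
      show "ModForm (g21 d) w21 (Otilde (g21 d) w21) (12 + card (Rl l) div 2) detchar (G \<circ> iota l)"
        by (rule F_modular[OF Gh GP])
      show "(G \<circ> iota l) w = 0" if "bil (g21 d) (cvec r) (cvec r) = - 2" "w \<in> D21" "bil (g21 d) w (cvec r) = 0" for r :: "int^21" and w
        by (rule F_root[OF Gh GP that])
      show "Cusp (g21 d) w21 (G \<circ> iota l)" if "0 < card (Rl l)"
        by (rule F_cusp[OF Gh GP]) (use that in \<open>simp_all add: card_Rl\<close>)
      show "VanishBranch (g21 d) w21 (Otilde (g21 d) w21) (G \<circ> iota l)"
        by (rule F_branch[OF Gh GP])
    qed
  qed
qed

end
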